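(* Let $1\le p<\infty$, $s\ge0$, $f\in M^{p,1}_s(\mathbf{R}^n)$, and let $I$ be the closed ideal in $M^{p,1}_s(\mathbf{R}^n)$ generated by the one function $f$. Then $I=M^{p,1}_s(\mathbf{R}^n)$ if and only if $f(x)\neq0$ for all $x\in\mathbf{R}^n$.
   Context: $\langle \xi\rangle=(1+|\xi|^2)^{1/2}$. For $f\in\mathcal{S}'(\mathbf{R}^n)$ and a window $\phi\in\mathcal{S}(\mathbf{R}^n)\setminus\{0\}$, $V_\phi f(x,\xi)=\int_{\mathbf{R}^n} f(t)\overline{\phi(t-x)}e^{-it\xi}\,dt$ (by duality). The modulation space $M^{p,1}_s(\mathbf{R}^n)$ consists of all $f\in\mathcal{S}'(\mathbf{R}^n)$ with $\|f\|_{M^{p,1}_s}=\int_{\mathbf{R}^n}\langle\xi\rangle^{s}\big(\int_{\mathbf{R}^n}|V_\phi f(x,\xi)|^p\,dx\big)^{1/p}d\xi<\infty$; different windows give equivalent norms. For $s\ge0$ its elements are continuous functions, and it is an algebra under pointwise multiplication with $\|fg\|_{M^{p,1}_s}\le c\|f\|_{M^{p,1}_s}\|g\|_{M^{p,1}_s}$. A linear subspace $I$ of $M^{p,1}_s$ is an ideal if $fg\in I$ whenever $f\in M^{p,1}_s$ and $g\in I$; it is a closed ideal if it is moreover a closed subset. The closed ideal generated by a subset $S$ is the smallest closed ideal containing $S$; it coincides with the closure in $M^{p,1}_s$ of $\{\sum_{j=1}^N f_jg_j\mid f_j\in M^{p,1}_s,\ g_j\in S,\ N\in\mathbf{N}\}$.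 *)

theory Defs
  imports "HOL-Analysis.Analysis"
begin

definition japanese :: "'a::real_normed_vector \<Rightarrow> real" where
  "japanese x = sqrt (1 + (norm x)\<^sup>2)"

section \<open>Schwartz functions and tempered distributions\<close>

definition partial_deriv :: "'n::finite \<Rightarrow> (real^'n \<Rightarrow> complex) \<Rightarrow> real^'n \<Rightarrow> complex" where
  "partial_deriv i f x = frechet_derivative f (at x) (axis i 1)"

text \<open>A multi-index derivative is given by the list of directions in which to differentiate; by
  symmetry of the derivatives of a smooth function the order of the list does not matter.\<close>

definition iter_deriv :: "'n::finite list \<Rightarrow> (real^'n \<Rightarrow> complex) \<Rightarrow> real^'n \<Rightarrow> complex" where
  "iter_deriv is f = foldr partial_deriv is f"

definition smooth :: "(real^'n::finite \<Rightarrow> complex) \<Rightarrow> bool" where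
  "smooth f \<longleftrightarrow> (\<forall>is. iter_deriv is f differentiable_on UNIV)"

definition schwartz :: "(real^'n::finite \<Rightarrow> complex) set" where
  "schwartz = {\<phi>. smooth \<phi> \<and>
     (\<forall>k is. bounded (range (\<lambda>x. japanese x ^ k *\<^sub>R iter_deriv is \<phi> x)))}"

text \<open>An increasing family of norms that defines the topology of the Schwartz space.\<close>

definition schwartz_norm :: "nat \<Rightarrow> (real^'n::finite \<Rightarrow> complex) \<Rightarrow> real" where
  "schwartz_norm N \<phi> =
     (\<Sum>is \<in> {is. length is \<le> N}. SUP x. japanese x ^ N * norm (iter_deriv is \<phi> x))"

type_synonym 'n functional = "(real^'n \<Rightarrow> complex) \<Rightarrow> complex"

text \<open>Tempered distributions are the continuous complex-linear functionals on the Schwartz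
  space. As HOL functions they are total; fixing the value \<open>0\<close> outside the Schwartz space makes
  equality of functionals coincide with equality of distributions.\<close>

definition tempered :: "('n::finite) functional set" where
  "tempered = {u.
     (\<forall>\<phi>\<in>schwartz. \<forall>\<psi>\<in>schwartz. u (\<lambda>x. \<phi> x + \<psi> x) = u \<phi> + u \<psi>) \<and>
     (\<forall>c. \<forall>\<phi>\<in>schwartz. u (\<lambda>x. c * \<phi> x) = c * u \<phi>) \<and>
     (\<exists>C N. \<forall>\<phi>\<in>schwartz. norm (u \<phi>) \<le> C * schwartz_norm N \<phi>) \<and>
     (\<forall>\<phi>. \<phi> \<notin> schwartz \<longrightarrow> u \<phi> = 0)}"

definition distr_of :: "(real^'n::finite \<Rightarrow> complex) \<Rightarrow> 'n functional" where
  "distr_of g = (\<lambda>\<psi>. if \<psi> \<in> schwartz then (\<integral>x. g x * \<psi> x \<partial>lborel) else 0)"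

definition represents :: "(real^'n::finite \<Rightarrow> complex) \<Rightarrow> 'n functional \<Rightarrow> bool" where
  "represents g u \<longleftrightarrow> continuous_on UNIV g \<and>
     (\<forall>\<psi>\<in>schwartz. integrable lborel (\<lambda>x. g x * \<psi> x)) \<and> u = distr_of g"

text \<open>The continuous function with which a distribution is identified. It is unique if it exists,
  and it exists for all elements of the modulation spaces below when \<open>0 \<le> s\<close>.\<close>

definition fun_of :: "('n::finite) functional \<Rightarrow> real^'n \<Rightarrow> complex" where
  "fun_of u = (THE g. represents g u)"

definition distr_mult :: "('n::finite) functional \<Rightarrow> 'n functional \<Rightarrow> 'n functional" where
  "distr_mult u v = distr_of (\<lambda>x. fun_of u x * fun_of v x)"

section \<open>Modulation spaces\<close>

text \<open>The duality pairing is bilinear, so the window is conjugated in the test function.\<close>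

definition stft :: "(real^'n::finite \<Rightarrow> complex) \<Rightarrow> 'n functional \<Rightarrow> real^'n \<Rightarrow> real^'n \<Rightarrow> complex" where
  "stft \<phi> u x \<xi> = u (\<lambda>t. cnj (\<phi> (t - x)) * cis (- (t \<bullet> \<xi>)))"

text \<open>Powers with positive exponent \<open>a\<close>; only used for \<open>a = 1 / p\<close>.\<close>

definition ennreal_powr :: "ennreal \<Rightarrow> real \<Rightarrow> ennreal" where
  "ennreal_powr y a = (if y = \<infinity> then \<infinity> else ennreal (enn2real y powr a))"

definition mod_norm ::
  "(real^'n::finite \<Rightarrow> complex) \<Rightarrow> real \<Rightarrow> real \<Rightarrow> 'n functional \<Rightarrow> ennreal" where
  "mod_norm \<phi> p s u =
     (\<integral>\<^sup>+ \<xi>. ennreal (japanese \<xi> powr s) *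
        ennreal_powr (\<integral>\<^sup>+ x. ennreal (norm (stft \<phi> u x \<xi>) powr p) \<partial>lborel) (1 / p) \<partial>lborel)"

definition modulation_space ::
  "(real^'n::finite \<Rightarrow> complex) \<Rightarrow> real \<Rightarrow> real \<Rightarrow> 'n functional set" where
  "modulation_space \<phi> p s = {u \<in> tempered. mod_norm \<phi> p s u < \<infinity>}"

definition mod_dist ::
  "(real^'n::finite \<Rightarrow> complex) \<Rightarrow> real \<Rightarrow> real \<Rightarrow> 'n functional \<Rightarrow> 'n functional \<Rightarrow> real" where
  "mod_dist \<phi> p s u v = enn2real (mod_norm \<phi> p s (\<lambda>\<psi>. u \<psi> - v \<psi>))"

definition mod_topology ::
  "(real^'n::finite \<Rightarrow> complex) \<Rightarrow> real \<Rightarrow> real \<Rightarrow> 'n functional topology" where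
  "mod_topology \<phi> p s = Metric_space.mtopology (modulation_space \<phi> p s) (mod_dist \<phi> p s)"

section \<open>Closed ideals\<close>

definition mod_ideal ::
  "(real^'n::finite \<Rightarrow> complex) \<Rightarrow> real \<Rightarrow> real \<Rightarrow> 'n functional set \<Rightarrow> bool" where
  "mod_ideal \<phi> p s I \<longleftrightarrow>
     I \<subseteq> modulation_space \<phi> p s \<and>
     (\<lambda>\<psi>. 0) \<in> I \<and>
     (\<forall>u\<in>I. \<forall>v\<in>I. (\<lambda>\<psi>. u \<psi> + v \<psi>) \<in> I) \<and>
     (\<forall>c. \<forall>u\<in>I. (\<lambda>\<psi>. c * u \<psi>) \<in> I) \<and>
     (\<forall>u\<in>modulation_space \<phi> p s. \<forall>v\<in>I. distr_mult u v \<in> I)"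

definition closed_ideal ::
  "(real^'n::finite \<Rightarrow> complex) \<Rightarrow> real \<Rightarrow> real \<Rightarrow> 'n functional set \<Rightarrow> bool" where
  "closed_ideal \<phi> p s I \<longleftrightarrow> mod_ideal \<phi> p s I \<and> closedin (mod_topology \<phi> p s) I"

definition closed_ideal_gen ::
  "(real^'n::finite \<Rightarrow> complex) \<Rightarrow> real \<Rightarrow> real \<Rightarrow> 'n functional set \<Rightarrow> 'n functional set" where
  "closed_ideal_gen \<phi> p s S = \<Inter> {J. closed_ideal \<phi> p s J \<and> S \<subseteq> J}"

end

theory Submission
  imports Defs "HOL-Probability.Probability"
begin

text \<open>Elements of the modulation space are bounded continuous functions. By the reproducing formula
  a tempered distribution is a superposition of time-frequency shifts of the window, the density
  being its short-time Fourier transform; finiteness of the norm makes the superposition converge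
  absolutely at every point, so that it defines a bounded continuous function which represents the
  distribution (\<open>reproducing_formula\<close>, \<open>distr_of_synth\<close>, \<open>modulation_space_eq\<close>).
  Point evaluations are therefore bounded, and the members vanishing at a given point form a closed
  ideal (\<open>vanishing_closed_ideal\<close>). It is proper, since it misses some translate of the window.
  So a generator with a zero generates a proper ideal.

  For the other direction all analytic input comes from one estimate, \<open>product_ft_bound\<close>: the
  Fourier transform of a product of \<open>g\<close> with a smooth localised function is dominated by a
  convolution of the short-time Fourier transform of \<open>g\<close> with rapidly decreasing functions.
  It shows that the space is an algebra (\<open>mod_fun_mult\<close>), that functions of compact support are
  dense (\<open>dilation_tendsto\<close>), and that a member times a Schwartz function is the Fourier
  transform of a function that is integrable against the weight (\<open>weighted_L1_ft_mult\<close>).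

  Let \<open>f\<close> have no zero and lie in the closed ideal \<open>J\<close>. Close to a point \<open>x0\<close> it is
  inverted by a Neumann series. Let \<open>X\<close> be a smooth function that is \<open>1\<close> near \<open>x0\<close>, and put
  \<open>r = X (1 - f / f x0)\<close>, so that \<open>f / f x0 = 1 - r\<close> wherever \<open>X = 1\<close>. Shrinking the support of
  \<open>X\<close> makes the \<open>L\<^sup>1\<close> norm of the Fourier transform of \<open>r\<close> small, because \<open>1 - f / f x0\<close>
  vanishes at \<open>x0\<close> (\<open>local_smallness\<close>); this is Wiener's argument. The weighted norm need not
  become small, but the weight grows only polynomially, so the unweighted \<open>L\<^sup>1\<close> norm alone controls
  the powers of \<open>r\<close>: \<open>b r\<^sup>N\<close> tends to \<open>0\<close> in the modulation norm for every member \<open>b\<close>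
  (\<open>multiplier_powers_tendsto\<close>). If \<open>b\<close> is supported where \<open>X = 1\<close>, then
  \<open>b - b r\<^sup>N = (b + b r + \<dots> + b r\<^sup>N\<^sup>-\<^sup>1) f / f x0\<close> lies in \<open>J\<close>, hence so does \<open>b\<close>. In this way
  \<open>J\<close> contains functions that equal \<open>1\<close> near a prescribed point. Finitely many of them combine
  to a function equal to \<open>1\<close> on a prescribed compact set
  (\<open>closed_ideal_contains_unit_on_compact\<close>), so \<open>J\<close> contains every member of compact support
  and, being closed, is the whole space.\<close>

section \<open>Weights of polynomial growth and decay\<close>

lemma japanese_ge_1: "1 \<le> japanese x"
  by (simp add: japanese_def)

lemma japanese_pos [simp]: "0 < japanese x"
  using japanese_ge_1[of x] by linarith

lemma japanese_nonneg [simp]: "0 \<le> japanese x"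
  using japanese_ge_1[of x] by linarith

lemma japanese_neq_0 [simp]: "japanese x \<noteq> 0"
  using japanese_pos[of x] by linarith

lemma norm_le_japanese: "norm x \<le> japanese x"
  unfolding japanese_def by (rule real_le_rsqrt) simp

lemma japanese_minus [simp]: "japanese (- x) = japanese x"
  by (simp add: japanese_def)

lemma japanese_diff_commute: "japanese (x - y) = japanese (y - x)"
  by (simp add: japanese_def norm_minus_commute)

lemma japanese_sq: "(japanese x)\<^sup>2 = 1 + (norm x)\<^sup>2"
  by (simp add: japanese_def add_nonneg_nonneg)

lemma japanese_add_le: "japanese (x + y) \<le> japanese x + norm y"
proof -
  have "(norm (x + y))\<^sup>2 \<le> (norm x + norm y)\<^sup>2"
    by (intro power_mono norm_triangle_ineq) auto
  also have "\<dots> = (norm x)\<^sup>2 + (norm y)\<^sup>2 + 2 * norm x * norm y"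
    by (simp add: power2_sum)
  also have "2 * norm x * norm y \<le> 2 * japanese x * norm y"
    by (intro mult_right_mono mult_left_mono norm_le_japanese) auto
  finally have "1 + (norm (x + y))\<^sup>2 \<le> (japanese x + norm y)\<^sup>2"
    by (simp add: power2_sum japanese_sq)
  then show ?thesis
    unfolding japanese_def[of "x + y"] by (intro real_le_lsqrt) (auto simp: add_nonneg_nonneg)
qed

text \<open>Submultiplicativity up to a constant is what makes the weight compatible with convolution.\<close>

lemma japanese_submult: "japanese (x + y) \<le> 2 * (japanese x * japanese y)"
proof -
  have "japanese (x + y) \<le> japanese x + japanese y"
    using japanese_add_le[of x y] norm_le_japanese[of y] by linarith
  also have "\<dots> \<le> japanese x * japanese y + japanese x * japanese y"
    using japanese_ge_1[of x] japanese_ge_1[of y]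
    by (intro add_mono) (auto simp: mult_le_cancel_left1 mult_le_cancel_right1)
  finally show ?thesis by simp
qed

lemma continuous_on_japanese [continuous_intros]:
  "continuous_on S f \<Longrightarrow> continuous_on S (\<lambda>x. japanese (f x))"
  unfolding japanese_def by (intro continuous_intros)

lemma japanese_measurable [measurable]:
  "f \<in> borel_measurable M \<Longrightarrow> (\<lambda>x. japanese (f x :: 'a::{euclidean_space})) \<in> borel_measurable M"
  unfolding japanese_def by measurable

definition decay :: "nat \<Rightarrow> 'a::real_normed_vector \<Rightarrow> real" where
  "decay k x = inverse (japanese x ^ k)"

lemma decay_nonneg [simp]: "0 \<le> decay k x" and decay_pos [simp]: "0 < decay k x"
  by (simp_all add: decay_def)

lemma decay_le_1: "decay k x \<le> 1"
  using one_le_power[OF japanese_ge_1, of x k] by (simp add: decay_def inverse_le_1_iff)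

lemma decay_minus [simp]: "decay k (- x) = decay k x"
  by (simp add: decay_def)

lemma decay_diff_commute: "decay k (x - y) = decay k (y - x)"
  by (simp add: decay_def japanese_diff_commute)

lemma decay_add: "decay (k + l) x = decay k x * decay l x"
  by (simp add: decay_def power_add)

lemma decay_antimono: "k \<le> l \<Longrightarrow> decay l x \<le> decay k x"
  unfolding decay_def using japanese_ge_1[of x] by (intro le_imp_inverse_le power_increasing) auto

text \<open>Peetre's inequality: translating a polynomial weight costs only a polynomial factor in the translation.\<close>

lemma decay_shift: "decay k x \<le> 2 ^ k * japanese y ^ k * decay k (x + y)"
proof -
  have "japanese (x + y) ^ k \<le> (2 * (japanese x * japanese y)) ^ k"
    by (intro power_mono japanese_submult) auto
  then show ?thesis
    by (simp add: decay_def field_simps power_mult_distrib)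
qed

lemma decay_0 [simp]: "decay 0 x = 1"
  by (simp add: decay_def)

lemma continuous_on_decay [continuous_intros]:
  "continuous_on S f \<Longrightarrow> continuous_on S (\<lambda>x. decay k (f x))"
  unfolding decay_def by (intro continuous_intros) auto

lemma decay_measurable [measurable]:
  "f \<in> borel_measurable M \<Longrightarrow> (\<lambda>x. decay k (f x :: 'a::{euclidean_space})) \<in> borel_measurable M"
  unfolding decay_def by measurable

section \<open>Partial derivatives\<close>

lemma partial_deriv_eqI:
  "(f has_derivative D) (at x) \<Longrightarrow> partial_deriv i f x = D (axis i 1)"
  unfolding partial_deriv_def by (metis frechet_derivative_at)

lemma differentiable_has_derivative_partial:
  fixes f :: "real^'n::finite \<Rightarrow> complex"
  assumes "f differentiable (at x)"
  shows "(f has_derivative (\<lambda>h. \<Sum>i\<in>UNIV. h $ i *\<^sub>R partial_deriv i f x)) (at x)"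
proof -
  let ?D = "frechet_derivative f (at x)"
  have D: "(f has_derivative ?D) (at x)"
    using assms frechet_derivative_works by blast
  have lin: "linear ?D" by (rule linear_frechet_derivative[OF assms])
  have "?D = (\<lambda>h. \<Sum>i\<in>UNIV. h $ i *\<^sub>R partial_deriv i f x)"
  proof
    fix h :: "real^'n"
    have "h = (\<Sum>i\<in>UNIV. h $ i *\<^sub>R axis i 1)"
      by (metis (no_types) basis_expansion scalar_mult_eq_scaleR)
    then have "?D h = ?D (\<Sum>i\<in>UNIV. h $ i *\<^sub>R axis i 1)" by simp
    also have "\<dots> = (\<Sum>i\<in>UNIV. h $ i *\<^sub>R ?D (axis i 1))"
      by (simp add: linear_sum[OF lin] linear_scale[OF lin] del: scaleR_complex_def)
    finally show "?D h = (\<Sum>i\<in>UNIV. h $ i *\<^sub>R partial_deriv i f x)"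
      by (simp add: partial_deriv_def)
  qed
  with D show ?thesis by simp
qed

lemma partial_deriv_has_vector_derivative:
  assumes "f differentiable (at (x + s *\<^sub>R axis i 1))"
  shows "((\<lambda>s. f (x + s *\<^sub>R axis i 1)) has_vector_derivative partial_deriv i f (x + s *\<^sub>R axis i 1)) (at s)"
proof -
  let ?D = "frechet_derivative f (at (x + s *\<^sub>R axis i 1))"
  have D: "(f has_derivative ?D) (at (x + s *\<^sub>R axis i 1))"
    using assms frechet_derivative_works by blast
  have "((\<lambda>s. x + s *\<^sub>R axis i 1) has_derivative (\<lambda>h. h *\<^sub>R axis i 1)) (at s)"
    by (auto intro!: derivative_eq_intros)
  from has_derivative_compose[OF this D]
  have "((\<lambda>s. f (x + s *\<^sub>R axis i 1)) has_derivative (\<lambda>h. ?D (h *\<^sub>R axis i 1))) (at s)" .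
  moreover have "?D (h *\<^sub>R axis i 1) = h *\<^sub>R ?D (axis i 1)" for h
    using linear_frechet_derivative[OF assms] by (rule linear_scale)
  ultimately show ?thesis
    by (simp add: has_vector_derivative_def partial_deriv_def)
qed

lemma partial_deriv_add:
  "f differentiable (at x) \<Longrightarrow> g differentiable (at x) \<Longrightarrow>
   partial_deriv i (\<lambda>x. f x + g x) x = partial_deriv i f x + partial_deriv i g x"
  unfolding frechet_derivative_works
  by (subst partial_deriv_eqI[OF has_derivative_add]) (auto simp: partial_deriv_def)

lemma partial_deriv_cmult:
  "f differentiable (at x) \<Longrightarrow> partial_deriv i (\<lambda>x. c * f x) x = c * partial_deriv i f x"
  unfolding frechet_derivative_works
  by (subst partial_deriv_eqI[OF has_derivative_mult_right]) (auto simp: partial_deriv_def)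

lemma partial_deriv_mult:
  "f differentiable (at x) \<Longrightarrow> g differentiable (at x) \<Longrightarrow>
   partial_deriv i (\<lambda>x. f x * g x) x = partial_deriv i f x * g x + f x * partial_deriv i g x"
  unfolding frechet_derivative_works
  by (subst partial_deriv_eqI[OF has_derivative_mult]) (auto simp: partial_deriv_def)

lemma partial_deriv_cnj:
  "f differentiable (at x) \<Longrightarrow> partial_deriv i (\<lambda>x. cnj (f x)) x = cnj (partial_deriv i f x)"
  unfolding frechet_derivative_works
  by (subst partial_deriv_eqI[OF has_derivative_cnj]) (auto simp: partial_deriv_def)

lemma has_derivative_affine:
  fixes f :: "real^'n::finite \<Rightarrow> complex"
  assumes "f differentiable (at (a *\<^sub>R x + b))"
  shows "((\<lambda>x. f (a *\<^sub>R x + b)) has_derivative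
    (\<lambda>h. frechet_derivative f (at (a *\<^sub>R x + b)) (a *\<^sub>R h))) (at x)"
proof -
  have D: "(f has_derivative frechet_derivative f (at (a *\<^sub>R x + b))) (at (a *\<^sub>R x + b))"
    using assms frechet_derivative_works by blast
  have "((\<lambda>x. a *\<^sub>R x + b) has_derivative (\<lambda>h. a *\<^sub>R h)) (at x)"
    by (auto intro!: derivative_eq_intros)
  from has_derivative_compose[OF this D] show ?thesis .
qed

lemma partial_deriv_affine:
  assumes "f differentiable (at (a *\<^sub>R x + b))"
  shows "partial_deriv i (\<lambda>x. f (a *\<^sub>R x + b)) x = of_real a * partial_deriv i f (a *\<^sub>R x + b)"
  using partial_deriv_eqI[OF has_derivative_affine[OF assms], of i]
    linear_scale[OF linear_frechet_derivative[OF assms]]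
  by (simp add: partial_deriv_def scaleR_conv_of_real)

lemma has_derivative_cis_inner:
  "((\<lambda>t. cis (- (t \<bullet> \<xi>))) has_derivative (\<lambda>h. cis (- (x \<bullet> \<xi>)) * (- (\<i> * of_real (h \<bullet> \<xi>))))) (at x)"
proof -
  have "((\<lambda>t. - (t \<bullet> \<xi>)) has_derivative (\<lambda>h. - (h \<bullet> \<xi>))) (at x)"
    by (auto intro!: derivative_eq_intros)
  moreover have "(cis has_derivative (\<lambda>h. h *\<^sub>R (\<i> * cis y))) (at y)" for y
    unfolding cis_conv_exp has_vector_derivative_def[symmetric]
    by (auto intro!: derivative_eq_intros simp: mult_ac)
  ultimately show ?thesis
    by (drule_tac has_derivative_compose) (auto simp: scaleR_conv_of_real mult_ac)
qed

lemma partial_deriv_cis: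
  "partial_deriv i (\<lambda>t. cis (- (t \<bullet> \<xi>))) x = - (\<i> * of_real (\<xi> $ i)) * cis (- (x \<bullet> \<xi>))"
  by (subst partial_deriv_eqI[OF has_derivative_cis_inner]) (simp add: inner_axis' mult_ac)

lemma differentiable_cis: "(\<lambda>t. cis (- (t \<bullet> \<xi>))) differentiable (at x)"
  using has_derivative_cis_inner differentiable_def by blast

section \<open>Uniform derivative bounds for families of functions\<close>

text \<open>Seminorm estimates are needed for whole families of functions with constants independent of the
  parameter, for instance for all time-frequency shifts of the window at once. The predicate says that
  the partial derivatives of \<open>F z\<close> up to order \<open>N\<close> exist and are bounded by a multiple of the
  majorant \<open>W z\<close>, with one constant for all \<open>z\<close>. The constant is left implicit, so that the
  closure rules below compose without bookkeeping.\<close>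

primrec dbound :: "nat \<Rightarrow> ('z \<Rightarrow> real^'n \<Rightarrow> real) \<Rightarrow> ('z \<Rightarrow> real^'n::finite \<Rightarrow> complex) \<Rightarrow> bool" where
  "dbound 0 W F \<longleftrightarrow> (\<exists>C. \<forall>z t. norm (F z t) \<le> C * W z t)"
| "dbound (Suc N) W F \<longleftrightarrow> (\<exists>C. \<forall>z t. norm (F z t) \<le> C * W z t) \<and>
     (\<forall>z t. F z differentiable (at t)) \<and> (\<forall>i. dbound N W (\<lambda>z. partial_deriv i (F z)))"

lemma dbound_bound:
  assumes "dbound N W F" "\<And>z t. 0 \<le> W z t"
  obtains C where "0 \<le> C" "\<And>z t. norm (F z t) \<le> C * W z t"
proof -
  from assms(1) obtain C where C: "\<And>z t. norm (F z t) \<le> C * W z t" by (cases N) auto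
  have "norm (F z t) \<le> \<bar>C\<bar> * W z t" for z t
    using C[of z t] assms(2)[of z t] by (meson abs_ge_self mult_right_mono order_trans)
  then show ?thesis using that[of "\<bar>C\<bar>"] by auto
qed

lemma dbound_differentiable: "dbound (Suc N) W F \<Longrightarrow> F z differentiable (at t)"
  by simp

lemma dbound_continuous: "dbound (Suc N) W F \<Longrightarrow> continuous_on UNIV (F z)"
  by (meson dbound_differentiable differentiable_imp_continuous_within continuous_at_imp_continuous_on)

lemma dbound_partial: "dbound (Suc N) W F \<Longrightarrow> dbound N W (\<lambda>z. partial_deriv i (F z))"
  by simp

lemma dbound_pred: "dbound (Suc N) W F \<Longrightarrow> dbound N W F"
  by (induction N arbitrary: F) auto

lemma dbound_le: "M \<le> N \<Longrightarrow> dbound N W F \<Longrightarrow> dbound M W F"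
  by (induction N rule: dec_induct) (auto simp del: dbound.simps dest: dbound_pred)

lemma dbound_mono:
  assumes "dbound N W F" "\<And>z t. 0 \<le> W z t" "\<And>z t. W z t \<le> C * W' z t"
  shows "dbound N W' F"
proof -
  have *: "\<exists>C'. \<forall>z t. norm (F z t) \<le> C' * W' z t" if "\<exists>C. \<forall>z t. norm (F z t) \<le> C * W z t" for F :: "'a \<Rightarrow> real^'b \<Rightarrow> complex"
  proof -
    from that obtain B where B: "\<And>z t. norm (F z t) \<le> B * W z t" by auto
    have "norm (F z t) \<le> (\<bar>B\<bar> * C) * W' z t" for z t
    proof -
      have "norm (F z t) \<le> B * W z t" by (rule B)
      also have "\<dots> \<le> \<bar>B\<bar> * W z t" by (intro mult_right_mono assms) auto
      also have "\<dots> \<le> \<bar>B\<bar> * (C * W' z t)" by (intro mult_left_mono assms) auto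
      finally show ?thesis by (simp add: mult_ac)
    qed
    then show ?thesis by blast
  qed
  show ?thesis using assms(1)
    by (induction N arbitrary: F) (auto intro!: *)
qed

lemma dbound_reindex: "dbound N W F \<Longrightarrow> dbound N (\<lambda>z. W (h z)) (\<lambda>z. F (h z))"
  by (induction N arbitrary: F) (simp_all, blast+)

lemma dbound_add:
  assumes "dbound N W F" "dbound N W G"
  shows "dbound N W (\<lambda>z t. F z t + G z t)"
proof -
  have *: "\<exists>C. \<forall>z t. norm (F z t + G z t) \<le> C * W z t"
    if "\<exists>C. \<forall>z t. norm (F z t) \<le> C * W z t" "\<exists>C. \<forall>z t. norm (G z t) \<le> C * W z t"
    for F G :: "'a \<Rightarrow> real^'b \<Rightarrow> complex"
  proof -
    from that obtain C1 C2 where C: "\<And>z t. norm (F z t) \<le> C1 * W z t" "\<And>z t. norm (G z t) \<le> C2 * W z t"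
      by blast
    have "norm (F z t + G z t) \<le> (C1 + C2) * W z t" for z t
      using norm_triangle_ineq[of "F z t" "G z t"] C(1)[of z t] C(2)[of z t]
      by (simp add: distrib_right)
    then show ?thesis by blast
  qed
  show ?thesis using assms
  proof (induction N arbitrary: F G)
    case 0 then show ?case using * by simp
  next
    case (Suc N)
    have "partial_deriv i (\<lambda>t. F z t + G z t) = (\<lambda>t. partial_deriv i (F z) t + partial_deriv i (G z) t)" for i z
      using Suc.prems by (intro ext partial_deriv_add) auto
    with Suc show ?case by (auto intro!: * differentiable_add)
  qed
qed

lemma dbound_cmult:
  assumes "dbound N W F"
  shows "dbound N (\<lambda>z t. norm (c z) * W z t) (\<lambda>z t. c z * F z t)"
proof -
  have *: "\<exists>C. \<forall>z t. norm (c z * F z t) \<le> C * (norm (c z) * W z t)"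
    if "\<exists>C. \<forall>z t. norm (F z t) \<le> C * W z t"
    for F :: "'a \<Rightarrow> real^'b \<Rightarrow> complex"
  proof -
    from that obtain C where C: "\<And>z t. norm (F z t) \<le> C * W z t" by blast
    have "norm (c z * F z t) \<le> C * (norm (c z) * W z t)" for z t
      using mult_left_mono[OF C[of z t], of "norm (c z)"] by (simp add: norm_mult mult_ac)
    then show ?thesis by blast
  qed
  show ?thesis using assms
  proof (induction N arbitrary: F)
    case 0 then show ?case using * by simp
  next
    case (Suc N)
    have "partial_deriv i (\<lambda>t. c z * F z t) = (\<lambda>t. c z * partial_deriv i (F z) t)" for i z
      using Suc.prems by (intro ext partial_deriv_cmult) auto
    with Suc show ?case by (auto intro!: * differentiable_mult)
  qed
qed

lemma dbound_cmult_bounded: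
  assumes "dbound N W F" "\<And>z t. 0 \<le> W z t" "\<And>z. norm (c z) \<le> B"
  shows "dbound N W (\<lambda>z t. c z * F z t)"
  by (rule dbound_mono[OF dbound_cmult[OF assms(1)], of _ B]) (auto intro!: mult_right_mono assms mult_nonneg_nonneg)

lemma dbound_uminus: "dbound N W F \<Longrightarrow> (\<And>z t. 0 \<le> W z t) \<Longrightarrow> dbound N W (\<lambda>z t. - F z t)"
  using dbound_cmult_bounded[of N W F "\<lambda>_. -1" 1] by simp

lemma dbound_diff:
  "dbound N W F \<Longrightarrow> dbound N W G \<Longrightarrow> (\<And>z t. 0 \<le> W z t) \<Longrightarrow> dbound N W (\<lambda>z t. F z t - G z t)"
  using dbound_add[OF _ dbound_uminus] by (metis (no_types, lifting) ext diff_conv_add_uminus)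

lemma dbound_0: "(\<And>z t. 0 \<le> W z t) \<Longrightarrow> dbound N W (\<lambda>z t. 0)"
proof (induction N)
  case 0 then show ?case by (auto intro!: exI[of _ 1])
next
  case (Suc N)
  have "partial_deriv i (\<lambda>t. 0) = (\<lambda>t::real^'b. 0)" for i
    by (auto simp: partial_deriv_def)
  with Suc show ?case by (auto intro!: exI[of _ 1])
qed

lemma dbound_sum:
  assumes "finite I" "\<And>i. i \<in> I \<Longrightarrow> dbound N W (F i)" "(\<And>z t. 0 \<le> W z t)"
  shows "dbound N W (\<lambda>z t. \<Sum>i\<in>I. F i z t)"
  using assms by (induction I rule: finite_induct) (auto intro: dbound_0 dbound_add)

lemma dbound_mult:
  assumes "dbound N W F" "dbound N W' G"
  shows "dbound N (\<lambda>z t. W z t * W' z t) (\<lambda>z t. F z t * G z t)"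
proof -
  have *: "\<exists>C. \<forall>z t. norm (F z t * G z t) \<le> C * (W z t * W' z t)"
    if "\<exists>C. \<forall>z t. norm (F z t) \<le> C * W z t" "\<exists>C. \<forall>z t. norm (G z t) \<le> C * W' z t"
    for F G :: "'a \<Rightarrow> real^'b \<Rightarrow> complex"
  proof -
    from that obtain C1 C2 where C: "\<And>z t. norm (F z t) \<le> C1 * W z t" "\<And>z t. norm (G z t) \<le> C2 * W' z t"
      by blast
    have "norm (F z t * G z t) \<le> (C1 * C2) * (W z t * W' z t)" for z t
    proof -
      have "norm (F z t) * norm (G z t) \<le> (C1 * W z t) * (C2 * W' z t)"
        by (intro mult_mono C order_trans[OF norm_ge_zero C(1)] norm_ge_zero)
      then show ?thesis by (simp add: norm_mult mult_ac)
    qed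
    then show ?thesis by blast
  qed
  show ?thesis using assms
  proof (induction N arbitrary: F G)
    case 0 then show ?case using * by simp
  next
    case (Suc N)
    have "partial_deriv i (\<lambda>t. F z t * G z t) = (\<lambda>t. partial_deriv i (F z) t * G z t + F z t * partial_deriv i (G z) t)" for i z
      using Suc.prems by (intro ext partial_deriv_mult) auto
    moreover have "dbound N (\<lambda>z t. W z t * W' z t)
       (\<lambda>z t. partial_deriv i (F z) t * G z t + F z t * partial_deriv i (G z) t)" for i
      by (intro dbound_add Suc.IH dbound_partial Suc.prems dbound_pred[OF Suc.prems(1)] dbound_pred[OF Suc.prems(2)])
    ultimately show ?case using Suc by (auto intro!: * differentiable_mult)
  qed
qed

lemma dbound_cnj: "dbound N W F \<Longrightarrow> dbound N W (\<lambda>z t. cnj (F z t))"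
proof (induction N arbitrary: F)
  case 0 then show ?case by simp
next
  case (Suc N)
  have "partial_deriv i (\<lambda>t. cnj (F z t)) = (\<lambda>t. cnj (partial_deriv i (F z) t))" for i z
    using Suc.prems by (intro ext partial_deriv_cnj) auto
  moreover have "(\<lambda>t. cnj (F z t)) differentiable (at t)" for z t
    using Suc.prems has_derivative_cnj[of "F z" _ "at t"] unfolding dbound.simps differentiable_def by blast
  ultimately show ?case using Suc by auto
qed

lemma dbound_affine:
  assumes "dbound N W F" "\<And>z t. 0 \<le> W z t" "\<And>z. \<bar>a z\<bar> \<le> A"
  shows "dbound N (\<lambda>z t. W (h z) (a z *\<^sub>R t + b z)) (\<lambda>z t. F (h z) (a z *\<^sub>R t + b z))"
  using assms(1)
proof (induction N arbitrary: F)
  case 0 then show ?case by auto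
next
  case (Suc N)
  have eq: "partial_deriv i (\<lambda>t. F (h z) (a z *\<^sub>R t + b z)) =
      (\<lambda>t. of_real (a z) * partial_deriv i (F (h z)) (a z *\<^sub>R t + b z))" for i z
    using Suc.prems by (intro ext partial_deriv_affine) auto
  have "dbound N (\<lambda>z t. W (h z) (a z *\<^sub>R t + b z))
      (\<lambda>z t. of_real (a z) * partial_deriv i (F (h z)) (a z *\<^sub>R t + b z))" for i
    by (rule dbound_cmult_bounded[where B=A])
       (use Suc.prems assms in \<open>auto intro!: Suc.IH[of "\<lambda>z. partial_deriv i (F z)"]\<close>)
  moreover have "(\<lambda>t. F (h z) (a z *\<^sub>R t + b z)) differentiable (at t)" for z t
    using has_derivative_affine[of "F (h z)" "a z" t "b z"] Suc.prems by (auto simp: differentiable_def)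
  moreover have "\<exists>C. \<forall>z t. norm (F (h z) (a z *\<^sub>R t + b z)) \<le> C * W (h z) (a z *\<^sub>R t + b z)"
    using Suc.prems by auto
  ultimately show ?case by (simp add: eq)
qed

text \<open>The reparametrisation \<open>h\<close>, together with a translation that depends on the parameter, lets the
  window enter families indexed by points of phase space.\<close>

lemma dbound_translate:
  "dbound N W F \<Longrightarrow> (\<And>z t. 0 \<le> W z t) \<Longrightarrow>
    dbound N (\<lambda>z t. W (h z) (t - b z)) (\<lambda>z t. F (h z) (t - b z))"
  using dbound_affine[of N W F "\<lambda>_. 1" 1 h "\<lambda>z. - b z"] by simp

lemma dbound_cis:
  "dbound N (\<lambda>\<xi> t. japanese \<xi> ^ N) (\<lambda>\<xi> t. cis (- (t \<bullet> \<xi>)))"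
proof (induction N)
  case 0 then show ?case by (auto intro!: exI[of _ 1])
next
  case (Suc N)
  have eq: "partial_deriv i (\<lambda>t. cis (- (t \<bullet> \<xi>))) = (\<lambda>t. - (\<i> * of_real (\<xi> $ i)) * cis (- (t \<bullet> \<xi>)))" for i and \<xi> :: "real^'a"
    by (intro ext partial_deriv_cis)
  have "dbound N (\<lambda>\<xi> t. japanese \<xi> ^ Suc N) (\<lambda>\<xi> t. - (\<i> * of_real (\<xi> $ i)) * cis (- (t \<bullet> \<xi>)))" for i :: 'a
  proof (rule dbound_mono[OF dbound_cmult[OF Suc.IH], of _ 1])
    fix \<xi> :: "real^'a"
    have "\<bar>\<xi> $ i\<bar> \<le> japanese \<xi>"
      using component_le_norm_cart[of \<xi> i] norm_le_japanese[of \<xi>] by linarith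
    then show "norm (- (\<i> * complex_of_real (\<xi> $ i))) * japanese \<xi> ^ N \<le> 1 * japanese \<xi> ^ Suc N"
      by (auto simp: norm_mult intro!: mult_right_mono)
  qed auto
  moreover have "1 \<le> 1 * japanese \<xi> ^ Suc N" for \<xi> :: "real^'a"
    using one_le_power[OF japanese_ge_1, of \<xi> "Suc N"] by simp
  ultimately show ?case by (auto simp: eq differentiable_cis intro!: exI[of _ 1] simp del: power_Suc)
qed

text \<open>The bound vanishes with \<open>h\<close>, at the price of one power of \<open>t\<close>. It gives continuity of
  time-frequency shifts in the frequency variable.\<close>

lemma dbound_cis_diff:
  "dbound N (\<lambda>h t. norm h * japanese h ^ N * japanese t) (\<lambda>h t. cis (- (t \<bullet> h)) - 1)"
proof -
  have b: "norm (cis (- (t \<bullet> h)) - 1) \<le> 1 * (norm h * japanese h ^ N * japanese t)" for h t :: "real^'a" and N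
  proof -
    have "norm (cis (- (t \<bullet> h)) - 1) \<le> \<bar>t \<bullet> h\<bar>"
      unfolding cis_conv_exp using norm_exp_i_times[of "- (t \<bullet> h)"] iexp_approx1[of "- (t \<bullet> h)" 0]
      by simp
    also have "\<dots> \<le> norm t * norm h" by (rule Cauchy_Schwarz_ineq2)
    also have "\<dots> \<le> japanese t * norm h * 1"
      using norm_le_japanese[of t] by (simp add: mult_right_mono)
    also have "\<dots> \<le> japanese t * norm h * japanese h ^ N"
      by (intro mult_left_mono one_le_power japanese_ge_1) auto
    finally show ?thesis by (simp add: mult_ac)
  qed
  show ?thesis
  proof (cases N)
    case 0 then show ?thesis using b[of _ _ 0] by (auto intro!: exI[of _ 1])
  next
    case (Suc M)
    have eq: "partial_deriv i (\<lambda>t. cis (- (t \<bullet> \<xi>)) - 1) = (\<lambda>t. - (\<i> * of_real (\<xi> $ i)) * cis (- (t \<bullet> \<xi>)))" for i and \<xi> :: "real^'a"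
    proof
      fix t
      have "((\<lambda>t. cis (- (t \<bullet> \<xi>)) - 1) has_derivative (\<lambda>h. cis (- (t \<bullet> \<xi>)) * (- (\<i> * of_real (h \<bullet> \<xi>))))) (at t)"
        using has_derivative_diff[OF has_derivative_cis_inner has_derivative_const] by simp
      from partial_deriv_eqI[OF this]
      show "partial_deriv i (\<lambda>t. cis (- (t \<bullet> \<xi>)) - 1) t = - (\<i> * of_real (\<xi> $ i)) * cis (- (t \<bullet> \<xi>))"
        by (simp add: inner_axis' mult_ac)
    qed
    have "dbound M (\<lambda>h t. norm h * japanese h ^ Suc M * japanese t) (\<lambda>\<xi> t. - (\<i> * of_real (\<xi> $ i)) * cis (- (t \<bullet> \<xi>)))" for i :: 'a
    proof (rule dbound_mono[OF dbound_cmult[OF dbound_cis[of M], where c="\<lambda>\<xi>. - (\<i> * of_real (\<xi> $ i))"], of 1])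
      fix \<xi> t :: "real^'a"
      have "\<bar>\<xi> $ i\<bar> * japanese \<xi> ^ M * 1 \<le> norm \<xi> * japanese \<xi> ^ Suc M * japanese t"
        using component_le_norm_cart[of \<xi> i] japanese_ge_1
        by (intro mult_mono power_increasing) auto
      then show "norm (- (\<i> * complex_of_real (\<xi> $ i))) * japanese \<xi> ^ M \<le> 1 * (norm \<xi> * japanese \<xi> ^ Suc M * japanese t)"
        by (auto simp: norm_mult)
    qed auto
    moreover have "\<exists>C. \<forall>z t::real^'a. cmod (cis (- (t \<bullet> z)) - 1) \<le> C * (norm z * japanese z ^ Suc M * japanese t)"
      using b by blast
    moreover have "(\<lambda>t::real^'a. cis (- (t \<bullet> z)) - 1) differentiable at t" for z t
      by (intro differentiable_diff differentiable_cis) auto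
    ultimately show ?thesis unfolding Suc by (simp add: eq del: power_Suc)
  qed
qed

section \<open>Schwartz functions\<close>

lemma iter_deriv_Nil [simp]: "iter_deriv [] f = f"
  by (simp add: iter_deriv_def)

lemma iter_deriv_Cons: "iter_deriv (i # is) f = partial_deriv i (iter_deriv is f)"
  by (simp add: iter_deriv_def)

lemma iter_deriv_snoc: "iter_deriv (is @ [i]) f = iter_deriv is (partial_deriv i f)"
  by (simp add: iter_deriv_def)

lemma dbound_iter_deriv:
  assumes "dbound N W F" "length is \<le> N"
  shows "dbound (N - length is) W (\<lambda>z. iter_deriv is (F z))"
  using assms
proof (induction "is" arbitrary: N F rule: rev_induct)
  case Nil then show ?case by simp
next
  case (snoc i "is")
  then obtain M where N: "N = Suc M" by (cases N) auto
  have "dbound (M - length is) W (\<lambda>z. iter_deriv is (partial_deriv i (F z)))"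
    using snoc.prems N by (intro snoc.IH dbound_partial) auto
  then show ?case by (simp add: iter_deriv_snoc N)
qed

lemma dboundI_iter_deriv:
  assumes "\<And>is. length is \<le> N \<Longrightarrow> \<exists>C. \<forall>z t. norm (iter_deriv is (F z) t) \<le> C * W z t"
    and "\<And>is z t. length is < N \<Longrightarrow> iter_deriv is (F z) differentiable (at t)"
  shows "dbound N W F"
  using assms
proof (induction N arbitrary: F)
  case 0 then show ?case using "0.prems"(1)[of "[]"] by simp
next
  case (Suc N)
  have "dbound N W (\<lambda>z. partial_deriv i (F z))" for i
    using Suc.prems(1)[of "_ @ [i]"] Suc.prems(2)[of "_ @ [i]"]
    by (intro Suc.IH) (auto simp: iter_deriv_snoc)
  with Suc.prems(1)[of "[]"] Suc.prems(2)[of "[]"] show ?case by auto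
qed

text \<open>A single function is a family indexed by \<open>unit\<close>. Closure properties of the Schwartz
  space are inherited from those of \<open>dbound\<close>.\<close>

lemma schwartz_iff_dbound:
  "\<phi> \<in> schwartz \<longleftrightarrow> (\<forall>N k. dbound N (\<lambda>_ t. decay k t) (\<lambda>_::unit. \<phi>))"
proof safe
  fix N k assume \<phi>: "\<phi> \<in> schwartz"
  show "dbound N (\<lambda>_ t. decay k t) (\<lambda>_::unit. \<phi>)"
  proof (rule dboundI_iter_deriv)
    fix "is" :: "'a list"
    from \<phi> have "bounded (range (\<lambda>x. japanese x ^ k *\<^sub>R iter_deriv is \<phi> x))"
      by (simp add: schwartz_def)
    then obtain B where "\<And>x. norm (japanese x ^ k *\<^sub>R iter_deriv is \<phi> x) \<le> B"
      by (auto simp: bounded_iff)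
    then have "norm (iter_deriv is \<phi> t) \<le> B * decay k t" for t
      by (simp add: decay_def field_simps)
    then show "\<exists>C. \<forall>z t. norm (iter_deriv is \<phi> t) \<le> C * decay k t" by blast
  next
    fix "is" :: "'a list" and t show "iter_deriv is \<phi> differentiable at t"
      using \<phi> by (auto simp: schwartz_def smooth_def differentiable_on_def)
  qed
next
  assume d: "\<forall>N k. dbound N (\<lambda>_ t. decay k t) (\<lambda>_::unit. \<phi>)"
  have "iter_deriv is \<phi> differentiable (at t)" for "is" t
    using dbound_iter_deriv[OF d[rule_format, of "Suc (length is)" 0], of "is"] by simp
  then have "smooth \<phi>" by (auto simp: smooth_def differentiable_on_def)
  moreover have "bounded (range (\<lambda>x. japanese x ^ k *\<^sub>R iter_deriv is \<phi> x))" for k "is"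
  proof -
    obtain C where "\<And>t. norm (iter_deriv is \<phi> t) \<le> C * decay k t"
      using dbound_iter_deriv[OF d[rule_format, of "length is" k], of "is"] by auto
    then have "norm (japanese t ^ k *\<^sub>R iter_deriv is \<phi> t) \<le> C" for t
      by (simp add: decay_def field_simps)
    then show ?thesis by (auto simp: bounded_iff)
  qed
  ultimately show "\<phi> \<in> schwartz" by (simp add: schwartz_def)
qed

lemma schwartz_dbound: "\<phi> \<in> schwartz \<Longrightarrow> dbound N (\<lambda>_ t. decay k t) (\<lambda>_. \<phi>)"
  using dbound_reindex[of N "\<lambda>_ t. decay k t" "\<lambda>_::unit. \<phi>" "\<lambda>_. ()"] by (simp add: schwartz_iff_dbound)

lemma schwartz_bound:
  assumes "\<phi> \<in> schwartz"
  obtains C where "0 \<le> C" "\<And>t. norm (\<phi> t) \<le> C * decay k t"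
  using dbound_bound[OF schwartz_dbound[OF assms, of 0 k]] by auto

lemma schwartz_differentiable: "\<phi> \<in> schwartz \<Longrightarrow> \<phi> differentiable (at t)"
  using schwartz_dbound[of \<phi> "Suc 0" 0] by auto

lemma schwartz_continuous: "\<phi> \<in> schwartz \<Longrightarrow> continuous_on UNIV \<phi>"
  by (meson schwartz_differentiable differentiable_imp_continuous_within continuous_at_imp_continuous_on)

lemma schwartz_partial: "\<phi> \<in> schwartz \<Longrightarrow> partial_deriv i \<phi> \<in> schwartz"
  unfolding schwartz_iff_dbound
  by (intro allI dbound_partial[of _ _ "\<lambda>_. \<phi>"]) blast

lemma schwartz_iter: "\<phi> \<in> schwartz \<Longrightarrow> iter_deriv is \<phi> \<in> schwartz"
  by (induction "is") (auto simp: iter_deriv_Cons schwartz_partial)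

lemma schwartz_add: "\<phi> \<in> schwartz \<Longrightarrow> \<psi> \<in> schwartz \<Longrightarrow> (\<lambda>t. \<phi> t + \<psi> t) \<in> schwartz"
  using dbound_add by (fastforce simp: schwartz_iff_dbound)

lemma schwartz_cmult: "\<phi> \<in> schwartz \<Longrightarrow> (\<lambda>t. c * \<phi> t) \<in> schwartz"
  unfolding schwartz_iff_dbound
  by (intro allI dbound_cmult_bounded[where B="norm c" and c="\<lambda>_. c"]) auto

lemma schwartz_0: "(\<lambda>t. 0) \<in> schwartz"
  unfolding schwartz_iff_dbound by (intro allI dbound_0) auto

lemma schwartz_diff: "\<phi> \<in> schwartz \<Longrightarrow> \<psi> \<in> schwartz \<Longrightarrow> (\<lambda>t. \<phi> t - \<psi> t) \<in> schwartz"
  using schwartz_add[OF _ schwartz_cmult[of \<psi> "-1"]] by simp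

lemma schwartz_sum: "finite I \<Longrightarrow> (\<And>i. i \<in> I \<Longrightarrow> \<phi> i \<in> schwartz) \<Longrightarrow> (\<lambda>t. \<Sum>i\<in>I. \<phi> i t) \<in> schwartz"
  by (induction I rule: finite_induct) (auto intro: schwartz_0 schwartz_add)

lemma schwartz_cnj: "\<phi> \<in> schwartz \<Longrightarrow> (\<lambda>t. cnj (\<phi> t)) \<in> schwartz"
  using dbound_cnj by (fastforce simp: schwartz_iff_dbound)

lemma schwartz_mult: "\<phi> \<in> schwartz \<Longrightarrow> \<psi> \<in> schwartz \<Longrightarrow> (\<lambda>t. \<phi> t * \<psi> t) \<in> schwartz"
  unfolding schwartz_iff_dbound
  using dbound_mult[of _ "\<lambda>_::unit. decay _" "\<lambda>_. \<phi>" "\<lambda>_. decay 0" "\<lambda>_. \<psi>"] by simp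

lemma schwartz_translate: "\<phi> \<in> schwartz \<Longrightarrow> (\<lambda>t. \<phi> (t - x)) \<in> schwartz"
  unfolding schwartz_iff_dbound
proof (intro allI)
  fix N k assume d: "\<forall>N k. dbound N (\<lambda>_. decay k) (\<lambda>_::unit. \<phi>)"
  have "dbound N (\<lambda>_ t. decay k (t - x)) (\<lambda>_::unit. \<lambda>t. \<phi> (t - x))"
    using dbound_translate[of N "\<lambda>_ t. decay k t" "\<lambda>_::unit. \<phi>" "\<lambda>_. ()" "\<lambda>_. x"] d by simp
  then show "dbound N (\<lambda>_. decay k) (\<lambda>_::unit. \<lambda>t. \<phi> (t - x))"
    by (rule dbound_mono[where C="2 ^ k * japanese x ^ k"])
       (use decay_shift[of k "_ - x" x] in auto)
qed

lemma schwartz_modulate: "\<phi> \<in> schwartz \<Longrightarrow> (\<lambda>t. \<phi> t * cis (- (t \<bullet> \<xi>))) \<in> schwartz"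
  unfolding schwartz_iff_dbound
proof (intro allI)
  fix N k assume d: "\<forall>N k. dbound N (\<lambda>_. decay k) (\<lambda>_::unit. \<phi>)"
  have "dbound N (\<lambda>_ t. japanese \<xi> ^ N) (\<lambda>_::unit. \<lambda>t. cis (- (t \<bullet> \<xi>)))"
    using dbound_reindex[OF dbound_cis, of N "\<lambda>_. \<xi>"] by simp
  from dbound_mult[OF d[rule_format, of N k] this]
  show "dbound N (\<lambda>_. decay k) (\<lambda>_::unit. \<lambda>t. \<phi> t * cis (- (t \<bullet> \<xi>)))"
    by (rule dbound_mono[where C="japanese \<xi> ^ N"]) auto
qed

text \<open>The mean value theorem along the segment from \<open>t - x'\<close> to \<open>t - x\<close>, applied to every
  derivative. It gives continuity of time-frequency shifts in the time variable.\<close>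

lemma dbound_translate_diff:
  assumes "\<phi> \<in> schwartz"
  shows "dbound N (\<lambda>(x, x') t. norm (x' - x) * japanese (x' - x) ^ k * decay k (t - x))
           (\<lambda>(x, x') t. \<phi> (t - x') - \<phi> (t - x))"
  using assms
proof (induction N arbitrary: \<phi>)
  case base: 0
  show ?case
  proof -
    have "\<exists>C. \<forall>i t. norm (partial_deriv i \<phi> t) \<le> C * decay k t"
    proof -
      have "\<forall>i. \<exists>C. \<forall>t. norm (partial_deriv i \<phi> t) \<le> C * decay k t"
        using schwartz_partial[OF base] schwartz_bound by metis
      then obtain C where C: "\<And>i t. norm (partial_deriv i \<phi> t) \<le> C i * decay k t" by metis
      have "norm (partial_deriv i \<phi> t) \<le> (\<Sum>i\<in>UNIV. \<bar>C i\<bar>) * decay k t" for i t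
      proof -
        have "C i \<le> (\<Sum>i\<in>UNIV. \<bar>C i\<bar>)"
          using member_le_sum[of i UNIV "\<lambda>i. \<bar>C i\<bar>"] by simp
        then show ?thesis by (rule order_trans[OF C mult_right_mono]) simp
      qed
      then show ?thesis by blast
    qed
    then obtain C where C: "\<And>i t. norm (partial_deriv i \<phi> t) \<le> C * decay k t" by blast
    have "norm (\<phi> (t - x') - \<phi> (t - x)) \<le>
       real CARD('a) * C * 2 ^ k * (norm (x' - x) * japanese (x' - x) ^ k * decay k (t - x))" for t x x' :: "real^'a"
    proof -
      let ?S = "closed_segment (t - x') (t - x)"
      let ?B = "real CARD('a) * (C * (2 ^ k * japanese (x' - x) ^ k * decay k (t - x)))"
      have "norm (\<phi> (t - x') - \<phi> (t - x)) \<le> ?B * norm ((t - x') - (t - x))"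
      proof (rule differentiable_bound)
        fix y assume y: "y \<in> ?S"
        show "(\<phi> has_derivative (\<lambda>h. \<Sum>i\<in>UNIV. h $ i *\<^sub>R partial_deriv i \<phi> y)) (at y within ?S)"
          using differentiable_has_derivative_partial[OF schwartz_differentiable[OF base], of y]
          by (rule has_derivative_at_withinI)
        obtain s where s: "0 \<le> s" "s \<le> 1" "y = (1 - s) *\<^sub>R (t - x') + s *\<^sub>R (t - x)"
          using y by (auto simp: closed_segment_def)
        \<comment> \<open>\<open>v\<close> carries the point \<open>y\<close> of the segment to its end \<open>t - x\<close>, so the weight at \<open>y\<close> is
          compared with the weight at \<open>t - x\<close>.\<close>
        define v where "v = (1 - s) *\<^sub>R (x' - x)"
        have yv: "y + v = t - x" using s by (simp add: v_def algebra_simps)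
        have "norm v \<le> norm (x' - x)"
          using s by (simp add: v_def mult_left_le_one_le)
        then have "japanese v \<le> japanese (x' - x)"
          by (simp add: japanese_def power_mono)
        then have d: "decay k y \<le> 2 ^ k * japanese (x' - x) ^ k * decay k (t - x)"
          using decay_shift[of k y v] unfolding yv
          by (meson decay_nonneg japanese_nonneg mult_left_mono mult_right_mono order_trans power_mono zero_le_numeral zero_le_power)
        have C0: "0 \<le> C" using C[of undefined 0] order_trans[OF norm_ge_zero C[of undefined 0]] decay_pos[of k "0::real^'a"]
          by (simp add: zero_le_mult_iff not_le[symmetric] del: decay_pos)
        have bd: "norm (partial_deriv i \<phi> y) \<le> C * (2 ^ k * japanese (x' - x) ^ k * decay k (t - x))" for i
          using C[of i y] mult_left_mono[OF d C0] by linarith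
        show "onorm (\<lambda>h. \<Sum>i\<in>UNIV. h $ i *\<^sub>R partial_deriv i \<phi> y) \<le> ?B"
        proof (rule onorm_le)
          fix h :: "real^'a"
          have "norm (\<Sum>i\<in>UNIV. h $ i *\<^sub>R partial_deriv i \<phi> y) \<le> (\<Sum>i\<in>(UNIV::'a set). norm h * (C * (2 ^ k * japanese (x' - x) ^ k * decay k (t - x))))"
            unfolding norm_scaleR[symmetric]
            by (intro sum_norm_le) (auto simp del: scaleR_complex_def intro!: mult_mono component_le_norm_cart bd)
          then show "norm (\<Sum>i\<in>UNIV. h $ i *\<^sub>R partial_deriv i \<phi> y) \<le> ?B * norm h"
            by (simp add: mult_ac)
        qed
      qed auto
      also have "norm ((t - x') - (t - x)) = norm (x' - x)" by (simp add: norm_minus_commute)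
      finally show ?thesis by (simp add: mult_ac)
    qed
    then show ?thesis by (auto intro!: exI[of _ "real CARD('a) * C * 2 ^ k"])
  qed
next
  case (Suc N)
  have b: "\<exists>C. \<forall>z t. norm ((\<lambda>(x, x') t. \<phi> (t - x') - \<phi> (t - x)) z t) \<le> C * (\<lambda>(x, x') t. norm (x' - x) * japanese (x' - x) ^ k * decay k (t - x)) z t"
    using dbound_le[OF _ Suc.IH[OF Suc.prems], of 0] by simp
  have diff: "(\<lambda>t. \<phi> (t - x)) differentiable (at t)" for x t
    by (rule schwartz_differentiable[OF schwartz_translate[OF Suc.prems]])
  have eq: "partial_deriv i ((\<lambda>(x, x') t. \<phi> (t - x') - \<phi> (t - x)) z) =
      (\<lambda>(x, x') t. partial_deriv i \<phi> (t - x') - partial_deriv i \<phi> (t - x)) z" for i z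
  proof (cases z, rule ext)
    fix x x' t assume z: "z = (x, x')"
    have tr: "partial_deriv i (\<lambda>t. \<phi> (t - x)) t = partial_deriv i \<phi> (t - x)" for x
      using partial_deriv_affine[of \<phi> 1 t "-x" i] schwartz_differentiable[OF Suc.prems] by simp
    have "partial_deriv i (\<lambda>t. \<phi> (t - x') + (-1) * \<phi> (t - x)) t = partial_deriv i \<phi> (t - x') + (-1) * partial_deriv i \<phi> (t - x)"
      by (subst partial_deriv_add partial_deriv_cmult, auto intro!: differentiable_mult differentiable_minus diff simp: tr partial_deriv_cmult[OF diff, of _ "-1", simplified])
    then show "partial_deriv i ((\<lambda>(x, x') t. \<phi> (t - x') - \<phi> (t - x)) z) t =
      (\<lambda>(x, x') t. partial_deriv i \<phi> (t - x') - partial_deriv i \<phi> (t - x)) z t"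
      by (simp add: z)
  qed
  show ?case
    using b Suc.IH[OF schwartz_partial[OF Suc.prems]] diff
    by (auto simp: eq split: prod.splits intro!: differentiable_diff)
qed

lemma schwartz_norm_le:
  assumes "\<psi> \<in> schwartz" "\<And>is t. length is \<le> N \<Longrightarrow> norm (iter_deriv is \<psi> t) \<le> B * decay N t"
  shows "schwartz_norm N (\<psi> :: real^'n::finite \<Rightarrow> complex) \<le> real (card {is :: 'n list. length is \<le> N}) * B"
proof -
  have "schwartz_norm N \<psi> \<le> (\<Sum>is \<in> {is :: 'n list. length is \<le> N}. B)"
    unfolding schwartz_norm_def
  proof (intro sum_mono cSUP_least)
    fix "is" :: "'n list" and x assume "is \<in> {is. length is \<le> N}"
    then show "japanese x ^ N * norm (iter_deriv is \<psi> x) \<le> B"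
      using assms(2)[of "is" x] by (simp add: decay_def field_simps)
  qed simp
  then show ?thesis by simp
qed

lemma finite_lists_le: "finite {is :: ('n::finite) list. length is \<le> N}"
  using finite_lists_length_le[of "UNIV :: 'n set" N] by simp

text \<open>Passes from the existential constants inside \<open>dbound\<close> to one constant for all derivatives; there
  are only finitely many directions and orders.\<close>

lemma dbound_uniform:
  fixes F :: "'z \<Rightarrow> real^'n::finite \<Rightarrow> complex"
  assumes "dbound N W F" "\<And>z t. 0 \<le> W z t"
  obtains C where "0 \<le> C" "\<And>is z t. length is \<le> N \<Longrightarrow> norm (iter_deriv is (F z) t) \<le> C * W z t"
proof -
  have "\<forall>is\<in>{is :: 'n list. length is \<le> N}. \<exists>C. \<forall>z t. norm (iter_deriv is (F z) t) \<le> C * W z t"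
  proof
    fix "is" :: "'n list" assume "is \<in> {is. length is \<le> N}"
    then have d: "dbound (N - length is) W (\<lambda>z. iter_deriv is (F z))"
      using dbound_iter_deriv assms by blast
    obtain C where "\<And>z t. norm (iter_deriv is (F z) t) \<le> C * W z t"
      using dbound_bound[OF d assms(2)] by blast
    then show "\<exists>C. \<forall>z t. norm (iter_deriv is (F z) t) \<le> C * W z t" by blast
  qed
  then obtain C where C: "\<And>is z t. length is \<le> N \<Longrightarrow> norm (iter_deriv is (F z) t) \<le> C is * W z t"
    unfolding mem_Collect_eq Ball_def by metis
  define D where "D = (\<Sum>is\<in>{is :: 'n list. length is \<le> N}. \<bar>C is\<bar>)"
  have "norm (iter_deriv is (F z) t) \<le> D * W z t" if "length is \<le> N" for "is" z t
  proof -
    have "C is \<le> D"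
      unfolding D_def using member_le_sum[of "is" "{is :: 'n list. length is \<le> N}" "\<lambda>i. \<bar>C i\<bar>"] that finite_lists_le
      by fastforce
    from mult_right_mono[OF this assms(2), of z t] C[OF that, of z t] show ?thesis by linarith
  qed
  moreover have "0 \<le> D" by (simp add: D_def sum_nonneg)
  ultimately show ?thesis using that by blast
qed

section \<open>Lebesgue integrals on Euclidean space\<close>

lemma nn_integral_lborel_affine:
  fixes f :: "'a::euclidean_space \<Rightarrow> ennreal"
  assumes [measurable]: "f \<in> borel_measurable borel" and "c \<noteq> 0"
  shows "(\<integral>\<^sup>+x. f (a + c *\<^sub>R x) \<partial>lborel) = ennreal (inverse (\<bar>c\<bar> ^ DIM('a))) * (\<integral>\<^sup>+x. f x \<partial>lborel)"
proof -
  have "(\<integral>\<^sup>+x. f x \<partial>lborel) = (\<integral>\<^sup>+x. ennreal (\<bar>c\<bar> ^ DIM('a)) * f (a + c *\<^sub>R x) \<partial>lborel)"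
    by (subst lborel_affine[OF assms(2), of a]) (simp add: nn_integral_density nn_integral_distr)
  also have "\<dots> = ennreal (\<bar>c\<bar> ^ DIM('a)) * (\<integral>\<^sup>+x. f (a + c *\<^sub>R x) \<partial>lborel)"
    by (rule nn_integral_cmult) simp
  finally show ?thesis
    using assms(2) by (simp add: mult.assoc[symmetric] ennreal_mult[symmetric])
qed

lemma nn_integral_lborel_translate:
  fixes f :: "'a::euclidean_space \<Rightarrow> ennreal"
  assumes [measurable]: "f \<in> borel_measurable borel"
  shows "(\<integral>\<^sup>+x. f (x - a) \<partial>lborel) = (\<integral>\<^sup>+x. f x \<partial>lborel)"
  using nn_integral_lborel_affine[OF assms, of 1 "- a"] by simp

lemma nn_integral_lborel_reflect:
  fixes f :: "'a::euclidean_space \<Rightarrow> ennreal"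
  assumes [measurable]: "f \<in> borel_measurable borel"
  shows "(\<integral>\<^sup>+x. f (a - x) \<partial>lborel) = (\<integral>\<^sup>+x. f x \<partial>lborel)"
  using nn_integral_lborel_affine[OF assms, of "-1" a] by simp

lemma integrable_lborel_affine_iff:
  fixes f :: "'a::euclidean_space \<Rightarrow> 'b::{banach, second_countable_topology}"
  assumes [measurable]: "f \<in> borel_measurable borel" and "c \<noteq> 0"
  shows "integrable lborel (\<lambda>x. f (a + c *\<^sub>R x)) \<longleftrightarrow> integrable lborel f"
proof -
  have "(\<integral>\<^sup>+x. ennreal (norm (f (a + c *\<^sub>R x))) \<partial>lborel) = ennreal (inverse (\<bar>c\<bar> ^ DIM('a))) * (\<integral>\<^sup>+x. ennreal (norm (f x)) \<partial>lborel)"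
    by (rule nn_integral_lborel_affine) (use assms in auto)
  moreover have "inverse (\<bar>c\<bar> ^ DIM('a)) > 0" using assms(2) by simp
  ultimately show ?thesis
    by (auto simp: integrable_iff_bounded ennreal_mult_less_top)
qed

lemma integral_lborel_affine:
  fixes f :: "'a::euclidean_space \<Rightarrow> 'b::{banach, second_countable_topology}"
  assumes [measurable]: "f \<in> borel_measurable borel" and "c \<noteq> 0"
  shows "(\<integral>x. f (a + c *\<^sub>R x) \<partial>lborel) = inverse (\<bar>c\<bar> ^ DIM('a)) *\<^sub>R (\<integral>x. f x \<partial>lborel)"
proof -
  have "(\<integral>x. f x \<partial>lborel) = (\<integral>x. (\<bar>c\<bar> ^ DIM('a)) *\<^sub>R f (a + c *\<^sub>R x) \<partial>lborel)"
    by (subst lborel_affine[OF assms(2), of a]) (simp add: integral_density integral_distr)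
  then show ?thesis using assms(2) by simp
qed

lemma integral_lborel_translate:
  fixes f :: "'a::euclidean_space \<Rightarrow> 'b::{banach, second_countable_topology}"
  assumes [measurable]: "f \<in> borel_measurable borel"
  shows "(\<integral>x. f (x - a) \<partial>lborel) = (\<integral>x. f x \<partial>lborel)"
  using integral_lborel_affine[OF assms, of 1 "- a"] by simp

lemma integrable_lborel_translate:
  fixes f :: "'a::euclidean_space \<Rightarrow> 'b::{banach, second_countable_topology}"
  assumes [measurable]: "f \<in> borel_measurable borel"
  shows "integrable lborel (\<lambda>x. f (x - a)) \<longleftrightarrow> integrable lborel f"
  using integrable_lborel_affine_iff[OF assms, of 1 "- a"] by simp

lemma integrable_lborel_bounded:
  fixes f :: "'a::euclidean_space \<Rightarrow> 'b::{banach, second_countable_topology}"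
  assumes "f \<in> borel_measurable borel" "integrable lborel g" "\<And>x. norm (f x) \<le> C * g x"
  shows "integrable lborel f"
proof -
  have "integrable lborel (\<lambda>x. C * g x)" using assms by simp
  then show ?thesis
    by (rule Bochner_Integration.integrable_bound) (use assms in \<open>auto intro!: AE_I2 order_trans[OF assms(3)]\<close>)
qed

lemma borel_pair: "borel_measurable (lborel \<Otimes>\<^sub>M lborel) = (borel_measurable borel :: ('a::euclidean_space \<times> 'b::euclidean_space \<Rightarrow> 'c::topological_space) set)"
  unfolding lborel_prod by simp

lemma continuous_cnj_cis_measurable [measurable]:
  "cis \<in> borel_measurable borel" "cnj \<in> borel_measurable borel"
  by (intro borel_measurable_continuous_onI continuous_intros)+

lemma integrable_pairI:
  fixes f :: "'a::euclidean_space \<times> 'b::euclidean_space \<Rightarrow> 'c::{banach, second_countable_topology}"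
  assumes [measurable]: "f \<in> borel_measurable borel"
    and "(\<integral>\<^sup>+x. \<integral>\<^sup>+y. ennreal (norm (f (x, y))) \<partial>lborel \<partial>lborel) < \<infinity>"
  shows "integrable (lborel \<Otimes>\<^sub>M lborel) f"
proof -
  have [measurable]: "f \<in> borel_measurable (lborel \<Otimes>\<^sub>M lborel)" by (simp add: borel_pair)
  show ?thesis
    using assms(2) by (intro integrableI_bounded) (simp_all add: lborel.nn_integral_fst[symmetric])
qed

text \<open>Write \<open>f (t + e) - f t\<close> as the integral of the derivative along the segment and integrate over
  \<open>t\<close>: by translation invariance the left side integrates to \<open>0\<close> and, after exchanging the
  integrals, the right side to the integral of the derivative.\<close>

lemma integral_partial_deriv_eq_0:
  fixes f :: "real^'n::finite \<Rightarrow> complex"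
  assumes diff: "\<And>x. f differentiable (at x)" and cont: "continuous_on UNIV (partial_deriv i f)"
    and int: "integrable lborel f" "integrable lborel (partial_deriv i f)"
  shows "(\<integral>x. partial_deriv i f x \<partial>lborel) = 0"
proof -
  let ?e = "axis i 1 :: real^'n"
  let ?d = "partial_deriv i f"
  have [measurable]: "f \<in> borel_measurable borel"
    by (meson diff differentiable_imp_continuous_within continuous_at_imp_continuous_on borel_measurable_continuous_onI)
  have [measurable]: "?d \<in> borel_measurable borel"
    by (intro borel_measurable_continuous_onI cont)
  let ?G = "\<lambda>s t. indicator {0..1::real} s *\<^sub>R ?d (t + s *\<^sub>R ?e)"
  have shift: "(\<integral>\<^sup>+t. ennreal (norm (?d (t + v))) \<partial>lborel) = (\<integral>\<^sup>+t. ennreal (norm (?d t)) \<partial>lborel)" for v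
    using nn_integral_lborel_translate[of "\<lambda>t. ennreal (norm (?d t))" "- v"] by simp
  have fin: "(\<integral>\<^sup>+t. ennreal (norm (?d t)) \<partial>lborel) < \<infinity>"
    using int(2) by (simp add: integrable_iff_bounded)
  have I: "integrable (lborel \<Otimes>\<^sub>M lborel) (case_prod ?G)"
  proof (rule integrable_pairI)
    have "(\<lambda>p::real \<times> (real^'n). indicator {0..1::real} (fst p) *\<^sub>R ?d (snd p + fst p *\<^sub>R ?e)) \<in> borel_measurable (borel \<Otimes>\<^sub>M borel)"
      by measurable
    then show "case_prod ?G \<in> borel_measurable borel" by (simp add: borel_prod split_beta')
    have "(\<integral>\<^sup>+s. \<integral>\<^sup>+t. ennreal (norm (case (s, t) of (s, t) \<Rightarrow> ?G s t)) \<partial>lborel \<partial>lborel)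
      = (\<integral>\<^sup>+s. indicator {0..1::real} s * (\<integral>\<^sup>+t. ennreal (norm (?d t)) \<partial>lborel) \<partial>lborel)"
      by (rule nn_integral_cong) (auto simp: shift split: split_indicator)
    also have "\<dots> = (\<integral>\<^sup>+t. ennreal (norm (?d t)) \<partial>lborel)"
      by (subst nn_integral_multc) auto
    finally show "(\<integral>\<^sup>+s. \<integral>\<^sup>+t. ennreal (norm (case (s, t) of (s, t) \<Rightarrow> ?G s t)) \<partial>lborel \<partial>lborel) < \<infinity>"
      using fin by simp
  qed
  have inner: "(\<integral>s. ?G s t \<partial>lborel) = f (t + ?e) - f t" for t
  proof -
    have 1: "((\<lambda>s. f (t + s *\<^sub>R ?e)) has_vector_derivative ?d (t + s *\<^sub>R ?e)) (at s within {0..1})" for s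
      by (rule has_vector_derivative_at_within[OF partial_deriv_has_vector_derivative[OF diff]])
    have 2: "continuous_on {0..1} (\<lambda>s. ?d (t + s *\<^sub>R ?e))"
      by (rule continuous_on_compose2[OF cont]) (auto intro!: continuous_intros)
    have "(\<integral>s. ?G s t \<partial>lborel) = f (t + 1 *\<^sub>R ?e) - f (t + 0 *\<^sub>R ?e)"
      by (rule integral_FTC_Icc[OF _ 1 2]) auto
    then show ?thesis by simp
  qed
  have "(\<integral>x. ?d x \<partial>lborel) = (\<integral>s. indicator {0..1::real} s *\<^sub>R (\<integral>x. ?d x \<partial>lborel) \<partial>lborel)"
    by (simp add: integral_scaleR_left)
  also have "\<dots> = (\<integral>s. (\<integral>t. ?G s t \<partial>lborel) \<partial>lborel)"
  proof -
    have "(\<integral>t. ?d (t + v) \<partial>lborel) = (\<integral>t. ?d t \<partial>lborel)" for v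
      using integral_lborel_translate[of ?d "- v"] by simp
    then show ?thesis by (simp del: scaleR_complex_def)
  qed
  also have "\<dots> = (\<integral>t. (\<integral>s. ?G s t \<partial>lborel) \<partial>lborel)"
    using lborel_pair.Fubini_integral[OF I] by (rule sym)
  also have "\<dots> = (\<integral>t. f (t + ?e) - f t \<partial>lborel)" by (simp only: inner)
  also have "\<dots> = (\<integral>t. f (t + ?e) \<partial>lborel) - (\<integral>t. f t \<partial>lborel)"
    using int(1) integrable_lborel_translate[of f "- ?e"] by (intro Bochner_Integration.integral_diff) auto
  also have "\<dots> = 0"
    using integral_lborel_translate[of f "- ?e"] by simp
  finally show ?thesis .
qed

section \<open>The Fourier transform\<close>

definition ft :: "(real^'n::finite \<Rightarrow> complex) \<Rightarrow> real^'n \<Rightarrow> complex" where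
  "ft g \<omega> = (\<integral>t. g t * cis (- (t \<bullet> \<omega>)) \<partial>lborel)"

lemma integrable_ft:
  "integrable lborel g \<Longrightarrow> integrable lborel (\<lambda>t. g t * cis (- (t \<bullet> \<omega>)))"
  by (rule Bochner_Integration.integrable_bound[of lborel g]) (auto simp: norm_mult)

lemma ft_partial_deriv:
  fixes f :: "real^'n::finite \<Rightarrow> complex"
  assumes diff: "\<And>x. f differentiable (at x)" and cont: "continuous_on UNIV (partial_deriv i f)"
    and int: "integrable lborel f" "integrable lborel (partial_deriv i f)"
  shows "ft (partial_deriv i f) \<omega> = \<i> * of_real (\<omega> $ i) * ft f \<omega>"
proof -
  let ?g = "\<lambda>t. f t * cis (- (t \<bullet> \<omega>))"
  have d: "partial_deriv i ?g = (\<lambda>t. partial_deriv i f t * cis (- (t \<bullet> \<omega>)) - (\<i> * of_real (\<omega> $ i)) * ?g t)"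
    using diff by (auto simp: fun_eq_iff partial_deriv_mult differentiable_cis partial_deriv_cis)
  have cf: "continuous_on UNIV f"
    by (meson diff differentiable_imp_continuous_within continuous_at_imp_continuous_on)
  have "(\<integral>x. partial_deriv i ?g x \<partial>lborel) = 0"
  proof (rule integral_partial_deriv_eq_0)
    show "?g differentiable (at x)" for x by (intro differentiable_mult diff differentiable_cis)
    show "continuous_on UNIV (partial_deriv i ?g)"
      unfolding d by (intro continuous_intros cont cf)
    show "integrable lborel ?g" by (rule integrable_ft[OF int(1)])
    show "integrable lborel (partial_deriv i ?g)"
      unfolding d by (intro Bochner_Integration.integrable_diff integrable_mult_right integrable_ft int)
  qed
  also have "(\<integral>x. partial_deriv i ?g x \<partial>lborel) = ft (partial_deriv i f) \<omega> - \<i> * of_real (\<omega> $ i) * ft f \<omega>"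
    unfolding d ft_def
    by (subst Bochner_Integration.integral_diff) (auto intro!: integrable_ft int integrable_mult_right)
  finally show ?thesis by simp
qed

text \<open>Integration by parts with \<open>1 - \<Delta>\<close> gains \<open>(1 + |\<omega>|\<^sup>2)\<close> in every step. The majorant enters only
  through its integral, so the estimate is uniform over families.\<close>

lemma ft_decay:
  fixes F :: "'z \<Rightarrow> real^'n::finite \<Rightarrow> complex"
  assumes "dbound (Suc (2 * m)) W F" "\<And>z t. 0 \<le> W z t" "\<And>z. integrable lborel (W z)"
  obtains C where "0 \<le> C" "\<And>z \<omega>. norm (ft (F z) \<omega>) \<le> C * decay (2 * m) \<omega> * (\<integral>t. W z t \<partial>lborel)"
proof -
  have "\<exists>C\<ge>0. \<forall>z \<omega>. norm (ft (F z) \<omega>) \<le> C * decay (2 * m) \<omega> * (\<integral>t. W z t \<partial>lborel)"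
    using assms(1)
  proof (induction m arbitrary: F)
    case 0
    obtain C where C: "0 \<le> C" "\<And>z t. norm (F z t) \<le> C * W z t"
      using dbound_bound[OF 0 assms(2)] by blast
    have [measurable]: "F z \<in> borel_measurable borel" for z
      using dbound_continuous[of "2 * 0", OF 0] by (intro borel_measurable_continuous_onI)
    have "norm (ft (F z) \<omega>) \<le> C * (\<integral>t. W z t \<partial>lborel)" for z \<omega>
    proof -
      have I: "integrable lborel (F z)"
        by (rule integrable_lborel_bounded[OF _ assms(3)[of z] C(2)]) simp
      have "norm (ft (F z) \<omega>) \<le> (\<integral>t. C * W z t \<partial>lborel)"
        unfolding ft_def
        using integrable_ft[OF I] assms(3) C
        by (intro Bochner_Integration.integral_norm_bound_integral) (auto simp: norm_mult)
      then show ?thesis by simp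
    qed
    then show ?case using C(1) by auto
  next
    case (Suc m)
    have F: "dbound (Suc (Suc (Suc (2 * m)))) W F" using Suc.prems by simp
    have F1: "dbound (Suc (Suc (2 * m))) W (\<lambda>z. partial_deriv i (F z))" for i
      using dbound_partial[OF F] .
    have F2: "dbound (Suc (2 * m)) W (\<lambda>z. partial_deriv i (partial_deriv i (F z)))" for i
      using dbound_partial[OF F1] .
    \<comment> \<open>\<open>G z\<close> is \<open>(1 - \<Delta>) (F z)\<close>, whose Fourier transform is \<open>japanese \<omega> ^ 2\<close> times that of \<open>F z\<close>.\<close>
    define G where "G z t = F z t - (\<Sum>i\<in>UNIV. partial_deriv i (partial_deriv i (F z)) t)" for z t
    have "dbound (Suc (2 * m)) W G"
      unfolding G_def
      by (intro dbound_diff dbound_sum finite dbound_pred[OF dbound_pred[OF F]] F2 assms(2))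
    from Suc.IH[OF this] obtain C where C: "0 \<le> C"
      "\<And>z \<omega>. norm (ft (G z) \<omega>) \<le> C * decay (2 * m) \<omega> * (\<integral>t. W z t \<partial>lborel)" by blast
    have int: "integrable lborel (H z)" if d: "dbound (Suc k) W H" for k H z
    proof -
      obtain C where C: "0 \<le> C" "\<And>z t. norm (H z t) \<le> C * W z t"
        using dbound_bound[OF d assms(2)] by blast
      show ?thesis
        by (rule integrable_lborel_bounded[OF _ assms(3)[of z] C(2)])
          (intro borel_measurable_continuous_onI dbound_continuous[OF d])
    qed
    have "norm (ft (F z) \<omega>) \<le> C * decay (2 * Suc m) \<omega> * (\<integral>t. W z t \<partial>lborel)" for z \<omega>
    proof -
      have 2: "ft (partial_deriv i (partial_deriv i (F z))) \<omega> = - of_real ((\<omega> $ i)\<^sup>2) * ft (F z) \<omega>" for i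
      proof -
        have "ft (partial_deriv i (partial_deriv i (F z))) \<omega> = \<i> * of_real (\<omega> $ i) * ft (partial_deriv i (F z)) \<omega>"
          by (rule ft_partial_deriv[OF dbound_differentiable[OF F1] dbound_continuous[OF F2] int[OF F1] int[OF F2]])
        also have "ft (partial_deriv i (F z)) \<omega> = \<i> * of_real (\<omega> $ i) * ft (F z) \<omega>"
          by (rule ft_partial_deriv[OF dbound_differentiable[OF F] dbound_continuous[OF F1] int[OF F] int[OF F1]])
        finally show ?thesis by (simp add: power2_eq_square mult_ac)
      qed
      have "ft (G z) \<omega> = (\<integral>t. F z t * cis (- (t \<bullet> \<omega>)) - (\<Sum>i\<in>UNIV. partial_deriv i (partial_deriv i (F z)) t * cis (- (t \<bullet> \<omega>))) \<partial>lborel)"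
        unfolding ft_def G_def by (simp add: left_diff_distrib sum_distrib_right)
      also have "\<dots> = ft (F z) \<omega> - (\<Sum>i\<in>UNIV. ft (partial_deriv i (partial_deriv i (F z))) \<omega>)"
        unfolding ft_def
        by (subst Bochner_Integration.integral_diff Bochner_Integration.integral_sum;
            intro Bochner_Integration.integrable_sum Bochner_Integration.integral_sum arg_cong2[where f=minus] refl integrable_ft int[OF F] int[OF F2])
      also have "\<dots> = of_real (1 + (norm \<omega>)\<^sup>2) * ft (F z) \<omega>"
        by (simp add: 2 sum_negf sum_distrib_right[symmetric] norm_vec_def L2_set_def real_sqrt_pow2 sum_nonneg distrib_right
          del: of_real_power)
      finally have "norm (ft (G z) \<omega>) = (japanese \<omega>)\<^sup>2 * norm (ft (F z) \<omega>)"
        by (simp only: norm_mult norm_of_real japanese_sq[symmetric]) simp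
      with C(2)[of z \<omega>] have "norm (ft (F z) \<omega>) \<le> inverse ((japanese \<omega>)\<^sup>2) * (C * decay (2 * m) \<omega> * (\<integral>t. W z t \<partial>lborel))"
        by (simp add: field_simps)
      moreover have "decay (2 * Suc m) \<omega> = inverse ((japanese \<omega>)\<^sup>2) * decay (2 * m) \<omega>"
        using decay_add[of 2 "2 * m" \<omega>] by (simp add: decay_def)
      ultimately show ?thesis by (simp add: mult_ac)
    qed
    then show ?case using C(1) by blast
  qed
  then show ?thesis using that by blast
qed

lemma Basis_real_vec: "(Basis :: (real^'n::finite) set) = (\<lambda>i. axis i 1) ` UNIV"
  by (auto simp: Basis_vec_def)

lemma prod_Basis_vec: "(\<Prod>b\<in>(Basis :: (real^'n::finite) set). f b) = (\<Prod>i\<in>UNIV. f (axis i 1))"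
  unfolding Basis_real_vec by (rule prod.reindex_cong[OF _ refl refl]) (auto simp: inj_on_def axis_eq_axis)

text \<open>Fubini for product functions; it reduces integrals of decay weights and of Gaussians to
  dimension one.\<close>

lemma integrable_prod_vec:
  fixes f :: "'n::finite \<Rightarrow> real \<Rightarrow> 'a::{real_normed_field,banach,second_countable_topology}"
  assumes f: "\<And>i. integrable lborel (f i)"
  shows "integrable lborel (\<lambda>x::real^'n. \<Prod>i\<in>UNIV. f i (x $ i))" (is ?A)
    and "(\<integral>x. (\<Prod>i\<in>UNIV. f i (x $ i)) \<partial>(lborel :: (real^'n) measure)) = (\<Prod>i\<in>UNIV. \<integral>x. f i x \<partial>lborel)" (is ?B)
proof -
  define g where "g b = f (THE i. b = axis i 1)" for b :: "real^'n"
  have g: "g (axis i 1) = f i" for i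
    unfolding g_def by (rule arg_cong[where f=f]) (auto simp: axis_eq_axis)
  interpret product_sigma_finite "\<lambda>b::real^'n. lborel :: real measure" ..
  have ig: "integrable lborel (g b)" if "b \<in> Basis" for b
    using that f by (auto simp: Basis_real_vec g)
  have [measurable]: "f i \<in> borel_measurable borel" for i
    using borel_measurable_integrable[OF f, of i] by simp
  have m: "(\<lambda>x::real^'n. \<Prod>i\<in>UNIV. f i (x $ i)) \<in> borel_measurable borel"
    by measurable
  have m2: "(\<lambda>h. \<Sum>b\<in>Basis. h b *\<^sub>R b) \<in> Pi\<^sub>M Basis (\<lambda>b::real^'n. lborel :: real measure) \<rightarrow>\<^sub>M borel"
    by measurable
  have eq: "(\<Prod>i\<in>UNIV. f i ((\<Sum>b\<in>Basis. h b *\<^sub>R b) $ i)) = (\<Prod>b\<in>Basis. g b (h b))" for h :: "real^'n \<Rightarrow> real"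
  proof -
    have "(\<Sum>b\<in>Basis. h b *\<^sub>R b) $ i = h (axis i 1)" for i
    proof -
      have "(\<Sum>b\<in>Basis. h b *\<^sub>R b) $ i = (\<Sum>b\<in>Basis. h b *\<^sub>R b) \<bullet> axis i 1"
        by (simp add: inner_axis)
      also have "\<dots> = h (axis i 1)" by (subst inner_sum_left_Basis) auto
      finally show ?thesis .
    qed
    then show ?thesis by (simp add: prod_Basis_vec g)
  qed
  show ?A
    unfolding lborel_eq[where 'a="real^'n"] integrable_distr_eq[OF m2 m] eq
    by (rule product_integrable_prod) (auto intro: ig)
  show ?B
    unfolding lborel_eq[where 'a="real^'n"] integral_distr[OF m2 m] eq
    by (subst product_integral_prod) (auto intro: ig simp: prod_Basis_vec g)
qed

text \<open>The weight is dominated by the product over the coordinates of the functions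
  \<open>1 / (1 + x\<^sub>i\<^sup>2)\<close>, each of which is integrable. This is where the exponent \<open>2 * CARD('n)\<close>,
  which appears throughout, comes from.\<close>

lemma integrable_decay:
  assumes "2 * CARD('n) \<le> k"
  shows "integrable lborel (decay k :: real^'n::finite \<Rightarrow> real)"
proof -
  have "set_integrable lborel (einterval (-\<infinity>) \<infinity>) (\<lambda>x::real. inverse (1 + x^2))"
    by (rule integrable_inverse_1_plus_square)
  then have 1: "integrable lborel (\<lambda>x::real. inverse (1 + x^2))"
    by (simp add: set_integrable_def)
  have "decay k x \<le> 1 * (\<Prod>i\<in>UNIV. inverse (1 + (x $ i)\<^sup>2))" for x :: "real^'n"
  proof -
    have "decay k x \<le> decay (2 * CARD('n)) x" by (rule decay_antimono[OF assms])
    also have "\<dots> = (\<Prod>i\<in>(UNIV :: 'n set). inverse ((japanese x)\<^sup>2))"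
      by (simp add: decay_def power_mult power_inverse)
    also have "\<dots> \<le> (\<Prod>i\<in>UNIV. inverse (1 + (x $ i)\<^sup>2))"
    proof (intro prod_mono conjI le_imp_inverse_le)
      fix i
      have "\<bar>x $ i\<bar>^2 \<le> (norm x)^2" by (intro power_mono component_le_norm_cart) auto
      then show "1 + (x $ i)\<^sup>2 \<le> (japanese x)\<^sup>2" by (simp add: japanese_sq)
    qed (auto simp: add_pos_nonneg)
    finally show ?thesis by simp
  qed
  then show ?thesis
    by (intro integrable_lborel_bounded[OF _ integrable_prod_vec(1)[of "\<lambda>_ x. inverse (1 + x\<^sup>2)"], of _ 1])
       (use 1 in auto)
qed

section \<open>Fourier inversion\<close>

lemma integrable_gauss_real: "integrable lborel (\<lambda>x::real. exp (- x\<^sup>2 / 2))"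
  and gauss_real: "(\<integral>x. cis (x * t) * of_real (exp (- x\<^sup>2 / 2)) \<partial>lborel) = of_real (sqrt (2 * pi) * exp (- t\<^sup>2 / 2))"
proof -
  have "integrable lborel (\<lambda>x. sqrt (2 * pi) * std_normal_density x)"
    by (intro integrable_mult_right) simp
  then show "integrable lborel (\<lambda>x::real. exp (- x\<^sup>2 / 2))"
    by (simp add: std_normal_density_def)
  have "of_real (exp (- t\<^sup>2 / 2)) = char std_normal_distribution t"
    by (simp add: char_std_normal_distribution)
  also have "\<dots> = (\<integral>x. std_normal_density x *\<^sub>R iexp (t * x) \<partial>lborel)"
    unfolding char_def by (subst integral_density) (auto simp: normal_density_nonneg)
  also have "\<dots> = (\<integral>x. of_real (1 / sqrt (2 * pi)) * (cis (x * t) * of_real (exp (- x\<^sup>2 / 2))) \<partial>lborel)"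
    by (rule Bochner_Integration.integral_cong)
       (simp_all add: std_normal_density_def cis_conv_exp scaleR_conv_of_real mult_ac)
  also have "\<dots> = of_real (1 / sqrt (2 * pi)) * (\<integral>x. cis (x * t) * of_real (exp (- x\<^sup>2 / 2)) \<partial>lborel)"
    by simp
  finally have "of_real (sqrt (2 * pi)) * complex_of_real (exp (- t\<^sup>2 / 2)) =
      of_real (sqrt (2 * pi)) * of_real (1 / sqrt (2 * pi)) * (\<integral>x. cis (x * t) * of_real (exp (- x\<^sup>2 / 2)) \<partial>lborel)"
    by simp
  also have "complex_of_real (sqrt (2 * pi)) * of_real (1 / sqrt (2 * pi)) = 1"
    by (simp flip: of_real_mult)
  finally show "(\<integral>x. cis (x * t) * of_real (exp (- x\<^sup>2 / 2)) \<partial>lborel) = of_real (sqrt (2 * pi) * exp (- t\<^sup>2 / 2))"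
    by simp
qed

definition gauss :: "real^'n::finite \<Rightarrow> real" where
  "gauss x = exp (- (norm x)\<^sup>2 / 2)"

lemma gauss_measurable [measurable]: "gauss \<in> borel_measurable borel"
  unfolding gauss_def by measurable

lemma gauss_nonneg [simp]: "0 \<le> gauss x" by (simp add: gauss_def)

lemma gauss_prod: "gauss x = (\<Prod>i\<in>UNIV. exp (- (x $ i)\<^sup>2 / 2))"
proof -
  have "- (norm x)\<^sup>2 / 2 = (\<Sum>i\<in>UNIV. - (x $ i)\<^sup>2 / 2)"
    by (simp add: norm_vec_def L2_set_def sum_nonneg sum_negf sum_divide_distrib)
  then show ?thesis by (simp add: gauss_def exp_sum)
qed

lemma integrable_gauss: "integrable lborel (gauss :: real^'n::finite \<Rightarrow> real)"
  unfolding gauss_prod[abs_def] using integrable_prod_vec(1)[OF integrable_gauss_real] .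

lemma cis_sum: "finite I \<Longrightarrow> cis (\<Sum>i\<in>I. f i) = (\<Prod>i\<in>I. cis (f i))"
  by (induction I rule: finite_induct) (auto simp: cis_mult[symmetric])

lemma ft_gauss:
  fixes v :: "real^'n::finite"
  shows "(\<integral>x. cis (x \<bullet> v) * of_real (gauss x) \<partial>lborel) = of_real (sqrt (2 * pi) ^ CARD('n) * gauss v)"
proof -
  have "cis (x \<bullet> v) * of_real (gauss x) = (\<Prod>i\<in>UNIV. cis (x $ i * v $ i) * of_real (exp (- (x $ i)\<^sup>2 / 2)))" for x
    by (simp add: inner_vec_def cis_sum gauss_prod prod.distrib)
  then have "(\<integral>x. cis (x \<bullet> v) * of_real (gauss x) \<partial>lborel) =
      (\<integral>x. (\<Prod>i\<in>UNIV. cis (x $ i * v $ i) * of_real (exp (- (x $ i)\<^sup>2 / 2))) \<partial>lborel)"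
    by simp
  also have "\<dots> = (\<Prod>i\<in>UNIV. \<integral>x. cis (x * v $ i) * of_real (exp (- x\<^sup>2 / 2)) \<partial>lborel)"
  proof (rule integrable_prod_vec(2))
    fix i
    show "integrable lborel (\<lambda>x. cis (x * v $ i) * complex_of_real (exp (- x\<^sup>2 / 2)))"
      by (rule integrable_lborel_bounded[OF _ integrable_gauss_real, of _ 1]) (auto simp: norm_mult)
  qed
  also have "\<dots> = of_real (sqrt (2 * pi) ^ CARD('n) * gauss v)"
    unfolding gauss_real by (simp add: prod.distrib gauss_prod)
  finally show ?thesis .
qed

text \<open>Gaussian regularisation: damp the inversion integral by a dilated Gaussian, exchange the integrals,
  and let the Gaussian tend to \<open>1\<close> on the frequency side, hence to a point mass on the other.\<close>

lemma fourier_inversion: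
  fixes g :: "real^'n::finite \<Rightarrow> complex"
  assumes cont: "continuous_on UNIV g" and bd: "\<And>x. norm (g x) \<le> B"
    and int: "integrable lborel g" and intf: "integrable lborel (ft g)"
  shows "(\<integral>\<omega>. ft g \<omega> * cis (t \<bullet> \<omega>) \<partial>lborel) = of_real ((2 * pi) ^ CARD('n)) * g t"
proof -
  have [measurable]: "g \<in> borel_measurable borel" by (intro borel_measurable_continuous_onI cont)
  have [measurable]: "ft g \<in> borel_measurable borel" using borel_measurable_integrable[OF intf] by simp
  let ?c = "sqrt (2 * pi) ^ CARD('n)"
  define e where "e n = inverse (real (Suc n))" for n
  have e: "e n > 0" "e n \<noteq> 0" for n by (auto simp: e_def)
  have e0: "e \<longlonglongrightarrow> 0" unfolding e_def by (rule LIMSEQ_inverse_real_of_nat)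
  have key: "(\<integral>\<omega>. ft g \<omega> * cis (t \<bullet> \<omega>) * of_real (gauss (e n *\<^sub>R \<omega>)) \<partial>lborel) =
     of_real ?c * (\<integral>v. g (t - e n *\<^sub>R v) * of_real (gauss v) \<partial>lborel)" for n
  proof -
    let ?e = "e n"
    have ig: "integrable lborel (\<lambda>\<omega>::real^'n. gauss (?e *\<^sub>R \<omega>))"
      using integrable_lborel_affine_iff[of "gauss :: real^'n \<Rightarrow> real" ?e 0] e integrable_gauss by simp
    let ?H = "\<lambda>\<omega> s. g s * cis (- (s \<bullet> \<omega>)) * cis (t \<bullet> \<omega>) * complex_of_real (gauss (?e *\<^sub>R \<omega>))"
    have I: "integrable (lborel \<Otimes>\<^sub>M lborel) (case_prod ?H)"
    proof (rule integrable_pairI)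
      have "(\<lambda>p. ?H (fst p) (snd p)) \<in> borel_measurable (borel \<Otimes>\<^sub>M borel)" by measurable
      then show "case_prod ?H \<in> borel_measurable borel" by (simp add: borel_prod split_beta')
      have "(\<integral>\<^sup>+\<omega>. \<integral>\<^sup>+s. ennreal (norm (case (\<omega>, s) of (\<omega>, s) \<Rightarrow> ?H \<omega> s)) \<partial>lborel \<partial>lborel)
        = (\<integral>\<^sup>+\<omega>. (\<integral>\<^sup>+s. ennreal (norm (g s)) \<partial>lborel) * ennreal (gauss (?e *\<^sub>R \<omega>)) \<partial>(lborel :: (real^'n) measure))"
        by (intro nn_integral_cong) (simp add: norm_mult ennreal_mult nn_integral_multc)
      also have "\<dots> = (\<integral>\<^sup>+s. ennreal (norm (g s)) \<partial>lborel) * (\<integral>\<^sup>+\<omega>. ennreal (gauss (?e *\<^sub>R \<omega>)) \<partial>(lborel :: (real^'n) measure))"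
        by (rule nn_integral_cmult) simp
      also have "\<dots> < \<infinity>"
        using int ig by (simp add: integrable_iff_bounded ennreal_mult_less_top)
      finally show "(\<integral>\<^sup>+\<omega>. \<integral>\<^sup>+s. ennreal (norm (case (\<omega>, s) of (\<omega>, s) \<Rightarrow> ?H \<omega> s)) \<partial>lborel \<partial>lborel) < \<infinity>" .
    qed
    have "(\<integral>\<omega>. ft g \<omega> * cis (t \<bullet> \<omega>) * of_real (gauss (?e *\<^sub>R \<omega>)) \<partial>lborel) = (\<integral>\<omega>. (\<integral>s. ?H \<omega> s \<partial>lborel) \<partial>lborel)"
      by (simp add: ft_def)
    also have "\<dots> = (\<integral>s. (\<integral>\<omega>. ?H \<omega> s \<partial>lborel) \<partial>lborel)"
      by (rule lborel_pair.Fubini_integral[OF I, symmetric])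
    also have "\<dots> = (\<integral>s. g s * of_real (inverse (?e ^ CARD('n)) * (?c * gauss (inverse ?e *\<^sub>R (t - s)))) \<partial>lborel)"
    proof (rule Bochner_Integration.integral_cong[OF refl])
      fix s
      let ?k = "\<lambda>\<omega>. cis (\<omega> \<bullet> (inverse ?e *\<^sub>R (t - s))) * complex_of_real (gauss \<omega>)"
      have "?H \<omega> s = g s * ?k (0 + ?e *\<^sub>R \<omega>)" for \<omega>
      proof -
        have "cis (- (s \<bullet> \<omega>)) * cis (t \<bullet> \<omega>) = cis ((0 + ?e *\<^sub>R \<omega>) \<bullet> (inverse ?e *\<^sub>R (t - s)))"
          using e(2)[of n] by (simp add: cis_mult inner_diff_left inner_diff_right inner_commute mult.assoc[symmetric])
        then show ?thesis by (simp add: mult.assoc)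
      qed
      then have "(\<integral>\<omega>. ?H \<omega> s \<partial>lborel) = g s * (\<integral>\<omega>. ?k (0 + ?e *\<^sub>R \<omega>) \<partial>lborel)" by (simp only: integral_mult_right_zero)
      also have "(\<integral>\<omega>. ?k (0 + ?e *\<^sub>R \<omega>) \<partial>lborel) = inverse (\<bar>?e\<bar> ^ DIM(real^'n)) *\<^sub>R (\<integral>\<omega>. ?k \<omega> \<partial>lborel)"
        by (rule integral_lborel_affine) (use e in auto)
      also have "(\<integral>\<omega>. ?k \<omega> \<partial>lborel) = of_real (?c * gauss (inverse ?e *\<^sub>R (t - s)))"
        by (rule ft_gauss)
      finally show "(\<integral>\<omega>. ?H \<omega> s \<partial>lborel) = g s * of_real (inverse (?e ^ CARD('n)) * (?c * gauss (inverse ?e *\<^sub>R (t - s))))"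
        using abs_of_pos[OF e(1)[of n]] by (simp add: scaleR_conv_of_real[where 'a=complex])
    qed
    also have "\<dots> = of_real ?c * (of_real (inverse (?e ^ CARD('n))) * (\<integral>s. g s * of_real (gauss (inverse ?e *\<^sub>R (t - s))) \<partial>lborel))"
      unfolding integral_mult_right_zero[symmetric] by (rule Bochner_Integration.integral_cong) (simp_all add: mult_ac)
    also have "(\<integral>v. g (t + (- ?e) *\<^sub>R v) * of_real (gauss (inverse ?e *\<^sub>R (t - (t + (- ?e) *\<^sub>R v)))) \<partial>lborel)
        = inverse (\<bar>- ?e\<bar> ^ DIM(real^'n)) *\<^sub>R (\<integral>s. g s * of_real (gauss (inverse ?e *\<^sub>R (t - s))) \<partial>lborel)"
      by (rule integral_lborel_affine) (use e in auto)
    then have "of_real (inverse (?e ^ CARD('n))) * (\<integral>s. g s * of_real (gauss (inverse ?e *\<^sub>R (t - s))) \<partial>lborel)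
        = (\<integral>v. g (t - ?e *\<^sub>R v) * of_real (gauss v) \<partial>lborel)"
      using e(2)[of n] abs_of_pos[OF e(1)[of n]] by (simp add: scaleR_conv_of_real[where 'a=complex])
    finally show ?thesis .
  qed
  \<comment> \<open>Both sides of \<open>key\<close> converge as the dilation parameter tends to \<open>0\<close>.\<close>
  have L1: "(\<lambda>n. \<integral>\<omega>. ft g \<omega> * cis (t \<bullet> \<omega>) * of_real (gauss (e n *\<^sub>R \<omega>)) \<partial>lborel) \<longlonglongrightarrow> (\<integral>\<omega>. ft g \<omega> * cis (t \<bullet> \<omega>) \<partial>lborel)"
  proof (rule integral_dominated_convergence[where w="\<lambda>\<omega>. norm (ft g \<omega>)"])
    show "AE \<omega> in lborel. (\<lambda>n. ft g \<omega> * cis (t \<bullet> \<omega>) * of_real (gauss (e n *\<^sub>R \<omega>))) \<longlonglongrightarrow> ft g \<omega> * cis (t \<bullet> \<omega>)"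
    proof (rule AE_I2)
      fix \<omega>
      have "(\<lambda>n. ft g \<omega> * cis (t \<bullet> \<omega>) * of_real (gauss (e n *\<^sub>R \<omega>))) \<longlonglongrightarrow> ft g \<omega> * cis (t \<bullet> \<omega>) * of_real (gauss (0 *\<^sub>R \<omega>))"
        unfolding gauss_def by (intro tendsto_intros e0) auto
      then show "(\<lambda>n. ft g \<omega> * cis (t \<bullet> \<omega>) * of_real (gauss (e n *\<^sub>R \<omega>))) \<longlonglongrightarrow> ft g \<omega> * cis (t \<bullet> \<omega>)"
        by (simp add: gauss_def)
    qed
    show "AE \<omega> in lborel. norm (ft g \<omega> * cis (t \<bullet> \<omega>) * complex_of_real (gauss (e n *\<^sub>R \<omega>))) \<le> norm (ft g \<omega>)" for n
      by (auto simp: norm_mult gauss_def mult_right_le_one_le)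
  qed (use intf in auto)
  have L2: "(\<lambda>n. \<integral>v. g (t - e n *\<^sub>R v) * of_real (gauss v) \<partial>lborel) \<longlonglongrightarrow> (\<integral>v. g t * of_real (gauss v) \<partial>(lborel :: (real^'n) measure))"
  proof (rule integral_dominated_convergence[where w="\<lambda>v. B * gauss v"])
    show "AE v in lborel. (\<lambda>n. g (t - e n *\<^sub>R v) * of_real (gauss v)) \<longlonglongrightarrow> g t * of_real (gauss v)"
    proof (rule AE_I2)
      fix v
      have "(\<lambda>n. t - e n *\<^sub>R v) \<longlonglongrightarrow> t - 0 *\<^sub>R v" by (intro tendsto_intros e0)
      then have "(\<lambda>n. g (t - e n *\<^sub>R v)) \<longlonglongrightarrow> g (t - 0 *\<^sub>R v)"
        using continuous_on_tendsto_compose[OF cont] by auto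
      then show "(\<lambda>n. g (t - e n *\<^sub>R v) * of_real (gauss v)) \<longlonglongrightarrow> g t * of_real (gauss v)"
        by (intro tendsto_intros) auto
    qed
    show "AE v in lborel. norm (g (t - e n *\<^sub>R v) * complex_of_real (gauss v)) \<le> B * gauss v" for n
      by (auto simp: norm_mult intro!: mult_right_mono bd)
  qed (use integrable_gauss in auto)
  have "(\<integral>v. complex_of_real (gauss v) \<partial>(lborel :: (real^'n) measure)) = of_real ?c"
    using ft_gauss[of "0::real^'n"] by (simp add: gauss_def)
  then have "(\<integral>v. g t * of_real (gauss v) \<partial>(lborel :: (real^'n) measure)) = g t * of_real ?c"
    by (simp del: integral_complex_of_real)
  with L2 have "(\<lambda>n. of_real ?c * (\<integral>v. g (t - e n *\<^sub>R v) * of_real (gauss v) \<partial>lborel)) \<longlonglongrightarrow> of_real ?c * (g t * of_real ?c)"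
    by (intro tendsto_intros) auto
  with L1 have "(\<integral>\<omega>. ft g \<omega> * cis (t \<bullet> \<omega>) \<partial>lborel) = of_real ?c * (g t * of_real ?c)"
    unfolding key by (rule LIMSEQ_unique)
  also have "\<dots> = of_real (?c * ?c) * g t" by simp
  also have "?c * ?c = (2 * pi) ^ CARD('n)"
    by (simp only: power_mult_distrib[symmetric]) simp
  finally show ?thesis .
qed

section \<open>Tempered distributions and vector-valued integrals\<close>

lemma tempered_add: "u \<in> tempered \<Longrightarrow> \<phi> \<in> schwartz \<Longrightarrow> \<psi> \<in> schwartz \<Longrightarrow> u (\<lambda>x. \<phi> x + \<psi> x) = u \<phi> + u \<psi>"
  and tempered_cmult: "u \<in> tempered \<Longrightarrow> \<phi> \<in> schwartz \<Longrightarrow> u (\<lambda>x. c * \<phi> x) = c * u \<phi>"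
  and tempered_outside: "u \<in> tempered \<Longrightarrow> \<phi> \<notin> schwartz \<Longrightarrow> u \<phi> = 0"
  by (auto simp: tempered_def)

lemma tempered_diff:
  assumes "u \<in> tempered" "\<phi> \<in> schwartz" "\<psi> \<in> schwartz"
  shows "u (\<lambda>x. \<phi> x - \<psi> x) = u \<phi> - u \<psi>"
  using tempered_add[OF assms(1,2) schwartz_cmult[OF assms(3), of "-1"]] tempered_cmult[OF assms(1,3), of "-1"]
  by simp

lemma tempered_sum:
  assumes "u \<in> tempered" "finite I" "\<And>i. i \<in> I \<Longrightarrow> \<phi> i \<in> schwartz"
  shows "u (\<lambda>x. \<Sum>i\<in>I. c i * \<phi> i x) = (\<Sum>i\<in>I. c i * u (\<phi> i))"
  using assms(2,3)
proof (induction I rule: finite_induct)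
  case empty
  show ?case using tempered_cmult[OF assms(1) schwartz_0, of 0] by simp
next
  case (insert i I)
  have "u (\<lambda>x. c i * \<phi> i x + (\<Sum>i\<in>I. c i * \<phi> i x)) = u (\<lambda>x. c i * \<phi> i x) + u (\<lambda>x. \<Sum>i\<in>I. c i * \<phi> i x)"
    using insert by (intro tempered_add assms(1) schwartz_cmult schwartz_sum) auto
  then show ?case using insert tempered_cmult[OF assms(1)] by simp
qed

lemma schwartz_norm_nonneg:
  assumes "\<psi> \<in> schwartz" shows "0 \<le> schwartz_norm N (\<psi> :: real^'n::finite \<Rightarrow> complex)"
  unfolding schwartz_norm_def
proof (intro sum_nonneg)
  fix "is" :: "'n list"
  have "bounded (range (\<lambda>x. japanese x ^ N *\<^sub>R iter_deriv is \<psi> x))"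
    using assms by (simp add: schwartz_def)
  then obtain B where "\<And>x. norm (japanese x ^ N *\<^sub>R iter_deriv is \<psi> x) \<le> B" by (auto simp: bounded_iff)
  then have "bdd_above (range (\<lambda>x. japanese x ^ N * norm (iter_deriv is \<psi> x)))"
    by (auto simp: bdd_above_def)
  then show "0 \<le> (SUP x. japanese x ^ N * norm (iter_deriv is \<psi> x))"
    by (rule cSUP_upper2[of _ _ undefined]) auto
qed

lemma tempered_bound:
  assumes "u \<in> tempered"
  obtains C N where "0 \<le> C" "\<And>\<psi>. \<psi> \<in> schwartz \<Longrightarrow> norm (u \<psi>) \<le> C * schwartz_norm N \<psi>"
proof -
  from assms obtain C N where C: "\<And>\<psi>. \<psi> \<in> schwartz \<Longrightarrow> norm (u \<psi>) \<le> C * schwartz_norm N \<psi>"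
    unfolding tempered_def by blast
  have "norm (u \<psi>) \<le> \<bar>C\<bar> * schwartz_norm N \<psi>" if "\<psi> \<in> schwartz" for \<psi>
    using C[OF that] mult_right_mono[OF abs_ge_self schwartz_norm_nonneg[OF that], of C] by (rule order_trans)
  then show ?thesis using that[of "\<bar>C\<bar>" N] by auto
qed

lemma iter_deriv_sum:
  assumes "finite I" "\<And>i. i \<in> I \<Longrightarrow> \<phi> i \<in> schwartz"
  shows "iter_deriv is (\<lambda>x. \<Sum>i\<in>I. c i * \<phi> i x) = (\<lambda>x. \<Sum>i\<in>I. c i * iter_deriv is (\<phi> i) x)"
proof (induction "is")
  case Nil then show ?case by simp
next
  case (Cons j "is")
  have d: "iter_deriv is (\<phi> i) differentiable (at x)" if "i \<in> I" for i x
    by (rule schwartz_differentiable[OF schwartz_iter[OF assms(2)[OF that]]])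
  have "partial_deriv j (\<lambda>x. \<Sum>i\<in>I. c i * iter_deriv is (\<phi> i) x) x = (\<Sum>i\<in>I. c i * partial_deriv j (iter_deriv is (\<phi> i)) x)" for x
  proof -
    have "((\<lambda>x. \<Sum>i\<in>I. c i * iter_deriv is (\<phi> i) x) has_derivative
       (\<lambda>h. \<Sum>i\<in>I. c i * frechet_derivative (iter_deriv is (\<phi> i)) (at x) h)) (at x)"
      using d frechet_derivative_works by (intro has_derivative_sum has_derivative_mult_right) blast
    from partial_deriv_eqI[OF this] show ?thesis by (simp add: partial_deriv_def)
  qed
  with Cons show ?case by (auto simp: iter_deriv_Cons)
qed

lemma iter_deriv_diff:
  assumes "\<phi> \<in> schwartz" "\<psi> \<in> schwartz"
  shows "iter_deriv is (\<lambda>x. \<phi> x - \<psi> x) = (\<lambda>x. iter_deriv is \<phi> x - iter_deriv is \<psi> x)"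
  using iter_deriv_sum[of "UNIV :: bool set" "\<lambda>b. if b then \<phi> else \<psi>" "is" "\<lambda>b. if b then 1 else -1"] assms
  by (simp add: UNIV_bool)

text \<open>The form of the derivative to which dominated convergence applies.\<close>

lemma partial_deriv_LIMSEQ:
  fixes f :: "real^'n::finite \<Rightarrow> complex"
  assumes "f differentiable (at x)"
  shows "(\<lambda>n. of_real (real (Suc n)) * (f (x + inverse (real (Suc n)) *\<^sub>R axis i 1) - f x)) \<longlonglongrightarrow> partial_deriv i f x"
proof -
  let ?D = "frechet_derivative f (at x)"
  let ?h = "\<lambda>n. inverse (real (Suc n)) *\<^sub>R (axis i 1 :: real^'n)"
  have D: "(f has_derivative ?D) (at x)" using assms frechet_derivative_works by blast
  have lin: "linear ?D" by (rule linear_frechet_derivative[OF assms])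
  from D have lim: "((\<lambda>h. norm (f (x + h) - f x - ?D h) / norm h) \<longlongrightarrow> 0) (at 0)"
    by (simp add: has_derivative_at)
  have "?h \<longlonglongrightarrow> 0 *\<^sub>R axis i 1"
    by (intro tendsto_intros LIMSEQ_inverse_real_of_nat)
  moreover have "?h n \<noteq> 0" for n by (simp add: axis_eq_0_iff)
  ultimately have "filterlim ?h (at 0) sequentially" by (intro filterlim_atI) auto
  from filterlim_compose[OF lim this]
  have "(\<lambda>n. norm (f (x + ?h n) - f x - ?D (?h n)) / norm (?h n)) \<longlonglongrightarrow> 0" .
  moreover have "norm (f (x + ?h n) - f x - ?D (?h n)) / norm (?h n) =
      norm (of_real (real (Suc n)) * (f (x + ?h n) - f x) - partial_deriv i f x)" for n
  proof -
    have "?D (?h n) = inverse (real (Suc n)) *\<^sub>R partial_deriv i f x"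
      using linear_scale[OF lin] by (simp add: partial_deriv_def)
    then have "of_real (real (Suc n)) * (f (x + ?h n) - f x) - partial_deriv i f x = of_real (real (Suc n)) * (f (x + ?h n) - f x - ?D (?h n))"
      by (simp add: algebra_simps scaleR_conv_of_real[where 'a=complex] flip: of_nat_Suc)
    then show ?thesis
      by (simp add: norm_mult divide_inverse mult.commute del: of_nat_Suc)
  qed
  ultimately have "(\<lambda>n. norm (of_real (real (Suc n)) * (f (x + ?h n) - f x) - partial_deriv i f x)) \<longlonglongrightarrow> 0" by simp
  then show ?thesis by (simp add: LIM_zero_cancel tendsto_norm_zero_iff)
qed

text \<open>The constant \<open>3\<close> comes from linearising at \<open>x\<close>, which costs \<open>2 * B\<close>, plus the linear term.\<close>

lemma difference_quotient_bound:
  fixes f :: "real^'n::finite \<Rightarrow> complex"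
  assumes "\<And>x. f differentiable (at x)" "\<And>x. norm (partial_deriv i f x) \<le> B"
  shows "norm (f (x + s *\<^sub>R axis i 1) - f x) \<le> 3 * B * \<bar>s\<bar>"
proof -
  have "norm ((\<lambda>s. f (x + s *\<^sub>R axis i 1)) s - (\<lambda>s. f (x + s *\<^sub>R axis i 1)) 0 - (s - 0) *\<^sub>R partial_deriv i f (x + 0 *\<^sub>R axis i 1)) \<le> norm (s - 0) * (2 * B)"
  proof (rule vector_differentiable_bound_linearization[where S=UNIV and f'="\<lambda>s. partial_deriv i f (x + s *\<^sub>R axis i 1)"])
    show "((\<lambda>s. f (x + s *\<^sub>R axis i 1)) has_vector_derivative partial_deriv i f (x + s *\<^sub>R axis i 1)) (at s within UNIV)" for s
      using partial_deriv_has_vector_derivative[OF assms(1)] by simp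
    show "norm (partial_deriv i f (x + s *\<^sub>R axis i 1) - partial_deriv i f (x + 0 *\<^sub>R axis i 1)) \<le> 2 * B" for s
      using norm_triangle_ineq4[of "partial_deriv i f (x + s *\<^sub>R axis i 1)" "partial_deriv i f (x + 0 *\<^sub>R axis i 1)"]
        assms(2)[of "x + s *\<^sub>R axis i 1"] assms(2)[of "x + 0 *\<^sub>R axis i 1"] by linarith
  qed auto
  then have "norm (f (x + s *\<^sub>R axis i 1) - f x - s *\<^sub>R partial_deriv i f x) \<le> 2 * B * \<bar>s\<bar>" by (simp add: mult_ac)
  moreover have "norm (s *\<^sub>R partial_deriv i f x) \<le> B * \<bar>s\<bar>"
    using mult_left_mono[OF assms(2)[of x], of "\<bar>s\<bar>"] by (simp add: mult.commute del: scaleR_complex_def)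
  moreover have "norm (f (x + s *\<^sub>R axis i 1) - f x) \<le> norm (f (x + s *\<^sub>R axis i 1) - f x - s *\<^sub>R partial_deriv i f x) + norm (s *\<^sub>R partial_deriv i f x)"
    by (rule norm_triangle_sub[of _ "s *\<^sub>R partial_deriv i f x", unfolded add.commute[of "norm (s *\<^sub>R partial_deriv i f x)"]])
  ultimately show ?thesis by linarith
qed

text \<open>A simple function turns an integral over the parameter into a finite sum, on which a linear
  functional can act term by term.\<close>

lemma integral_simple_reindex:
  fixes K :: "'z \<Rightarrow> complex"
  assumes q: "simple_function M q" and K: "integrable M K"
  shows "(\<integral>z. K z * h (q z) \<partial>M) = (\<Sum>c\<in>q ` space M. (\<integral>z. K z * indicator (q -` {c} \<inter> space M) z \<partial>M) * h c)"
    and "integrable M (\<lambda>z. K z * h (q z))"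
proof -
  have fin: "finite (q ` space M)" by (rule simple_functionD(1)[OF q])
  have s: "q -` {c} \<inter> space M \<in> sets M" for c by (rule simple_functionD(2)[OF q])
  have I: "integrable M (\<lambda>z. K z * indicator (q -` {c} \<inter> space M) z)" for c
    by (rule Bochner_Integration.integrable_cong[THEN iffD1, OF refl _ integrable_mult_indicator[OF s K, of c]])
       (simp split: split_indicator)
  have eq: "K z * h (q z) = (\<Sum>c\<in>q ` space M. K z * indicator (q -` {c} \<inter> space M) z * h c)" if "z \<in> space M" for z
  proof -
    have "(\<Sum>c\<in>q ` space M. K z * indicator (q -` {c} \<inter> space M) z * h c) = (\<Sum>c\<in>q ` space M. if c = q z then K z * h (q z) else 0)"
      using that by (intro sum.cong) auto
    then show ?thesis using that fin by simp
  qed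
  have "(\<integral>z. K z * h (q z) \<partial>M) = (\<integral>z. (\<Sum>c\<in>q ` space M. K z * indicator (q -` {c} \<inter> space M) z * h c) \<partial>M)"
    by (rule Bochner_Integration.integral_cong[OF refl]) (rule eq)
  also have "\<dots> = (\<Sum>c\<in>q ` space M. (\<integral>z. K z * indicator (q -` {c} \<inter> space M) z \<partial>M) * h c)"
    by (subst Bochner_Integration.integral_sum) (auto intro!: integrable_mult_left I)
  finally show "(\<integral>z. K z * h (q z) \<partial>M) = (\<Sum>c\<in>q ` space M. (\<integral>z. K z * indicator (q -` {c} \<inter> space M) z \<partial>M) * h c)" .
  have "integrable M (\<lambda>z. \<Sum>c\<in>q ` space M. K z * indicator (q -` {c} \<inter> space M) z * h c)"
    by (intro Bochner_Integration.integrable_sum integrable_mult_left I)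
  then show "integrable M (\<lambda>z. K z * h (q z))"
    by (subst Bochner_Integration.integrable_cong[OF refl eq])
qed

text \<open>Differentiation under the integral sign, by dominated convergence of difference quotients.\<close>

lemma iter_deriv_integral:
  fixes F :: "'z::euclidean_space \<Rightarrow> real^'n::finite \<Rightarrow> complex"
  assumes \<psi>: "\<psi> \<in> schwartz" and F: "\<And>z. F z \<in> schwartz"
    and meas: "\<And>is t. length is \<le> Suc N \<Longrightarrow> (\<lambda>z. iter_deriv is (F z) t) \<in> borel_measurable borel"
    and K: "K \<in> borel_measurable borel" and \<Omega>: "integrable lborel (\<lambda>z. norm (K z) * \<Omega> z)"
    and bd: "\<And>is z t. length is \<le> Suc N \<Longrightarrow> norm (iter_deriv is (F z) t) \<le> C * \<Omega> z"
    and eq: "\<And>t. \<psi> t = (\<integral>z. K z * F z t \<partial>lborel)"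
  shows "length is \<le> Suc N \<Longrightarrow> iter_deriv is \<psi> t = (\<integral>z. K z * iter_deriv is (F z) t \<partial>lborel)"
proof (induction "is" arbitrary: t)
  case Nil then show ?case by (simp add: eq)
next
  case (Cons i "is")
  note [measurable] = K
  let ?D = "\<lambda>z. iter_deriv is (F z)"
  have l: "length is \<le> Suc N" using Cons.prems by simp
  have int: "integrable lborel (\<lambda>z. K z * iter_deriv js (F z) t)" if "length js \<le> Suc N" for js t
  proof (rule integrable_lborel_bounded[OF _ \<Omega>, of _ C])
    show "(\<lambda>z. K z * iter_deriv js (F z) t) \<in> borel_measurable borel"
      using meas[OF that] by measurable
    show "norm (K z * iter_deriv js (F z) t) \<le> C * (norm (K z) * \<Omega> z)" for z
      using mult_left_mono[OF bd[OF that, of z t], of "norm (K z)"] by (simp add: norm_mult mult_ac)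
  qed
  let ?q = "\<lambda>f n. of_real (real (Suc n)) * (f (t + inverse (real (Suc n)) *\<^sub>R axis i 1) - f t) :: complex"
  have "?q (iter_deriv is \<psi>) n = (\<integral>z. K z * ?q (?D z) n \<partial>lborel)" for n
  proof -
    have "(\<integral>z. K z * ?q (?D z) n \<partial>lborel) = (\<integral>z. of_real (real (Suc n)) * (K z * ?D z (t + inverse (real (Suc n)) *\<^sub>R axis i 1) - K z * ?D z t) \<partial>lborel)"
      by (simp add: algebra_simps)
    also have "\<dots> = ?q (iter_deriv is \<psi>) n"
      using Cons.IH[OF l] int[OF l] by (simp del: of_nat_Suc)
    finally show ?thesis by simp
  qed
  moreover have "(\<lambda>n. \<integral>z. K z * ?q (?D z) n \<partial>lborel) \<longlonglongrightarrow> (\<integral>z. K z * iter_deriv (i # is) (F z) t \<partial>lborel)"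
  proof (rule integral_dominated_convergence[where w="\<lambda>z. 3 * C * (norm (K z) * \<Omega> z)"])
    note [measurable] = meas[OF l] meas[OF Cons.prems]
    show "(\<lambda>z. K z * iter_deriv (i # is) (F z) t) \<in> borel_measurable lborel" by measurable
    show "(\<lambda>z. K z * ?q (?D z) n) \<in> borel_measurable lborel" for n by measurable
    show "integrable lborel (\<lambda>z. 3 * C * (norm (K z) * \<Omega> z))" using \<Omega> by simp
    show "AE z in lborel. (\<lambda>n. K z * ?q (?D z) n) \<longlonglongrightarrow> K z * iter_deriv (i # is) (F z) t"
      unfolding iter_deriv_Cons
      by (intro AE_I2 tendsto_mult tendsto_const partial_deriv_LIMSEQ schwartz_differentiable schwartz_iter F)
    show "AE z in lborel. norm (K z * ?q (?D z) n) \<le> 3 * C * (norm (K z) * \<Omega> z)" for n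
    proof (rule AE_I2)
      fix z
      have "norm (?D z (t + inverse (real (Suc n)) *\<^sub>R axis i 1) - ?D z t) \<le> 3 * (C * \<Omega> z) * \<bar>inverse (real (Suc n))\<bar>"
        using bd[OF Cons.prems, of z]
        by (intro difference_quotient_bound schwartz_differentiable schwartz_iter F) (simp add: iter_deriv_Cons)
      then have "norm (?q (?D z) n) \<le> 3 * (C * \<Omega> z)"
        by (simp add: norm_mult divide_simps mult.commute del: of_nat_Suc)
      from mult_left_mono[OF this, of "norm (K z)"]
      show "norm (K z * ?q (?D z) n) \<le> 3 * C * (norm (K z) * \<Omega> z)"
        by (simp only: norm_mult[of "K z"] norm_ge_zero) (simp add: mult_ac)
    qed
  qed
  ultimately have "?q (iter_deriv is \<psi>) \<longlonglongrightarrow> (\<integral>z. K z * iter_deriv (i # is) (F z) t \<partial>lborel)"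
    by simp
  moreover have "?q (iter_deriv is \<psi>) \<longlonglongrightarrow> iter_deriv (i # is) \<psi> t"
    unfolding iter_deriv_Cons by (intro partial_deriv_LIMSEQ schwartz_differentiable schwartz_iter \<psi>)
  ultimately show ?case by (rule LIMSEQ_unique[rotated])
qed

text \<open>To see that a tempered distribution commutes with superpositions of Schwartz functions, approximate
  the identity on the parameter space by simple functions \<open>q k\<close>. Replacing \<open>z\<close> by \<open>q k z\<close> inside
  \<open>F\<close> gives finite sums \<open>R k\<close>. They converge to \<open>\<psi>\<close> in the Schwartz norm that bounds \<open>u\<close>, because
  \<open>F\<close> is Lipschitz in \<open>z\<close> up to polynomial factors. These factors are absorbed by the rapid decrease of \<open>K\<close>.\<close>

lemma tempered_integral:
  fixes F :: "'z::euclidean_space \<Rightarrow> real^'n::finite \<Rightarrow> complex"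
  assumes u: "u \<in> tempered" and \<psi>: "\<psi> \<in> schwartz" and F: "\<And>z. F z \<in> schwartz"
    and K: "K \<in> borel_measurable borel" and rapid: "\<And>k. integrable lborel (\<lambda>z. norm (K z) * japanese z ^ k)"
    and bd: "\<And>N. \<exists>C M. \<forall>is z t. length is \<le> N \<longrightarrow> norm (iter_deriv is (F z) t) \<le> C * japanese z ^ M * decay N t"
    and lip: "\<And>N. \<exists>C M. \<forall>is z z' t. length is \<le> N \<longrightarrow> norm (iter_deriv is (F z') t - iter_deriv is (F z) t) \<le>
        C * (norm (z' - z) * japanese z ^ M * japanese z' ^ M) * decay N t"
    and eq: "\<And>t. \<psi> t = (\<integral>z. K z * F z t \<partial>lborel)"
  shows "continuous_on UNIV (\<lambda>z. u (F z))" and "u \<psi> = (\<integral>z. K z * u (F z) \<partial>lborel)"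
proof -
  note [measurable] = K
  obtain C0 N where C0: "0 \<le> C0" "\<And>\<psi>. \<psi> \<in> schwartz \<Longrightarrow> norm (u \<psi>) \<le> C0 * schwartz_norm N \<psi>"
    using tempered_bound[OF u] by blast
  let ?n = "real (card {is :: 'n list. length is \<le> N})"
  obtain C1 M1 where bd1: "\<And>is z t. length is \<le> Suc N \<Longrightarrow> norm (iter_deriv is (F z) t) \<le> C1 * japanese z ^ M1 * decay (Suc N) t"
    using bd[of "Suc N"] by blast
  have C1: "0 \<le> C1"
  proof (rule ccontr)
    assume "\<not> 0 \<le> C1"
    moreover have "0 < japanese (0::'z) ^ M1 * decay (Suc N) (0 :: real^'n)" by simp
    ultimately have "C1 * (japanese (0::'z) ^ M1 * decay (Suc N) (0 :: real^'n)) < 0" by (intro mult_neg_pos) auto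
    then show False
      using order_trans[OF norm_ge_zero bd1[of "[]" 0 0]] by (simp add: mult.assoc)
  qed
  have bd': "norm (iter_deriv is (F z) t) \<le> C1 * japanese z ^ M1" if "length is \<le> Suc N" for "is" z t
    using bd1[OF that, of z t] mult_left_mono[OF decay_le_1[of "Suc N" t], of "C1 * japanese z ^ M1"] C1 by simp
  obtain C2 M2 where lip2: "\<And>is z z' t. length is \<le> Suc N \<Longrightarrow> norm (iter_deriv is (F z') t - iter_deriv is (F z) t) \<le>
        C2 * (norm (z' - z) * japanese z ^ M2 * japanese z' ^ M2) * decay (Suc N) t"
    using lip[of "Suc N"] by blast
  \<comment> \<open>\<open>A z z'\<close> bounds the distance between \<open>F z\<close> and \<open>F z'\<close> in the seminorms up to order \<open>Suc N\<close>.\<close>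
  define A where "A z z' = \<bar>C2\<bar> * (norm (z' - z) * japanese z ^ M2 * japanese z' ^ M2)" for z z' :: 'z
  have A0: "0 \<le> A z z'" for z z' by (simp add: A_def)
  have lipA: "norm (iter_deriv is (F z') t - iter_deriv is (F z) t) \<le> A z z' * decay N t" if "length is \<le> Suc N" for "is" z z' t
  proof -
    have "norm (iter_deriv is (F z') t - iter_deriv is (F z) t) \<le> C2 * (norm (z' - z) * japanese z ^ M2 * japanese z' ^ M2) * decay (Suc N) t"
      by (rule lip2[OF that])
    also have "\<dots> \<le> A z z' * decay N t"
      unfolding A_def by (intro mult_mono decay_antimono) auto
    finally show ?thesis .
  qed
  have cont: "continuous_on UNIV (\<lambda>z. iter_deriv is (F z) t)" if "length is \<le> Suc N" for "is" t
  proof -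
    have "((\<lambda>z'. iter_deriv is (F z') t) \<longlongrightarrow> iter_deriv is (F z) t) (at z)" for z
    proof (rule Lim_transform_bound[of "\<lambda>z'. iter_deriv is (F z') t - iter_deriv is (F z) t" "\<lambda>z'. A z z' * decay N t", THEN LIM_zero_cancel])
      show "\<forall>\<^sub>F z' in at z. norm (iter_deriv is (F z') t - iter_deriv is (F z) t) \<le> norm (A z z' * decay N t)"
        using lipA[OF that, of _ t z] A0 by (intro always_eventually allI) (auto simp: abs_mult)
      have "((\<lambda>z'. A z z' * decay N t) \<longlongrightarrow> A z z * decay N t) (at z)"
        unfolding A_def japanese_def by (intro tendsto_intros)
      then show "((\<lambda>z'. A z z' * decay N t) \<longlongrightarrow> 0) (at z)" by (simp add: A_def)
    qed
    then show ?thesis by (auto simp: continuous_on_def)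
  qed
  have meas: "(\<lambda>z. iter_deriv is (F z) t) \<in> borel_measurable borel" if "length is \<le> Suc N" for "is" t
    by (intro borel_measurable_continuous_onI cont that)
  have udiff: "norm (u (F z') - u (F z)) \<le> C0 * (?n * A z z')" for z z'
  proof -
    have "norm (u (F z') - u (F z)) = norm (u (\<lambda>t. F z' t - F z t))"
      by (simp add: tempered_diff u F)
    also have "\<dots> \<le> C0 * schwartz_norm N (\<lambda>t. F z' t - F z t)"
      by (intro C0 schwartz_diff F)
    also have "\<dots> \<le> C0 * (?n * A z z')"
      by (intro mult_left_mono C0 schwartz_norm_le schwartz_diff F)
         (use lipA in \<open>auto simp: iter_deriv_diff F\<close>)
    finally show ?thesis .
  qed
  show contu: "continuous_on UNIV (\<lambda>z. u (F z))"
  proof -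
    have "((\<lambda>z'. u (F z')) \<longlongrightarrow> u (F z)) (at z)" for z
    proof (rule Lim_transform_bound[of "\<lambda>z'. u (F z') - u (F z)" "\<lambda>z'. C0 * (?n * A z z')", THEN LIM_zero_cancel])
      show "\<forall>\<^sub>F z' in at z. norm (u (F z') - u (F z)) \<le> norm (C0 * (?n * A z z'))"
        using udiff[of _ z] A0 C0 by (intro always_eventually allI) (auto simp: abs_mult)
      have "((\<lambda>z'. C0 * (?n * A z z')) \<longlongrightarrow> C0 * (?n * A z z)) (at z)"
        unfolding A_def japanese_def by (intro tendsto_intros)
      then show "((\<lambda>z'. C0 * (?n * A z z')) \<longlongrightarrow> 0) (at z)" by (simp add: A_def)
    qed
    then show ?thesis by (auto simp: continuous_on_def)
  qed
  have [measurable]: "(\<lambda>z. u (F z)) \<in> borel_measurable borel"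
    by (intro borel_measurable_continuous_onI contu)
  obtain q :: "nat \<Rightarrow> 'z \<Rightarrow> 'z" where q: "\<And>k. simple_function lborel (q k)"
    "\<And>z. (\<lambda>k. q k z) \<longlonglongrightarrow> z" "\<And>k z. norm (q k z) \<le> 2 * norm z"
    using borel_measurable_implies_sequence_metric[of "\<lambda>z::'z. z" lborel 0] by auto
  have qm [measurable]: "q k \<in> borel_measurable borel" for k
    using borel_measurable_simple_function[OF q(1)[of k]] by simp
  have qA: "(\<lambda>k. A z (q k z)) \<longlonglongrightarrow> 0" for z
  proof -
    have "(\<lambda>k. A z (q k z)) \<longlonglongrightarrow> A z z"
      unfolding A_def japanese_def by (intro tendsto_intros q(2))
    then show ?thesis by (simp add: A_def)
  qed
  \<comment> \<open>An exponent large enough for all polynomial factors that occur.\<close>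
  define P where "P = 1 + M2 + M2 + M1"
  have qb: "A z (q k z) \<le> \<bar>C2\<bar> * 3 * 2 ^ M2 * japanese z ^ P" for z k
  proof -
    have "norm (q k z - z) \<le> 3 * japanese z"
      using norm_triangle_ineq4[of "q k z" z] q(3)[of k z] norm_le_japanese[of z] by linarith
    moreover have "japanese (q k z) \<le> 2 * japanese z"
    proof -
      have "(norm (q k z))\<^sup>2 \<le> (2 * norm z)\<^sup>2" by (intro power_mono q) auto
      then have "1 + (norm (q k z))\<^sup>2 \<le> (2 * japanese z)\<^sup>2"
        by (simp add: power_mult_distrib japanese_sq)
      then show ?thesis
        unfolding japanese_def[of "q k z"] by (intro real_le_lsqrt) auto
    qed
    ultimately have "A z (q k z) \<le> \<bar>C2\<bar> * ((3 * japanese z) * japanese z ^ M2 * (2 * japanese z) ^ M2)"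
      unfolding A_def by (intro mult_left_mono mult_mono power_mono) auto
    also have "\<dots> = \<bar>C2\<bar> * 3 * 2 ^ M2 * japanese z ^ (1 + M2 + M2)"
      by (simp add: power_add power_mult_distrib)
    also have "\<dots> \<le> \<bar>C2\<bar> * 3 * 2 ^ M2 * japanese z ^ P"
      by (intro mult_left_mono power_increasing japanese_ge_1) (auto simp: P_def)
    finally show ?thesis .
  qed
  have Kint: "integrable lborel K"
    by (rule integrable_lborel_bounded[OF K rapid[of 0], of 1]) simp
  define R where "R k t = (\<integral>z. K z * F (q k z) t \<partial>lborel)" for k t
  define w where "w k c = (\<integral>z. K z * indicator (q k -` {c} \<inter> space lborel) z \<partial>lborel)" for k c
  have fin: "finite (q k ` space lborel)" for k by (rule simple_functionD(1)[OF q(1)])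
  have R: "R k = (\<lambda>t. \<Sum>c\<in>q k ` space lborel. w k c * F c t)" for k
    unfolding R_def w_def by (intro ext integral_simple_reindex(1)[OF q(1) Kint])
  have RS: "R k \<in> schwartz" for k
    unfolding R by (intro schwartz_sum fin schwartz_cmult F)
  have uR: "u (R k) = (\<integral>z. K z * u (F (q k z)) \<partial>lborel)" for k
    unfolding R w_def
    by (subst tempered_sum[OF u fin F]) (rule integral_simple_reindex(1)[OF q(1) Kint, symmetric])
  have iR: "iter_deriv is (R k) t = (\<integral>z. K z * iter_deriv is (F (q k z)) t \<partial>lborel)" for "is" k t
    unfolding R w_def
    by (subst iter_deriv_sum[OF fin F]) (rule integral_simple_reindex(1)[OF q(1) Kint, symmetric])
  have i\<psi>: "iter_deriv is \<psi> t = (\<integral>z. K z * iter_deriv is (F z) t \<partial>lborel)" if "length is \<le> Suc N" for "is" t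
    by (rule iter_deriv_integral[OF \<psi> F meas K rapid[of M1] _ eq that]) (use bd' in auto)
  have int1: "integrable lborel (\<lambda>z. K z * iter_deriv is (F z) t)" if "length is \<le> Suc N" for "is" t
  proof (rule integrable_lborel_bounded[OF _ rapid[of M1], of _ C1])
    show "(\<lambda>z. K z * iter_deriv is (F z) t) \<in> borel_measurable borel" using meas[OF that] by measurable
    show "norm (K z * iter_deriv is (F z) t) \<le> C1 * (norm (K z) * japanese z ^ M1)" for z
      using mult_left_mono[OF bd'[OF that, of z t], of "norm (K z)"] by (simp add: norm_mult mult_ac)
  qed
  have intA: "integrable lborel (\<lambda>z. norm (K z) * A z (q k z))" for k
  proof (rule integrable_lborel_bounded[OF _ rapid[of P], of _ "\<bar>C2\<bar> * 3 * 2 ^ M2"])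
    show "(\<lambda>z. norm (K z) * A z (q k z)) \<in> borel_measurable borel" unfolding A_def by measurable
    show "norm (norm (K z) * A z (q k z)) \<le> \<bar>C2\<bar> * 3 * 2 ^ M2 * (norm (K z) * japanese z ^ P)" for z
      using mult_left_mono[OF qb[of z k], of "norm (K z)"] A0[of z "q k z"] by (simp add: mult_ac)
  qed
  have nb: "schwartz_norm N (\<lambda>t. \<psi> t - R k t) \<le> ?n * (\<integral>z. norm (K z) * A z (q k z) \<partial>lborel)" for k
  proof (rule schwartz_norm_le)
    show "(\<lambda>t. \<psi> t - R k t) \<in> schwartz" by (intro schwartz_diff \<psi> RS)
    fix "is" :: "'n list" and t assume l: "length is \<le> N"
    then have l': "length is \<le> Suc N" by simp
    have "iter_deriv is (\<lambda>t. \<psi> t - R k t) t = (\<integral>z. K z * iter_deriv is (F z) t - K z * iter_deriv is (F (q k z)) t \<partial>lborel)"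
      unfolding iter_deriv_diff[OF \<psi> RS] iR i\<psi>[OF l']
      by (rule Bochner_Integration.integral_diff[symmetric, OF int1[OF l'] integral_simple_reindex(2)[OF q(1) Kint]])
    also have "norm \<dots> \<le> (\<integral>z. norm (K z) * A z (q k z) * decay N t \<partial>lborel)"
    proof (rule Bochner_Integration.integral_norm_bound_integral)
      show "integrable lborel (\<lambda>z. K z * iter_deriv is (F z) t - K z * iter_deriv is (F (q k z)) t)"
        by (intro Bochner_Integration.integrable_diff int1[OF l'] integral_simple_reindex(2)[OF q(1) Kint])
      show "integrable lborel (\<lambda>z. norm (K z) * A z (q k z) * decay N t)" using intA by simp
      fix z :: 'z
      have "norm (K z * iter_deriv is (F z) t - K z * iter_deriv is (F (q k z)) t) = norm (K z) * norm (iter_deriv is (F (q k z)) t - iter_deriv is (F z) t)"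
        by (simp add: norm_mult[symmetric] norm_minus_commute algebra_simps)
      also have "\<dots> \<le> norm (K z) * (A z (q k z) * decay N t)"
        by (intro mult_left_mono lipA l') auto
      finally show "norm (K z * iter_deriv is (F z) t - K z * iter_deriv is (F (q k z)) t) \<le> norm (K z) * A z (q k z) * decay N t"
        by (simp add: mult_ac)
    qed
    finally show "norm (iter_deriv is (\<lambda>t. \<psi> t - R k t) t) \<le> (\<integral>z. norm (K z) * A z (q k z) \<partial>lborel) * decay N t"
      by simp
  qed
  have lim0: "(\<lambda>k. \<integral>z. norm (K z) * A z (q k z) \<partial>lborel) \<longlonglongrightarrow> (\<integral>z. 0 \<partial>(lborel :: 'z measure))"
  proof (rule integral_dominated_convergence[where w="\<lambda>z. \<bar>C2\<bar> * 3 * 2 ^ M2 * (norm (K z) * japanese z ^ P)"])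
    show "(\<lambda>z. norm (K z) * A z (q k z)) \<in> borel_measurable lborel" for k unfolding A_def by measurable
    show "AE z in lborel. (\<lambda>k. norm (K z) * A z (q k z)) \<longlonglongrightarrow> 0"
    proof (rule AE_I2)
      fix z show "(\<lambda>k. norm (K z) * A z (q k z)) \<longlonglongrightarrow> 0"
        using tendsto_mult_right_zero[OF qA[of z], of "norm (K z)"] by simp
    qed
    show "AE z in lborel. norm (norm (K z) * A z (q k z)) \<le> \<bar>C2\<bar> * 3 * 2 ^ M2 * (norm (K z) * japanese z ^ P)" for k
      using mult_left_mono[OF qb[of _ k], of "norm (K _)"] A0 by (intro AE_I2) (auto simp: abs_mult mult_ac)
  qed (use rapid in auto)
  have "(\<lambda>k. u (R k) - u \<psi>) \<longlonglongrightarrow> 0"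
  proof (rule Lim_transform_bound[of _ "\<lambda>k. C0 * (?n * (\<integral>z. norm (K z) * A z (q k z) \<partial>lborel))"])
    have "norm (u (R k) - u \<psi>) \<le> C0 * (?n * (\<integral>z. norm (K z) * A z (q k z) \<partial>lborel))" for k
    proof -
      have "norm (u (R k) - u \<psi>) = norm (u (\<lambda>t. \<psi> t - R k t))"
        by (simp add: tempered_diff u \<psi> RS norm_minus_commute)
      also have "\<dots> \<le> C0 * schwartz_norm N (\<lambda>t. \<psi> t - R k t)" by (intro C0 schwartz_diff \<psi> RS)
      also have "\<dots> \<le> C0 * (?n * (\<integral>z. norm (K z) * A z (q k z) \<partial>lborel))"
        by (intro mult_left_mono nb C0)
      finally show ?thesis .
    qed
    then show "\<forall>\<^sub>F k in sequentially. norm (u (R k) - u \<psi>) \<le> norm (C0 * (?n * (\<integral>z. norm (K z) * A z (q k z) \<partial>lborel)))"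
      unfolding real_norm_def by (intro always_eventually allI order_trans[OF _ abs_ge_self])
    have "(\<lambda>k. C0 * (?n * (\<integral>z. norm (K z) * A z (q k z) \<partial>lborel))) \<longlonglongrightarrow> C0 * (?n * (\<integral>z. 0 \<partial>(lborel :: 'z measure)))"
      by (intro tendsto_intros lim0)
    then show "(\<lambda>k. C0 * (?n * (\<integral>z. norm (K z) * A z (q k z) \<partial>lborel))) \<longlonglongrightarrow> 0" by simp
  qed
  then have L1: "(\<lambda>k. u (R k)) \<longlonglongrightarrow> u \<psi>" by (rule LIM_zero_cancel)
  have ub: "norm (u (F z)) \<le> C0 * (?n * (C1 * japanese z ^ M1))" for z
  proof -
    have "norm (u (F z)) \<le> C0 * schwartz_norm N (F z)" by (intro C0 F)
    also have "\<dots> \<le> C0 * (?n * (C1 * japanese z ^ M1))"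
    proof (intro mult_left_mono C0 schwartz_norm_le F)
      fix "is" :: "'n list" and t assume "length is \<le> N"
      then have "norm (iter_deriv is (F z) t) \<le> C1 * japanese z ^ M1 * decay (Suc N) t"
        by (intro bd1) auto
      also have "\<dots> \<le> C1 * japanese z ^ M1 * decay N t"
        using C1 by (intro mult_left_mono decay_antimono) auto
      finally show "norm (iter_deriv is (F z) t) \<le> C1 * japanese z ^ M1 * decay N t" .
    qed
    finally show ?thesis .
  qed
  have L2: "(\<lambda>k. \<integral>z. K z * u (F (q k z)) \<partial>lborel) \<longlonglongrightarrow> (\<integral>z. K z * u (F z) \<partial>lborel)"
  proof (rule integral_dominated_convergence[where w="\<lambda>z. C0 * ?n * 2 ^ M1 * C1 * (norm (K z) * japanese z ^ M1)"])
    show "(\<lambda>z. K z * u (F (q k z))) \<in> borel_measurable lborel" for k by measurable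
    show "AE z in lborel. (\<lambda>k. K z * u (F (q k z))) \<longlonglongrightarrow> K z * u (F z)"
      using continuous_on_tendsto_compose[OF contu q(2)] by (intro AE_I2 tendsto_intros) auto
    show "AE z in lborel. norm (K z * u (F (q k z))) \<le> C0 * ?n * 2 ^ M1 * C1 * (norm (K z) * japanese z ^ M1)" for k
    proof (rule AE_I2)
      fix z :: 'z
      have "(norm (q k z))\<^sup>2 \<le> (2 * norm z)\<^sup>2" by (intro power_mono q) auto
      then have "1 + (norm (q k z))\<^sup>2 \<le> (2 * japanese z)\<^sup>2"
        by (simp add: power_mult_distrib japanese_sq)
      then have "japanese (q k z) \<le> 2 * japanese z"
        unfolding japanese_def[of "q k z"] by (intro real_le_lsqrt) auto
      then have "norm (u (F (q k z))) \<le> C0 * (?n * (C1 * (2 * japanese z) ^ M1))"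
        by (intro order_trans[OF ub] mult_left_mono power_mono C0 C1) auto
      from mult_left_mono[OF this, of "norm (K z)"]
      show "norm (K z * u (F (q k z))) \<le> C0 * ?n * 2 ^ M1 * C1 * (norm (K z) * japanese z ^ M1)"
        by (simp add: norm_mult power_mult_distrib mult_ac)
    qed
  qed (use rapid in auto)
  show "u \<psi> = (\<integral>z. K z * u (F z) \<partial>lborel)"
    by (rule LIMSEQ_unique[OF L1]) (use L2 in \<open>simp add: uR\<close>)
qed

section \<open>The reproducing formula\<close>

lemma japanese_fst_le: "japanese (fst z) \<le> japanese z" and japanese_snd_le: "japanese (snd z) \<le> japanese z"
  using norm_fst_le[of "fst z" "snd z"] norm_snd_le[of "snd z" "fst z"]
  by (auto simp: japanese_def intro!: power_mono)

lemma japanese_Pair_le: "japanese (x, y) \<le> japanese x * japanese y"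
proof -
  have "1 + (norm (x, y))\<^sup>2 \<le> (japanese x)\<^sup>2 * (japanese y)\<^sup>2"
    by (simp add: japanese_sq norm_Pair algebra_simps)
  then have "1 + (norm (x, y))\<^sup>2 \<le> (japanese x * japanese y)\<^sup>2" by (simp add: power_mult_distrib)
  then show ?thesis unfolding japanese_def[of "(x, y)"] by (intro real_le_lsqrt) auto
qed

lemma decay_mult_le_Pair: "decay k x * decay k y \<le> decay k (x, y)"
proof -
  have "japanese (x, y) ^ k \<le> (japanese x * japanese y) ^ k"
    by (intro power_mono japanese_Pair_le) auto
  then show ?thesis
    by (simp add: decay_def power_mult_distrib flip: inverse_mult_distrib)
qed

lemma nn_integral_lborel_pair:
  fixes f :: "'a::euclidean_space \<times> 'b::euclidean_space \<Rightarrow> ennreal"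
  assumes [measurable]: "f \<in> borel_measurable borel"
  shows "(\<integral>\<^sup>+z. f z \<partial>lborel) = (\<integral>\<^sup>+x. \<integral>\<^sup>+y. f (x, y) \<partial>lborel \<partial>lborel)"
  using lborel.nn_integral_fst[of f lborel] assms by (simp add: lborel_prod)

lemma integral_lborel_pair:
  fixes f :: "'a::euclidean_space \<times> 'b::euclidean_space \<Rightarrow> 'c::{banach,second_countable_topology}"
  assumes "integrable lborel f"
  shows "(\<integral>z. f z \<partial>lborel) = (\<integral>x. \<integral>y. f (x, y) \<partial>lborel \<partial>lborel)"
  using lborel_pair.integral_fst'[of f] assms by (simp add: lborel_prod)

lemma integrable_decay_pair:
  assumes "4 * CARD('n) \<le> k"
  shows "integrable lborel (decay k :: (real^'n::finite) \<times> (real^'n) \<Rightarrow> real)"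
proof -
  let ?n = "2 * CARD('n)"
  have le: "decay k z \<le> decay ?n (fst z) * decay ?n (snd z)" for z :: "(real^'n) \<times> (real^'n)"
  proof -
    have "decay k z \<le> decay (?n + ?n) z" using assms by (intro decay_antimono) simp
    also have "\<dots> = decay ?n z * decay ?n z" by (rule decay_add)
    also have "\<dots> \<le> decay ?n (fst z) * decay ?n (snd z)"
      unfolding decay_def
      by (intro mult_mono le_imp_inverse_le power_mono japanese_fst_le japanese_snd_le) auto
    finally show ?thesis .
  qed
  have fin: "(\<integral>\<^sup>+x. ennreal (decay ?n x) \<partial>(lborel :: (real^'n) measure)) < \<infinity>"
    using integrable_decay[of ?n, where 'n='n] by (simp add: integrable_iff_bounded)
  have "(\<integral>\<^sup>+z. ennreal (decay k z) \<partial>(lborel :: ((real^'n) \<times> (real^'n)) measure)) \<le>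
     (\<integral>\<^sup>+z. ennreal (decay ?n (fst z)) * ennreal (decay ?n (snd z)) \<partial>(lborel :: ((real^'n) \<times> (real^'n)) measure))"
    by (intro nn_integral_mono) (simp add: ennreal_mult[symmetric] le)
  also have "\<dots> = (\<integral>\<^sup>+x. ennreal (decay ?n x) \<partial>(lborel :: (real^'n) measure)) * (\<integral>\<^sup>+x. ennreal (decay ?n x) \<partial>(lborel :: (real^'n) measure))"
    by (subst nn_integral_lborel_pair) (simp_all add: nn_integral_cmult nn_integral_multc borel_prod[symmetric])
  also have "\<dots> < \<infinity>" using fin by (simp add: ennreal_mult_less_top)
  finally show ?thesis by (simp add: integrable_iff_bounded)
qed

text \<open>The time-frequency shift of the window against which a distribution is tested to obtain its
  short-time Fourier transform.\<close>

definition atom :: "(real^'n::finite \<Rightarrow> complex) \<Rightarrow> (real^'n) \<times> (real^'n) \<Rightarrow> real^'n \<Rightarrow> complex" where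
  "atom \<phi> z t = cnj (\<phi> (t - fst z)) * cis (- (t \<bullet> snd z))"

lemma stft_atom: "stft \<phi> u x \<xi> = u (atom \<phi> (x, \<xi>))"
  by (simp add: stft_def atom_def[abs_def])

lemma atom_schwartz: "\<phi> \<in> schwartz \<Longrightarrow> atom \<phi> z \<in> schwartz"
  unfolding atom_def[abs_def] by (intro schwartz_modulate schwartz_cnj schwartz_translate)

lemma decay_translate_le: "decay N (t - x) \<le> 2 ^ N * japanese x ^ N * decay N t"
  using decay_shift[of N "t - x" x] by simp

lemma dbound_window:
  assumes "\<phi> \<in> schwartz"
  shows "dbound N (\<lambda>z t. decay k (t - h z)) (\<lambda>z t. \<phi> (t - h z))"
    and "dbound N (\<lambda>z t. decay k (t - h z)) (\<lambda>z t. cnj (\<phi> (t - h z)))"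
  using dbound_translate[OF schwartz_dbound[OF assms, of N k], of h]
    dbound_translate[OF dbound_cnj[OF schwartz_dbound[OF assms, of N k]], of h] by simp_all

lemma atom_bound:
  fixes \<phi> :: "real^'n::finite \<Rightarrow> complex"
  assumes \<phi>: "\<phi> \<in> schwartz"
  shows "\<exists>C M. \<forall>is z t. length is \<le> N \<longrightarrow> norm (iter_deriv is (atom \<phi> z) t) \<le> C * japanese z ^ M * decay N t"
proof -
  have "dbound N (\<lambda>z t. decay N (t - fst z) * japanese (snd z) ^ N) (\<lambda>z t. atom \<phi> z t)"
    unfolding atom_def
    by (intro dbound_mult dbound_window[OF \<phi>] dbound_reindex[OF dbound_cis])
  from dbound_uniform[OF this] obtain C where C: "0 \<le> C"
    "\<And>is z t. length is \<le> N \<Longrightarrow> norm (iter_deriv is (atom \<phi> z) t) \<le> C * (decay N (t - fst z) * japanese (snd z) ^ N)"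
    by (auto simp: mult_nonneg_nonneg)
  have "norm (iter_deriv is (atom \<phi> z) t) \<le> (C * 2 ^ N) * japanese z ^ (N + N) * decay N t" if "length is \<le> N" for "is" z t
  proof -
    have "decay N (t - fst z) * japanese (snd z) ^ N \<le> (2 ^ N * japanese z ^ N * decay N t) * japanese z ^ N"
    proof (intro mult_mono power_mono japanese_snd_le)
      have "decay N (t - fst z) \<le> 2 ^ N * japanese (fst z) ^ N * decay N t" by (rule decay_translate_le)
      also have "\<dots> \<le> 2 ^ N * japanese z ^ N * decay N t"
        by (intro mult_right_mono mult_left_mono power_mono japanese_fst_le) auto
      finally show "decay N (t - fst z) \<le> 2 ^ N * japanese z ^ N * decay N t" .
    qed auto
    from mult_left_mono[OF this C(1)] C(2)[OF that, of z t] show ?thesis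
      by (simp add: power_add mult_ac)
  qed
  then show ?thesis by blast
qed

text \<open>A change of \<open>z\<close> moves the window and changes the frequency; the two effects are split into the
  terms \<open>?T1\<close> and \<open>?T2\<close>. The second one produces a factor \<open>t\<close>, which is paid for by one more order
  of decay of the window.\<close>

lemma atom_lipschitz:
  fixes \<phi> :: "real^'n::finite \<Rightarrow> complex"
  assumes \<phi>: "\<phi> \<in> schwartz"
  shows "\<exists>C M. \<forall>is z z' t. length is \<le> N \<longrightarrow> norm (iter_deriv is (atom \<phi> z') t - iter_deriv is (atom \<phi> z) t) \<le>
        C * (norm (z' - z) * japanese z ^ M * japanese z' ^ M) * decay N t"
proof -
  let ?T1 = "\<lambda>(z, z') t. (cnj (\<phi> (t - fst z')) - cnj (\<phi> (t - fst z))) * cis (- (t \<bullet> snd z'))"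
  let ?T2 = "\<lambda>(z, z') t. cnj (\<phi> (t - fst z)) * cis (- (t \<bullet> snd z)) * (cis (- (t \<bullet> (snd z' - snd z))) - 1)"
  let ?W = "\<lambda>(z, z') t. norm (z' - z) * japanese z ^ (4 * N + 4) * japanese z' ^ (4 * N + 4) * decay N t"
  have J: "japanese (a - b) \<le> 2 * (japanese z * japanese z')" if "japanese a \<le> japanese z'" "japanese b \<le> japanese z"
    for a b :: "real^'n" and z z' :: "(real^'n) \<times> (real^'n)"
  proof -
    have "japanese (a - b) \<le> 2 * (japanese a * japanese b)" using japanese_submult[of a "-b"] by simp
    also have "\<dots> \<le> 2 * (japanese z' * japanese z)" by (intro mult_left_mono mult_mono that) auto
    finally show ?thesis by (simp add: mult_ac)
  qed
  have pw: "japanese z ^ a \<le> japanese z ^ b" if "a \<le> b" for z :: "(real^'n) \<times> (real^'n)" and a b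
    by (rule power_increasing[OF that japanese_ge_1])
  have "dbound N ?W ?T1"
  proof -
    have "dbound N (\<lambda>p t. norm (fst (snd p) - fst (fst p)) * japanese (fst (snd p) - fst (fst p)) ^ N * decay N (t - fst (fst p)) * japanese (snd (snd p)) ^ N)
      (\<lambda>p t. (cnj (\<phi> (t - fst (snd p))) - cnj (\<phi> (t - fst (fst p)))) * cis (- (t \<bullet> snd (snd p))))"
      using dbound_mult[OF dbound_reindex[OF dbound_translate_diff[OF schwartz_cnj[OF \<phi>], of N N], of "\<lambda>p. (fst (fst p), fst (snd p))"]
          dbound_reindex[OF dbound_cis[of N], of "\<lambda>p. snd (snd p)"]] by simp
    then have "dbound N ?W (\<lambda>p t. (cnj (\<phi> (t - fst (snd p))) - cnj (\<phi> (t - fst (fst p)))) * cis (- (t \<bullet> snd (snd p))))"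
    proof (rule dbound_mono)
      fix p :: "((real^'n) \<times> (real^'n)) \<times> ((real^'n) \<times> (real^'n))" and t :: "real^'n"
      obtain z z' where p: "p = (z, z')" by (rule prod.exhaust)
      have "norm (fst z' - fst z) * japanese (fst z' - fst z) ^ N * decay N (t - fst z) * japanese (snd z') ^ N
        \<le> norm (z' - z) * (2 * (japanese z * japanese z')) ^ N * (2 ^ N * japanese z ^ N * decay N t) * japanese z' ^ N"
      proof (intro mult_mono power_mono japanese_snd_le J japanese_fst_le)
        show "norm (fst z' - fst z) \<le> norm (z' - z)" by (cases z; cases z') (simp add: norm_fst_le)
        have "decay N (t - fst z) \<le> 2 ^ N * japanese (fst z) ^ N * decay N t" by (rule decay_translate_le)
        also have "\<dots> \<le> 2 ^ N * japanese z ^ N * decay N t"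
          by (intro mult_right_mono mult_left_mono power_mono japanese_fst_le) auto
        finally show "decay N (t - fst z) \<le> 2 ^ N * japanese z ^ N * decay N t" .
      qed auto
      also have "\<dots> = 4 ^ N * (norm (z' - z) * japanese z ^ (N + N) * japanese z' ^ (N + N) * decay N t)"
      proof -
        have "(4::real) ^ N = 2 ^ N * 2 ^ N" by (simp flip: power_mult_distrib)
        then show ?thesis by (simp only: power_mult_distrib power_add mult_ac)
      qed
      also have "\<dots> \<le> 4 ^ N * ?W p t"
        unfolding p prod.case
        by (intro mult_left_mono mult_right_mono mult_mono pw) auto
      finally show "norm (fst (snd p) - fst (fst p)) * japanese (fst (snd p) - fst (fst p)) ^ N * decay N (t - fst (fst p)) * japanese (snd (snd p)) ^ N
        \<le> 4 ^ N * ?W p t" by (simp add: p)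
    qed auto
    then show ?thesis by (simp add: split_beta')
  qed
  moreover have "dbound N ?W ?T2"
  proof -
    have "dbound N (\<lambda>p t. decay (Suc N) (t - fst (fst p)) * japanese (snd (fst p)) ^ N * (norm (snd (snd p) - snd (fst p)) * japanese (snd (snd p) - snd (fst p)) ^ N * japanese t))
      (\<lambda>p t. cnj (\<phi> (t - fst (fst p))) * cis (- (t \<bullet> snd (fst p))) * (cis (- (t \<bullet> (snd (snd p) - snd (fst p)))) - 1))"
      by (intro dbound_mult dbound_window[OF \<phi>] dbound_reindex[OF dbound_cis] dbound_reindex[OF dbound_cis_diff])
    then have "dbound N ?W (\<lambda>p t. cnj (\<phi> (t - fst (fst p))) * cis (- (t \<bullet> snd (fst p))) * (cis (- (t \<bullet> (snd (snd p) - snd (fst p)))) - 1))"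
    proof (rule dbound_mono)
      fix p :: "((real^'n) \<times> (real^'n)) \<times> ((real^'n) \<times> (real^'n))" and t :: "real^'n"
      obtain z z' where p: "p = (z, z')" by (rule prod.exhaust)
      have "decay (Suc N) (t - fst z) * japanese (snd z) ^ N * (norm (snd z' - snd z) * japanese (snd z' - snd z) ^ N * japanese t)
        \<le> (2 ^ Suc N * japanese z ^ Suc N * decay (Suc N) t) * japanese z ^ N * (norm (z' - z) * (2 * (japanese z * japanese z')) ^ N * japanese t)"
      proof (intro mult_mono power_mono japanese_snd_le J)
        show "norm (snd z' - snd z) \<le> norm (z' - z)" by (cases z; cases z') (simp add: norm_snd_le)
        have "decay (Suc N) (t - fst z) \<le> 2 ^ Suc N * japanese (fst z) ^ Suc N * decay (Suc N) t" by (rule decay_translate_le)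
        also have "\<dots> \<le> 2 ^ Suc N * japanese z ^ Suc N * decay (Suc N) t"
          by (intro mult_right_mono mult_left_mono power_mono japanese_fst_le) auto
        finally show "decay (Suc N) (t - fst z) \<le> 2 ^ Suc N * japanese z ^ Suc N * decay (Suc N) t" .
      qed auto
      also have "\<dots> = 2 * 4 ^ N * (norm (z' - z) * japanese z ^ (3 * N + 1) * japanese z' ^ N * (decay (Suc N) t * japanese t))"
      proof -
        have "(4::real) ^ N = 2 ^ N * 2 ^ N" by (simp flip: power_mult_distrib)
        moreover have "japanese z ^ (3 * N + 1) = japanese z * japanese z ^ N * japanese z ^ N * japanese z ^ N"
          by (simp add: power_add eval_nat_numeral)
        ultimately show ?thesis by (simp add: power_mult_distrib mult_ac)
      qed
      also have "decay (Suc N) t * japanese t = decay N t" by (simp add: decay_def)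
      also have "2 * 4 ^ N * (norm (z' - z) * japanese z ^ (3 * N + 1) * japanese z' ^ N * decay N t) \<le> 2 * 4 ^ N * ?W p t"
        unfolding p prod.case
        by (intro mult_left_mono mult_right_mono mult_mono pw) auto
      finally show "decay (Suc N) (t - fst (fst p)) * japanese (snd (fst p)) ^ N * (norm (snd (snd p) - snd (fst p)) * japanese (snd (snd p) - snd (fst p)) ^ N * japanese t)
        \<le> 2 * 4 ^ N * ?W p t" by (simp add: p)
    qed auto
    then show ?thesis by (simp add: split_beta')
  qed
  ultimately have "dbound N ?W (\<lambda>p t. ?T1 p t + ?T2 p t)" by (rule dbound_add)
  moreover have "(\<lambda>p t. ?T1 p t + ?T2 p t) = (\<lambda>p t. atom \<phi> (snd p) t - atom \<phi> (fst p) t)"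
    by (auto simp: fun_eq_iff atom_def algebra_simps cis_mult)
  ultimately have d: "dbound N ?W (\<lambda>p t. atom \<phi> (snd p) t - atom \<phi> (fst p) t)" by simp
  obtain C where "0 \<le> C" and C: "\<And>is p t. length is \<le> N \<Longrightarrow> norm (iter_deriv is (\<lambda>t. atom \<phi> (snd p) t - atom \<phi> (fst p) t) t) \<le> C * ?W p t"
    by (rule dbound_uniform[OF d]) auto
  have "norm (iter_deriv is (atom \<phi> z') t - iter_deriv is (atom \<phi> z) t) \<le>
        C * (norm (z' - z) * japanese z ^ (4 * N + 4) * japanese z' ^ (4 * N + 4)) * decay N t" if "length is \<le> N" for "is" z z' t
    using C[OF that, of "(z, z')" t] by (simp add: iter_deriv_diff atom_schwartz[OF \<phi>] mult_ac)
  then show ?thesis by blast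
qed

text \<open>The coefficient of \<open>atom \<phi> z\<close> in the expansion of the test function \<open>\<psi>\<close>. It is the short-time
  Fourier transform of \<open>\<psi>\<close> with respect to the conjugate window, at the reflected frequency.\<close>

definition coatom :: "(real^'n::finite \<Rightarrow> complex) \<Rightarrow> (real^'n \<Rightarrow> complex) \<Rightarrow> (real^'n) \<times> (real^'n) \<Rightarrow> complex" where
  "coatom \<phi> \<psi> z = (\<integral>t. \<phi> (t - fst z) * \<psi> t * cis (t \<bullet> snd z) \<partial>lborel)"

lemma coatom_ft: "coatom \<phi> \<psi> (x, \<xi>) = ft (\<lambda>t. \<phi> (t - x) * \<psi> t) (- \<xi>)"
  by (simp add: coatom_def ft_def)

lemma schwartz_measurable: "\<phi> \<in> schwartz \<Longrightarrow> \<phi> \<in> borel_measurable borel"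
  by (intro borel_measurable_continuous_onI schwartz_continuous)

lemma schwartz_integrable: "\<phi> \<in> schwartz \<Longrightarrow> integrable lborel (\<phi> :: real^'n::finite \<Rightarrow> complex)"
  by (rule schwartz_bound[of \<phi> "2 * CARD('n)"])
     (auto intro: integrable_lborel_bounded[OF _ integrable_decay] schwartz_measurable)

text \<open>If both \<open>t\<close> and \<open>t - x\<close> are small then so is \<open>x\<close>.\<close>

lemma decay_translate_mult_le: "decay k (t - x) * decay k t \<le> 2 ^ k * decay k x"
proof -
  have "decay k (t - x) \<le> 2 ^ k * japanese (- t) ^ k * decay k (t - x + - t)" by (rule decay_shift)
  then have "decay k (t - x) \<le> 2 ^ k * japanese t ^ k * decay k x"
    using decay_minus[of k x] by (simp del: decay_minus)
  then show ?thesis by (simp add: decay_def[of k t] field_simps)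
qed

lemma window_product_integral:
  fixes x :: "real^'n::finite"
  defines "n \<equiv> 2 * CARD('n)"
  shows "integrable lborel (\<lambda>t. decay k (t - x) * decay (k + n) t)"
    and "(\<integral>t. decay k (t - x) * decay (k + n) t \<partial>lborel) \<le> 2 ^ k * (\<integral>t. decay n t \<partial>(lborel :: (real^'n) measure)) * decay k x"
proof -
  have le: "decay k (t - x) * decay (k + n) t \<le> 2 ^ k * decay k x * decay n t" for t
    using mult_right_mono[OF decay_translate_mult_le[of k t x], of "decay n t"] by (simp add: decay_add mult_ac)
  show 1: "integrable lborel (\<lambda>t. decay k (t - x) * decay (k + n) t)"
    by (rule integrable_lborel_bounded[OF _ integrable_decay[of n, where 'n='n], of _ "2 ^ k * decay k x"])
       (use le in \<open>auto simp: n_def\<close>)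
  have "(\<integral>t. decay k (t - x) * decay (k + n) t \<partial>lborel) \<le> (\<integral>t. 2 ^ k * decay k x * decay n t \<partial>(lborel :: (real^'n) measure))"
    by (rule integral_mono[OF 1]) (use le integrable_decay[of n, where 'n='n] in \<open>auto simp: n_def\<close>)
  then show "(\<integral>t. decay k (t - x) * decay (k + n) t \<partial>lborel) \<le> 2 ^ k * (\<integral>t. decay n t \<partial>(lborel :: (real^'n) measure)) * decay k x"
    by (simp add: mult_ac)
qed

text \<open>The short-time Fourier transform of a Schwartz function decreases rapidly in both variables: in
  frequency by smoothness, in time because the two factors are concentrated far apart when \<open>x\<close> is large.\<close>

lemma window_product_decay:
  fixes \<phi> \<psi> :: "real^'n::finite \<Rightarrow> complex"
  assumes \<phi>: "\<phi> \<in> schwartz" and \<psi>: "\<psi> \<in> schwartz"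
  obtains C where "0 \<le> C" "\<And>x \<omega>. norm (ft (\<lambda>t. \<phi> (t - x) * \<psi> t) \<omega>) \<le> C * decay (2 * m) \<omega> * decay k x"
proof -
  let ?n = "2 * CARD('n)"
  have d: "dbound (Suc (2 * m)) (\<lambda>x t. decay k (t - x) * decay (k + ?n) t) (\<lambda>x t. \<phi> (t - x) * \<psi> t)"
    by (intro dbound_mult dbound_window[OF \<phi>] schwartz_dbound[OF \<psi>])
  obtain C where C: "0 \<le> C" "\<And>x \<omega>. norm (ft (\<lambda>t. \<phi> (t - x) * \<psi> t) \<omega>) \<le> C * decay (2 * m) \<omega> * (\<integral>t. decay k (t - x) * decay (k + ?n) t \<partial>lborel)"
    by (rule ft_decay[OF d]) (auto intro: window_product_integral)
  have "norm (ft (\<lambda>t. \<phi> (t - x) * \<psi> t) \<omega>) \<le> (C * 2 ^ k * (\<integral>t. decay ?n t \<partial>(lborel :: (real^'n) measure))) * decay (2 * m) \<omega> * decay k x" for x \<omega>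
    using order_trans[OF C(2)[of x \<omega>] mult_left_mono[OF window_product_integral(2)[where x=x and k=k]]] C(1)
    by (simp add: mult_ac)
  then show ?thesis using that[of "C * 2 ^ k * (\<integral>t. decay ?n t \<partial>(lborel :: (real^'n) measure))"] C(1)
    by (simp add: integral_nonneg_AE)
qed

lemma coatom_decay:
  fixes \<phi> \<psi> :: "real^'n::finite \<Rightarrow> complex"
  assumes \<phi>: "\<phi> \<in> schwartz" and \<psi>: "\<psi> \<in> schwartz"
  obtains C where "0 \<le> C" "\<And>z. norm (coatom \<phi> \<psi> z) \<le> C * (decay k (fst z) * decay k (snd z))"
proof -
  obtain C where C: "0 \<le> C" "\<And>x \<omega>. norm (ft (\<lambda>t. \<phi> (t - x) * \<psi> t) \<omega>) \<le> C * decay (2 * k) \<omega> * decay k x"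
    using window_product_decay[OF \<phi> \<psi>, where m=k and k=k] by blast
  have "norm (coatom \<phi> \<psi> z) \<le> C * (decay k (fst z) * decay k (snd z))" for z
  proof -
    obtain x \<xi> where z: "z = (x, \<xi>)" by force
    have "norm (coatom \<phi> \<psi> z) \<le> C * decay (2 * k) \<xi> * decay k x"
      unfolding z coatom_ft using C(2)[of x "- \<xi>"] by simp
    also have "\<dots> \<le> C * decay k \<xi> * decay k x"
      by (intro mult_right_mono mult_left_mono decay_antimono C) auto
    finally show ?thesis by (simp add: z mult_ac)
  qed
  with C(1) show ?thesis using that by blast
qed

lemma coatom_measurable:
  fixes \<phi> \<psi> :: "real^'n::finite \<Rightarrow> complex"
  assumes [measurable]: "\<phi> \<in> borel_measurable borel" "\<psi> \<in> borel_measurable borel"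
  shows "coatom \<phi> \<psi> \<in> borel_measurable borel"
proof -
  have "(\<lambda>z. \<integral>t. \<phi> (t - fst z) * \<psi> t * cis (t \<bullet> snd z) \<partial>lborel) \<in> borel_measurable (borel \<Otimes>\<^sub>M borel)"
    by measurable
  then show ?thesis by (simp add: coatom_def[abs_def] borel_prod)
qed

lemma coatom_rapid:
  fixes \<phi> \<psi> :: "real^'n::finite \<Rightarrow> complex"
  assumes \<phi>: "\<phi> \<in> schwartz" and \<psi>: "\<psi> \<in> schwartz"
  shows "integrable lborel (\<lambda>z. norm (coatom \<phi> \<psi> z) * japanese z ^ k)"
proof -
  note [measurable] = coatom_measurable[OF schwartz_measurable[OF \<phi>] schwartz_measurable[OF \<psi>]]
  obtain C where C: "0 \<le> C" "\<And>z. norm (coatom \<phi> \<psi> z) \<le> C * (decay (4 * CARD('n) + k) (fst z) * decay (4 * CARD('n) + k) (snd z))"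
    using coatom_decay[OF \<phi> \<psi>, where k="4 * CARD('n) + k"] by blast
  show ?thesis
  proof (rule integrable_lborel_bounded[OF _ integrable_decay_pair[of "4 * CARD('n)", where 'n='n], of _ C])
    fix z :: "(real^'n) \<times> (real^'n)"
    have "norm (coatom \<phi> \<psi> z) \<le> C * decay (4 * CARD('n) + k) z"
      using order_trans[OF C(2)[of z] mult_left_mono[OF decay_mult_le_Pair C(1)]] by simp
    from mult_right_mono[OF this, of "japanese z ^ k"]
    show "norm (norm (coatom \<phi> \<psi> z) * japanese z ^ k) \<le> C * decay (4 * CARD('n)) z"
      by (simp add: decay_add decay_def[of k] field_simps)
  qed auto
qed

text \<open>Fourier inversion in the frequency variable recovers \<open>\<phi> (t - x) * \<psi> t\<close>; multiplying by the
  conjugate of \<open>\<phi> (t - x)\<close> and integrating over \<open>x\<close> leaves \<open>\<psi> t\<close> times the squared norm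
  of the window.\<close>

lemma coatom_inversion:
  fixes \<phi> \<psi> :: "real^'n::finite \<Rightarrow> complex"
  assumes \<phi>: "\<phi> \<in> schwartz" and \<psi>: "\<psi> \<in> schwartz"
  shows "(\<integral>z. coatom \<phi> \<psi> z * atom \<phi> z t \<partial>lborel) = of_real ((2 * pi) ^ CARD('n) * (\<integral>t. (norm (\<phi> t))\<^sup>2 \<partial>lborel)) * \<psi> t"
proof -
  note [measurable] = schwartz_measurable[OF \<phi>] schwartz_measurable[OF \<psi>] coatom_measurable[OF schwartz_measurable[OF \<phi>] schwartz_measurable[OF \<psi>]]
  obtain B where B: "0 \<le> B" "\<And>t. norm (\<phi> t) \<le> B * decay 0 t"
    using schwartz_bound[OF \<phi>, where k=0] by blast
  have I: "integrable lborel (\<lambda>z. coatom \<phi> \<psi> z * atom \<phi> z t)"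
  proof (rule integrable_lborel_bounded[OF _ coatom_rapid[OF \<phi> \<psi>, of 0], of _ B])
    have "(\<lambda>z. coatom \<phi> \<psi> z * (cnj (\<phi> (t - fst z)) * cis (- (t \<bullet> snd z)))) \<in> borel_measurable borel"
    proof (rule borel_measurable_times)
      have "(\<lambda>z. cnj (\<phi> (t - fst z)) * cis (- (t \<bullet> snd z))) \<in> borel_measurable (borel \<Otimes>\<^sub>M borel)"
        by measurable
      then show "(\<lambda>z. cnj (\<phi> (t - fst z)) * cis (- (t \<bullet> snd z))) \<in> borel_measurable borel"
        by (simp add: borel_prod)
    qed simp
    then show "(\<lambda>z. coatom \<phi> \<psi> z * atom \<phi> z t) \<in> borel_measurable borel" by (simp add: atom_def)
    show "norm (coatom \<phi> \<psi> z * atom \<phi> z t) \<le> B * (norm (coatom \<phi> \<psi> z) * japanese z ^ 0)" for z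
      using mult_left_mono[OF B(2)[of "t - fst z"], of "norm (coatom \<phi> \<psi> z)"]
      by (simp add: atom_def norm_mult mult_ac)
  qed
  have inner: "(\<integral>\<xi>. coatom \<phi> \<psi> (x, \<xi>) * atom \<phi> (x, \<xi>) t \<partial>lborel) = cnj (\<phi> (t - x)) * (of_real ((2 * pi) ^ CARD('n)) * (\<phi> (t - x) * \<psi> t))" for x
  proof -
    let ?g = "\<lambda>t. \<phi> (t - x) * \<psi> t"
    have g: "?g \<in> schwartz" by (intro schwartz_mult schwartz_translate \<phi> \<psi>)
    obtain Bg where Bg: "0 \<le> Bg" "\<And>t. norm (?g t) \<le> Bg * decay 0 t" using schwartz_bound[OF g, where k=0] by blast
    have mft: "ft ?g \<in> borel_measurable borel" unfolding ft_def[abs_def] by measurable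
    obtain C where C: "0 \<le> C" "\<And>x \<omega>. norm (ft (\<lambda>t. \<phi> (t - x) * \<psi> t) \<omega>) \<le> C * decay (2 * CARD('n)) \<omega> * decay 0 x"
      using window_product_decay[OF \<phi> \<psi>, where m="CARD('n)" and k=0] by blast
    have ift: "integrable lborel (ft ?g)"
      by (rule integrable_lborel_bounded[OF mft integrable_decay[of "2 * CARD('n)", where 'n='n], of C])
         (use C(2)[of x] in auto)
    have "(\<integral>\<xi>. coatom \<phi> \<psi> (x, \<xi>) * atom \<phi> (x, \<xi>) t \<partial>lborel) = (\<integral>\<xi>. cnj (\<phi> (t - x)) * (\<lambda>\<omega>. ft ?g \<omega> * cis (t \<bullet> \<omega>)) (0 + (-1) *\<^sub>R \<xi>) \<partial>lborel)"
      by (intro Bochner_Integration.integral_cong) (simp_all add: coatom_ft atom_def mult_ac)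
    also have "\<dots> = cnj (\<phi> (t - x)) * (\<integral>\<xi>. (\<lambda>\<omega>. ft ?g \<omega> * cis (t \<bullet> \<omega>)) (0 + (-1) *\<^sub>R \<xi>) \<partial>lborel)"
      by (rule integral_mult_right_zero)
    also have "(\<integral>\<xi>. (\<lambda>\<omega>. ft ?g \<omega> * cis (t \<bullet> \<omega>)) (0 + (-1) *\<^sub>R \<xi>) \<partial>lborel) = (\<integral>\<omega>. ft ?g \<omega> * cis (t \<bullet> \<omega>) \<partial>lborel)"
      using mft by (subst integral_lborel_affine) auto
    also have "\<dots> = of_real ((2 * pi) ^ CARD('n)) * ?g t"
      by (rule fourier_inversion[OF schwartz_continuous[OF g] _ schwartz_integrable[OF g] ift, of Bg]) (use Bg in auto)
    finally show ?thesis .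
  qed
  have "(\<integral>z. coatom \<phi> \<psi> z * atom \<phi> z t \<partial>lborel) = (\<integral>x. of_real ((2 * pi) ^ CARD('n)) * \<psi> t * of_real ((norm (\<phi> (t - x)))\<^sup>2) \<partial>lborel)"
    unfolding integral_lborel_pair[OF I] inner
    by (intro Bochner_Integration.integral_cong refl) (simp only: complex_norm_square mult_ac)
  also have "\<dots> = of_real ((2 * pi) ^ CARD('n)) * \<psi> t * of_real (\<integral>x. (norm (\<phi> (t - x)))\<^sup>2 \<partial>lborel)"
    by (subst integral_mult_right_zero) (simp only: integral_complex_of_real)
  also have "(\<integral>x. (norm (\<phi> (t - x)))\<^sup>2 \<partial>lborel) = (\<integral>x. (norm (\<phi> x))\<^sup>2 \<partial>lborel)"
    using integral_lborel_affine[of "\<lambda>x. (norm (\<phi> x))\<^sup>2" "-1" t] by simp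
  finally show ?thesis by (simp add: mult_ac)
qed

lemma stft_continuous:
  assumes \<phi>: "\<phi> \<in> schwartz" and u: "u \<in> tempered"
  shows "continuous_on UNIV (\<lambda>z. stft \<phi> u (fst z) (snd z))"
  using tempered_integral(1)[OF u schwartz_0 atom_schwartz[OF \<phi>] _ _ atom_bound[OF \<phi>] atom_lipschitz[OF \<phi>], of "\<lambda>_. 0"]
  by (simp add: stft_atom)

text \<open>Apply \<open>u\<close> under the integral in \<open>coatom_inversion\<close>.\<close>

lemma reproducing_formula:
  fixes \<phi> \<psi> :: "real^'n::finite \<Rightarrow> complex"
  assumes \<phi>: "\<phi> \<in> schwartz" and u: "u \<in> tempered" and \<psi>: "\<psi> \<in> schwartz"
  shows "of_real ((2 * pi) ^ CARD('n) * (\<integral>t. (norm (\<phi> t))\<^sup>2 \<partial>lborel)) * u \<psi> = (\<integral>z. coatom \<phi> \<psi> z * stft \<phi> u (fst z) (snd z) \<partial>lborel)"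
proof -
  let ?c = "complex_of_real ((2 * pi) ^ CARD('n) * (\<integral>t. (norm (\<phi> t))\<^sup>2 \<partial>lborel))"
  have "u (\<lambda>t. ?c * \<psi> t) = (\<integral>z. coatom \<phi> \<psi> z * u (atom \<phi> z) \<partial>lborel)"
    by (rule tempered_integral(2)[OF u schwartz_cmult[OF \<psi>] atom_schwartz[OF \<phi>] coatom_measurable coatom_rapid[OF \<phi> \<psi>] atom_bound[OF \<phi>] atom_lipschitz[OF \<phi>]])
       (simp_all add: coatom_inversion[OF \<phi> \<psi>] schwartz_measurable \<phi> \<psi> del: of_real_mult)
  then show ?thesis using tempered_cmult[OF u \<psi>] by (simp add: stft_atom)
qed

section \<open>Lebesgue norms and Minkowski's integral inequality\<close>

lemma ennreal_powr_ennreal [simp]: "0 \<le> r \<Longrightarrow> ennreal_powr (ennreal r) a = ennreal (r powr a)"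
  by (simp add: ennreal_powr_def)

lemma ennreal_powr_top [simp]: "ennreal_powr top a = top"
  by (simp add: ennreal_powr_def)

lemma ennreal_powr_0 [simp]: "ennreal_powr 0 a = 0"
  by (simp add: ennreal_powr_def)

lemma ennreal_powr_mono: "0 \<le> a \<Longrightarrow> x \<le> y \<Longrightarrow> ennreal_powr x a \<le> ennreal_powr y a"
  by (cases x; cases y) (auto simp: powr_mono2 top_unique ennreal_leI)

lemma ennreal_powr_mult: "ennreal_powr (x * y) a = ennreal_powr x a * ennreal_powr y a"
proof (cases x; cases y)
  fix r q assume "0 \<le> r" "x = ennreal r" "0 \<le> q" "y = ennreal q"
  then show ?thesis by (simp add: ennreal_mult[symmetric] powr_mult)
next
  fix r assume "0 \<le> r" "x = ennreal r" "y = top"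
  then show ?thesis by (cases "r = 0") (auto simp: ennreal_mult_top)
next
  fix r assume "0 \<le> r" "y = ennreal r" "x = top"
  then show ?thesis by (cases "r = 0") (auto simp: ennreal_top_mult)
qed auto

lemma ennreal_powr_powr: "ennreal_powr (ennreal_powr x a) b = ennreal_powr x (a * b)"
  by (cases x) (auto simp: powr_powr)

lemma ennreal_powr_1 [simp]: "ennreal_powr x 1 = x"
  by (cases x) auto

lemma ennreal_powr_eq_top_iff [simp]: "ennreal_powr x a = top \<longleftrightarrow> x = top"
  by (cases x) auto

lemma ennreal_powr_less_top_iff [simp]: "ennreal_powr x a < top \<longleftrightarrow> x < top"
  by (cases x) auto

lemma ennreal_powr_eq_0_iff [simp]: "ennreal_powr x a = 0 \<longleftrightarrow> x = 0"
  by (cases x) auto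

lemma ennreal_powr_measurable [measurable]:
  assumes [measurable]: "f \<in> borel_measurable M"
  shows "(\<lambda>x. ennreal_powr (f x) a) \<in> borel_measurable M"
proof -
  have "{x \<in> space M. f x = \<infinity>} = f -` {\<infinity>} \<inter> space M" by auto
  then have 1: "{x \<in> space M. f x = \<infinity>} \<in> sets M" by simp
  show ?thesis unfolding ennreal_powr_def by (rule measurable_If) (use 1 in simp_all)
qed

text \<open>The convex function \<open>y powr p\<close> lies above its tangent at \<open>a\<close>.\<close>

lemma young_tangent:
  assumes "1 \<le> p" "0 \<le> a" "0 \<le> (y::real)"
  shows "p * a powr (p - 1) * y \<le> y powr p + (p - 1) * a powr p"
proof (cases "p = 1 \<or> a = 0")
  case True then show ?thesis using assms by auto
next
  case False
  then have p: "1 < p" and a: "0 < a" using assms by auto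
  define q where "q = p / (p - 1)"
  have q: "1 < q" "1 / p + 1 / q = 1" using p by (auto simp: q_def field_simps)
  have "(a powr (p - 1)) powr q = a powr p" using p by (simp add: powr_powr q_def)
  then have "y * a powr (p - 1) \<le> y powr p / p + a powr p / q"
    using Youngs_inequality[of p q y "a powr (p - 1)"] p q assms by simp
  from mult_left_mono[OF this, of p] have "p * (y * a powr (p - 1)) \<le> y powr p + p / q * a powr p"
    using p by (simp add: distrib_left)
  moreover have "p / q = p - 1" using p by (simp add: q_def)
  ultimately show ?thesis by (simp add: mult_ac)
qed

text \<open>A crude substitute for Hoelder's inequality: after normalising the \<open>L\<^sup>p\<close> norm it bounds an
  integral against a bounded integrable weight.\<close>

lemma le_1_plus_powr: "1 \<le> p \<Longrightarrow> y \<le> 1 + ennreal_powr y p"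
proof (cases y)
  case (real r)
  assume p: "1 \<le> p"
  have "r \<le> 1 + r powr p"
  proof (cases "r \<le> 1")
    case False
    then have "r powr 1 \<le> r powr p" using p by (intro powr_mono) auto
    then show ?thesis using False by simp
  qed (use powr_ge_zero[of r p] in linarith)
  then have "ennreal r \<le> ennreal (1 + r powr p)" by (rule ennreal_leI)
  also have "\<dots> = 1 + ennreal (r powr p)" by (subst ennreal_plus) auto
  finally show ?thesis using real by simp
qed simp

text \<open>Integrate the tangent inequality at the mean. If the mean is infinite, so is the right side.\<close>

lemma (in prob_space) jensen_powr:
  assumes p: "1 \<le> p" and [measurable]: "y \<in> borel_measurable M"
  shows "ennreal_powr (\<integral>\<^sup>+x. y x \<partial>M) p \<le> (\<integral>\<^sup>+x. ennreal_powr (y x) p \<partial>M)"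
proof (cases "\<integral>\<^sup>+x. y x \<partial>M")
  case top
  have "(\<integral>\<^sup>+x. y x \<partial>M) \<le> (\<integral>\<^sup>+x. 1 + ennreal_powr (y x) p \<partial>M)"
    by (intro nn_integral_mono le_1_plus_powr p)
  also have "\<dots> = 1 + (\<integral>\<^sup>+x. ennreal_powr (y x) p \<partial>M)"
    by (subst nn_integral_add) (auto simp: emeasure_space_1)
  finally have "(\<integral>\<^sup>+x. ennreal_powr (y x) p \<partial>M) = top"
    using top by (simp add: top_unique ennreal_add_eq_top)
  then show ?thesis by simp
next
  case (real a)
  have le: "ennreal (p * a powr (p - 1)) * y x \<le> ennreal_powr (y x) p + ennreal ((p - 1) * a powr p)" for x
  proof (cases "y x")
    case r: (real r)
    have "ennreal (p * a powr (p - 1) * r) \<le> ennreal (r powr p + (p - 1) * a powr p)"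
      using real r p by (intro ennreal_leI young_tangent) auto
    then show ?thesis using r p by (simp add: ennreal_mult[symmetric] ennreal_plus[symmetric] del: ennreal_plus)
  qed simp
  have "ennreal (p * a powr (p - 1)) * (\<integral>\<^sup>+x. y x \<partial>M) = (\<integral>\<^sup>+x. ennreal (p * a powr (p - 1)) * y x \<partial>M)"
    by (simp add: nn_integral_cmult)
  also have "\<dots> \<le> (\<integral>\<^sup>+x. ennreal_powr (y x) p + ennreal ((p - 1) * a powr p) \<partial>M)"
    by (intro nn_integral_mono le)
  also have "\<dots> = (\<integral>\<^sup>+x. ennreal_powr (y x) p \<partial>M) + ennreal ((p - 1) * a powr p)"
    by (subst nn_integral_add) (auto simp: emeasure_space_1)
  finally have *: "ennreal (p * a powr (p - 1) * a) \<le> (\<integral>\<^sup>+x. ennreal_powr (y x) p \<partial>M) + ennreal ((p - 1) * a powr p)"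
    using real p by (simp add: ennreal_mult)
  have "p * a powr (p - 1) * a = a powr p + (p - 1) * a powr p"
    using real p by (cases "a = 0") (auto simp: powr_diff field_simps)
  then have "ennreal (p * a powr (p - 1) * a) = ennreal (a powr p) + ennreal ((p - 1) * a powr p)"
    using p by simp
  with * have "ennreal (a powr p) \<le> (\<integral>\<^sup>+x. ennreal_powr (y x) p \<partial>M)"
    using ennreal_add_left_cancel_le[of "ennreal ((p - 1) * a powr p)"] by (simp add: add.commute)
  then show ?thesis using real by simp
qed

text \<open>Norms are taken of functions with values in \<open>ennreal\<close>, so that inequalities between them need no
  integrability hypotheses.\<close>

definition Lp :: "real \<Rightarrow> ('a::euclidean_space \<Rightarrow> ennreal) \<Rightarrow> ennreal" where
  "Lp p g = ennreal_powr (\<integral>\<^sup>+x. ennreal_powr (g x) p \<partial>lborel) (1 / p)"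

lemma Lp_powr: "1 \<le> p \<Longrightarrow> ennreal_powr (Lp p g) p = (\<integral>\<^sup>+x. ennreal_powr (g x) p \<partial>lborel)"
  by (simp add: Lp_def ennreal_powr_powr)

lemma Lp_leI:
  assumes "1 \<le> p" "(\<integral>\<^sup>+x. ennreal_powr (g x) p \<partial>lborel) \<le> ennreal_powr T p"
  shows "Lp p g \<le> T"
  using ennreal_powr_mono[OF _ assms(2), of "1 / p"] assms(1) by (simp add: Lp_def ennreal_powr_powr)

lemma Lp_mono: "1 \<le> p \<Longrightarrow> (\<And>x. f x \<le> g x) \<Longrightarrow> Lp p f \<le> Lp p g"
  unfolding Lp_def by (intro ennreal_powr_mono nn_integral_mono) auto

lemma Lp_cmult:
  assumes "1 \<le> p" and [measurable]: "g \<in> borel_measurable borel"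
  shows "Lp p (\<lambda>x. c * g x) = c * Lp p g"
  using assms(1) by (simp add: Lp_def ennreal_powr_mult nn_integral_cmult ennreal_powr_powr)

lemma Lp_0: "Lp p (\<lambda>x. 0) = 0"
  by (simp add: Lp_def)

lemma Lp_translate:
  "g \<in> borel_measurable borel \<Longrightarrow> Lp p (\<lambda>x. g (x - a)) = Lp p g"
  unfolding Lp_def by (subst nn_integral_lborel_translate[of "\<lambda>x. ennreal_powr (g x) p"]) auto

lemma Lp_measurable [measurable]:
  assumes "(\<lambda>(\<eta>, x). G x \<eta>) \<in> borel_measurable (M \<Otimes>\<^sub>M lborel)"
  shows "(\<lambda>\<eta>. Lp p (\<lambda>x. G x \<eta>)) \<in> borel_measurable M"
proof -
  have "(\<lambda>\<eta>. \<integral>\<^sup>+x. ennreal_powr (G x \<eta>) p \<partial>lborel) \<in> borel_measurable M"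
    using assms by measurable
  then show ?thesis unfolding Lp_def by measurable
qed

text \<open>Let \<open>N \<eta>\<close> be the norm of \<open>G\<close> in the slice at \<open>\<eta>\<close> and \<open>T\<close> its integral. Then \<open>N / T\<close> is a
  probability density, and Jensen's inequality for it, applied to \<open>G x \<eta> / N \<eta>\<close>, followed by an
  integration over \<open>x\<close> gives the claim with constant \<open>1\<close>. Adding a small strictly positive
  integrable function to \<open>N\<close> avoids division by \<open>0\<close>.\<close>

lemma minkowski_integral:
  fixes G :: "'a::euclidean_space \<Rightarrow> 'b::euclidean_space \<Rightarrow> ennreal"
  assumes p: "1 \<le> p" and G: "case_prod G \<in> borel_measurable (lborel \<Otimes>\<^sub>M lborel)"
  shows "Lp p (\<lambda>x. \<integral>\<^sup>+\<eta>. G x \<eta> \<partial>lborel) \<le> (\<integral>\<^sup>+\<eta>. Lp p (\<lambda>x. G x \<eta>) \<partial>lborel)"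
proof -
  note [measurable] = G
  have G2 [measurable]: "(\<lambda>(\<eta>, x). G x \<eta>) \<in> borel_measurable (lborel \<Otimes>\<^sub>M lborel)"
    using measurable_compose[OF measurable_pair_swap' G] by (simp add: split_beta' case_prod_unfold)
  define N where "N \<eta> = Lp p (\<lambda>x. G x \<eta>)" for \<eta>
  have [measurable]: "N \<in> borel_measurable borel"
    using Lp_measurable[OF G2, of p] unfolding N_def[abs_def] by simp
  let ?T = "\<integral>\<^sup>+\<eta>. N \<eta> \<partial>lborel"
  obtain h :: "'b \<Rightarrow> ennreal" where [measurable]: "h \<in> borel_measurable borel" and h: "integral\<^sup>N lborel h \<noteq> \<infinity>" "\<And>x. 0 < h x"
    using sigma_finite_measure.Ex_finite_integrable_function[OF sigma_finite_lborel[where 'a='b]] by auto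
  have "Lp p (\<lambda>x. \<integral>\<^sup>+\<eta>. G x \<eta> \<partial>lborel) \<le> ?T"
  proof (cases "?T = \<infinity>")
    case False
    have main: "Lp p (\<lambda>x. \<integral>\<^sup>+\<eta>. G x \<eta> \<partial>lborel) \<le> ?T + \<epsilon> * integral\<^sup>N lborel h" if \<epsilon>: "0 < \<epsilon>" "\<epsilon> < \<infinity>" for \<epsilon>
    proof -
      define N' where "N' \<eta> = N \<eta> + \<epsilon> * h \<eta>" for \<eta>
      have [measurable]: "N' \<in> borel_measurable borel" unfolding N'_def by measurable
      define T' where "T' = (\<integral>\<^sup>+\<eta>. N' \<eta> \<partial>lborel)"
      have T': "T' = ?T + \<epsilon> * integral\<^sup>N lborel h"
        by (simp add: T'_def N'_def nn_integral_add nn_integral_cmult)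
      have Tfin: "T' < \<infinity>" using False h \<epsilon> by (simp add: T' ennreal_mult_less_top less_top)
      have N'0: "0 < N' \<eta>" for \<eta> using \<epsilon> h(2)[of \<eta>] by (simp add: N'_def ennreal_zero_less_mult_iff add_nonneg_pos)
      have T0: "T' \<noteq> 0"
      proof
        assume "T' = 0"
        then have "AE \<eta> in lborel. N' \<eta> = 0" unfolding T'_def by (subst (asm) nn_integral_0_iff_AE) auto
        then have "AE \<eta> in (lborel :: 'b measure). False" using N'0 by (simp add: less_le)
        then show False by (simp add: AE_iff_null null_sets_def)
      qed
      have N'fin: "AE \<eta> in lborel. N' \<eta> \<noteq> \<infinity>"
        using Tfin unfolding T'_def by (intro nn_integral_noteq_infinite) auto
      define \<mu> where "\<mu> = density lborel (\<lambda>\<eta>. N' \<eta> / T')"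
      interpret prob_space \<mu>
      proof
        have "emeasure \<mu> (space \<mu>) = (\<integral>\<^sup>+\<eta>. N' \<eta> / T' \<partial>lborel)"
          by (simp add: \<mu>_def emeasure_density)
        also have "\<dots> = T' / T'" by (simp add: nn_integral_divide T'_def)
        finally show "emeasure \<mu> (space \<mu>) = 1" using T0 Tfin by (simp add: top.not_eq_extremum)
      qed
      have pt: "ennreal_powr (\<integral>\<^sup>+\<eta>. G x \<eta> \<partial>lborel) p \<le>
         ennreal_powr T' p * (\<integral>\<^sup>+\<eta>. (N' \<eta> / T') * (ennreal_powr (inverse (N' \<eta>)) p * ennreal_powr (G x \<eta>) p) \<partial>lborel)" for x
      proof -
        have [measurable]: "G x \<in> borel_measurable borel" using measurable_Pair2[OF G, of x] by simp
        have "(\<integral>\<^sup>+\<eta>. G x \<eta> \<partial>lborel) = (\<integral>\<^sup>+\<eta>. T' * ((N' \<eta> / T') * (inverse (N' \<eta>) * G x \<eta>)) \<partial>lborel)"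
          using N'fin
        proof (intro nn_integral_cong_AE, elim eventually_mono)
          fix \<eta> assume n: "N' \<eta> \<noteq> \<infinity>"
          have 1: "T' * (N' \<eta> / T') = N' \<eta>"
            using T0 Tfin by (metis ennreal_times_divide ennreal_mult_divide_eq mult.commute infinity_ennreal_def less_top)
          have 2: "N' \<eta> * inverse (N' \<eta>) = 1"
            using N'0[of \<eta>] n by (simp add: ennreal_divide_self divide_ennreal_def[symmetric] less_top)
          have "T' * ((N' \<eta> / T') * (inverse (N' \<eta>) * G x \<eta>)) = (T' * (N' \<eta> / T')) * inverse (N' \<eta>) * G x \<eta>"
            by (simp only: mult.assoc)
          then show "G x \<eta> = T' * ((N' \<eta> / T') * (inverse (N' \<eta>) * G x \<eta>))" by (simp add: 1 2)
        qed
        also have "\<dots> = T' * (\<integral>\<^sup>+\<eta>. inverse (N' \<eta>) * G x \<eta> \<partial>\<mu>)"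
          unfolding \<mu>_def by (subst nn_integral_density) (auto simp: nn_integral_cmult)
        finally have "ennreal_powr (\<integral>\<^sup>+\<eta>. G x \<eta> \<partial>lborel) p = ennreal_powr T' p * ennreal_powr (\<integral>\<^sup>+\<eta>. inverse (N' \<eta>) * G x \<eta> \<partial>\<mu>) p"
          by (simp add: ennreal_powr_mult)
        also have "\<dots> \<le> ennreal_powr T' p * (\<integral>\<^sup>+\<eta>. ennreal_powr (inverse (N' \<eta>) * G x \<eta>) p \<partial>\<mu>)"
          by (intro mult_left_mono jensen_powr p) (auto simp: \<mu>_def)
        also have "(\<integral>\<^sup>+\<eta>. ennreal_powr (inverse (N' \<eta>) * G x \<eta>) p \<partial>\<mu>) = (\<integral>\<^sup>+\<eta>. (N' \<eta> / T') * (ennreal_powr (inverse (N' \<eta>)) p * ennreal_powr (G x \<eta>) p) \<partial>lborel)"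
          unfolding \<mu>_def by (subst nn_integral_density) (auto simp: ennreal_powr_mult)
        finally show ?thesis .
      qed
      let ?w = "\<lambda>\<eta>. (N' \<eta> / T') * ennreal_powr (inverse (N' \<eta>)) p"
      have "(\<integral>\<^sup>+x. ennreal_powr (\<integral>\<^sup>+\<eta>. G x \<eta> \<partial>lborel) p \<partial>lborel) \<le>
        (\<integral>\<^sup>+x. ennreal_powr T' p * (\<integral>\<^sup>+\<eta>. ?w \<eta> * ennreal_powr (G x \<eta>) p \<partial>lborel) \<partial>lborel)"
        using pt by (intro nn_integral_mono) (simp add: mult.assoc)
      also have "\<dots> = ennreal_powr T' p * (\<integral>\<^sup>+x. (\<integral>\<^sup>+\<eta>. ?w \<eta> * ennreal_powr (G x \<eta>) p \<partial>lborel) \<partial>lborel)"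
        by (rule nn_integral_cmult) measurable
      also have "(\<integral>\<^sup>+x. (\<integral>\<^sup>+\<eta>. ?w \<eta> * ennreal_powr (G x \<eta>) p \<partial>lborel) \<partial>lborel) = (\<integral>\<^sup>+\<eta>. (\<integral>\<^sup>+x. ?w \<eta> * ennreal_powr (G x \<eta>) p \<partial>lborel) \<partial>lborel)"
        by (rule lborel_pair.Fubini'[symmetric]) measurable
      also have "\<dots> = (\<integral>\<^sup>+\<eta>. ?w \<eta> * ennreal_powr (N \<eta>) p \<partial>lborel)"
      proof (rule nn_integral_cong)
        fix \<eta>
        have [measurable]: "(\<lambda>x. G x \<eta>) \<in> borel_measurable borel" using measurable_Pair1[OF G, of \<eta>] by simp
        show "(\<integral>\<^sup>+x. ?w \<eta> * ennreal_powr (G x \<eta>) p \<partial>lborel) = ?w \<eta> * ennreal_powr (N \<eta>) p"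
          by (simp add: nn_integral_cmult N_def Lp_powr[OF p])
      qed
      also have "\<dots> \<le> (\<integral>\<^sup>+\<eta>. N' \<eta> / T' \<partial>lborel)"
        using N'fin
      proof (intro nn_integral_mono_AE, elim eventually_mono)
        fix \<eta> assume n: "N' \<eta> \<noteq> \<infinity>"
        have "ennreal_powr (inverse (N' \<eta>)) p * ennreal_powr (N \<eta>) p \<le> ennreal_powr (inverse (N' \<eta>)) p * ennreal_powr (N' \<eta>) p"
          using p by (intro mult_left_mono ennreal_powr_mono) (auto simp: N'_def)
        also have "\<dots> = ennreal_powr (inverse (N' \<eta>) * N' \<eta>) p" by (simp add: ennreal_powr_mult)
        also have "inverse (N' \<eta>) * N' \<eta> = 1"
          using N'0[of \<eta>] n by (simp add: mult.commute[of "inverse _"] ennreal_divide_self divide_ennreal_def[symmetric] less_top)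
        also have "ennreal_powr 1 p = 1" using ennreal_powr_ennreal[of 1 p] by simp
        finally have "(N' \<eta> / T') * (ennreal_powr (inverse (N' \<eta>)) p * ennreal_powr (N \<eta>) p) \<le> (N' \<eta> / T') * 1"
          by (intro mult_left_mono) auto
        then show "?w \<eta> * ennreal_powr (N \<eta>) p \<le> N' \<eta> / T'" by (simp add: mult.assoc)
      qed
      also have "\<dots> = T' / T'" by (simp add: nn_integral_divide T'_def)
      also have "\<dots> = 1" using T0 Tfin by (simp add: top.not_eq_extremum)
      finally have "(\<integral>\<^sup>+x. ennreal_powr (\<integral>\<^sup>+\<eta>. G x \<eta> \<partial>lborel) p \<partial>lborel) \<le> ennreal_powr T' p"
        by (simp add: mult_left_mono)
      then show ?thesis unfolding T'[symmetric] by (intro Lp_leI p)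
    qed
    show ?thesis
    proof (rule ennreal_le_epsilon)
      fix e :: real assume e: "0 < e"
      define H where "H = integral\<^sup>N lborel h"
      obtain H' where H': "H = ennreal H'" "0 \<le> H'" using h(1) by (cases H) (auto simp: H_def)
      have "ennreal (e / (H' + 1)) * H = ennreal (e / (H' + 1) * H')"
        using H' e by (simp add: ennreal_mult[symmetric])
      also have "\<dots> \<le> ennreal e"
        using H' e by (intro ennreal_leI) (simp add: field_simps)
      finally have "ennreal (e / (H' + 1)) * H \<le> ennreal e" .
      then show "Lp p (\<lambda>x. \<integral>\<^sup>+\<eta>. G x \<eta> \<partial>lborel) \<le> ?T + ennreal e"
        using main[of "ennreal (e / (H' + 1))"] e H' unfolding H_def[symmetric]
        by (auto intro: order_trans add_left_mono)
    qed
  qed simp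
  then show ?thesis by (simp add: N_def)
qed

text \<open>The triangle inequality is the case of an integrand that is constant on two intervals of length
  \<open>1\<close>.\<close>

lemma Lp_add_le:
  fixes f g :: "'a::euclidean_space \<Rightarrow> ennreal"
  assumes p: "1 \<le> p" and [measurable]: "f \<in> borel_measurable borel" "g \<in> borel_measurable borel"
  shows "Lp p (\<lambda>x. f x + g x) \<le> Lp p f + Lp p g"
proof -
  let ?G = "\<lambda>x (\<eta>::real). indicator {0..1} \<eta> * f x + indicator {1<..2} \<eta> * g x"
  have [simp]: "emeasure lborel {1<..2::real} = 1" by simp
  have "Lp p (\<lambda>x. \<integral>\<^sup>+\<eta>. ?G x \<eta> \<partial>lborel) \<le> (\<integral>\<^sup>+\<eta>. Lp p (\<lambda>x. ?G x \<eta>) \<partial>lborel)"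
    by (rule minkowski_integral[OF p]) measurable
  moreover have "(\<integral>\<^sup>+\<eta>. ?G x \<eta> \<partial>lborel) = f x + g x" for x
    by (simp add: nn_integral_add nn_integral_multc)
  moreover have "Lp p (\<lambda>x. ?G x \<eta>) = indicator {0..1} \<eta> * Lp p f + indicator {1<..2} \<eta> * Lp p g" for \<eta>
    by (auto split: split_indicator simp: Lp_0)
  then have "(\<integral>\<^sup>+\<eta>. Lp p (\<lambda>x. ?G x \<eta>) \<partial>lborel) = Lp p f + Lp p g"
    by (simp add: nn_integral_add nn_integral_multc)
  ultimately show ?thesis by simp
qed

lemma ennreal_powr_tendsto_0:
  assumes "(f \<longlongrightarrow> 0) F" "0 < a" shows "((\<lambda>x. ennreal_powr (f x) a) \<longlongrightarrow> 0) F"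
proof (rule order_tendstoI)
  fix e :: ennreal assume "0 < e"
  then obtain d where d: "0 < d" "ennreal d \<le> e"
    by (cases e) (auto intro: that[of 1] that)
  have "\<forall>\<^sub>F x in F. f x < ennreal (d powr (1 / a))"
    using assms(1) d by (intro order_tendstoD) auto
  then show "\<forall>\<^sub>F x in F. ennreal_powr (f x) a < e"
  proof eventually_elim
    case (elim x)
    then obtain r where r: "f x = ennreal r" "0 \<le> r" "r < d powr (1 / a)"
      by (cases "f x") (auto simp: ennreal_less_iff)
    have "r powr a < (d powr (1 / a)) powr a" using r assms(2) by (intro powr_less_mono2) auto
    then have "r powr a < d" using d assms(2) by (simp add: powr_powr)
    then have "ennreal (r powr a) < ennreal d" by (simp add: ennreal_less_iff)
    then show ?case using r d(2) by simp
  qed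
qed simp

text \<open>Young's inequality for the convolution with an integrable kernel.\<close>

lemma Lp_convolution:
  fixes k B :: "'a::euclidean_space \<Rightarrow> ennreal"
  assumes p: "1 \<le> p" and [measurable]: "k \<in> borel_measurable borel" "B \<in> borel_measurable borel"
  shows "Lp p (\<lambda>x. \<integral>\<^sup>+t. k (x - t) * B t \<partial>lborel) \<le> (\<integral>\<^sup>+t. k t \<partial>lborel) * Lp p B"
proof -
  have "(\<integral>\<^sup>+t. k (x - t) * B t \<partial>lborel) = (\<integral>\<^sup>+t. k t * B (x - t) \<partial>lborel)" for x
    using nn_integral_lborel_reflect[of "\<lambda>t. k t * B (x - t)" x] by simp
  then have "Lp p (\<lambda>x. \<integral>\<^sup>+t. k (x - t) * B t \<partial>lborel) = Lp p (\<lambda>x. \<integral>\<^sup>+t. k t * B (x - t) \<partial>lborel)"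
    by simp
  also have "\<dots> \<le> (\<integral>\<^sup>+t. Lp p (\<lambda>x. k t * B (x - t)) \<partial>lborel)"
    by (rule minkowski_integral[OF p]) measurable
  also have "\<dots> = (\<integral>\<^sup>+t. k t * Lp p B \<partial>lborel)"
    using p by (simp add: Lp_cmult Lp_translate)
  also have "\<dots> = (\<integral>\<^sup>+t. k t \<partial>lborel) * Lp p B"
    by (rule nn_integral_multc) simp
  finally show ?thesis .
qed

text \<open>A bounded integrable kernel lies in the dual space of \<open>L\<^sup>p\<close> for every \<open>p\<close>. The constant is what
  \<open>le_1_plus_powr\<close> gives without the conjugate exponent.\<close>

lemma pointwise_le_Lp:
  fixes k V :: "'a::euclidean_space \<Rightarrow> ennreal"
  assumes p: "1 \<le> p" and [measurable]: "k \<in> borel_measurable borel" "V \<in> borel_measurable borel"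
    and k1: "\<And>x. k x \<le> 1"
  shows "(\<integral>\<^sup>+y. k y * V y \<partial>lborel) \<le> ((\<integral>\<^sup>+t. k t \<partial>lborel) + 1) * Lp p V"
proof (cases "Lp p V = 0 \<or> Lp p V = top")
  case True
  then show ?thesis
  proof
    assume "Lp p V = 0"
    then have "(\<integral>\<^sup>+x. ennreal_powr (V x) p \<partial>lborel) = 0" by (simp add: Lp_def)
    then have "AE x in lborel. V x = 0" by (subst (asm) nn_integral_0_iff_AE) auto
    then have "(\<integral>\<^sup>+y. k y * V y \<partial>lborel) = (\<integral>\<^sup>+y. 0 \<partial>(lborel :: 'a measure))"
      by (intro nn_integral_cong_AE) auto
    then show ?thesis by simp
  next
    assume "Lp p V = top"
    then show ?thesis by simp
  qed
next
  case False
  define N where "N = Lp p V"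
  have N: "N \<noteq> 0" "N < top" using False by (auto simp: N_def less_top)
  have NN: "N * inverse N = 1" using N by (simp add: ennreal_divide_self divide_ennreal_def[symmetric])
  have "k y * V y \<le> N * (k y + ennreal_powr (inverse N) p * ennreal_powr (V y) p)" for y
  proof -
    have "V y = N * (inverse N * V y)" by (simp add: mult.assoc[symmetric] NN)
    also have "\<dots> \<le> N * (1 + ennreal_powr (inverse N * V y) p)"
      by (intro mult_left_mono le_1_plus_powr p) auto
    finally have "k y * V y \<le> k y * (N * (1 + ennreal_powr (inverse N * V y) p))" by (intro mult_left_mono) auto
    also have "\<dots> = N * (k y + k y * ennreal_powr (inverse N * V y) p)" by (simp add: distrib_left mult_ac)
    also have "\<dots> \<le> N * (k y + 1 * ennreal_powr (inverse N * V y) p)"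
      by (intro mult_left_mono add_left_mono mult_right_mono k1) auto
    finally show ?thesis by (simp add: ennreal_powr_mult)
  qed
  then have "(\<integral>\<^sup>+y. k y * V y \<partial>lborel) \<le> (\<integral>\<^sup>+y. N * (k y + ennreal_powr (inverse N) p * ennreal_powr (V y) p) \<partial>lborel)"
    by (intro nn_integral_mono)
  also have "\<dots> = N * ((\<integral>\<^sup>+t. k t \<partial>lborel) + ennreal_powr (inverse N) p * ennreal_powr N p)"
    by (simp add: nn_integral_cmult nn_integral_add N_def Lp_powr[OF p])
  also have "ennreal_powr (inverse N) p * ennreal_powr N p = 1"
    using ennreal_powr_ennreal[of 1 p] by (simp add: ennreal_powr_mult[symmetric] NN mult.commute)
  finally show ?thesis by (simp add: N_def mult.commute)
qed

lemma Lp_le_integral: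
  fixes k :: "'a::euclidean_space \<Rightarrow> ennreal"
  assumes p: "1 \<le> p" and k1: "\<And>x. k x \<le> 1"
  shows "Lp p k \<le> ennreal_powr (\<integral>\<^sup>+t. k t \<partial>lborel) (1 / p)"
proof -
  have "ennreal_powr (k x) p \<le> k x" for x
  proof -
    obtain r where r: "k x = ennreal r" "0 \<le> r" "r \<le> 1"
      using k1[of x] by (cases "k x") (auto simp: top_unique)
    have "r powr p \<le> r powr 1" using r p by (intro powr_mono') auto
    then show ?thesis using r by (simp add: ennreal_leI)
  qed
  then show ?thesis unfolding Lp_def using p by (intro ennreal_powr_mono nn_integral_mono) auto
qed

definition wt :: "real \<Rightarrow> real^'n::finite \<Rightarrow> ennreal" where
  "wt s \<xi> = ennreal (japanese \<xi> powr s)"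

lemma wt_measurable [measurable]: "f \<in> borel_measurable M \<Longrightarrow> (\<lambda>x. wt s (f x)) \<in> borel_measurable M"
  unfolding wt_def by measurable

lemma wt_ge_1: "0 \<le> s \<Longrightarrow> 1 \<le> wt s \<xi>"
  unfolding wt_def using japanese_ge_1[of \<xi>] by (simp add: ge_one_powr_ge_zero)

lemma wt_0 [simp]: "wt 0 \<xi> = 1"
  by (simp add: wt_def)

lemma wt_add:
  assumes "0 \<le> s" shows "wt s (\<xi> + \<eta>) \<le> ennreal (2 powr s) * (wt s \<xi> * wt s \<eta>)"
proof -
  have "japanese (\<xi> + \<eta>) powr s \<le> (2 * (japanese \<xi> * japanese \<eta>)) powr s"
    using assms by (intro powr_mono2 japanese_submult) auto
  also have "\<dots> = 2 powr s * (japanese \<xi> powr s * japanese \<eta> powr s)" by (simp add: powr_mult)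
  finally show ?thesis
    unfolding wt_def by (subst ennreal_mult[symmetric]; simp)+
qed

text \<open>Convolution is bounded on \<open>L\<^sup>1\<close> with a submultiplicative weight.\<close>

lemma weighted_convolution:
  fixes b R :: "real^'n::finite \<Rightarrow> ennreal"
  assumes s: "0 \<le> s" and [measurable]: "b \<in> borel_measurable borel" "R \<in> borel_measurable borel"
  shows "(\<integral>\<^sup>+\<omega>. wt s \<omega> * (\<integral>\<^sup>+\<eta>. b \<eta> * R (\<omega> - \<eta>) \<partial>lborel) \<partial>lborel) \<le>
     ennreal (2 powr s) * ((\<integral>\<^sup>+\<eta>. wt s \<eta> * b \<eta> \<partial>lborel) * (\<integral>\<^sup>+\<zeta>. wt s \<zeta> * R \<zeta> \<partial>lborel))"
proof -
  have "(\<integral>\<^sup>+\<omega>. wt s \<omega> * (\<integral>\<^sup>+\<eta>. b \<eta> * R (\<omega> - \<eta>) \<partial>lborel) \<partial>lborel) = (\<integral>\<^sup>+\<omega>. \<integral>\<^sup>+\<eta>. wt s \<omega> * (b \<eta> * R (\<omega> - \<eta>)) \<partial>lborel \<partial>lborel)"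
    by (simp add: nn_integral_cmult)
  also have "\<dots> = (\<integral>\<^sup>+\<eta>. \<integral>\<^sup>+\<omega>. wt s \<omega> * (b \<eta> * R (\<omega> - \<eta>)) \<partial>lborel \<partial>lborel)"
    by (rule lborel_pair.Fubini') measurable
  also have "\<dots> \<le> (\<integral>\<^sup>+\<eta>. \<integral>\<^sup>+\<omega>. ennreal (2 powr s) * (wt s \<eta> * b \<eta>) * (wt s (\<omega> - \<eta>) * R (\<omega> - \<eta>)) \<partial>lborel \<partial>lborel)"
  proof (intro nn_integral_mono)
    fix \<eta> \<omega> :: "real^'n"
    have "wt s \<omega> \<le> ennreal (2 powr s) * (wt s \<eta> * wt s (\<omega> - \<eta>))" using wt_add[OF s, of \<eta> "\<omega> - \<eta>"] by simp
    then have "wt s \<omega> * (b \<eta> * R (\<omega> - \<eta>)) \<le> ennreal (2 powr s) * (wt s \<eta> * wt s (\<omega> - \<eta>)) * (b \<eta> * R (\<omega> - \<eta>))"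
      by (intro mult_right_mono) auto
    then show "wt s \<omega> * (b \<eta> * R (\<omega> - \<eta>)) \<le> ennreal (2 powr s) * (wt s \<eta> * b \<eta>) * (wt s (\<omega> - \<eta>) * R (\<omega> - \<eta>))"
      by (simp add: mult_ac)
  qed
  also have "\<dots> = (\<integral>\<^sup>+\<eta>. ennreal (2 powr s) * (wt s \<eta> * b \<eta>) * (\<integral>\<^sup>+\<zeta>. wt s \<zeta> * R \<zeta> \<partial>lborel) \<partial>lborel)"
    by (simp add: nn_integral_cmult nn_integral_lborel_translate[of "\<lambda>\<zeta>. wt s \<zeta> * R \<zeta>"])
  also have "\<dots> = ennreal (2 powr s) * ((\<integral>\<^sup>+\<eta>. wt s \<eta> * b \<eta> \<partial>lborel) * (\<integral>\<^sup>+\<zeta>. wt s \<zeta> * R \<zeta> \<partial>lborel))"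
    by (subst nn_integral_multc, measurable, subst nn_integral_cmult, measurable) (simp add: mult.assoc)
  finally show ?thesis .
qed

lemma decay_nn_finite:
  assumes "2 * CARD('n) \<le> k"
  shows "(\<integral>\<^sup>+x. ennreal (decay k x) \<partial>(lborel :: (real^'n::finite) measure)) < top"
  using integrable_decay[OF assms] by (simp add: integrable_iff_bounded)

lemma wt_decay_finite:
  assumes "2 * CARD('n) + nat \<lceil>s\<rceil> \<le> k"
  shows "(\<integral>\<^sup>+x. wt s x * ennreal (decay k x) \<partial>(lborel :: (real^'n::finite) measure)) < top"
proof -
  let ?n = "2 * CARD('n)"
  have "wt s x * ennreal (decay k x) \<le> ennreal (decay ?n x)" for x :: "real^'n"
  proof -
    have "japanese x powr s \<le> japanese x powr real (nat \<lceil>s\<rceil>)"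
      by (intro powr_mono) (auto simp: japanese_ge_1 real_nat_ceiling_ge)
    also have "\<dots> = japanese x ^ nat \<lceil>s\<rceil>" by (simp add: powr_realpow)
    finally have "japanese x powr s * decay k x \<le> japanese x ^ nat \<lceil>s\<rceil> * decay (?n + nat \<lceil>s\<rceil>) x"
      by (intro mult_mono decay_antimono assms) auto
    also have "\<dots> = decay ?n x" by (simp add: decay_add decay_def[of "nat _"])
    finally show ?thesis unfolding wt_def by (simp add: ennreal_mult[symmetric] ennreal_leI)
  qed
  then have "(\<integral>\<^sup>+x. wt s x * ennreal (decay k x) \<partial>(lborel :: (real^'n::finite) measure)) \<le> (\<integral>\<^sup>+x. ennreal (decay ?n x) \<partial>(lborel :: (real^'n::finite) measure))"
    by (intro nn_integral_mono)
  also have "\<dots> < top" by (rule decay_nn_finite) simp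
  finally show ?thesis .
qed

section \<open>Distributions given by bounded continuous functions\<close>

definition bcont :: "(real^'n::finite \<Rightarrow> complex) \<Rightarrow> bool" where
  "bcont g \<longleftrightarrow> continuous_on UNIV g \<and> (\<exists>B. \<forall>x. norm (g x) \<le> B)"

lemma bcont_continuous: "bcont g \<Longrightarrow> continuous_on UNIV g"
  by (simp add: bcont_def)

lemma bcont_measurable: "bcont g \<Longrightarrow> g \<in> borel_measurable borel"
  by (simp add: bcont_def borel_measurable_continuous_onI)

lemma bcont_bound:
  assumes "bcont g" obtains B where "0 \<le> B" "\<And>x. norm (g x) \<le> B"
  using assms order_trans[OF norm_ge_zero] unfolding bcont_def by blast

lemma bcont_integrable:
  assumes "bcont g" "integrable lborel \<psi>"
  shows "integrable lborel (\<lambda>x. g x * \<psi> x :: complex)"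
proof -
  obtain B where B: "0 \<le> B" "\<And>x. norm (g x) \<le> B" using bcont_bound[OF assms(1)] by blast
  have [measurable]: "g \<in> borel_measurable borel" "\<psi> \<in> borel_measurable borel"
    using bcont_measurable[OF assms(1)] borel_measurable_integrable[OF assms(2)] by auto
  show ?thesis
    by (rule integrable_lborel_bounded[OF _ integrable_norm[OF assms(2)], of _ B])
       (auto simp: norm_mult intro!: mult_right_mono B)
qed

lemma bcont_const: "bcont (\<lambda>x. c)"
  by (auto simp: bcont_def)

lemma bcont_add: "bcont f \<Longrightarrow> bcont g \<Longrightarrow> bcont (\<lambda>x. f x + g x)"
  unfolding bcont_def by (blast intro: add_mono continuous_on_add norm_triangle_ineq[THEN order_trans])

lemma bcont_mult:
  assumes "bcont f" "bcont g" shows "bcont (\<lambda>x. f x * g x)"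
proof -
  obtain A where A: "0 \<le> A" "\<And>x. norm (f x) \<le> A" using bcont_bound[OF assms(1)] by blast
  obtain B where B: "0 \<le> B" "\<And>x. norm (g x) \<le> B" using bcont_bound[OF assms(2)] by blast
  have "norm (f x * g x) \<le> A * B" for x
    unfolding norm_mult by (intro mult_mono A B) auto
  then show ?thesis using assms by (auto simp: bcont_def intro: continuous_on_mult)
qed

lemma bcont_cmult: "bcont g \<Longrightarrow> bcont (\<lambda>x. c * g x)"
  by (intro bcont_mult bcont_const)

lemma bcont_diff: "bcont f \<Longrightarrow> bcont g \<Longrightarrow> bcont (\<lambda>x. f x - g x)"
  using bcont_add[OF _ bcont_cmult[of g "-1"]] by simp

lemma bcont_schwartz: "\<phi> \<in> schwartz \<Longrightarrow> bcont \<phi>"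
proof -
  assume \<phi>: "\<phi> \<in> schwartz"
  obtain C where "\<And>t. norm (\<phi> t) \<le> C * decay 0 t" using schwartz_bound[OF \<phi>, where k=0] by blast
  then show ?thesis by (auto simp: bcont_def schwartz_continuous \<phi>)
qed

lemma distr_of_schwartz: "\<psi> \<in> schwartz \<Longrightarrow> distr_of g \<psi> = (\<integral>x. g x * \<psi> x \<partial>lborel)"
  by (simp add: distr_of_def)

text \<open>Boundedness of \<open>g\<close> suffices, since one Schwartz seminorm dominates the \<open>L\<^sup>1\<close> norm.\<close>

lemma distr_of_tempered:
  fixes g :: "real^'n::finite \<Rightarrow> complex"
  assumes g: "bcont g" shows "distr_of g \<in> tempered"
  unfolding tempered_def
proof (intro CollectI conjI ballI allI impI)
  note I = bcont_integrable[OF g schwartz_integrable]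
  fix \<phi> \<psi> :: "real^'n \<Rightarrow> complex" assume "\<phi> \<in> schwartz" "\<psi> \<in> schwartz"
  then show "distr_of g (\<lambda>x. \<phi> x + \<psi> x) = distr_of g \<phi> + distr_of g \<psi>"
    using Bochner_Integration.integral_add[OF I I, of \<phi> \<psi>] by (simp add: distr_of_schwartz schwartz_add distrib_left)
next
  fix c and \<phi> :: "real^'n \<Rightarrow> complex" assume "\<phi> \<in> schwartz"
  then show "distr_of g (\<lambda>x. c * \<phi> x) = c * distr_of g \<phi>"
    by (simp add: distr_of_schwartz schwartz_cmult mult.left_commute)
next
  obtain B where B: "0 \<le> B" "\<And>x. norm (g x) \<le> B" using bcont_bound[OF g] by blast
  let ?N = "2 * CARD('n)"
  have "norm (distr_of g \<phi>) \<le> (B * (\<integral>t. decay ?N t \<partial>(lborel :: (real^'n) measure))) * schwartz_norm ?N \<phi>"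
    if \<phi>: "\<phi> \<in> schwartz" for \<phi> :: "real^'n \<Rightarrow> complex"
  proof -
    have le: "norm (\<phi> t) \<le> schwartz_norm ?N \<phi> * decay ?N t" for t
    proof -
      have bdd: "bdd_above (range (\<lambda>x. japanese x ^ ?N * norm (iter_deriv is \<phi> x)))" for "is"
      proof -
        have "bounded (range (\<lambda>x. japanese x ^ ?N *\<^sub>R iter_deriv is \<phi> x))" using \<phi> by (simp add: schwartz_def)
        then obtain B where "\<And>x. norm (japanese x ^ ?N *\<^sub>R iter_deriv is \<phi> x) \<le> B" by (auto simp: bounded_iff)
        then show ?thesis by (auto simp: bdd_above_def)
      qed
      have "japanese t ^ ?N * norm (iter_deriv [] \<phi> t) \<le> (SUP x. japanese x ^ ?N * norm (iter_deriv [] \<phi> x))"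
        by (rule cSUP_upper[OF _ bdd]) simp
      also have "\<dots> \<le> schwartz_norm ?N \<phi>"
        unfolding schwartz_norm_def
        by (rule member_le_sum) (auto simp: finite_lists_le intro!: cSUP_upper2[OF bdd])
      finally show ?thesis by (simp add: decay_def field_simps)
    qed
    have "norm (distr_of g \<phi>) \<le> (\<integral>t. B * (schwartz_norm ?N \<phi> * decay ?N t) \<partial>(lborel :: (real^'n) measure))"
      unfolding distr_of_schwartz[OF \<phi>]
    proof (rule Bochner_Integration.integral_norm_bound_integral)
      show "integrable lborel (\<lambda>x. g x * \<phi> x)" by (rule bcont_integrable[OF g schwartz_integrable[OF \<phi>]])
      show "integrable lborel (\<lambda>t::real^'n. B * (schwartz_norm ?N \<phi> * decay ?N t))"
        using integrable_decay[of ?N, where 'n='n] by simp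
      show "norm (g t * \<phi> t) \<le> B * (schwartz_norm ?N \<phi> * decay ?N t)" for t
        unfolding norm_mult by (intro mult_mono B le) auto
    qed
    then show ?thesis by (simp add: mult_ac)
  qed
  then show "\<exists>C N. \<forall>\<phi>\<in>schwartz. norm (distr_of g \<phi>) \<le> C * schwartz_norm N \<phi>" by blast
next
  fix \<phi> :: "real^'n \<Rightarrow> complex" assume "\<phi> \<notin> schwartz"
  then show "distr_of g \<phi> = 0" by (simp add: distr_of_def)
qed

lemma distr_of_add:
  assumes "bcont f" "bcont g"
  shows "distr_of (\<lambda>x. f x + g x) = (\<lambda>\<psi>. distr_of f \<psi> + distr_of g \<psi>)"
  using Bochner_Integration.integral_add[OF bcont_integrable[OF assms(1) schwartz_integrable] bcont_integrable[OF assms(2) schwartz_integrable]]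
  by (auto simp: distr_of_def distrib_right)

lemma distr_of_cmult: "distr_of (\<lambda>x. c * g x) = (\<lambda>\<psi>. c * distr_of g \<psi>)"
  by (auto simp: distr_of_def mult.assoc)

lemma distr_of_diff:
  assumes "bcont f" "bcont g"
  shows "distr_of (\<lambda>x. f x - g x) = (\<lambda>\<psi>. distr_of f \<psi> - distr_of g \<psi>)"
  using distr_of_add[OF assms(1) bcont_cmult[OF assms(2), of "-1"]] distr_of_cmult[of "-1" g] by simp

text \<open>The open set where \<open>h\<close> is nonzero is a null set, hence empty.\<close>

lemma continuous_nonneg_integral_eq_0:
  fixes h :: "'a::euclidean_space \<Rightarrow> real"
  assumes cont: "continuous_on UNIV h" and nonneg: "\<And>x. 0 \<le> h x" and int: "integrable lborel h"
    and zero: "(\<integral>x. h x \<partial>lborel) = 0"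
  shows "h x = 0"
proof -
  from zero have "AE t in lborel. h t = 0"
    by (subst (asm) integral_nonneg_eq_0_iff_AE[OF int]) (auto simp: nonneg)
  then have ae: "AE t in lborel. t \<notin> {t. h t \<noteq> 0}" by simp
  have op: "open {t. h t \<noteq> 0}" by (intro open_Collect_neq cont continuous_intros)
  then have "{t. h t \<noteq> 0} \<in> null_sets lborel" using ae by (subst AE_iff_null_sets) auto
  then have "{t. h t \<noteq> 0} = {}"
    using open_not_negligible[OF op] negligible_iff_null_sets null_sets_completionI by blast
  then show ?thesis by auto
qed

section \<open>The synthesis formula\<close>

lemma stft_measurable:
  assumes "\<phi> \<in> schwartz" "u \<in> tempered" "f \<in> borel_measurable M" "g \<in> borel_measurable M"
  shows "(\<lambda>w. stft \<phi> u (f w) (g w)) \<in> borel_measurable M"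
proof -
  have "(\<lambda>z. stft \<phi> u (fst z) (snd z)) \<in> borel_measurable (borel \<Otimes>\<^sub>M borel)"
    unfolding borel_prod by (intro borel_measurable_continuous_onI stft_continuous assms)
  from measurable_compose[OF measurable_Pair[OF assms(3,4)] this] show ?thesis by simp
qed

lemma mod_norm_eq:
  assumes "1 \<le> p"
  shows "mod_norm \<phi> p s u = (\<integral>\<^sup>+\<xi>. wt s \<xi> * Lp p (\<lambda>x. ennreal (norm (stft \<phi> u x \<xi>))) \<partial>lborel)"
  unfolding mod_norm_def wt_def Lp_def by simp

lemma mod_norm_mono_weight:
  assumes "1 \<le> p" "0 \<le> s"
  shows "mod_norm \<phi> p 0 u \<le> mod_norm \<phi> p s u"
  unfolding mod_norm_eq[OF assms(1)]
  by (intro nn_integral_mono mult_right_mono) (auto simp: wt_ge_1 assms)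

definition decay_mass :: "'n::finite itself \<Rightarrow> ennreal" where
  "decay_mass _ = (\<integral>\<^sup>+t. ennreal (decay (2 * CARD('n)) t) \<partial>(lborel :: (real^'n) measure))"

lemma decay_mass_finite: "decay_mass TYPE('n::finite) < top"
  unfolding decay_mass_def by (rule decay_nn_finite) simp

text \<open>Window and exponent are fixed from here on. The weight exponent \<open>s\<close> remains a parameter, because
  estimates for \<open>s\<close> use those for \<open>0\<close>.\<close>

locale gabor =
  fixes \<phi> :: "real^'n::finite \<Rightarrow> complex" and p :: real
  assumes window: "\<phi> \<in> schwartz" and window_nz: "\<phi> \<noteq> (\<lambda>x. 0)" and p: "1 \<le> p"
begin

definition gabor_const :: real where
  "gabor_const = inverse ((2 * pi) ^ CARD('n) * (\<integral>t. (norm (\<phi> t))\<^sup>2 \<partial>lborel))"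

lemma window_measurable [measurable]: "\<phi> \<in> borel_measurable borel"
  by (rule schwartz_measurable[OF window])

lemma gabor_const_pos: "0 < gabor_const"
proof -
  obtain t0 where t0: "\<phi> t0 \<noteq> 0" using window_nz by auto
  obtain B where B: "0 \<le> B" "\<And>t. norm (\<phi> t) \<le> B * decay (2 * CARD('n)) t" using schwartz_bound[OF window, where k="2 * CARD('n)"] by blast
  have I: "integrable lborel (\<lambda>t. (norm (\<phi> t))\<^sup>2)"
  proof (rule integrable_lborel_bounded[OF _ integrable_decay[of "2 * CARD('n)", where 'n='n], of _ "B * B"])
    show "norm ((norm (\<phi> t))\<^sup>2) \<le> B * B * decay (2 * CARD('n)) t" for t
    proof -
      have "norm (\<phi> t) \<le> B * 1"
        using order_trans[OF B(2) mult_left_mono[OF decay_le_1 B(1)]] .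
      then have "norm (\<phi> t) * norm (\<phi> t) \<le> B * (B * decay (2 * CARD('n)) t)"
        using B by (intro mult_mono) auto
      then show ?thesis by (simp add: power2_eq_square)
    qed
  qed auto
  have "(\<integral>t. (norm (\<phi> t))\<^sup>2 \<partial>lborel) \<noteq> 0"
    using continuous_nonneg_integral_eq_0[OF _ _ I, of t0] t0
      continuous_on_power[OF continuous_on_norm[OF schwartz_continuous[OF window]], of 2] by auto
  moreover have "0 \<le> (\<integral>t. (norm (\<phi> t))\<^sup>2 \<partial>lborel)" by (intro integral_nonneg_AE) auto
  ultimately have "0 < (\<integral>t. (norm (\<phi> t))\<^sup>2 \<partial>lborel)" by linarith
  then show ?thesis by (simp add: gabor_const_def)
qed

lemma reproducing:
  assumes "u \<in> tempered" "\<psi> \<in> schwartz"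
  shows "u \<psi> = of_real gabor_const * (\<integral>z. coatom \<phi> \<psi> z * stft \<phi> u (fst z) (snd z) \<partial>lborel)"
proof -
  have nz: "complex_of_real ((2 * pi) ^ CARD('n) * (\<integral>t. (norm (\<phi> t))\<^sup>2 \<partial>lborel)) \<noteq> 0"
    using gabor_const_pos unfolding gabor_const_def by (auto simp del: of_real_mult)
  then show ?thesis
    unfolding reproducing_formula[OF window assms, symmetric] gabor_const_def
    by (simp only: of_real_inverse mult.assoc[symmetric] left_inverse[OF nz] mult_1_left)
qed

text \<open>This replaces the embedding into the space with \<open>p = \<infinity>\<close>: locally averaged in time, the
  short-time Fourier transform is bounded in time and integrable in frequency.\<close>

lemma stft_pointwise:
  assumes u: "u \<in> tempered"
  shows "(\<integral>\<^sup>+\<xi>. \<integral>\<^sup>+x. ennreal (norm (stft \<phi> u x \<xi>)) * ennreal (decay (2 * CARD('n)) (t - x)) \<partial>lborel \<partial>lborel) \<le> (decay_mass TYPE('n) + 1) * mod_norm \<phi> p 0 u"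
proof -
  note [measurable] = stft_measurable[OF window u]
  have "(\<integral>\<^sup>+x. ennreal (norm (stft \<phi> u x \<xi>)) * ennreal (decay (2 * CARD('n)) (t - x)) \<partial>lborel) \<le> (decay_mass TYPE('n) + 1) * Lp p (\<lambda>x. ennreal (norm (stft \<phi> u x \<xi>)))" for \<xi>
  proof -
    have "(\<integral>\<^sup>+x. ennreal (decay (2 * CARD('n)) (t - x)) * ennreal (norm (stft \<phi> u x \<xi>)) \<partial>lborel) \<le>
       ((\<integral>\<^sup>+x. ennreal (decay (2 * CARD('n)) (t - x)) \<partial>lborel) + 1) * Lp p (\<lambda>x. ennreal (norm (stft \<phi> u x \<xi>)))"
      by (rule pointwise_le_Lp[OF p]) (auto simp: decay_le_1)
    also have "(\<integral>\<^sup>+x. ennreal (decay (2 * CARD('n)) (t - x)) \<partial>lborel) = decay_mass TYPE('n)"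
      unfolding decay_mass_def
      by (rule nn_integral_lborel_reflect[of "\<lambda>x. ennreal (decay (2 * CARD('n)) x)"]) simp
    finally show ?thesis by (simp add: mult.commute)
  qed
  then have "(\<integral>\<^sup>+\<xi>. \<integral>\<^sup>+x. ennreal (norm (stft \<phi> u x \<xi>)) * ennreal (decay (2 * CARD('n)) (t - x)) \<partial>lborel \<partial>lborel) \<le>
      (\<integral>\<^sup>+\<xi>. (decay_mass TYPE('n) + 1) * Lp p (\<lambda>x. ennreal (norm (stft \<phi> u x \<xi>))) \<partial>lborel)"
    by (intro nn_integral_mono)
  also have "\<dots> = (decay_mass TYPE('n) + 1) * mod_norm \<phi> p 0 u"
    unfolding mod_norm_eq[OF p] by (subst nn_integral_cmult) auto
  finally show ?thesis .
qed

text \<open>The function that the reproducing formula assigns to a distribution of finite norm.\<close>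

definition synth :: "'n functional \<Rightarrow> real^'n \<Rightarrow> complex" where
  "synth u t = of_real gabor_const * (\<integral>z. stft \<phi> u (fst z) (snd z) * (\<phi> (t - fst z) * cis (t \<bullet> snd z)) \<partial>lborel)"

lemma decay_weighted_integrable:
  assumes u: "u \<in> tempered" and fin: "mod_norm \<phi> p 0 u < top"
  shows "integrable lborel (\<lambda>z. norm (stft \<phi> u (fst z) (snd z)) * decay (2 * CARD('n)) (t - fst z))"
    and "ennreal (\<integral>z. norm (stft \<phi> u (fst z) (snd z)) * decay (2 * CARD('n)) (t - fst z) \<partial>lborel) \<le> (decay_mass TYPE('n) + 1) * mod_norm \<phi> p 0 u"
proof -
  note [measurable] = stft_measurable[OF window u]
  have m: "(\<lambda>z. norm (stft \<phi> u (fst z) (snd z)) * decay (2 * CARD('n)) (t - fst z)) \<in> borel_measurable borel"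
    unfolding borel_prod[symmetric] by measurable
  then have m': "(\<lambda>z. ennreal (norm (stft \<phi> u (fst z) (snd z)) * decay (2 * CARD('n)) (t - fst z))) \<in> borel_measurable borel"
    by simp
  have "(\<integral>\<^sup>+z. ennreal (norm (stft \<phi> u (fst z) (snd z)) * decay (2 * CARD('n)) (t - fst z)) \<partial>lborel) =
      (\<integral>\<^sup>+x. \<integral>\<^sup>+\<xi>. ennreal (norm (stft \<phi> u x \<xi>)) * ennreal (decay (2 * CARD('n)) (t - x)) \<partial>lborel \<partial>lborel)"
    unfolding nn_integral_lborel_pair[OF m'] by (simp add: ennreal_mult)
  also have "\<dots> = (\<integral>\<^sup>+\<xi>. \<integral>\<^sup>+x. ennreal (norm (stft \<phi> u x \<xi>)) * ennreal (decay (2 * CARD('n)) (t - x)) \<partial>lborel \<partial>lborel)"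
    by (rule lborel_pair.Fubini') measurable
  also note stft_pointwise[OF u]
  finally have le: "(\<integral>\<^sup>+z. ennreal (norm (stft \<phi> u (fst z) (snd z)) * decay (2 * CARD('n)) (t - fst z)) \<partial>lborel) \<le> (decay_mass TYPE('n) + 1) * mod_norm \<phi> p 0 u" .
  moreover have "(decay_mass TYPE('n) + 1) * mod_norm \<phi> p 0 u < top"
    using fin decay_mass_finite[where 'n='n] by (simp add: ennreal_mult_less_top)
  ultimately show I: "integrable lborel (\<lambda>z. norm (stft \<phi> u (fst z) (snd z)) * decay (2 * CARD('n)) (t - fst z))"
    using m by (intro integrableI_bounded) (auto simp: abs_mult intro: le_less_trans)
  show "ennreal (\<integral>z. norm (stft \<phi> u (fst z) (snd z)) * decay (2 * CARD('n)) (t - fst z) \<partial>lborel) \<le> (decay_mass TYPE('n) + 1) * mod_norm \<phi> p 0 u"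
    using le by (subst nn_integral_eq_integral[OF I, symmetric]) auto
qed

text \<open>Continuity is dominated convergence; near \<open>t\<close> the shifted windows share a majorant by
  \<open>decay_shift\<close>. In the uniform bound the constant does not depend on \<open>u\<close>, which makes point
  evaluations continuous.\<close>

lemma synth_bcont:
  assumes u: "u \<in> tempered" and fin: "mod_norm \<phi> p 0 u < top"
  shows "bcont (synth u)"
    and "\<exists>C. 0 \<le> C \<and> (\<forall>u t. u \<in> tempered \<longrightarrow> mod_norm \<phi> p 0 u < top \<longrightarrow> norm (synth u t) \<le> C * enn2real (mod_norm \<phi> p 0 u))"
proof -
  obtain B where B: "0 \<le> B" "\<And>t. norm (\<phi> t) \<le> B * decay (2 * CARD('n)) t" using schwartz_bound[OF window, where k="2 * CARD('n)"] by blast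
  have bd: "norm (stft \<phi> u (fst z) (snd z) * (\<phi> (t - fst z) * cis (t \<bullet> snd z))) \<le> B * (norm (stft \<phi> u (fst z) (snd z)) * decay (2 * CARD('n)) (t - fst z))" for u z t
    using mult_left_mono[OF B(2)[of "t - fst z"], of "norm (stft \<phi> u (fst z) (snd z))"] by (simp add: norm_mult mult_ac)
  have m: "(\<lambda>z. stft \<phi> u (fst z) (snd z) * (\<phi> (t - fst z) * cis (t \<bullet> snd z))) \<in> borel_measurable borel" if "u \<in> tempered" for u t
  proof -
    note [measurable] = stft_measurable[OF window that]
    show ?thesis unfolding borel_prod[symmetric] by measurable
  qed
  let ?C = "gabor_const * (B * enn2real (decay_mass TYPE('n) + 1))"
  have "norm (synth u t) \<le> ?C * enn2real (mod_norm \<phi> p 0 u)" if u: "u \<in> tempered" and fin: "mod_norm \<phi> p 0 u < top" for u t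
  proof -
    have I: "integrable lborel (\<lambda>z. stft \<phi> u (fst z) (snd z) * (\<phi> (t - fst z) * cis (t \<bullet> snd z)))"
      by (rule integrable_lborel_bounded[OF m[OF u] decay_weighted_integrable(1)[OF u fin] bd])
    have "norm (\<integral>z. stft \<phi> u (fst z) (snd z) * (\<phi> (t - fst z) * cis (t \<bullet> snd z)) \<partial>lborel) \<le> (\<integral>z. B * (norm (stft \<phi> u (fst z) (snd z)) * decay (2 * CARD('n)) (t - fst z)) \<partial>lborel)"
      by (rule Bochner_Integration.integral_norm_bound_integral[OF I _ bd])
         (use decay_weighted_integrable(1)[OF u fin] in simp)
    also have "\<dots> = B * (\<integral>z. norm (stft \<phi> u (fst z) (snd z)) * decay (2 * CARD('n)) (t - fst z) \<partial>lborel)" by simp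
    also have "(\<integral>z. norm (stft \<phi> u (fst z) (snd z)) * decay (2 * CARD('n)) (t - fst z) \<partial>lborel) \<le> enn2real ((decay_mass TYPE('n) + 1) * mod_norm \<phi> p 0 u)"
    proof -
      have "(decay_mass TYPE('n) + 1) * mod_norm \<phi> p 0 u < top" using fin decay_mass_finite[where 'n='n] by (simp add: ennreal_mult_less_top)
      from enn2real_mono[OF decay_weighted_integrable(2)[OF u fin] this] show ?thesis
        by (simp add: integral_nonneg_AE)
    qed
    then have "B * (\<integral>z. norm (stft \<phi> u (fst z) (snd z)) * decay (2 * CARD('n)) (t - fst z) \<partial>lborel) \<le> B * (enn2real (decay_mass TYPE('n) + 1) * enn2real (mod_norm \<phi> p 0 u))"
      using B(1) by (intro mult_left_mono) (auto simp: enn2real_mult)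
    finally have "gabor_const * norm (\<integral>z. stft \<phi> u (fst z) (snd z) * (\<phi> (t - fst z) * cis (t \<bullet> snd z)) \<partial>lborel) \<le> gabor_const * (B * (enn2real (decay_mass TYPE('n) + 1) * enn2real (mod_norm \<phi> p 0 u)))"
      using gabor_const_pos by (intro mult_left_mono) auto
    then show ?thesis using gabor_const_pos by (simp add: synth_def norm_mult mult_ac)
  qed
  moreover have "0 \<le> ?C" using gabor_const_pos B(1) by simp
  ultimately show ex: "\<exists>C. 0 \<le> C \<and> (\<forall>u t. u \<in> tempered \<longrightarrow> mod_norm \<phi> p 0 u < top \<longrightarrow> norm (synth u t) \<le> C * enn2real (mod_norm \<phi> p 0 u))"
    by blast
  have "continuous_on UNIV (synth u)"
    unfolding continuous_on_sequentially
  proof (intro allI ballI impI)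
    fix T :: "nat \<Rightarrow> real^'n" and t assume "(\<forall>n. T n \<in> UNIV) \<and> T \<longlonglongrightarrow> t"
    then have T: "T \<longlonglongrightarrow> t" by simp
    then have "(\<lambda>n. t - T n) \<longlonglongrightarrow> 0" using tendsto_diff[OF tendsto_const T, of t] by simp
    then have "Bseq (\<lambda>n. t - T n)" by (intro convergent_imp_Bseq) (auto simp: convergent_def)
    then obtain M where M: "0 < M" "\<And>n. norm (t - T n) \<le> M" by (auto simp: Bseq_def)
    \<comment> \<open>A bound for the weight of the translations, since a convergent sequence is bounded.\<close>
    define A where "A = sqrt (1 + M\<^sup>2)"
    have A: "japanese (t - T n) \<le> A" for n
      unfolding japanese_def A_def using M(2)[of n] by (auto intro!: power_mono)
    have A0: "0 \<le> A" by (simp add: A_def)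
    have "(\<lambda>n. \<integral>z. stft \<phi> u (fst z) (snd z) * (\<phi> (T n - fst z) * cis (T n \<bullet> snd z)) \<partial>lborel) \<longlonglongrightarrow> (\<integral>z. stft \<phi> u (fst z) (snd z) * (\<phi> (t - fst z) * cis (t \<bullet> snd z)) \<partial>lborel)"
    proof (rule integral_dominated_convergence[where w="\<lambda>z. B * 2 ^ (2 * CARD('n)) * A ^ (2 * CARD('n)) * (norm (stft \<phi> u (fst z) (snd z)) * decay (2 * CARD('n)) (t - fst z))"])
      show "(\<lambda>z. stft \<phi> u (fst z) (snd z) * (\<phi> (t - fst z) * cis (t \<bullet> snd z))) \<in> borel_measurable lborel" for t
        using m[OF u] by simp
      show "(\<lambda>z. stft \<phi> u (fst z) (snd z) * (\<phi> (T n - fst z) * cis (T n \<bullet> snd z))) \<in> borel_measurable lborel" for n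
        using m[OF u] by simp
      show "integrable lborel (\<lambda>z. B * 2 ^ (2 * CARD('n)) * A ^ (2 * CARD('n)) * (norm (stft \<phi> u (fst z) (snd z)) * decay (2 * CARD('n)) (t - fst z)))"
        by (rule integrable_mult_right[OF decay_weighted_integrable(1)[OF u fin]])
      show "AE z in lborel. (\<lambda>n. stft \<phi> u (fst z) (snd z) * (\<phi> (T n - fst z) * cis (T n \<bullet> snd z))) \<longlonglongrightarrow> stft \<phi> u (fst z) (snd z) * (\<phi> (t - fst z) * cis (t \<bullet> snd z))"
      proof (rule AE_I2)
        fix z :: "(real^'n) \<times> (real^'n)"
        have 1: "(\<lambda>n. \<phi> (T n - fst z)) \<longlonglongrightarrow> \<phi> (t - fst z)"
          by (rule continuous_on_tendsto_compose[OF schwartz_continuous[OF window]]) (auto intro!: tendsto_intros T)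
        have 2: "(\<lambda>n. cis (T n \<bullet> snd z)) \<longlonglongrightarrow> cis (t \<bullet> snd z)" by (intro tendsto_intros T)
        show "(\<lambda>n. stft \<phi> u (fst z) (snd z) * (\<phi> (T n - fst z) * cis (T n \<bullet> snd z))) \<longlonglongrightarrow> stft \<phi> u (fst z) (snd z) * (\<phi> (t - fst z) * cis (t \<bullet> snd z))"
          by (intro tendsto_mult tendsto_const 1 2)
      qed
      show "AE z in lborel. norm (stft \<phi> u (fst z) (snd z) * (\<phi> (T n - fst z) * cis (T n \<bullet> snd z))) \<le> B * 2 ^ (2 * CARD('n)) * A ^ (2 * CARD('n)) * (norm (stft \<phi> u (fst z) (snd z)) * decay (2 * CARD('n)) (t - fst z))" for n
      proof (rule AE_I2)
        fix z :: "(real^'n) \<times> (real^'n)"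
        have "decay (2 * CARD('n)) (T n - fst z) \<le> 2 ^ (2 * CARD('n)) * japanese (t - T n) ^ (2 * CARD('n)) * decay (2 * CARD('n)) (t - fst z)"
          using decay_shift[of "2 * CARD('n)" "T n - fst z" "t - T n"] by simp
        also have "\<dots> \<le> 2 ^ (2 * CARD('n)) * A ^ (2 * CARD('n)) * decay (2 * CARD('n)) (t - fst z)"
          by (intro mult_right_mono mult_left_mono power_mono A) auto
        finally have "B * (norm (stft \<phi> u (fst z) (snd z)) * decay (2 * CARD('n)) (T n - fst z)) \<le> B * (norm (stft \<phi> u (fst z) (snd z)) * (2 ^ (2 * CARD('n)) * A ^ (2 * CARD('n)) * decay (2 * CARD('n)) (t - fst z)))"
          by (intro mult_left_mono B) auto
        with bd[of u z "T n"] show "norm (stft \<phi> u (fst z) (snd z) * (\<phi> (T n - fst z) * cis (T n \<bullet> snd z))) \<le> B * 2 ^ (2 * CARD('n)) * A ^ (2 * CARD('n)) * (norm (stft \<phi> u (fst z) (snd z)) * decay (2 * CARD('n)) (t - fst z))"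
          by (simp only: mult_ac)
      qed
    qed
    then show "(synth u \<circ> T) \<longlonglongrightarrow> synth u t"
      unfolding synth_def o_def by (intro tendsto_mult tendsto_const)
  qed
  then show "bcont (synth u)" using ex u fin unfolding bcont_def by blast
qed

text \<open>Fubini. The test function need only be integrable here, so the formula also applies when \<open>\<psi>\<close>
  contains a bounded continuous factor, as in \<open>mod_fun_mult\<close>.\<close>

lemma synth_pairing:
  assumes u: "u \<in> tempered" and fin: "mod_norm \<phi> p 0 u < top" and \<psi>: "integrable lborel \<psi>"
  shows "(\<integral>t. synth u t * \<psi> t \<partial>lborel) = of_real gabor_const * (\<integral>z. coatom \<phi> \<psi> z * stft \<phi> u (fst z) (snd z) \<partial>lborel)"
proof -
  have [measurable]: "\<psi> \<in> borel_measurable borel" using borel_measurable_integrable[OF \<psi>] by simp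
  note [measurable] = stft_measurable[OF window u]
  obtain B where B: "0 \<le> B" "\<And>t. norm (\<phi> t) \<le> B * decay (2 * CARD('n)) t" using schwartz_bound[OF window, where k="2 * CARD('n)"] by blast
  let ?H = "\<lambda>t z. \<psi> t * (stft \<phi> u (fst z) (snd z) * (\<phi> (t - fst z) * cis (t \<bullet> snd z)))"
  have bd: "norm (?H t z) \<le> norm (\<psi> t) * (B * (norm (stft \<phi> u (fst z) (snd z)) * decay (2 * CARD('n)) (t - fst z)))" for t z
    using mult_left_mono[OF B(2)[of "t - fst z"], of "norm (\<psi> t) * norm (stft \<phi> u (fst z) (snd z))"] by (simp add: norm_mult mult_ac)
  have I: "integrable (lborel \<Otimes>\<^sub>M lborel) (case_prod ?H)"
  proof (rule integrable_pairI)
    have "(\<lambda>w. ?H (fst w) (snd w)) \<in> borel_measurable (borel \<Otimes>\<^sub>M (borel \<Otimes>\<^sub>M borel))" by measurable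
    then show "case_prod ?H \<in> borel_measurable borel" by (simp add: borel_prod split_beta')
    have "(\<integral>\<^sup>+t. \<integral>\<^sup>+z. ennreal (norm (case (t, z) of (t, z) \<Rightarrow> ?H t z)) \<partial>lborel \<partial>lborel) \<le>
        (\<integral>\<^sup>+t. ennreal (norm (\<psi> t)) * (ennreal B * ((decay_mass TYPE('n) + 1) * mod_norm \<phi> p 0 u)) \<partial>lborel)"
    proof (rule nn_integral_mono)
      fix t
      have "(\<integral>\<^sup>+z. ennreal (norm (case (t, z) of (t, z) \<Rightarrow> ?H t z)) \<partial>lborel) \<le> (\<integral>\<^sup>+z. ennreal (norm (\<psi> t)) * (ennreal B * ennreal (norm (stft \<phi> u (fst z) (snd z)) * decay (2 * CARD('n)) (t - fst z))) \<partial>lborel)"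
        using bd[of t] B(1) by (intro nn_integral_mono) (simp add: ennreal_mult'[symmetric] ennreal_leI)
      also have "\<dots> = ennreal (norm (\<psi> t)) * (ennreal B * (\<integral>\<^sup>+z. ennreal (norm (stft \<phi> u (fst z) (snd z)) * decay (2 * CARD('n)) (t - fst z)) \<partial>lborel))"
        using borel_measurable_integrable[OF decay_weighted_integrable(1)[OF u fin, of t]]
        by (simp add: nn_integral_cmult)
      also have "\<dots> \<le> ennreal (norm (\<psi> t)) * (ennreal B * ((decay_mass TYPE('n) + 1) * mod_norm \<phi> p 0 u))"
        using decay_weighted_integrable(2)[OF u fin, of t]
        by (intro mult_left_mono) (auto simp: nn_integral_eq_integral[OF decay_weighted_integrable(1)[OF u fin, of t]])
      finally show "(\<integral>\<^sup>+z. ennreal (norm (case (t, z) of (t, z) \<Rightarrow> ?H t z)) \<partial>lborel) \<le> ennreal (norm (\<psi> t)) * (ennreal B * ((decay_mass TYPE('n) + 1) * mod_norm \<phi> p 0 u))" .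
    qed
    also have "\<dots> = (\<integral>\<^sup>+t. ennreal (norm (\<psi> t)) \<partial>lborel) * (ennreal B * ((decay_mass TYPE('n) + 1) * mod_norm \<phi> p 0 u))"
      by (rule nn_integral_multc) simp
    also have "\<dots> < \<infinity>"
      using \<psi> fin decay_mass_finite[where 'n='n] by (simp add: integrable_iff_bounded ennreal_mult_less_top)
    finally show "(\<integral>\<^sup>+t. \<integral>\<^sup>+z. ennreal (norm (case (t, z) of (t, z) \<Rightarrow> ?H t z)) \<partial>lborel \<partial>lborel) < \<infinity>" .
  qed
  have "(\<integral>t. synth u t * \<psi> t \<partial>lborel) = of_real gabor_const * (\<integral>t. \<integral>z. ?H t z \<partial>lborel \<partial>lborel)"
    unfolding synth_def
    by (rule trans[OF _ integral_mult_right_zero]) (simp add: mult_ac)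
  also have "(\<integral>t. \<integral>z. ?H t z \<partial>lborel \<partial>lborel) = (\<integral>z. \<integral>t. ?H t z \<partial>lborel \<partial>lborel)"
    by (rule lborel_pair.Fubini_integral[OF I, symmetric])
  also have "\<dots> = (\<integral>z. coatom \<phi> \<psi> z * stft \<phi> u (fst z) (snd z) \<partial>lborel)"
  proof (rule Bochner_Integration.integral_cong[OF refl])
    fix z :: "(real^'n) \<times> (real^'n)"
    have "(\<integral>t. ?H t z \<partial>lborel) = (\<integral>t. (\<phi> (t - fst z) * \<psi> t * cis (t \<bullet> snd z)) * stft \<phi> u (fst z) (snd z) \<partial>lborel)"
      by (simp add: mult_ac)
    then show "(\<integral>t. ?H t z \<partial>lborel) = coatom \<phi> \<psi> z * stft \<phi> u (fst z) (snd z)"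
      by (simp add: coatom_def)
  qed
  finally show ?thesis .
qed

lemma distr_of_synth:
  assumes u: "u \<in> tempered" and fin: "mod_norm \<phi> p 0 u < top"
  shows "distr_of (synth u) = u"
proof
  fix \<psi> :: "real^'n \<Rightarrow> complex"
  show "distr_of (synth u) \<psi> = u \<psi>"
  proof (cases "\<psi> \<in> schwartz")
    case False
    then show ?thesis using tempered_outside[OF u] by (simp add: distr_of_def)
  next
    case True
    then show ?thesis
      using synth_pairing[OF u fin schwartz_integrable[OF True]] reproducing[OF u True]
      by (simp add: distr_of_schwartz)
  qed
qed

end

section \<open>Smooth plateau functions\<close>

text \<open>The classical smooth function that is flat at the origin. The powers of \<open>1 / t\<close> make the class
  closed under differentiation up to linear combinations (\<open>flat_exp_DERIV\<close>).\<close>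

definition flat_exp :: "nat \<Rightarrow> real \<Rightarrow> real" where
  "flat_exp k t = (if 0 < t then (1 / t) ^ k * exp (- (1 / t)) else 0)"

lemma flat_exp_nonneg: "0 \<le> flat_exp k t"
  by (simp add: flat_exp_def)

lemma flat_exp_tendsto_0: "((\<lambda>h. flat_exp k h) \<longlongrightarrow> 0) (at 0)"
proof -
  have "((\<lambda>x::real. x ^ k / exp x) \<longlongrightarrow> 0) at_top" by (rule tendsto_power_div_exp_0)
  moreover have "filterlim (\<lambda>h::real. 1 / h) at_top (at_right 0)"
    using filterlim_inverse_at_top_right by (simp add: inverse_eq_divide)
  ultimately have "((\<lambda>h::real. (1 / h) ^ k / exp (1 / h)) \<longlongrightarrow> 0) (at_right 0)"
    by (rule filterlim_compose)
  then have "((\<lambda>h. flat_exp k h) \<longlongrightarrow> 0) (at_right 0)"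
    by (rule Lim_transform_eventually)
       (auto simp: eventually_at_right_field flat_exp_def exp_minus divide_inverse intro!: exI[of _ 1])
  moreover have "((\<lambda>h. flat_exp k h) \<longlongrightarrow> 0) (at_left 0)"
    by (rule Lim_transform_eventually[of "\<lambda>_. 0"])
       (auto simp: eventually_at_left_field flat_exp_def intro!: exI[of _ "-1"])
  ultimately show ?thesis by (simp add: filterlim_at_split)
qed

lemma flat_exp_DERIV: "(flat_exp k has_real_derivative (flat_exp (k + 2) t - real k * flat_exp (k + 1) t)) (at t)"
proof -
  consider "0 < t" | "t < 0" | "t = 0" by linarith
  then show ?thesis
  proof cases
    case 1
    have "((\<lambda>t. (1 / t) ^ k * exp (- (1 / t))) has_real_derivative (flat_exp (k + 2) t - real k * flat_exp (k + 1) t)) (at t)"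
    proof -
      define y where "y = 1 / t"
      have "((\<lambda>t. (1 / t) ^ k * exp (- (1 / t))) has_real_derivative
          (real k * (- (y\<^sup>2)) * y ^ (k - Suc 0)) * exp (- y) + (exp (- y) * y\<^sup>2) * y ^ k) (at t)"
        using 1 by (auto intro!: derivative_eq_intros simp: y_def power2_eq_square)
      moreover have "(real k * (- (y\<^sup>2)) * y ^ (k - Suc 0)) * exp (- y) + (exp (- y) * y\<^sup>2) * y ^ k =
          y ^ (k + 2) * exp (- y) - real k * (y ^ (k + 1) * exp (- y))"
        by (cases k) (auto simp: power2_eq_square algebra_simps)
      ultimately show ?thesis using 1 by (simp add: flat_exp_def y_def)
    qed
    then show ?thesis
      by (rule has_field_derivative_transform_within_open[of _ _ _ "{0<..}"]) (use 1 in \<open>auto simp: flat_exp_def\<close>)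
  next
    case 2
    have "((\<lambda>t. 0) has_real_derivative (flat_exp (k + 2) t - real k * flat_exp (k + 1) t)) (at t)"
      using 2 by (simp add: flat_exp_def)
    then show ?thesis
      by (rule has_field_derivative_transform_within_open[of _ _ _ "{..<0}"]) (use 2 in \<open>auto simp: flat_exp_def\<close>)
  next
    case 3
    have "(\<lambda>h. (flat_exp k (0 + h) - flat_exp k 0) / h) = flat_exp (k + 1)"
      by (auto simp: flat_exp_def fun_eq_iff)
    moreover have "flat_exp j 0 = 0" for j by (simp add: flat_exp_def)
    ultimately show ?thesis
      unfolding 3 DERIV_def using flat_exp_tendsto_0[of "k + 1"] by simp
  qed
qed

lemma flat_exp_continuous: "continuous_on S (flat_exp k)"
  by (intro continuous_at_imp_continuous_on ballI DERIV_isCont[OF flat_exp_DERIV])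

definition hat :: "real \<Rightarrow> real" where "hat t = flat_exp 0 t * flat_exp 0 (1 - t)"

definition smooth_step :: "real \<Rightarrow> real" where "smooth_step t = integral {-1..t} hat / integral {-1..1} hat"

lemma hat_continuous: "continuous_on S hat"
  unfolding hat_def by (intro continuous_intros continuous_on_compose2[OF flat_exp_continuous[of UNIV]]) auto

lemma hat_eq_0: "t \<le> 0 \<or> 1 \<le> t \<Longrightarrow> hat t = 0"
  by (auto simp: hat_def flat_exp_def)

lemma hat_nonneg: "0 \<le> hat t"
  by (simp add: hat_def flat_exp_nonneg)

lemma hat_pos: "0 < t \<Longrightarrow> t < 1 \<Longrightarrow> 0 < hat t"
  by (simp add: hat_def flat_exp_def)

lemma hat_integral_neg: "t \<le> 0 \<Longrightarrow> integral {-1..t} hat = 0"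
  using integral_cong[of "{-1..t}" hat "\<lambda>_. 0"] by (simp add: hat_eq_0)

text \<open>The lower limit \<open>-1\<close> lies strictly left of the support of \<open>hat\<close>, so that the fundamental theorem
  applies at every \<open>t \<ge> 0\<close> as an interior point.\<close>

lemma hat_integral_DERIV: "((\<lambda>t. integral {-1..t} hat) has_real_derivative hat t) (at t)"
proof (cases "t < 0")
  case True
  have "((\<lambda>t. 0) has_real_derivative hat t) (at t)" using True by (simp add: hat_eq_0)
  then show ?thesis
    by (rule has_field_derivative_transform_within_open[of _ _ _ "{..<0}"]) (use True in \<open>auto simp: hat_integral_neg\<close>)
next
  case False
  have "((\<lambda>t. integral {-1..t} hat) has_real_derivative hat t) (at t within {-1..t+1})"
    by (rule integral_has_real_derivative) (use False hat_continuous in auto)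
  moreover have "t \<in> interior {-1..t+1}" using False by (simp add: interior_atLeastAtMost_real)
  ultimately show ?thesis by (metis at_within_interior)
qed

lemma hat_integral_mono: "s \<le> t \<Longrightarrow> integral {-1..s} hat \<le> integral {-1..t} hat"
  using hat_integral_DERIV hat_nonneg by (metis DERIV_nonneg_imp_nondecreasing)

lemma hat_integral_pos: "0 < integral {-1..1} hat"
proof -
  have "integral {-1..0} hat < integral {-1..1} hat"
  proof (rule DERIV_pos_imp_increasing_open[where f="\<lambda>t. integral {-1..t} hat"])
    show "\<exists>y. ((\<lambda>t. integral {-1..t} hat) has_real_derivative y) (at x) \<and> 0 < y" if "0 < x" "x < 1" for x
      using hat_integral_DERIV hat_pos that by blast
    show "continuous_on {0..1} (\<lambda>t. integral {-1..t} hat)"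
      by (intro continuous_at_imp_continuous_on ballI DERIV_isCont[OF hat_integral_DERIV])
  qed simp
  then show ?thesis by (simp add: hat_integral_neg)
qed

lemma smooth_step_0: "t \<le> 0 \<Longrightarrow> smooth_step t = 0"
  by (simp add: smooth_step_def hat_integral_neg)

lemma smooth_step_1: "1 \<le> t \<Longrightarrow> smooth_step t = 1"
proof -
  assume t: "1 \<le> t"
  have "integral {-1..1} hat + integral {1..t} hat = integral {-1..t} hat"
    by (rule Henstock_Kurzweil_Integration.integral_combine) (use t hat_continuous in \<open>auto intro: integrable_continuous_interval\<close>)
  moreover have "integral {1..t} hat = 0"
    using integral_cong[of "{1..t}" hat "\<lambda>_. 0"] by (simp add: hat_eq_0)
  ultimately show ?thesis using hat_integral_pos by (simp add: smooth_step_def)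
qed

lemma smooth_step_bounds: "0 \<le> smooth_step t" "smooth_step t \<le> 1"
proof -
  have "integral {-1..t} hat \<ge> 0"
    using hat_integral_mono[of "min t 0" t] hat_integral_neg[of "min t 0"] by simp
  then show "0 \<le> smooth_step t" using hat_integral_pos by (simp add: smooth_step_def)
  show "smooth_step t \<le> 1"
  proof (cases "t \<le> 1")
    case True then show ?thesis using hat_integral_mono[OF True] hat_integral_pos by (simp add: smooth_step_def)
  next
    case False then show ?thesis by (simp add: smooth_step_1)
  qed
qed

lemma smooth_step_DERIV: "(smooth_step has_real_derivative hat t / integral {-1..1} hat) (at t)"
  unfolding smooth_step_def by (intro DERIV_cdivide hat_integral_DERIV)

text \<open>Differentiability of order \<open>N\<close>, stated through \<open>dbound\<close> with an unspecified majorant so that the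
  product and sum rules for families can be reused.\<close>

definition diff_order :: "nat \<Rightarrow> (real^'n::finite \<Rightarrow> complex) \<Rightarrow> bool" where
  "diff_order N f \<longleftrightarrow> (\<exists>W. (\<forall>z t. 0 \<le> W z t) \<and> dbound N W (\<lambda>_::unit. f))"

lemma diff_order_0: "diff_order 0 f"
  unfolding diff_order_def by (intro exI[of _ "\<lambda>_ t. norm (f t)"]) (auto intro!: exI[of _ 1])

lemma diff_order_SucI:
  fixes f :: "real^'n::finite \<Rightarrow> complex"
  assumes "\<And>x. f differentiable (at x)" "\<And>i. diff_order N (partial_deriv i f)"
  shows "diff_order (Suc N) f"
proof -
  from assms(2) obtain W where W: "\<And>i z t. 0 \<le> W i z t" "\<And>i. dbound N (W i) (\<lambda>_::unit. partial_deriv i f)"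
    unfolding diff_order_def by metis
  let ?W = "\<lambda>z t. norm (f t) + (\<Sum>i\<in>UNIV. W i z t)"
  have "W i z t \<le> 1 * ?W z t" for i z t
    using member_le_sum[of i UNIV "\<lambda>i. W i z t"] W(1) by (auto intro: add_increasing)
  then have "dbound N ?W (\<lambda>_::unit. partial_deriv i f)" for i
    by (rule dbound_mono[OF W(2)[of i] W(1)])
  moreover have "norm (f t) \<le> 1 * ?W z t" for z t by (simp add: sum_nonneg W)
  ultimately have "dbound (Suc N) ?W (\<lambda>_::unit. f)" using assms(1) by (auto intro!: exI[of _ 1])
  then show ?thesis unfolding diff_order_def using W(1) by (intro exI[of _ ?W]) (auto intro!: add_nonneg_nonneg sum_nonneg)
qed

lemma diff_order_add: "diff_order N f \<Longrightarrow> diff_order N g \<Longrightarrow> diff_order N (\<lambda>x. f x + g x)"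
proof -
  assume "diff_order N f" "diff_order N g"
  then obtain W W' where W: "\<And>z t. 0 \<le> W z t" "dbound N W (\<lambda>_::unit. f)" "\<And>z t. 0 \<le> W' z t" "dbound N W' (\<lambda>_::unit. g)"
    unfolding diff_order_def by metis
  have "dbound N (\<lambda>z t. W z t + W' z t) (\<lambda>_::unit. \<lambda>x. f x + g x)"
    by (intro dbound_add dbound_mono[OF W(2) W(1), of 1] dbound_mono[OF W(4) W(3), of 1]) (use W in auto)
  then show ?thesis unfolding diff_order_def using W by (intro exI[of _ "\<lambda>z t. W z t + W' z t"]) auto
qed

lemma diff_order_mult: "diff_order N f \<Longrightarrow> diff_order N g \<Longrightarrow> diff_order N (\<lambda>x. f x * g x)"
proof -
  assume "diff_order N f" "diff_order N g"
  then obtain W W' where W: "\<And>z t. 0 \<le> W z t" "dbound N W (\<lambda>_::unit. f)" "\<And>z t. 0 \<le> W' z t" "dbound N W' (\<lambda>_::unit. g)"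
    unfolding diff_order_def by metis
  from dbound_mult[OF W(2,4)] show ?thesis
    unfolding diff_order_def using W by (intro exI[of _ "\<lambda>z t. W z t * W' z t"]) auto
qed

lemma diff_order_const: "diff_order N (\<lambda>x. c)"
proof (induction N arbitrary: c)
  case 0 show ?case by (rule diff_order_0)
next
  case (Suc N)
  have "partial_deriv i (\<lambda>x. c) = (\<lambda>x::real^'a. 0)" for i by (simp add: partial_deriv_def fun_eq_iff)
  then show ?case by (intro diff_order_SucI) (simp_all add: Suc)
qed

lemma diff_order_prod:
  "finite I \<Longrightarrow> (\<And>i. i \<in> I \<Longrightarrow> diff_order N (f i)) \<Longrightarrow> diff_order N (\<lambda>x. \<Prod>i\<in>I. f i x)"
  by (induction I rule: finite_induct) (auto intro: diff_order_const diff_order_mult)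

lemma coordinate_derivative:
  assumes "(h has_real_derivative h') (at (a * (x::real^'n::finite) $ i + b))"
  shows "((\<lambda>x. complex_of_real (h (a * x $ i + b))) has_derivative (\<lambda>v. complex_of_real (h' * (a * v $ i)))) (at x)"
proof -
  have "((\<lambda>x::real^'n. a * x $ i + b) has_derivative (\<lambda>v. a * v $ i)) (at x)"
    by (auto intro!: derivative_eq_intros bounded_linear.has_derivative[OF bounded_linear_vec_nth])
  from has_derivative_compose[OF this assms[unfolded has_field_derivative_def]]
  have "((\<lambda>x. h (a * x $ i + b)) has_derivative (\<lambda>v. h' * (a * v $ i))) (at x)" .
  from has_derivative_of_real[OF this] show ?thesis .
qed

lemma diff_order_coordinate_SucI:
  assumes "\<And>t. (h has_real_derivative h' t) (at t)" "diff_order N (\<lambda>x::real^'n::finite. complex_of_real (h' (a * x $ i + b)))"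
  shows "diff_order (Suc N) (\<lambda>x::real^'n. complex_of_real (h (a * x $ i + b)))"
proof (rule diff_order_SucI)
  note D = coordinate_derivative[OF assms(1), where a=a and i=i and b=b]
  show "(\<lambda>x::real^'n. complex_of_real (h (a * x $ i + b))) differentiable (at x)" for x
    using D differentiable_def by blast
  fix j
  have "partial_deriv j (\<lambda>x::real^'n. complex_of_real (h (a * x $ i + b))) = (\<lambda>x. of_real (a * (if i = j then 1 else 0)) * complex_of_real (h' (a * x $ i + b)))"
    by (intro ext, subst partial_deriv_eqI[OF D]) (simp add: axis_def)
  then show "diff_order N (partial_deriv j (\<lambda>x::real^'n. complex_of_real (h (a * x $ i + b))))"
    by (simp only:) (intro diff_order_mult diff_order_const assms)
qed

lemma diff_order_flat_exp: "diff_order N (\<lambda>x::real^'n::finite. complex_of_real (flat_exp k (a * x $ i + b)))"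
proof (induction N arbitrary: k)
  case 0 show ?case by (rule diff_order_0)
next
  case (Suc N)
  have "diff_order N (\<lambda>x::real^'n. complex_of_real (flat_exp (k + 2) (a * x $ i + b)) + of_real (- real k) * complex_of_real (flat_exp (k + 1) (a * x $ i + b)))"
    by (intro diff_order_add diff_order_mult diff_order_const Suc)
  then show ?case by (intro diff_order_coordinate_SucI[OF flat_exp_DERIV]) simp
qed

lemma diff_order_smooth_step: "diff_order N (\<lambda>x::real^'n::finite. complex_of_real (smooth_step (a * x $ i + b)))"
proof (cases N)
  case 0 then show ?thesis by (simp add: diff_order_0)
next
  case (Suc M)
  have "diff_order M (\<lambda>x::real^'n. complex_of_real (flat_exp 0 (a * x $ i + b)) * complex_of_real (flat_exp 0 ((- a) * x $ i + (1 - b))) * of_real (inverse (integral {-1..1} hat)))"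
    by (intro diff_order_mult diff_order_const diff_order_flat_exp)
  then show ?thesis unfolding Suc
    by (intro diff_order_coordinate_SucI[OF smooth_step_DERIV]) (simp add: hat_def divide_inverse algebra_simps)
qed

text \<open>The derivatives are continuous and vanish outside a ball.\<close>

lemma schwartz_compact_support:
  fixes f :: "real^'n::finite \<Rightarrow> complex"
  assumes d: "\<And>N. diff_order N f" and supp: "\<And>x. R < norm x \<Longrightarrow> f x = 0"
  shows "f \<in> schwartz"
proof -
  have diff: "iter_deriv is f differentiable (at x)" for "is" x
  proof -
    obtain W where "dbound (Suc (length is)) W (\<lambda>_::unit. f)" using d[of "Suc (length is)"] unfolding diff_order_def by blast
    from dbound_iter_deriv[OF this, of "is"] show ?thesis by simp
  qed
  have zero: "R < norm x \<Longrightarrow> iter_deriv is f x = 0" for "is" x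
  proof (induction "is" arbitrary: x)
    case Nil then show ?case by (simp add: supp)
  next
    case (Cons i "is")
    have "open {x::real^'n. R < norm x}" by (intro open_Collect_less continuous_intros)
    then have "((\<lambda>x. iter_deriv is f x) has_derivative (\<lambda>h. 0)) (at x)"
      by (rule has_derivative_transform_within_open[OF has_derivative_const]) (use Cons in auto)
    from partial_deriv_eqI[OF this] show ?case by (simp add: iter_deriv_Cons)
  qed
  have "bounded (range (\<lambda>x. japanese x ^ k *\<^sub>R iter_deriv is f x))" for k "is"
  proof -
    have cont: "continuous_on UNIV (iter_deriv is f)"
      by (meson diff differentiable_imp_continuous_within continuous_at_imp_continuous_on)
    have "compact ((\<lambda>x. japanese x ^ k *\<^sub>R iter_deriv is f x) ` cball 0 R)"
      by (intro compact_continuous_image continuous_intros continuous_on_subset[OF cont]) auto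
    then have "bounded (insert 0 ((\<lambda>x. japanese x ^ k *\<^sub>R iter_deriv is f x) ` cball 0 R))"
      by (simp add: compact_imp_bounded)
    then show ?thesis by (rule bounded_subset) (use zero in \<open>force simp: not_le\<close>)
  qed
  then show ?thesis using diff by (auto simp: schwartz_def smooth_def differentiable_on_def)
qed

text \<open>A product over the coordinates of rising and falling steps. Since the Euclidean norm is at most the
  sum of the moduli of the coordinates, some coordinate is large whenever the norm exceeds \<open>1\<close>; this
  determines the slope \<open>a\<close>.\<close>

lemma plateau_exists:
  obtains \<beta> :: "real^'n::finite \<Rightarrow> real" and r where "0 < r" "(\<lambda>x. complex_of_real (\<beta> x)) \<in> schwartz"
    "\<And>x. 0 \<le> \<beta> x" "\<And>x. \<beta> x \<le> 1" "\<And>x. norm x \<le> r \<Longrightarrow> \<beta> x = 1" "\<And>x. 1 < norm x \<Longrightarrow> \<beta> x = 0"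
proof -
  define a where "a = 2 * real CARD('n)"
  have a: "0 < a" by (simp add: a_def)
  define \<beta> where "\<beta> x = (\<Prod>i\<in>UNIV. smooth_step (a * x $ i + 2) * smooth_step ((- a) * x $ i + 2))" for x :: "real^'n"
  have out: "\<beta> x = 0" if "1 < norm x" for x
  proof -
    have "\<exists>i. 2 \<le> a * \<bar>x $ i\<bar>"
    proof (rule ccontr)
      assume "\<not> ?thesis"
      then have "\<And>i. \<bar>x $ i\<bar> \<le> 2 / a" using a by (simp add: not_le field_simps less_imp_le)
      then have "(\<Sum>i\<in>UNIV. \<bar>x $ i\<bar>) \<le> (\<Sum>i\<in>(UNIV::'n set). 2 / a)" by (intro sum_mono)
      also have "\<dots> = 1" by (simp add: a_def)
      finally show False using norm_le_l1_cart[of x] that by linarith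
    qed
    then obtain i where i: "2 \<le> a * \<bar>x $ i\<bar>" by blast
    then have "a * x $ i + 2 \<le> 0 \<or> (- a) * x $ i + 2 \<le> 0" by (auto simp: abs_if split: if_splits)
    then have "smooth_step (a * x $ i + 2) * smooth_step ((- a) * x $ i + 2) = 0"
      using smooth_step_0 by fastforce
    then show ?thesis unfolding \<beta>_def by (intro prod_zero) auto
  qed
  have S: "(\<lambda>x. complex_of_real (\<beta> x)) \<in> schwartz"
  proof (rule schwartz_compact_support)
    show "diff_order N (\<lambda>x. complex_of_real (\<beta> x))" for N
      unfolding \<beta>_def of_real_prod of_real_mult
      by (intro diff_order_prod diff_order_mult diff_order_smooth_step) simp
  qed (use out in auto)
  have one: "\<beta> x = 1" if "norm x \<le> 1 / a" for x
  proof -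
    have "smooth_step (a * x $ i + 2) = 1 \<and> smooth_step ((- a) * x $ i + 2) = 1" for i
    proof -
      have "\<bar>x $ i\<bar> \<le> 1 / a" using component_le_norm_cart[of x i] that by linarith
      then have "\<bar>a * x $ i\<bar> \<le> 1" using a by (simp add: abs_mult field_simps)
      then show ?thesis by (intro conjI smooth_step_1) (auto simp: abs_le_iff)
    qed
    then show ?thesis by (simp add: \<beta>_def)
  qed
  show ?thesis
  proof (rule that[of "1 / a" \<beta>])
    show "0 \<le> \<beta> x" for x unfolding \<beta>_def by (intro prod_nonneg ballI mult_nonneg_nonneg smooth_step_bounds)
    show "\<beta> x \<le> 1" for x unfolding \<beta>_def
      by (intro prod_le_1 ballI conjI mult_nonneg_nonneg mult_le_one smooth_step_bounds)
  qed (use a S out one in auto)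
qed

lemma schwartz_affine:
  fixes \<phi> :: "real^'n::finite \<Rightarrow> complex"
  assumes \<phi>: "\<phi> \<in> schwartz" and a: "a \<noteq> 0"
  shows "(\<lambda>t. \<phi> (a *\<^sub>R t + b)) \<in> schwartz"
  unfolding schwartz_iff_dbound
proof (intro allI)
  fix N k
  define c where "c = max 1 (inverse \<bar>a\<bar>)"
  have c: "1 \<le> c" "inverse \<bar>a\<bar> \<le> c" by (auto simp: c_def)
  have j: "japanese t \<le> c * japanese (a *\<^sub>R t)" for t :: "real^'n"
  proof -
    have "norm t = inverse \<bar>a\<bar> * norm (a *\<^sub>R t)" using a by simp
    also have "\<dots> \<le> c * norm (a *\<^sub>R t)" by (intro mult_right_mono c) auto
    finally have "(norm t)\<^sup>2 \<le> (c * norm (a *\<^sub>R t))\<^sup>2" by (intro power_mono) auto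
    moreover have "1 \<le> c\<^sup>2" using c by (simp add: one_le_power)
    ultimately have "1 + (norm t)\<^sup>2 \<le> (c * japanese (a *\<^sub>R t))\<^sup>2"
      by (simp only: power_mult_distrib japanese_sq) (simp add: algebra_simps)
    then show ?thesis unfolding japanese_def[of t] using c by (intro real_le_lsqrt) auto
  qed
  have le: "decay k (a *\<^sub>R t + b) \<le> (2 ^ k * japanese b ^ k * c ^ k) * decay k t" for t :: "real^'n"
  proof -
    have "decay k (a *\<^sub>R t + b) \<le> 2 ^ k * japanese (- b) ^ k * decay k (a *\<^sub>R t + b + - b)" by (rule decay_shift)
    also have "decay k (a *\<^sub>R t + b + - b) \<le> c ^ k * decay k t"
    proof -
      have "japanese t ^ k \<le> (c * japanese (a *\<^sub>R t)) ^ k" by (intro power_mono j) auto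
      then show ?thesis by (simp add: decay_def power_mult_distrib field_simps)
    qed
    finally show ?thesis by (simp add: mult_ac mult_left_mono)
  qed
  have "dbound N (\<lambda>_ t. decay k (a *\<^sub>R t + b)) (\<lambda>_::unit. \<lambda>t. \<phi> (a *\<^sub>R t + b))"
    using dbound_affine[OF schwartz_dbound[OF \<phi>, of N k], of "\<lambda>_. a" "\<bar>a\<bar>" "\<lambda>_. b"] by simp
  then show "dbound N (\<lambda>_ t. decay k t) (\<lambda>_::unit. \<lambda>t. \<phi> (a *\<^sub>R t + b))"
    by (rule dbound_mono) (use le in auto)
qed

section \<open>The function of a distribution\<close>

text \<open>Test against a plateau at a point where the functions differ, supported so close to it that the
  difference keeps its direction in the complex plane.\<close>

lemma continuous_eq_by_testing:
  fixes f g :: "real^'n::finite \<Rightarrow> complex"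
  assumes cont: "continuous_on UNIV f" "continuous_on UNIV g"
    and int: "\<And>\<psi>. \<psi> \<in> schwartz \<Longrightarrow> integrable lborel (\<lambda>x. f x * \<psi> x)" "\<And>\<psi>. \<psi> \<in> schwartz \<Longrightarrow> integrable lborel (\<lambda>x. g x * \<psi> x)"
    and eq: "\<And>\<psi>. \<psi> \<in> schwartz \<Longrightarrow> (\<integral>x. f x * \<psi> x \<partial>lborel) = (\<integral>x. g x * \<psi> x \<partial>lborel)"
  shows "f = g"
proof (rule ccontr)
  assume "f \<noteq> g"
  then obtain x0 where x0: "f x0 \<noteq> g x0" by auto
  \<comment> \<open>Multiplying by the conjugate turns the difference at \<open>x0\<close> into a positive number, so the real part
    of \<open>d\<close> is positive near \<open>x0\<close>.\<close>
  define d where "d x = (f x - g x) * cnj (f x0 - g x0)" for x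
  have dc: "continuous_on UNIV (\<lambda>x. Re (d x))" unfolding d_def by (intro continuous_intros cont)
  have "d x0 = of_real ((norm (f x0 - g x0))\<^sup>2)" unfolding d_def by (rule complex_norm_square[symmetric])
  then have d0: "0 < Re (d x0)" using x0 by simp
  have "open {x. 0 < Re (d x)}" by (intro open_Collect_less dc continuous_intros)
  then obtain \<delta> where \<delta>: "0 < \<delta>" "\<And>x. dist x x0 < \<delta> \<Longrightarrow> 0 < Re (d x)"
    using d0 unfolding open_dist by auto
  obtain \<beta> :: "real^'n \<Rightarrow> real" and r where \<beta>: "0 < r" "(\<lambda>x. complex_of_real (\<beta> x)) \<in> schwartz"
    "\<And>x. 0 \<le> \<beta> x" "\<And>x. norm x \<le> r \<Longrightarrow> \<beta> x = 1" "\<And>x. 1 < norm x \<Longrightarrow> \<beta> x = 0"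
    using plateau_exists[where 'n='n] by metis
  define \<psi> where "\<psi> x = cnj (f x0 - g x0) * complex_of_real (\<beta> ((2 / \<delta>) *\<^sub>R x + (- (2 / \<delta>)) *\<^sub>R x0))" for x
  have \<psi>: "\<psi> \<in> schwartz"
    unfolding \<psi>_def by (intro schwartz_cmult schwartz_affine[OF \<beta>(2)]) (use \<delta> in auto)
  let ?h = "\<lambda>x. Re (d x) * \<beta> ((2 / \<delta>) *\<^sub>R x + (- (2 / \<delta>)) *\<^sub>R x0)"
  have h: "?h x = Re (f x * \<psi> x - g x * \<psi> x)" for x
    by (simp add: d_def \<psi>_def algebra_simps)
  have I: "integrable lborel (\<lambda>x. f x * \<psi> x - g x * \<psi> x)" by (intro Bochner_Integration.integrable_diff int \<psi>)
  have "?h x0 = 0"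
  proof (rule continuous_nonneg_integral_eq_0[where h="?h"])
    show "continuous_on UNIV ?h" unfolding h
      by (intro continuous_intros cont schwartz_continuous[OF \<psi>])
    show "integrable lborel ?h" unfolding h using I by (rule integrable_Re)
    have "(\<integral>x. ?h x \<partial>lborel) = Re (\<integral>x. f x * \<psi> x - g x * \<psi> x \<partial>lborel)" unfolding h by (rule integral_Re[OF I])
    also have "\<dots> = 0" using int[OF \<psi>] eq[OF \<psi>] by simp
    finally show "(\<integral>x. ?h x \<partial>lborel) = 0" .
    fix x
    show "0 \<le> ?h x"
    proof (cases "dist x x0 < \<delta>")
      case True
      then show ?thesis using \<delta>(2)[OF True] \<beta>(3) by (simp add: less_imp_le)
    next
      case False
      have "norm ((2 / \<delta>) *\<^sub>R x + (- (2 / \<delta>)) *\<^sub>R x0) = (2 / \<delta>) * dist x x0"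
        using \<delta>(1) by (simp add: dist_norm flip: scaleR_right_diff_distrib)
      also have "\<dots> \<ge> (2 / \<delta>) * \<delta>" using False \<delta>(1) by (intro mult_left_mono) auto
      finally have "1 < norm ((2 / \<delta>) *\<^sub>R x + (- (2 / \<delta>)) *\<^sub>R x0)" using \<delta>(1) by simp
      then show ?thesis by (simp add: \<beta>(5))
    qed
  qed
  moreover have "\<beta> ((2 / \<delta>) *\<^sub>R x0 + (- (2 / \<delta>)) *\<^sub>R x0) = 1" using \<beta>(1) by (intro \<beta>(4)) simp
  ultimately show False using d0 by simp
qed

lemma fun_of_distr_of:
  fixes g :: "real^'n::finite \<Rightarrow> complex"
  assumes g: "bcont g" shows "fun_of (distr_of g) = g"
  unfolding fun_of_def
proof (rule the_equality)
  show "represents g (distr_of g)"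
    using bcont_integrable[OF g schwartz_integrable] by (auto simp: represents_def bcont_continuous[OF g])
  fix f assume f: "represents f (distr_of g)"
  show "f = g"
  proof (rule continuous_eq_by_testing)
    fix \<psi> :: "real^'n \<Rightarrow> complex" assume \<psi>: "\<psi> \<in> schwartz"
    show "integrable lborel (\<lambda>x. f x * \<psi> x)" "integrable lborel (\<lambda>x. g x * \<psi> x)"
      using f bcont_integrable[OF g schwartz_integrable] \<psi> by (auto simp: represents_def)
    have "distr_of f = distr_of g" using f by (auto simp: represents_def)
    then show "(\<integral>x. f x * \<psi> x \<partial>lborel) = (\<integral>x. g x * \<psi> x \<partial>lborel)"
      using distr_of_schwartz[OF \<psi>, of f] distr_of_schwartz[OF \<psi>, of g] by metis
  qed (use f bcont_continuous[OF g] in \<open>auto simp: represents_def\<close>)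
qed

context gabor
begin

abbreviation fun_norm :: "real \<Rightarrow> (real^'n \<Rightarrow> complex) \<Rightarrow> ennreal" where
  "fun_norm s g \<equiv> mod_norm \<phi> p s (distr_of g)"

text \<open>By \<open>modulation_space_eq\<close> these are exactly the functions that represent the elements of the
  modulation space. Working with functions avoids the description operator in \<open>fun_of\<close>.\<close>

definition mod_fun :: "real \<Rightarrow> (real^'n \<Rightarrow> complex) \<Rightarrow> bool" where
  "mod_fun s g \<longleftrightarrow> bcont g \<and> fun_norm s g < top"

definition V :: "(real^'n \<Rightarrow> complex) \<Rightarrow> real^'n \<Rightarrow> real^'n \<Rightarrow> complex" where
  "V g x \<xi> = ft (\<lambda>t. g t * cnj (\<phi> (t - x))) \<xi>"

lemma stft_distr_of: "stft \<phi> (distr_of g) = V g"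
proof (intro ext)
  fix x \<xi>
  show "stft \<phi> (distr_of g) x \<xi> = V g x \<xi>"
    unfolding stft_atom distr_of_schwartz[OF atom_schwartz[OF window]] V_def ft_def
    by (simp add: atom_def mult.assoc)
qed

definition stft_Lp :: "(real^'n \<Rightarrow> complex) \<Rightarrow> real^'n \<Rightarrow> ennreal" where
  "stft_Lp g \<xi> = Lp p (\<lambda>x. ennreal (norm (V g x \<xi>)))"

lemma fun_norm_eq: "fun_norm s g = (\<integral>\<^sup>+\<xi>. wt s \<xi> * stft_Lp g \<xi> \<partial>lborel)"
  unfolding mod_norm_eq[OF p] stft_distr_of stft_Lp_def ..

lemma V_measurable:
  assumes "bcont g" "f \<in> borel_measurable M" "h \<in> borel_measurable M"
  shows "(\<lambda>w. V g (f w) (h w)) \<in> borel_measurable M"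
  using stft_measurable[OF window distr_of_tempered[OF assms(1)] assms(2,3)] by (simp add: stft_distr_of)

lemma V_continuous: "bcont g \<Longrightarrow> continuous_on UNIV (\<lambda>z. V g (fst z) (snd z))"
  using stft_continuous[OF window distr_of_tempered] by (simp add: stft_distr_of)

lemma stft_Lp_measurable:
  assumes g: "bcont g" shows "stft_Lp g \<in> borel_measurable borel"
proof -
  note [measurable] = V_measurable[OF g]
  have "(\<lambda>\<eta>. Lp p (\<lambda>x. ennreal (norm (V g x \<eta>)))) \<in> borel_measurable borel" by measurable
  then show ?thesis by (simp add: stft_Lp_def[abs_def])
qed

lemma mod_fun_bcont: "mod_fun s g \<Longrightarrow> bcont g" and mod_fun_finite: "mod_fun s g \<Longrightarrow> fun_norm s g < top"
  by (auto simp: mod_fun_def)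

lemma mod_fun_0: "0 \<le> s \<Longrightarrow> mod_fun s g \<Longrightarrow> mod_fun 0 g"
  unfolding mod_fun_def using mod_norm_mono_weight[OF p] le_less_trans by blast

lemma synth_distr_of: "mod_fun 0 g \<Longrightarrow> synth (distr_of g) = g"
  using distr_of_synth[OF distr_of_tempered] synth_bcont(1)[OF distr_of_tempered] fun_of_distr_of
  unfolding mod_fun_def by metis

lemma modulation_space_eq:
  assumes s: "0 \<le> s" shows "modulation_space \<phi> p s = distr_of ` {g. mod_fun s g}"
proof safe
  fix u assume "u \<in> modulation_space \<phi> p s"
  then have u: "u \<in> tempered" "mod_norm \<phi> p s u < top" by (auto simp: modulation_space_def)
  then have u0: "mod_norm \<phi> p 0 u < top" using mod_norm_mono_weight[OF p s] le_less_trans by blast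
  have "u = distr_of (synth u)" "bcont (synth u)"
    using distr_of_synth[OF u(1) u0] synth_bcont(1)[OF u(1) u0] by auto
  then show "u \<in> distr_of ` {g. mod_fun s g}" using u by (auto simp: mod_fun_def)
next
  fix g assume "mod_fun s g"
  then show "distr_of g \<in> modulation_space \<phi> p s"
    by (auto simp: mod_fun_def modulation_space_def distr_of_tempered)
qed

lemma point_evaluation_bound:
  obtains C where "0 \<le> C" "\<And>g t. mod_fun 0 g \<Longrightarrow> norm (g t) \<le> C * enn2real (fun_norm 0 g)"
proof (cases "\<exists>g. mod_fun 0 g")
  case False then show ?thesis using that[of 0] by auto
next
  case True
  then obtain g0 where g0: "mod_fun 0 g0" by blast
  obtain C where C: "0 \<le> C" "\<And>u t. u \<in> tempered \<Longrightarrow> mod_norm \<phi> p 0 u < top \<Longrightarrow> norm (synth u t) \<le> C * enn2real (mod_norm \<phi> p 0 u)"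
    using synth_bcont(2)[OF distr_of_tempered[OF mod_fun_bcont[OF g0]] mod_fun_finite[OF g0]] by blast
  then show ?thesis
    using that[of C] by (metis synth_distr_of distr_of_tempered mod_fun_bcont mod_fun_finite)
qed

text \<open>Norm estimates below are obtained from pointwise estimates of the short-time Fourier transform.\<close>

lemma V_bound_imp_fun_norm_le:
  assumes "\<And>x \<xi>. ennreal (norm (V g x \<xi>)) \<le> G x \<xi>"
  shows "fun_norm s g \<le> (\<integral>\<^sup>+\<xi>. wt s \<xi> * Lp p (\<lambda>x. G x \<xi>) \<partial>lborel)"
  unfolding fun_norm_eq stft_Lp_def by (intro nn_integral_mono mult_left_mono Lp_mono[OF p] assms) auto

lemma V_add:
  assumes "bcont f" "bcont g" shows "V (\<lambda>t. f t + g t) x \<xi> = V f x \<xi> + V g x \<xi>"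
  unfolding stft_distr_of[symmetric] stft_def distr_of_add[OF assms] ..

lemma V_cmult: "V (\<lambda>t. c * g t) x \<xi> = c * V g x \<xi>"
  unfolding stft_distr_of[symmetric] stft_def distr_of_cmult ..

lemma fun_norm_add_le:
  assumes f: "bcont f" and g: "bcont g" shows "fun_norm s (\<lambda>t. f t + g t) \<le> fun_norm s f + fun_norm s g"
proof -
  note [measurable] = V_measurable[OF f] V_measurable[OF g] stft_Lp_measurable[OF f] stft_Lp_measurable[OF g]
  have "fun_norm s (\<lambda>t. f t + g t) \<le> (\<integral>\<^sup>+\<xi>. wt s \<xi> * Lp p (\<lambda>x. ennreal (norm (V f x \<xi>)) + ennreal (norm (V g x \<xi>))) \<partial>lborel)"
    by (rule V_bound_imp_fun_norm_le) (simp add: V_add f g norm_triangle_ineq ennreal_leI flip: ennreal_plus)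
  also have "\<dots> \<le> (\<integral>\<^sup>+\<xi>. wt s \<xi> * stft_Lp f \<xi> + wt s \<xi> * stft_Lp g \<xi> \<partial>lborel)"
    unfolding stft_Lp_def distrib_left[symmetric] by (intro nn_integral_mono mult_left_mono Lp_add_le p) auto
  also have "\<dots> = fun_norm s f + fun_norm s g"
    unfolding fun_norm_eq by (simp add: nn_integral_add)
  finally show ?thesis .
qed

lemma mod_fun_add: "mod_fun s f \<Longrightarrow> mod_fun s g \<Longrightarrow> mod_fun s (\<lambda>t. f t + g t)"
  using fun_norm_add_le[of f g s] by (auto simp: mod_fun_def bcont_add intro: le_less_trans)

lemma mod_fun_cmult:
  assumes "mod_fun s g" shows "mod_fun s (\<lambda>t. c * g t)"
proof -
  note g = mod_fun_bcont[OF assms]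
  note [measurable] = V_measurable[OF g] stft_Lp_measurable[OF g]
  have "fun_norm s (\<lambda>t. c * g t) = (\<integral>\<^sup>+\<xi>. wt s \<xi> * (ennreal (norm c) * stft_Lp g \<xi>) \<partial>lborel)"
    unfolding fun_norm_eq stft_Lp_def V_cmult norm_mult by (simp add: ennreal_mult Lp_cmult[OF p])
  also have "\<dots> = (\<integral>\<^sup>+\<xi>. ennreal (norm c) * (wt s \<xi> * stft_Lp g \<xi>) \<partial>lborel)" by (simp add: mult_ac)
  also have "\<dots> = ennreal (norm c) * fun_norm s g" unfolding fun_norm_eq by (subst nn_integral_cmult) auto
  also have "\<dots> < top" using mod_fun_finite[OF assms] by (simp add: ennreal_mult_less_top)
  finally show ?thesis using bcont_cmult[OF g] by (simp add: mod_fun_def)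
qed

lemma mod_fun_diff: "mod_fun s f \<Longrightarrow> mod_fun s g \<Longrightarrow> mod_fun s (\<lambda>t. f t - g t)"
  using mod_fun_add[OF _ mod_fun_cmult[of s g "-1"]] by simp

text \<open>The short-time Fourier transform of a Schwartz function decreases rapidly, so it has finite norm for
  every weight and exponent.\<close>

lemma schwartz_mod_fun:
  assumes \<psi>: "\<psi> \<in> schwartz" shows "mod_fun s \<psi>"
proof -
  define m where "m = 2 * CARD('n) + nat \<lceil>s\<rceil>"
  have m: "2 * CARD('n) + nat \<lceil>s\<rceil> \<le> 2 * m"
  proof -
    have "m \<le> 2 * m" by simp
    then show ?thesis by (simp only: m_def)
  qed
  obtain C where C: "0 \<le> C" "\<And>x \<omega>. norm (ft (\<lambda>t. cnj (\<phi> (t - x)) * \<psi> t) \<omega>) \<le> C * decay (2 * m) \<omega> * decay (2 * CARD('n)) x"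
    using window_product_decay[OF schwartz_cnj[OF window] \<psi>, where m=m and k="2 * CARD('n)"] by blast
  have "fun_norm s \<psi> \<le> (\<integral>\<^sup>+\<xi>. wt s \<xi> * Lp p (\<lambda>x::real^'n. ennreal (C * decay (2 * m) \<xi>) * ennreal (decay (2 * CARD('n)) x)) \<partial>(lborel :: (real^'n) measure))"
  proof (rule V_bound_imp_fun_norm_le)
    fix x \<xi>
    have "norm (V \<psi> x \<xi>) \<le> C * decay (2 * m) \<xi> * decay (2 * CARD('n)) x"
      using C(2)[of x \<xi>] by (simp add: V_def mult.commute[of "\<psi> _"])
    then show "ennreal (norm (V \<psi> x \<xi>)) \<le> ennreal (C * decay (2 * m) \<xi>) * ennreal (decay (2 * CARD('n)) x)"
      using C(1) by (simp add: ennreal_mult[symmetric] ennreal_leI)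
  qed
  also have "\<dots> = (\<integral>\<^sup>+\<xi>. (wt s \<xi> * ennreal (decay (2 * m) \<xi>)) * (ennreal C * Lp p (\<lambda>x::real^'n. ennreal (decay (2 * CARD('n)) x))) \<partial>(lborel :: (real^'n) measure))"
    using C(1) by (simp add: Lp_cmult[OF p] ennreal_mult mult_ac)
  also have "\<dots> = (\<integral>\<^sup>+\<xi>. wt s \<xi> * ennreal (decay (2 * m) \<xi>) \<partial>(lborel :: (real^'n) measure)) * (ennreal C * Lp p (\<lambda>x::real^'n. ennreal (decay (2 * CARD('n)) x)))"
    by (rule nn_integral_multc) simp
  also have "\<dots> < top"
  proof -
    have "Lp p (\<lambda>x::real^'n. ennreal (decay (2 * CARD('n)) x)) \<le> ennreal_powr (decay_mass TYPE('n)) (1 / p)"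
      unfolding decay_mass_def by (rule Lp_le_integral[OF p]) (simp add: decay_le_1)
    also have "\<dots> < top" using decay_mass_finite[where 'n='n] by simp
    finally show ?thesis
      using wt_decay_finite[OF m] by (simp add: ennreal_mult_less_top)
  qed
  finally show ?thesis using bcont_schwartz[OF \<psi>] by (simp add: mod_fun_def)
qed

section \<open>Short-time Fourier transforms of products\<close>

text \<open>The modulus of the short-time Fourier transform, averaged in time with a rapidly decaying kernel.
  It measures how much of the frequency \<open>\<eta>\<close> is present in \<open>g\<close> near \<open>t\<close>. The average is bounded in time by the
  \<open>L\<^sup>p\<close> norm in time of the transform.\<close>

definition local_stft :: "(real^'n \<Rightarrow> complex) \<Rightarrow> real^'n \<Rightarrow> real^'n \<Rightarrow> ennreal" where
  "local_stft g t \<eta> = (\<integral>\<^sup>+y. ennreal (decay (2 * CARD('n)) (t - y)) * ennreal (norm (V g y \<eta>)) \<partial>lborel)"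

lemma local_stft_measurable:
  assumes g: "bcont g" and [measurable]: "f \<in> borel_measurable M" "h \<in> borel_measurable M"
  shows "(\<lambda>w. local_stft g (f w) (h w)) \<in> borel_measurable M"
proof -
  note [measurable] = V_measurable[OF g]
  show ?thesis unfolding local_stft_def by measurable
qed

lemma local_stft_le:
  assumes g: "bcont g" shows "local_stft g t \<eta> \<le> (decay_mass TYPE('n) + 1) * stft_Lp g \<eta>"
proof -
  note [measurable] = V_measurable[OF g]
  have "local_stft g t \<eta> \<le> ((\<integral>\<^sup>+y. ennreal (decay (2 * CARD('n)) (t - y)) \<partial>(lborel :: (real^'n) measure)) + 1) * stft_Lp g \<eta>"
    unfolding local_stft_def stft_Lp_def by (rule pointwise_le_Lp[OF p]) (auto simp: decay_le_1)
  also have "(\<integral>\<^sup>+y. ennreal (decay (2 * CARD('n)) (t - y)) \<partial>(lborel :: (real^'n) measure)) = decay_mass TYPE('n)"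
    unfolding decay_mass_def by (rule nn_integral_lborel_reflect[of "\<lambda>y. ennreal (decay (2 * CARD('n)) y)"]) simp
  finally show ?thesis .
qed

lemma Lp_local_stft:
  assumes g: "bcont g" shows "Lp p (\<lambda>t. local_stft g t \<eta>) \<le> decay_mass TYPE('n) * stft_Lp g \<eta>"
proof -
  note [measurable] = V_measurable[OF g]
  show ?thesis unfolding local_stft_def stft_Lp_def decay_mass_def
    by (rule Lp_convolution[OF p, of "\<lambda>y. ennreal (decay (2 * CARD('n)) y)"]) measurable
qed

text \<open>Expand \<open>g\<close> by the reproducing formula. Each atom, multiplied by \<open>P z\<close>, has a Fourier transform that
  is concentrated near the frequency \<open>\<eta>\<close> of the atom, with size given by the overlap of the window
  with \<open>W z\<close>. Hence the transform of the product spreads the frequencies of \<open>g\<close> present in the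
  region described by \<open>W z\<close> by at most a rapidly decaying kernel. The constant depends on the family
  \<open>P\<close> but neither on \<open>g\<close> nor on the parameter.\<close>

lemma product_ft_bound:
  fixes P :: "'z \<Rightarrow> real^'n \<Rightarrow> complex"
  assumes P: "dbound (Suc (2 * m)) W P" and W0: "\<And>z t. 0 \<le> W z t" and Wint: "\<And>z. integrable lborel (W z)"
  obtains C where "0 \<le> C" "\<And>g z \<omega>. mod_fun 0 g \<Longrightarrow> ennreal (norm (ft (\<lambda>t. g t * P z t) \<omega>)) \<le>
     ennreal C * (\<integral>\<^sup>+\<eta>. (\<integral>\<^sup>+t. ennreal (W z t) * local_stft g t \<eta> \<partial>lborel) * ennreal (decay (2 * m) (\<omega> - \<eta>)) \<partial>lborel)"
proof -
  have Pm: "P z \<in> borel_measurable borel" for z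
    by (intro borel_measurable_continuous_onI dbound_continuous[OF P])
  have Wm [measurable]: "W z \<in> borel_measurable borel" for z using borel_measurable_integrable[OF Wint] by simp
  obtain B where B: "0 \<le> B" "\<And>z t. norm (P z t) \<le> B * W z t" using dbound_bound[OF P W0] by blast
  have Pint: "integrable lborel (P z)" for z by (rule integrable_lborel_bounded[OF Pm Wint B(2)])
  let ?d = "decay (2 * CARD('n)) :: real^'n \<Rightarrow> real"
  let ?W = "\<lambda>(z, y) t. ?d (t - y) * W z t"
  have d: "dbound (Suc (2 * m)) (\<lambda>q t. ?d (t - snd q) * W (fst q) t) (\<lambda>q t. \<phi> (t - snd q) * P (fst q) t)"
    by (intro dbound_mult dbound_window[OF window] dbound_reindex[OF P])
  have I2: "integrable lborel (\<lambda>t. ?d (t - y) * W z t)" for z y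
    by (rule integrable_lborel_bounded[OF _ Wint[of z], of _ 1]) (auto simp: abs_mult W0 mult_left_le_one_le decay_le_1)
  obtain C where C: "0 \<le> C" "\<And>q \<omega>. norm (ft (\<lambda>t. \<phi> (t - snd q) * P (fst q) t) \<omega>) \<le> C * decay (2 * m) \<omega> * (\<integral>t. ?d (t - snd q) * W (fst q) t \<partial>lborel)"
    by (rule ft_decay[OF d]) (auto simp: W0 I2)
  have main: "ennreal (norm (ft (\<lambda>t. g t * P z t) \<omega>)) \<le>
     ennreal (gabor_const * C) * (\<integral>\<^sup>+\<eta>. (\<integral>\<^sup>+t. ennreal (W z t) * local_stft g t \<eta> \<partial>lborel) * ennreal (decay (2 * m) (\<omega> - \<eta>)) \<partial>lborel)"
    if g: "mod_fun 0 g" for g z \<omega>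
  proof -
    note [measurable] = V_measurable[OF mod_fun_bcont[OF g]] local_stft_measurable[OF mod_fun_bcont[OF g]]
    \<comment> \<open>Pairing \<open>g\<close> with \<open>?\<psi>\<close> gives the Fourier transform of the product at \<open>\<omega>\<close>.\<close>
    let ?\<psi> = "\<lambda>t. P z t * cis (- (t \<bullet> \<omega>))"
    have co: "coatom \<phi> ?\<psi> (y, \<eta>) = ft (\<lambda>t. \<phi> (t - y) * P z t) (\<omega> - \<eta>)" for y \<eta>
      unfolding coatom_def ft_def
      by (intro Bochner_Integration.integral_cong) (auto simp: mult.assoc cis_mult inner_diff_right)
    have cb: "norm (coatom \<phi> ?\<psi> (y, \<eta>)) \<le> C * decay (2 * m) (\<omega> - \<eta>) * (\<integral>t. ?d (t - y) * W z t \<partial>lborel)" for y \<eta>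
      unfolding co using C(2)[of "(z, y)" "\<omega> - \<eta>"] by simp
    have nnW: "ennreal (\<integral>t. ?d (t - y) * W z t \<partial>lborel) = (\<integral>\<^sup>+t. ennreal (?d (t - y)) * ennreal (W z t) \<partial>lborel)" for y
      using nn_integral_eq_integral[OF I2[of y z]] W0 by (simp add: ennreal_mult)
    have "ft (\<lambda>t. g t * P z t) \<omega> = (\<integral>t. synth (distr_of g) t * ?\<psi> t \<partial>lborel)"
      unfolding synth_distr_of[OF g] ft_def by (simp add: mult.assoc)
    also have "\<dots> = of_real gabor_const * (\<integral>w. coatom \<phi> ?\<psi> w * V g (fst w) (snd w) \<partial>lborel)"
      using synth_pairing[OF distr_of_tempered[OF mod_fun_bcont[OF g]] mod_fun_finite[OF g] integrable_ft[OF Pint]]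
      by (simp add: stft_distr_of)
    finally have "ennreal (norm (ft (\<lambda>t. g t * P z t) \<omega>)) = ennreal gabor_const * ennreal (norm (\<integral>w. coatom \<phi> ?\<psi> w * V g (fst w) (snd w) \<partial>lborel))"
      using gabor_const_pos by (simp add: norm_mult ennreal_mult)
    also have "\<dots> \<le> ennreal gabor_const * (\<integral>\<^sup>+w. ennreal (norm (coatom \<phi> ?\<psi> w * V g (fst w) (snd w))) \<partial>lborel)"
    proof (intro mult_left_mono)
      show "ennreal (norm (\<integral>w. coatom \<phi> ?\<psi> w * V g (fst w) (snd w) \<partial>lborel)) \<le> (\<integral>\<^sup>+w. ennreal (norm (coatom \<phi> ?\<psi> w * V g (fst w) (snd w))) \<partial>lborel)"
        \<comment> \<open>If the integrand is not integrable, the integral on the left is \<open>0\<close> by convention.\<close>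
        by (cases "integrable lborel (\<lambda>w. coatom \<phi> ?\<psi> w * V g (fst w) (snd w))")
           (auto simp: integral_norm_bound_ennreal not_integrable_integral_eq)
    qed simp
    also have "(\<integral>\<^sup>+w. ennreal (norm (coatom \<phi> ?\<psi> w * V g (fst w) (snd w))) \<partial>lborel) =
       (\<integral>\<^sup>+y. \<integral>\<^sup>+\<eta>. ennreal (norm (coatom \<phi> ?\<psi> (y, \<eta>) * V g y \<eta>)) \<partial>lborel \<partial>lborel)"
    proof -
      have [measurable]: "coatom \<phi> ?\<psi> \<in> borel_measurable borel"
        using borel_measurable_integrable[OF integrable_ft[OF Pint[of z], of \<omega>]] by (intro coatom_measurable) auto
      have [measurable]: "(\<lambda>w. V g (fst w) (snd w)) \<in> borel_measurable borel"
        by (intro borel_measurable_continuous_onI V_continuous mod_fun_bcont[OF g])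
      show ?thesis by (subst nn_integral_lborel_pair) auto
    qed
    also have "\<dots> \<le> (\<integral>\<^sup>+y. \<integral>\<^sup>+\<eta>. ennreal C * ((\<integral>\<^sup>+t. ennreal (?d (t - y)) * ennreal (W z t) \<partial>lborel) * (ennreal (norm (V g y \<eta>)) * ennreal (decay (2 * m) (\<omega> - \<eta>)))) \<partial>lborel \<partial>lborel)"
    proof (intro nn_integral_mono)
      fix y \<eta>
      have "norm (coatom \<phi> ?\<psi> (y, \<eta>) * V g y \<eta>) \<le> C * ((\<integral>t. ?d (t - y) * W z t \<partial>lborel) * (norm (V g y \<eta>) * decay (2 * m) (\<omega> - \<eta>)))"
        using mult_right_mono[OF cb[of y \<eta>], of "norm (V g y \<eta>)"] by (simp add: norm_mult mult_ac)
      moreover have "0 \<le> (\<integral>t. ?d (t - y) * W z t \<partial>lborel)" by (intro integral_nonneg_AE) (auto simp: W0)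
      ultimately show "ennreal (norm (coatom \<phi> ?\<psi> (y, \<eta>) * V g y \<eta>)) \<le> ennreal C * ((\<integral>\<^sup>+t. ennreal (?d (t - y)) * ennreal (W z t) \<partial>lborel) * (ennreal (norm (V g y \<eta>)) * ennreal (decay (2 * m) (\<omega> - \<eta>))))"
        unfolding nnW[symmetric] using C(1) by (simp add: ennreal_mult[symmetric] ennreal_leI)
    qed
    also have "\<dots> = ennreal C * (\<integral>\<^sup>+y. \<integral>\<^sup>+\<eta>. (\<integral>\<^sup>+t. ennreal (?d (t - y)) * ennreal (W z t) \<partial>lborel) * (ennreal (norm (V g y \<eta>)) * ennreal (decay (2 * m) (\<omega> - \<eta>))) \<partial>lborel \<partial>lborel)"
      by (simp add: nn_integral_cmult)
    also have "(\<integral>\<^sup>+y. \<integral>\<^sup>+\<eta>. (\<integral>\<^sup>+t. ennreal (?d (t - y)) * ennreal (W z t) \<partial>lborel) * (ennreal (norm (V g y \<eta>)) * ennreal (decay (2 * m) (\<omega> - \<eta>))) \<partial>lborel \<partial>lborel) =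
      (\<integral>\<^sup>+\<eta>. \<integral>\<^sup>+y. (\<integral>\<^sup>+t. ennreal (?d (t - y)) * ennreal (W z t) \<partial>lborel) * (ennreal (norm (V g y \<eta>)) * ennreal (decay (2 * m) (\<omega> - \<eta>))) \<partial>lborel \<partial>lborel)"
      by (rule lborel_pair.Fubini') measurable
    also have "\<dots> = (\<integral>\<^sup>+\<eta>. (\<integral>\<^sup>+t. ennreal (W z t) * local_stft g t \<eta> \<partial>lborel) * ennreal (decay (2 * m) (\<omega> - \<eta>)) \<partial>lborel)"
    proof (rule nn_integral_cong)
      fix \<eta>
      have "(\<integral>\<^sup>+y. (\<integral>\<^sup>+t. ennreal (?d (t - y)) * ennreal (W z t) \<partial>lborel) * (ennreal (norm (V g y \<eta>)) * ennreal (decay (2 * m) (\<omega> - \<eta>))) \<partial>lborel) =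
         (\<integral>\<^sup>+y. \<integral>\<^sup>+t. ennreal (W z t) * (ennreal (?d (t - y)) * ennreal (norm (V g y \<eta>))) \<partial>lborel \<partial>lborel) * ennreal (decay (2 * m) (\<omega> - \<eta>))"
      proof -
        have "(\<integral>\<^sup>+t. ennreal (W z t) * (ennreal (?d (t - y)) * ennreal (norm (V g y \<eta>))) \<partial>lborel) =
            (\<integral>\<^sup>+t. (ennreal (?d (t - y)) * ennreal (W z t)) * ennreal (norm (V g y \<eta>)) \<partial>lborel)" for y
          by (simp add: mult_ac)
        then have "(\<integral>\<^sup>+t. ennreal (W z t) * (ennreal (?d (t - y)) * ennreal (norm (V g y \<eta>))) \<partial>lborel) =
            (\<integral>\<^sup>+t. ennreal (?d (t - y)) * ennreal (W z t) \<partial>lborel) * ennreal (norm (V g y \<eta>))" for y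
          by (simp add: nn_integral_multc)
        then show ?thesis by (simp add: nn_integral_multc mult.assoc[symmetric])
      qed
      also have "(\<integral>\<^sup>+y. \<integral>\<^sup>+t. ennreal (W z t) * (ennreal (?d (t - y)) * ennreal (norm (V g y \<eta>))) \<partial>lborel \<partial>lborel) =
         (\<integral>\<^sup>+t. \<integral>\<^sup>+y. ennreal (W z t) * (ennreal (?d (t - y)) * ennreal (norm (V g y \<eta>))) \<partial>lborel \<partial>lborel)"
        by (rule lborel_pair.Fubini') measurable
      also have "\<dots> = (\<integral>\<^sup>+t. ennreal (W z t) * local_stft g t \<eta> \<partial>lborel)"
        unfolding local_stft_def by (simp add: nn_integral_cmult)
      finally show "(\<integral>\<^sup>+y. (\<integral>\<^sup>+t. ennreal (?d (t - y)) * ennreal (W z t) \<partial>lborel) * (ennreal (norm (V g y \<eta>)) * ennreal (decay (2 * m) (\<omega> - \<eta>))) \<partial>lborel) =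
         (\<integral>\<^sup>+t. ennreal (W z t) * local_stft g t \<eta> \<partial>lborel) * ennreal (decay (2 * m) (\<omega> - \<eta>))" .
    qed
    finally show ?thesis using C(1) gabor_const_pos by (simp add: ennreal_mult mult.assoc mult_left_mono)
  qed
  show ?thesis by (rule that[OF _ main]) (use C(1) gabor_const_pos in auto)
qed

text \<open>The bound of \<open>product_ft_bound\<close> for functions localised at \<open>x\<close>. Up to a constant it dominates the
  short-time Fourier transform of \<open>g h\<close> for all \<open>h\<close> with bounded derivatives, and by \<open>stft_majorant_finite\<close> it
  has finite modulation norm itself.\<close>

definition stft_majorant :: "nat \<Rightarrow> (real^'n \<Rightarrow> complex) \<Rightarrow> real^'n \<Rightarrow> real^'n \<Rightarrow> ennreal" where
  "stft_majorant m g x \<omega> = (\<integral>\<^sup>+\<eta>. (\<integral>\<^sup>+t. ennreal (decay (2 * CARD('n)) (t - x)) * local_stft g t \<eta> \<partial>lborel) * ennreal (decay (2 * m) (\<omega> - \<eta>)) \<partial>lborel)"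

lemma stft_majorant_measurable:
  assumes g: "bcont g" and [measurable]: "f \<in> borel_measurable M" "h \<in> borel_measurable M"
  shows "(\<lambda>w. stft_majorant m g (f w) (h w)) \<in> borel_measurable M"
proof -
  note [measurable] = local_stft_measurable[OF g]
  show ?thesis unfolding stft_majorant_def by measurable
qed

lemma Lp_stft_majorant:
  assumes g: "bcont g"
  shows "Lp p (\<lambda>x. stft_majorant m g x \<omega>) \<le> (decay_mass TYPE('n) * decay_mass TYPE('n)) * (\<integral>\<^sup>+\<eta>. stft_Lp g \<eta> * ennreal (decay (2 * m) (\<omega> - \<eta>)) \<partial>lborel)"
proof -
  note [measurable] = local_stft_measurable[OF g] stft_Lp_measurable[OF g]
  let ?k = "\<lambda>x \<eta>. \<integral>\<^sup>+t. ennreal (decay (2 * CARD('n)) (x - t)) * local_stft g t \<eta> \<partial>lborel"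
  have "Lp p (\<lambda>x. stft_majorant m g x \<omega>) \<le> (\<integral>\<^sup>+\<eta>. Lp p (\<lambda>x. ennreal (decay (2 * m) (\<omega> - \<eta>)) * ?k x \<eta>) \<partial>lborel)"
    unfolding stft_majorant_def decay_diff_commute[of _ _ "_ :: real^'n", where k="2 * CARD('n)"]
    by (subst mult.commute, rule minkowski_integral[OF p]) measurable
  also have "\<dots> \<le> (\<integral>\<^sup>+\<eta>. (decay_mass TYPE('n) * decay_mass TYPE('n)) * (stft_Lp g \<eta> * ennreal (decay (2 * m) (\<omega> - \<eta>))) \<partial>lborel)"
  proof (intro nn_integral_mono)
    fix \<eta>
    have "Lp p (\<lambda>x. ?k x \<eta>) \<le> decay_mass TYPE('n) * Lp p (\<lambda>t. local_stft g t \<eta>)"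
      unfolding decay_mass_def by (rule Lp_convolution[OF p, of "\<lambda>y. ennreal (decay (2 * CARD('n)) y)"]) measurable
    also have "\<dots> \<le> decay_mass TYPE('n) * (decay_mass TYPE('n) * stft_Lp g \<eta>)"
      by (intro mult_left_mono Lp_local_stft g) simp
    finally have "ennreal (decay (2 * m) (\<omega> - \<eta>)) * Lp p (\<lambda>x. ?k x \<eta>) \<le> ennreal (decay (2 * m) (\<omega> - \<eta>)) * (decay_mass TYPE('n) * (decay_mass TYPE('n) * stft_Lp g \<eta>))"
      by (intro mult_left_mono) auto
    moreover have "Lp p (\<lambda>x. ennreal (decay (2 * m) (\<omega> - \<eta>)) * ?k x \<eta>) = ennreal (decay (2 * m) (\<omega> - \<eta>)) * Lp p (\<lambda>x. ?k x \<eta>)"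
      by (rule Lp_cmult[OF p]) measurable
    ultimately show "Lp p (\<lambda>x. ennreal (decay (2 * m) (\<omega> - \<eta>)) * ?k x \<eta>) \<le> (decay_mass TYPE('n) * decay_mass TYPE('n)) * (stft_Lp g \<eta> * ennreal (decay (2 * m) (\<omega> - \<eta>)))"
      by (simp add: mult_ac)
  qed
  also have "\<dots> = (decay_mass TYPE('n) * decay_mass TYPE('n)) * (\<integral>\<^sup>+\<eta>. stft_Lp g \<eta> * ennreal (decay (2 * m) (\<omega> - \<eta>)) \<partial>lborel)"
    by (rule nn_integral_cmult) measurable
  finally show ?thesis .
qed

lemma stft_majorant_finite:
  assumes s: "0 \<le> s" and g: "mod_fun s g" and m: "2 * CARD('n) + nat \<lceil>s\<rceil> \<le> 2 * m"
  shows "(\<integral>\<^sup>+\<omega>. wt s \<omega> * Lp p (\<lambda>x. stft_majorant m g x \<omega>) \<partial>lborel) < top"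
proof -
  note [measurable] = stft_Lp_measurable[OF mod_fun_bcont[OF g]]
  let ?K = "decay_mass TYPE('n) * decay_mass TYPE('n)"
  have "(\<integral>\<^sup>+\<omega>. wt s \<omega> * Lp p (\<lambda>x. stft_majorant m g x \<omega>) \<partial>lborel) \<le> (\<integral>\<^sup>+\<omega>. ?K * (wt s \<omega> * (\<integral>\<^sup>+\<eta>. stft_Lp g \<eta> * ennreal (decay (2 * m) (\<omega> - \<eta>)) \<partial>lborel)) \<partial>lborel)"
    using mult_left_mono[OF Lp_stft_majorant[OF mod_fun_bcont[OF g], of m], of "wt s _"] by (intro nn_integral_mono) (simp add: mult_ac)
  also have "\<dots> = ?K * (\<integral>\<^sup>+\<omega>. wt s \<omega> * (\<integral>\<^sup>+\<eta>. stft_Lp g \<eta> * ennreal (decay (2 * m) (\<omega> - \<eta>)) \<partial>lborel) \<partial>lborel)"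
    by (rule nn_integral_cmult) measurable
  also have "\<dots> \<le> ?K * (ennreal (2 powr s) * (fun_norm s g * (\<integral>\<^sup>+\<zeta>. wt s \<zeta> * ennreal (decay (2 * m) \<zeta>) \<partial>(lborel :: (real^'n) measure))))"
    unfolding fun_norm_eq by (intro mult_left_mono weighted_convolution[OF s, where R="\<lambda>\<zeta>. ennreal (decay (2 * m) \<zeta>)"]) auto
  also have "\<dots> < top"
    using decay_mass_finite[where 'n='n] wt_decay_finite[OF m] mod_fun_finite[OF g] by (simp add: ennreal_mult_less_top)
  finally show ?thesis .
qed

lemma window_decay_integrable: "integrable lborel (\<lambda>t::real^'n. decay (2 * CARD('n)) (t - x))"
  by (subst integrable_lborel_translate) (auto intro: integrable_decay)

text \<open>Expand \<open>f\<close> by the reproducing formula. This expresses the short-time Fourier transform of \<open>f g\<close>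
  through Fourier transforms of \<open>g\<close> times products of two windows, to which \<open>product_ft_bound\<close>
  applies. The decay in the distance of the two windows is used up in bounding \<open>f\<close> in time, and what
  remains is a convolution in the frequency variable.\<close>

lemma mod_fun_mult:
  assumes s: "0 \<le> s" and f: "mod_fun s f" and g: "mod_fun s g"
  shows "mod_fun s (\<lambda>t. f t * g t)"
proof -
  define m where "m = 2 * CARD('n) + nat \<lceil>s\<rceil>"
  have m: "2 * CARD('n) + nat \<lceil>s\<rceil> \<le> 2 * m"
  proof -
    have "m \<le> 2 * m" by simp
    then show ?thesis by (simp only: m_def)
  qed
  note fb = mod_fun_bcont[OF f] and gb = mod_fun_bcont[OF g]
  note [measurable] = V_measurable[OF fb] V_measurable[OF gb] local_stft_measurable[OF fb] local_stft_measurable[OF gb]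
    stft_Lp_measurable[OF fb] stft_Lp_measurable[OF gb] stft_majorant_measurable[OF gb]
  let ?d = "decay (2 * CARD('n)) :: real^'n \<Rightarrow> real"
  let ?W = "\<lambda>q t. ?d (t - fst q) * ?d (t - snd q)"
  have d: "dbound (Suc (2 * m)) ?W (\<lambda>q t. \<phi> (t - fst q) * cnj (\<phi> (t - snd q)))"
    by (intro dbound_mult dbound_window[OF window])
  have I2: "integrable lborel (?W q)" for q
    by (rule integrable_lborel_bounded[OF _ window_decay_integrable[of "fst q"], of _ 1])
       (auto simp: abs_mult mult_right_le_one_le decay_le_1)
  obtain C where C: "0 \<le> C" "\<And>g q \<omega>. mod_fun 0 g \<Longrightarrow> ennreal (norm (ft (\<lambda>t. g t * (\<phi> (t - fst q) * cnj (\<phi> (t - snd q)))) \<omega>)) \<le>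
     ennreal C * (\<integral>\<^sup>+\<eta>. (\<integral>\<^sup>+t. ennreal (?W q t) * local_stft g t \<eta> \<partial>lborel) * ennreal (decay (2 * m) (\<omega> - \<eta>)) \<partial>lborel)"
    by (rule product_ft_bound[OF d _ I2]) auto
  define K where "K = ennreal (gabor_const * C) * (decay_mass TYPE('n) + 1)"
  \<comment> \<open>In time \<open>f\<close> is bounded and \<open>g\<close> keeps its \<open>L\<^sup>p\<close> norm; in frequency the two are convolved.\<close>
  have Vb: "ennreal (norm (V (\<lambda>t. f t * g t) x \<xi>)) \<le> K * (\<integral>\<^sup>+\<eta>. stft_Lp f \<eta> * stft_majorant m g x (\<xi> - \<eta>) \<partial>lborel)" for x \<xi>
  proof -
    let ?\<psi> = "\<lambda>t. g t * cnj (\<phi> (t - x)) * cis (- (t \<bullet> \<xi>))"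
    have "integrable lborel (\<lambda>t. g t * cnj (\<phi> (t - x)))"
      by (intro bcont_integrable[OF gb] schwartz_integrable schwartz_cnj schwartz_translate window)
    then have I: "integrable lborel ?\<psi>" by (rule integrable_ft)
    have co: "coatom \<phi> ?\<psi> (y, \<eta>) = ft (\<lambda>t. g t * (\<phi> (t - y) * cnj (\<phi> (t - x)))) (\<xi> - \<eta>)" for y \<eta>
      unfolding coatom_def ft_def
    proof (intro Bochner_Integration.integral_cong refl)
      fix t
      have "cis (- (t \<bullet> \<xi>)) * cis (t \<bullet> \<eta>) = cis (- (t \<bullet> (\<xi> - \<eta>)))" by (simp add: cis_mult inner_diff_right)
      then show "\<phi> (t - fst (y, \<eta>)) * ?\<psi> t * cis (t \<bullet> snd (y, \<eta>)) = g t * (\<phi> (t - y) * cnj (\<phi> (t - x))) * cis (- (t \<bullet> (\<xi> - \<eta>)))"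
        by (simp add: mult_ac)
    qed
    have cm: "coatom \<phi> ?\<psi> \<in> borel_measurable borel"
      using borel_measurable_integrable[OF I] by (intro coatom_measurable) auto
    have [measurable]: "(\<lambda>w. V f (fst w) (snd w)) \<in> borel_measurable borel"
      by (intro borel_measurable_continuous_onI V_continuous fb)
    have "V (\<lambda>t. f t * g t) x \<xi> = (\<integral>t. synth (distr_of f) t * ?\<psi> t \<partial>lborel)"
      unfolding synth_distr_of[OF mod_fun_0[OF s f]] V_def ft_def by (simp add: mult.assoc)
    also have "\<dots> = of_real gabor_const * (\<integral>w. coatom \<phi> ?\<psi> w * V f (fst w) (snd w) \<partial>lborel)"
      using synth_pairing[OF distr_of_tempered[OF fb] mod_fun_finite[OF mod_fun_0[OF s f]] I]
      by (simp add: stft_distr_of)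
    finally have "ennreal (norm (V (\<lambda>t. f t * g t) x \<xi>)) = ennreal gabor_const * ennreal (norm (\<integral>w. coatom \<phi> ?\<psi> w * V f (fst w) (snd w) \<partial>lborel))"
      using gabor_const_pos by (simp add: norm_mult ennreal_mult)
    also have "\<dots> \<le> ennreal gabor_const * (\<integral>\<^sup>+w. ennreal (norm (coatom \<phi> ?\<psi> w * V f (fst w) (snd w))) \<partial>lborel)"
    proof (intro mult_left_mono)
      show "ennreal (norm (\<integral>w. coatom \<phi> ?\<psi> w * V f (fst w) (snd w) \<partial>lborel)) \<le> (\<integral>\<^sup>+w. ennreal (norm (coatom \<phi> ?\<psi> w * V f (fst w) (snd w))) \<partial>lborel)"
        by (cases "integrable lborel (\<lambda>w. coatom \<phi> ?\<psi> w * V f (fst w) (snd w))")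
           (auto simp: integral_norm_bound_ennreal not_integrable_integral_eq)
    qed simp
    also have "(\<integral>\<^sup>+w. ennreal (norm (coatom \<phi> ?\<psi> w * V f (fst w) (snd w))) \<partial>lborel) =
       (\<integral>\<^sup>+y. \<integral>\<^sup>+\<eta>. ennreal (norm (coatom \<phi> ?\<psi> (y, \<eta>) * V f y \<eta>)) \<partial>lborel \<partial>lborel)"
      using cm by (subst nn_integral_lborel_pair) auto
    also have "\<dots> \<le> (\<integral>\<^sup>+y. \<integral>\<^sup>+\<eta>. ennreal C * (ennreal (norm (V f y \<eta>)) * (\<integral>\<^sup>+\<zeta>. (\<integral>\<^sup>+t. ennreal (?d (t - y)) * (ennreal (?d (t - x)) * local_stft g t \<zeta>) \<partial>lborel) * ennreal (decay (2 * m) (\<xi> - \<eta> - \<zeta>)) \<partial>lborel)) \<partial>lborel \<partial>lborel)"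
    proof (intro nn_integral_mono)
      fix y \<eta>
      have "ennreal (norm (coatom \<phi> ?\<psi> (y, \<eta>))) \<le> ennreal C * (\<integral>\<^sup>+\<zeta>. (\<integral>\<^sup>+t. ennreal (?d (t - y)) * (ennreal (?d (t - x)) * local_stft g t \<zeta>) \<partial>lborel) * ennreal (decay (2 * m) (\<xi> - \<eta> - \<zeta>)) \<partial>lborel)"
        unfolding co using C(2)[OF mod_fun_0[OF s g], of "(y, x)" "\<xi> - \<eta>"] by (simp add: ennreal_mult mult.assoc)
      from mult_right_mono[OF this, of "ennreal (norm (V f y \<eta>))"]
      show "ennreal (norm (coatom \<phi> ?\<psi> (y, \<eta>) * V f y \<eta>)) \<le> ennreal C * (ennreal (norm (V f y \<eta>)) * (\<integral>\<^sup>+\<zeta>. (\<integral>\<^sup>+t. ennreal (?d (t - y)) * (ennreal (?d (t - x)) * local_stft g t \<zeta>) \<partial>lborel) * ennreal (decay (2 * m) (\<xi> - \<eta> - \<zeta>)) \<partial>lborel))"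
        by (simp add: norm_mult ennreal_mult mult_ac)
    qed
    also have "\<dots> = ennreal C * (\<integral>\<^sup>+y. \<integral>\<^sup>+\<eta>. ennreal (norm (V f y \<eta>)) * (\<integral>\<^sup>+\<zeta>. (\<integral>\<^sup>+t. ennreal (?d (t - y)) * (ennreal (?d (t - x)) * local_stft g t \<zeta>) \<partial>lborel) * ennreal (decay (2 * m) (\<xi> - \<eta> - \<zeta>)) \<partial>lborel) \<partial>lborel \<partial>lborel)"
      by (simp add: nn_integral_cmult)
    also have "(\<integral>\<^sup>+y. \<integral>\<^sup>+\<eta>. ennreal (norm (V f y \<eta>)) * (\<integral>\<^sup>+\<zeta>. (\<integral>\<^sup>+t. ennreal (?d (t - y)) * (ennreal (?d (t - x)) * local_stft g t \<zeta>) \<partial>lborel) * ennreal (decay (2 * m) (\<xi> - \<eta> - \<zeta>)) \<partial>lborel) \<partial>lborel \<partial>lborel) =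
      (\<integral>\<^sup>+\<eta>. \<integral>\<^sup>+y. ennreal (norm (V f y \<eta>)) * (\<integral>\<^sup>+\<zeta>. (\<integral>\<^sup>+t. ennreal (?d (t - y)) * (ennreal (?d (t - x)) * local_stft g t \<zeta>) \<partial>lborel) * ennreal (decay (2 * m) (\<xi> - \<eta> - \<zeta>)) \<partial>lborel) \<partial>lborel \<partial>lborel)"
      by (rule lborel_pair.Fubini') measurable
    also have "\<dots> \<le> (\<integral>\<^sup>+\<eta>. (decay_mass TYPE('n) + 1) * (stft_Lp f \<eta> * stft_majorant m g x (\<xi> - \<eta>)) \<partial>lborel)"
    proof (intro nn_integral_mono)
      fix \<eta>
      let ?D = "\<lambda>\<zeta>. ennreal (decay (2 * m) (\<xi> - \<eta> - \<zeta>))"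
      have "(\<integral>\<^sup>+y. ennreal (norm (V f y \<eta>)) * (\<integral>\<^sup>+\<zeta>. (\<integral>\<^sup>+t. ennreal (?d (t - y)) * (ennreal (?d (t - x)) * local_stft g t \<zeta>) \<partial>lborel) * ?D \<zeta> \<partial>lborel) \<partial>lborel)
        = (\<integral>\<^sup>+y. \<integral>\<^sup>+\<zeta>. (\<integral>\<^sup>+t. (ennreal (?d (t - y)) * ennreal (norm (V f y \<eta>))) * (ennreal (?d (t - x)) * local_stft g t \<zeta>) \<partial>lborel) * ?D \<zeta> \<partial>lborel \<partial>lborel)"
      proof -
        have "(\<integral>\<^sup>+t. (ennreal (?d (t - y)) * ennreal (norm (V f y \<eta>))) * (ennreal (?d (t - x)) * local_stft g t \<zeta>) \<partial>lborel) =
            (\<integral>\<^sup>+t. ennreal (norm (V f y \<eta>)) * (ennreal (?d (t - y)) * (ennreal (?d (t - x)) * local_stft g t \<zeta>)) \<partial>lborel)" for y \<zeta>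
          by (simp add: mult_ac)
        then have "(\<integral>\<^sup>+t. (ennreal (?d (t - y)) * ennreal (norm (V f y \<eta>))) * (ennreal (?d (t - x)) * local_stft g t \<zeta>) \<partial>lborel) =
            ennreal (norm (V f y \<eta>)) * (\<integral>\<^sup>+t. ennreal (?d (t - y)) * (ennreal (?d (t - x)) * local_stft g t \<zeta>) \<partial>lborel)" for y \<zeta>
          by (simp add: nn_integral_cmult)
        then show ?thesis by (simp add: nn_integral_cmult mult.assoc)
      qed
      also have "\<dots> = (\<integral>\<^sup>+\<zeta>. \<integral>\<^sup>+y. (\<integral>\<^sup>+t. (ennreal (?d (t - y)) * ennreal (norm (V f y \<eta>))) * (ennreal (?d (t - x)) * local_stft g t \<zeta>) \<partial>lborel) * ?D \<zeta> \<partial>lborel \<partial>lborel)"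
        by (rule lborel_pair.Fubini') measurable
      also have "\<dots> = (\<integral>\<^sup>+\<zeta>. (\<integral>\<^sup>+t. local_stft f t \<eta> * (ennreal (?d (t - x)) * local_stft g t \<zeta>) \<partial>lborel) * ?D \<zeta> \<partial>lborel)"
      proof (rule nn_integral_cong)
        fix \<zeta>
        have "(\<integral>\<^sup>+y. (\<integral>\<^sup>+t. (ennreal (?d (t - y)) * ennreal (norm (V f y \<eta>))) * (ennreal (?d (t - x)) * local_stft g t \<zeta>) \<partial>lborel) * ?D \<zeta> \<partial>lborel) =
           (\<integral>\<^sup>+y. (\<integral>\<^sup>+t. (ennreal (?d (t - y)) * ennreal (norm (V f y \<eta>))) * (ennreal (?d (t - x)) * local_stft g t \<zeta>) \<partial>lborel) \<partial>lborel) * ?D \<zeta>"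
          by (rule nn_integral_multc) measurable
        also have "(\<integral>\<^sup>+y. (\<integral>\<^sup>+t. (ennreal (?d (t - y)) * ennreal (norm (V f y \<eta>))) * (ennreal (?d (t - x)) * local_stft g t \<zeta>) \<partial>lborel) \<partial>lborel) =
           (\<integral>\<^sup>+t. (\<integral>\<^sup>+y. (ennreal (?d (t - y)) * ennreal (norm (V f y \<eta>))) * (ennreal (?d (t - x)) * local_stft g t \<zeta>) \<partial>lborel) \<partial>lborel)"
          by (rule lborel_pair.Fubini') measurable
        also have "\<dots> = (\<integral>\<^sup>+t. local_stft f t \<eta> * (ennreal (?d (t - x)) * local_stft g t \<zeta>) \<partial>lborel)"
          unfolding local_stft_def[of f] by (subst nn_integral_multc) auto
        finally show "(\<integral>\<^sup>+y. (\<integral>\<^sup>+t. (ennreal (?d (t - y)) * ennreal (norm (V f y \<eta>))) * (ennreal (?d (t - x)) * local_stft g t \<zeta>) \<partial>lborel) * ?D \<zeta> \<partial>lborel) =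
           (\<integral>\<^sup>+t. local_stft f t \<eta> * (ennreal (?d (t - x)) * local_stft g t \<zeta>) \<partial>lborel) * ?D \<zeta>" .
      qed
      also have "\<dots> \<le> (\<integral>\<^sup>+\<zeta>. (\<integral>\<^sup>+t. ((decay_mass TYPE('n) + 1) * stft_Lp f \<eta>) * (ennreal (?d (t - x)) * local_stft g t \<zeta>) \<partial>lborel) * ?D \<zeta> \<partial>lborel)"
        by (intro nn_integral_mono mult_right_mono local_stft_le fb) auto
      also have "\<dots> = (decay_mass TYPE('n) + 1) * (stft_Lp f \<eta> * stft_majorant m g x (\<xi> - \<eta>))"
        unfolding stft_majorant_def by (simp add: nn_integral_cmult mult.assoc)
      finally show "(\<integral>\<^sup>+y. ennreal (norm (V f y \<eta>)) * (\<integral>\<^sup>+\<zeta>. (\<integral>\<^sup>+t. ennreal (?d (t - y)) * (ennreal (?d (t - x)) * local_stft g t \<zeta>) \<partial>lborel) * ?D \<zeta> \<partial>lborel) \<partial>lborel) \<le> (decay_mass TYPE('n) + 1) * (stft_Lp f \<eta> * stft_majorant m g x (\<xi> - \<eta>))" .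
    qed
    also have "\<dots> = (decay_mass TYPE('n) + 1) * (\<integral>\<^sup>+\<eta>. stft_Lp f \<eta> * stft_majorant m g x (\<xi> - \<eta>) \<partial>lborel)"
      by (rule nn_integral_cmult) measurable
    finally show ?thesis
      using gabor_const_pos C(1) by (simp add: K_def ennreal_mult mult.assoc mult_left_mono)
  qed
  have "fun_norm s (\<lambda>t. f t * g t) \<le> (\<integral>\<^sup>+\<xi>. wt s \<xi> * Lp p (\<lambda>x. K * (\<integral>\<^sup>+\<eta>. stft_Lp f \<eta> * stft_majorant m g x (\<xi> - \<eta>) \<partial>lborel)) \<partial>lborel)"
    by (rule V_bound_imp_fun_norm_le[OF Vb])
  also have "\<dots> \<le> (\<integral>\<^sup>+\<xi>. K * (wt s \<xi> * (\<integral>\<^sup>+\<eta>. stft_Lp f \<eta> * Lp p (\<lambda>x. stft_majorant m g x (\<xi> - \<eta>)) \<partial>lborel)) \<partial>lborel)"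
  proof (intro nn_integral_mono)
    fix \<xi>
    have "Lp p (\<lambda>x. K * (\<integral>\<^sup>+\<eta>. stft_Lp f \<eta> * stft_majorant m g x (\<xi> - \<eta>) \<partial>lborel)) = K * Lp p (\<lambda>x. \<integral>\<^sup>+\<eta>. stft_Lp f \<eta> * stft_majorant m g x (\<xi> - \<eta>) \<partial>lborel)"
      by (rule Lp_cmult[OF p]) measurable
    also have "\<dots> \<le> K * (\<integral>\<^sup>+\<eta>. Lp p (\<lambda>x. stft_Lp f \<eta> * stft_majorant m g x (\<xi> - \<eta>)) \<partial>lborel)"
    proof (rule mult_left_mono[OF minkowski_integral[OF p]])
      have "(\<lambda>w. stft_majorant m g (fst w) (\<xi> - snd w)) \<in> borel_measurable (lborel \<Otimes>\<^sub>M lborel)"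
        by (rule stft_majorant_measurable[OF gb]) measurable
      then have "(\<lambda>w. stft_Lp f (snd w) * stft_majorant m g (fst w) (\<xi> - snd w)) \<in> borel_measurable (lborel \<Otimes>\<^sub>M lborel)"
        by measurable
      then show "(\<lambda>(x, \<eta>). stft_Lp f \<eta> * stft_majorant m g x (\<xi> - \<eta>)) \<in> borel_measurable (lborel \<Otimes>\<^sub>M lborel)"
        by (simp add: split_beta')
    qed simp
    also have "\<dots> = K * (\<integral>\<^sup>+\<eta>. stft_Lp f \<eta> * Lp p (\<lambda>x. stft_majorant m g x (\<xi> - \<eta>)) \<partial>lborel)"
      by (simp add: Lp_cmult[OF p])
    finally have *: "Lp p (\<lambda>x. K * (\<integral>\<^sup>+\<eta>. stft_Lp f \<eta> * stft_majorant m g x (\<xi> - \<eta>) \<partial>lborel)) \<le> K * (\<integral>\<^sup>+\<eta>. stft_Lp f \<eta> * Lp p (\<lambda>x. stft_majorant m g x (\<xi> - \<eta>)) \<partial>lborel)"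
      by simp
    show "wt s \<xi> * Lp p (\<lambda>x. K * (\<integral>\<^sup>+\<eta>. stft_Lp f \<eta> * stft_majorant m g x (\<xi> - \<eta>) \<partial>lborel)) \<le> K * (wt s \<xi> * (\<integral>\<^sup>+\<eta>. stft_Lp f \<eta> * Lp p (\<lambda>x. stft_majorant m g x (\<xi> - \<eta>)) \<partial>lborel))"
      using mult_left_mono[OF *, of "wt s \<xi>"] by (simp add: mult.left_commute)
  qed
  also have "\<dots> = K * (\<integral>\<^sup>+\<xi>. wt s \<xi> * (\<integral>\<^sup>+\<eta>. stft_Lp f \<eta> * Lp p (\<lambda>x. stft_majorant m g x (\<xi> - \<eta>)) \<partial>lborel) \<partial>lborel)"
    by (rule nn_integral_cmult) measurable
  also have "\<dots> \<le> K * (ennreal (2 powr s) * (fun_norm s f * (\<integral>\<^sup>+\<zeta>. wt s \<zeta> * Lp p (\<lambda>x. stft_majorant m g x \<zeta>) \<partial>lborel)))"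
    unfolding fun_norm_eq by (intro mult_left_mono weighted_convolution[OF s, where R="\<lambda>\<zeta>. Lp p (\<lambda>x. stft_majorant m g x \<zeta>)"]) auto
  also have "\<dots> < top"
    using stft_majorant_finite[OF s g m] mod_fun_finite[OF f] decay_mass_finite[where 'n='n] by (simp add: K_def ennreal_mult_less_top)
  finally show ?thesis using bcont_mult[OF fb gb] by (simp add: mod_fun_def)
qed

section \<open>Approximation by compactly supported functions\<close>

text \<open>Dominated convergence in both variables of the short-time Fourier transform. A majorant exists
  because the dilated functions \<open>h\<close> have derivatives bounded uniformly in the dilation parameter, so
  they form one family in \<open>product_ft_bound\<close>. This is where \<open>p < \<infinity>\<close> enters.\<close>

lemma dilation_tendsto:
  assumes s: "0 \<le> s" and g: "mod_fun s g" and h: "h \<in> schwartz" and h0: "h 0 = 1"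
  shows "(\<lambda>k. fun_norm s (\<lambda>t. g t * h (inverse (real (Suc k)) *\<^sub>R t) - g t)) \<longlonglongrightarrow> 0"
proof -
  define m where "m = 2 * CARD('n) + nat \<lceil>s\<rceil>"
  have m: "2 * CARD('n) + nat \<lceil>s\<rceil> \<le> 2 * m"
  proof -
    have "m \<le> 2 * m" by simp
    then show ?thesis by (simp only: m_def)
  qed
  note gb = mod_fun_bcont[OF g]
  define e where "e k = inverse (real (Suc k))" for k
  have e: "\<bar>e k\<bar> \<le> 1" for k by (simp add: e_def divide_simps)
  have e0: "e \<longlonglongrightarrow> 0" unfolding e_def by (rule LIMSEQ_inverse_real_of_nat)
  define gk where "gk k t = g t * h (e k *\<^sub>R t)" for k t
  have hk: "(\<lambda>t. h (e k *\<^sub>R t)) \<in> schwartz" for k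
    using schwartz_affine[OF h, of "e k" 0] by (simp add: e_def)
  have gkb: "bcont (gk k)" for k
    unfolding gk_def by (intro bcont_mult gb bcont_schwartz hk)
  note [measurable] = V_measurable[OF gb] V_measurable[OF gkb] V_measurable[OF bcont_diff[OF gkb gb]] stft_majorant_measurable[OF gb]
    stft_Lp_measurable[OF bcont_diff[OF gkb gb]]
  \<comment> \<open>The parameter of the family ranges over all reals, so it is clipped to the interval where the
    derivatives of the dilated functions are uniformly bounded.\<close>
  let ?cl = "\<lambda>a::real. max (-1) (min 1 a)"
  let ?P = "\<lambda>q t. h (?cl (snd q) *\<^sub>R t) * cnj (\<phi> (t - fst q))"
  have clb: "\<bar>?cl a\<bar> \<le> 1" for a by (simp add: abs_le_iff max_def min_def)
  have "dbound N (\<lambda>q t. 1) (\<lambda>q t. h (?cl (snd q) *\<^sub>R t))" for N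
    using dbound_affine[OF schwartz_dbound[OF h, of N 0], of "\<lambda>q. ?cl (snd q)" 1 "\<lambda>q. 0"] by (simp add: clb)
  then have "dbound (Suc (2 * m)) (\<lambda>q t. 1 * decay (2 * CARD('n)) (t - fst q)) ?P"
    by (intro dbound_mult dbound_window[OF window])
  then have d: "dbound (Suc (2 * m)) (\<lambda>q t. decay (2 * CARD('n)) (t - fst q)) ?P" by simp
  obtain C where C: "0 \<le> C" "\<And>g q \<omega>. mod_fun 0 g \<Longrightarrow> ennreal (norm (ft (\<lambda>t. g t * ?P q t) \<omega>)) \<le>
     ennreal C * (\<integral>\<^sup>+\<eta>. (\<integral>\<^sup>+t. ennreal (decay (2 * CARD('n)) (t - fst q)) * local_stft g t \<eta> \<partial>lborel) * ennreal (decay (2 * m) (\<omega> - \<eta>)) \<partial>lborel)"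
    by (rule product_ft_bound[OF d]) (auto simp: window_decay_integrable)
  have cl: "?cl a = a" if "\<bar>a\<bar> \<le> 1" for a :: real using that by (auto simp: max_def min_def abs_le_iff)
  have Vk: "ennreal (norm (V (gk k) x \<xi>)) \<le> ennreal C * stft_majorant m g x \<xi>" for k x \<xi>
    using C(2)[OF mod_fun_0[OF s g], of "(x, e k)" \<xi>] cl[OF e[of k]] by (simp add: V_def gk_def stft_majorant_def mult.assoc)
  have Vg: "ennreal (norm (V g x \<xi>)) \<le> ennreal C * stft_majorant m g x \<xi>" for x \<xi>
    using C(2)[OF mod_fun_0[OF s g], of "(x, 0)" \<xi>] by (simp add: V_def stft_majorant_def h0)
  have Vd: "V (\<lambda>t. gk k t - g t) x \<xi> = V (gk k) x \<xi> - V g x \<xi>" for k x \<xi>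
    using V_add[OF gkb bcont_cmult[OF gb, of "-1"]] V_cmult[of "-1" g] by simp
  have Vdom: "ennreal (norm (V (\<lambda>t. gk k t - g t) x \<xi>)) \<le> ennreal (2 * C) * stft_majorant m g x \<xi>" for k x \<xi>
  proof -
    have "ennreal (norm (V (\<lambda>t. gk k t - g t) x \<xi>)) \<le> ennreal (norm (V (gk k) x \<xi>)) + ennreal (norm (V g x \<xi>))"
      unfolding Vd by (simp add: norm_triangle_ineq4 ennreal_leI flip: ennreal_plus)
    also have "\<dots> \<le> ennreal C * stft_majorant m g x \<xi> + ennreal C * stft_majorant m g x \<xi>" by (intro add_mono Vk Vg)
    also have "\<dots> = ennreal (2 * C) * stft_majorant m g x \<xi>" by (simp only: mult_2 ennreal_plus[OF C(1) C(1)] distrib_right)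
    finally show ?thesis .
  qed
  have lim: "(\<lambda>k. V (gk k) x \<xi>) \<longlonglongrightarrow> V g x \<xi>" for x \<xi>
  proof -
    obtain B where B: "0 \<le> B" "\<And>t. norm (h t) \<le> B" using bcont_bound[OF bcont_schwartz[OF h]] by blast
    have I: "integrable lborel (\<lambda>t. g t * cnj (\<phi> (t - x)))"
      by (intro bcont_integrable gb schwartz_integrable schwartz_cnj schwartz_translate window)
    have [measurable]: "g \<in> borel_measurable borel" "gk k \<in> borel_measurable borel" for k
      using bcont_measurable gb gkb by auto
    show ?thesis
      unfolding V_def ft_def
    proof (rule integral_dominated_convergence[where w="\<lambda>t. B * norm (g t * cnj (\<phi> (t - x)))"])
      show "integrable lborel (\<lambda>t. B * norm (g t * cnj (\<phi> (t - x))))" using I by simp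
      show "AE t in lborel. (\<lambda>k. gk k t * cnj (\<phi> (t - x)) * cis (- (t \<bullet> \<xi>))) \<longlonglongrightarrow> g t * cnj (\<phi> (t - x)) * cis (- (t \<bullet> \<xi>))"
      proof (rule AE_I2)
        fix t :: "real^'n"
        have "(\<lambda>k. e k *\<^sub>R t) \<longlonglongrightarrow> 0 *\<^sub>R t" by (intro tendsto_intros e0)
        then have "(\<lambda>k. h (e k *\<^sub>R t)) \<longlonglongrightarrow> h (0 *\<^sub>R t)"
          by (intro continuous_on_tendsto_compose[OF schwartz_continuous[OF h]]) auto
        then have "(\<lambda>k. gk k t) \<longlonglongrightarrow> g t * h (0 *\<^sub>R t)" unfolding gk_def by (intro tendsto_intros)
        then have "(\<lambda>k. gk k t) \<longlonglongrightarrow> g t" by (simp add: h0)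
        then show "(\<lambda>k. gk k t * cnj (\<phi> (t - x)) * cis (- (t \<bullet> \<xi>))) \<longlonglongrightarrow> g t * cnj (\<phi> (t - x)) * cis (- (t \<bullet> \<xi>))"
          by (intro tendsto_mult tendsto_const)
      qed
      show "AE t in lborel. norm (gk k t * cnj (\<phi> (t - x)) * cis (- (t \<bullet> \<xi>))) \<le> B * norm (g t * cnj (\<phi> (t - x)))" for k
      proof (rule AE_I2)
        fix t :: "real^'n"
        show "norm (gk k t * cnj (\<phi> (t - x)) * cis (- (t \<bullet> \<xi>))) \<le> B * norm (g t * cnj (\<phi> (t - x)))"
          using mult_right_mono[OF B(2)[of "e k *\<^sub>R t"], of "norm (g t * cnj (\<phi> (t - x)))"]
          by (simp add: gk_def norm_mult mult_ac)
      qed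
      show "(\<lambda>t. g t * cnj (\<phi> (t - x)) * cis (- (t \<bullet> \<xi>))) \<in> borel_measurable lborel"
        using borel_measurable_integrable[OF integrable_ft[OF I]] by simp
      show "(\<lambda>t. gk k t * cnj (\<phi> (t - x)) * cis (- (t \<bullet> \<xi>))) \<in> borel_measurable lborel" for k
        by (rule borel_measurable_integrable[OF integrable_ft]) (intro bcont_integrable gkb schwartz_integrable schwartz_cnj schwartz_translate window)
    qed
  qed
  let ?L = "\<lambda>\<xi>. Lp p (\<lambda>x. stft_majorant m g x \<xi>)"
  have fin: "(\<integral>\<^sup>+\<xi>. wt s \<xi> * ?L \<xi> \<partial>lborel) < top" by (rule stft_majorant_finite[OF s g m])
  have ae: "AE \<xi> in lborel. wt s \<xi> * ?L \<xi> \<noteq> \<infinity>"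
    using fin by (intro nn_integral_noteq_infinite) auto
  have vlim: "(\<lambda>k. wt s \<xi> * stft_Lp (\<lambda>t. gk k t - g t) \<xi>) \<longlonglongrightarrow> 0" if \<xi>: "wt s \<xi> * ?L \<xi> \<noteq> \<infinity>" for \<xi>
  proof -
    have "?L \<xi> \<noteq> top" using \<xi> wt_ge_1[OF s, of \<xi>] by (auto simp: ennreal_mult_eq_top_iff)
    then have Lf: "(\<integral>\<^sup>+x. ennreal_powr (stft_majorant m g x \<xi>) p \<partial>lborel) < top" by (simp add: Lp_def less_top)
    have "(\<lambda>k. \<integral>\<^sup>+x. ennreal_powr (ennreal (norm (V (\<lambda>t. gk k t - g t) x \<xi>))) p \<partial>lborel) \<longlonglongrightarrow> (\<integral>\<^sup>+x. 0 \<partial>(lborel :: (real^'n) measure))"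
    proof (rule nn_integral_dominated_convergence[where w="\<lambda>x. ennreal_powr (ennreal (2 * C)) p * ennreal_powr (stft_majorant m g x \<xi>) p"])
      show "AE x in lborel. ennreal_powr (ennreal (norm (V (\<lambda>t. gk k t - g t) x \<xi>))) p \<le> ennreal_powr (ennreal (2 * C)) p * ennreal_powr (stft_majorant m g x \<xi>) p" for k
        unfolding ennreal_powr_mult[symmetric] using p by (intro AE_I2 ennreal_powr_mono Vdom) auto
      show "(\<integral>\<^sup>+x. ennreal_powr (ennreal (2 * C)) p * ennreal_powr (stft_majorant m g x \<xi>) p \<partial>lborel) < \<infinity>"
        using Lf C(1) by (subst nn_integral_cmult) (auto simp: ennreal_mult_less_top)
      show "AE x in lborel. (\<lambda>k. ennreal_powr (ennreal (norm (V (\<lambda>t. gk k t - g t) x \<xi>))) p) \<longlonglongrightarrow> 0"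
      proof (intro AE_I2 ennreal_powr_tendsto_0)
        fix x
        have "(\<lambda>k. V (gk k) x \<xi> - V g x \<xi>) \<longlonglongrightarrow> V g x \<xi> - V g x \<xi>" by (intro tendsto_intros lim)
        then have "(\<lambda>k. norm (V (\<lambda>t. gk k t - g t) x \<xi>)) \<longlonglongrightarrow> 0" unfolding Vd by (simp add: tendsto_norm_zero)
        then show "(\<lambda>k. ennreal (norm (V (\<lambda>t. gk k t - g t) x \<xi>))) \<longlonglongrightarrow> 0"
          using tendsto_ennrealI by fastforce
      qed (use p in auto)
    qed (measurable)
    then have "(\<lambda>k. stft_Lp (\<lambda>t. gk k t - g t) \<xi>) \<longlonglongrightarrow> 0"
      unfolding stft_Lp_def Lp_def using p by (intro ennreal_powr_tendsto_0) auto
    then have "(\<lambda>k. wt s \<xi> * stft_Lp (\<lambda>t. gk k t - g t) \<xi>) \<longlonglongrightarrow> wt s \<xi> * 0"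
      by (intro tendsto_mult_ennreal) (auto simp: wt_def)
    then show ?thesis by simp
  qed
  have "(\<lambda>k. \<integral>\<^sup>+\<xi>. wt s \<xi> * stft_Lp (\<lambda>t. gk k t - g t) \<xi> \<partial>lborel) \<longlonglongrightarrow> (\<integral>\<^sup>+\<xi>. 0 \<partial>(lborel :: (real^'n) measure))"
  proof (rule nn_integral_dominated_convergence[where w="\<lambda>\<xi>. ennreal (2 * C) * (wt s \<xi> * ?L \<xi>)"])
    show "AE \<xi> in lborel. wt s \<xi> * stft_Lp (\<lambda>t. gk k t - g t) \<xi> \<le> ennreal (2 * C) * (wt s \<xi> * ?L \<xi>)" for k
    proof (rule AE_I2)
      fix \<xi>
      have "stft_Lp (\<lambda>t. gk k t - g t) \<xi> \<le> Lp p (\<lambda>x. ennreal (2 * C) * stft_majorant m g x \<xi>)"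
        unfolding stft_Lp_def by (intro Lp_mono p Vdom)
      also have "\<dots> = ennreal (2 * C) * ?L \<xi>" by (rule Lp_cmult[OF p]) measurable
      finally show "wt s \<xi> * stft_Lp (\<lambda>t. gk k t - g t) \<xi> \<le> ennreal (2 * C) * (wt s \<xi> * ?L \<xi>)"
        using mult_left_mono by (fastforce simp: mult.left_commute)
    qed
    show "(\<integral>\<^sup>+\<xi>. ennreal (2 * C) * (wt s \<xi> * ?L \<xi>) \<partial>lborel) < \<infinity>"
      using fin by (subst nn_integral_cmult) (auto simp: ennreal_mult_less_top)
    show "AE \<xi> in lborel. (\<lambda>k. wt s \<xi> * stft_Lp (\<lambda>t. gk k t - g t) \<xi>) \<longlonglongrightarrow> 0"
      using ae by eventually_elim (rule vlim)
  qed (measurable)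
  then show ?thesis by (simp add: fun_norm_eq gk_def e_def)
qed

section \<open>Multiplication by Fourier transforms of integrable functions\<close>

text \<open>Products with an inverse Fourier transform become convolutions.\<close>

lemma ft_multiplier:
  fixes h R :: "real^'m::finite \<Rightarrow> complex"
  assumes I: "integrable lborel h" and R: "integrable lborel R" and r: "\<And>t. r t = (\<integral>\<eta>. R \<eta> * cis (t \<bullet> \<eta>) \<partial>lborel)"
  shows "ft (\<lambda>t. h t * r t) \<xi> = (\<integral>\<eta>. R \<eta> * ft h (\<xi> - \<eta>) \<partial>lborel)"
proof -
  have [measurable]: "R \<in> borel_measurable borel" "h \<in> borel_measurable borel"
    using borel_measurable_integrable[OF R] borel_measurable_integrable[OF I] by auto
  let ?H = "\<lambda>t \<eta>. R \<eta> * (h t * cis (- (t \<bullet> (\<xi> - \<eta>))))"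
  have J: "integrable (lborel \<Otimes>\<^sub>M lborel) (case_prod ?H)"
  proof (rule integrable_pairI)
    have "(\<lambda>w. ?H (fst w) (snd w)) \<in> borel_measurable (borel \<Otimes>\<^sub>M borel)" by measurable
    then show "case_prod ?H \<in> borel_measurable borel" by (simp add: borel_prod split_beta')
    have "(\<integral>\<^sup>+t. \<integral>\<^sup>+\<eta>. ennreal (norm (case (t, \<eta>) of (t, \<eta>) \<Rightarrow> ?H t \<eta>)) \<partial>lborel \<partial>lborel) =
      (\<integral>\<^sup>+t. (\<integral>\<^sup>+\<eta>. ennreal (norm (R \<eta>)) \<partial>lborel) * ennreal (norm (h t)) \<partial>lborel)"
      by (intro nn_integral_cong) (simp add: norm_mult ennreal_mult nn_integral_multc)
    also have "\<dots> = (\<integral>\<^sup>+\<eta>. ennreal (norm (R \<eta>)) \<partial>lborel) * (\<integral>\<^sup>+t. ennreal (norm (h t)) \<partial>lborel)"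
      by (rule nn_integral_cmult) measurable
    also have "\<dots> < \<infinity>" using R I by (simp add: integrable_iff_bounded ennreal_mult_less_top)
    finally show "(\<integral>\<^sup>+t. \<integral>\<^sup>+\<eta>. ennreal (norm (case (t, \<eta>) of (t, \<eta>) \<Rightarrow> ?H t \<eta>)) \<partial>lborel \<partial>lborel) < \<infinity>" .
  qed
  have "ft (\<lambda>t. h t * r t) \<xi> = (\<integral>t. \<integral>\<eta>. ?H t \<eta> \<partial>lborel \<partial>lborel)"
    unfolding ft_def r
  proof (intro Bochner_Integration.integral_cong refl)
    fix t
    have "cis (- (t \<bullet> (\<xi> - \<eta>))) = cis (t \<bullet> \<eta>) * cis (- (t \<bullet> \<xi>))" for \<eta> by (simp add: cis_mult inner_diff_right)
    then have "(\<integral>\<eta>. ?H t \<eta> \<partial>lborel) = (\<integral>\<eta>. (R \<eta> * cis (t \<bullet> \<eta>)) * (h t * cis (- (t \<bullet> \<xi>))) \<partial>lborel)"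
      by (simp add: mult_ac)
    also have "\<dots> = (\<integral>\<eta>. R \<eta> * cis (t \<bullet> \<eta>) \<partial>lborel) * (h t * cis (- (t \<bullet> \<xi>)))"
      by (rule integral_mult_left_zero)
    finally show "h t * (\<integral>\<eta>. R \<eta> * cis (t \<bullet> \<eta>) \<partial>lborel) * cis (- (t \<bullet> \<xi>)) = (\<integral>\<eta>. ?H t \<eta> \<partial>lborel)"
      by (simp add: mult_ac)
  qed
  also have "\<dots> = (\<integral>\<eta>. \<integral>t. ?H t \<eta> \<partial>lborel \<partial>lborel)"
    by (rule lborel_pair.Fubini_integral[OF J, symmetric])
  also have "\<dots> = (\<integral>\<eta>. R \<eta> * ft h (\<xi> - \<eta>) \<partial>lborel)"
    unfolding ft_def by simp
  finally show ?thesis .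
qed

lemma V_multiplier:
  assumes g: "bcont g" and R: "integrable lborel R" and r: "\<And>t. r t = (\<integral>\<eta>. R \<eta> * cis (t \<bullet> \<eta>) \<partial>lborel)"
  shows "V (\<lambda>t. g t * r t) x \<xi> = (\<integral>\<eta>. R \<eta> * V g x (\<xi> - \<eta>) \<partial>lborel)"
proof -
  have I: "integrable lborel (\<lambda>t. g t * cnj (\<phi> (t - x)))"
    by (intro bcont_integrable g schwartz_integrable schwartz_cnj schwartz_translate window)
  show ?thesis using ft_multiplier[OF I R r, of \<xi>] by (simp add: V_def mult_ac)
qed

lemma stft_Lp_multiplier:
  assumes g: "bcont g" and R: "integrable lborel R" and r: "\<And>t. r t = (\<integral>\<eta>. R \<eta> * cis (t \<bullet> \<eta>) \<partial>lborel)"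
  shows "stft_Lp (\<lambda>t. g t * r t) \<xi> \<le> (\<integral>\<^sup>+\<eta>. stft_Lp g \<eta> * ennreal (norm (R (\<xi> - \<eta>))) \<partial>lborel)"
proof -
  have [measurable]: "R \<in> borel_measurable borel" using borel_measurable_integrable[OF R] by simp
  note [measurable] = V_measurable[OF g] stft_Lp_measurable[OF g]
  have "ennreal (norm (V (\<lambda>t. g t * r t) x \<xi>)) \<le> (\<integral>\<^sup>+\<eta>. ennreal (norm (R (\<xi> - \<eta>))) * ennreal (norm (V g x \<eta>)) \<partial>lborel)" for x
  proof -
    have "ennreal (norm (\<integral>\<eta>. R \<eta> * V g x (\<xi> - \<eta>) \<partial>lborel)) \<le> (\<integral>\<^sup>+\<eta>. ennreal (norm (R \<eta> * V g x (\<xi> - \<eta>))) \<partial>lborel)"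
      by (cases "integrable lborel (\<lambda>\<eta>. R \<eta> * V g x (\<xi> - \<eta>))")
         (auto simp: integral_norm_bound_ennreal not_integrable_integral_eq)
    also have "\<dots> = (\<integral>\<^sup>+\<eta>. ennreal (norm (R (\<xi> - \<eta>))) * ennreal (norm (V g x \<eta>)) \<partial>lborel)"
      using nn_integral_lborel_reflect[of "\<lambda>\<eta>. ennreal (norm (R \<eta>)) * ennreal (norm (V g x (\<xi> - \<eta>)))" \<xi>]
      by (simp add: norm_mult ennreal_mult)
    finally show ?thesis unfolding V_multiplier[OF g R r] .
  qed
  then have "stft_Lp (\<lambda>t. g t * r t) \<xi> \<le> Lp p (\<lambda>x. \<integral>\<^sup>+\<eta>. ennreal (norm (R (\<xi> - \<eta>))) * ennreal (norm (V g x \<eta>)) \<partial>lborel)"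
    unfolding stft_Lp_def by (intro Lp_mono p)
  also have "\<dots> \<le> (\<integral>\<^sup>+\<eta>. Lp p (\<lambda>x. ennreal (norm (R (\<xi> - \<eta>))) * ennreal (norm (V g x \<eta>))) \<partial>lborel)"
    by (rule minkowski_integral[OF p]) measurable
  also have "\<dots> = (\<integral>\<^sup>+\<eta>. stft_Lp g \<eta> * ennreal (norm (R (\<xi> - \<eta>))) \<partial>lborel)"
    unfolding stft_Lp_def by (simp add: Lp_cmult[OF p] mult.commute)
  finally show ?thesis .
qed

text \<open>Since \<open>japanese \<omega> \<le> japanese \<eta> + japanese (\<omega> - \<eta>)\<close>, either the second summand is at most \<open>\<delta>\<close>
  times the first, or the first is at most \<open>1 / \<delta>\<close> times the second. Thus the constant in front of
  one weight can be made as close to \<open>1\<close> as desired, at the expense of the other.\<close>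

lemma wt_split:
  assumes s: "0 \<le> s" and \<delta>: "0 < \<delta>"
  shows "wt s \<omega> \<le> ennreal ((1 + \<delta>) powr s) * wt s \<eta> + ennreal ((1 + 1 / \<delta>) powr s) * wt s (\<omega> - \<eta>)"
proof -
  let ?a = "japanese \<eta>" and ?b = "japanese (\<omega> - \<eta>)"
  have le: "japanese \<omega> \<le> ?a + ?b"
    using japanese_add_le[of \<eta> "\<omega> - \<eta>"] norm_le_japanese[of "\<omega> - \<eta>"] by simp
  have "japanese \<omega> powr s \<le> (1 + \<delta>) powr s * ?a powr s + (1 + 1 / \<delta>) powr s * ?b powr s"
  proof (cases "?b \<le> \<delta> * ?a")
    case True
    then have "japanese \<omega> \<le> (1 + \<delta>) * ?a" using le by (simp add: distrib_right)
    then have "japanese \<omega> powr s \<le> ((1 + \<delta>) * ?a) powr s" using s by (intro powr_mono2) auto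
    also have "\<dots> = (1 + \<delta>) powr s * ?a powr s" by (rule powr_mult)
    finally show ?thesis by (simp add: add_increasing2)
  next
    case False
    then have "?a \<le> 1 / \<delta> * ?b" using \<delta> by (simp add: field_simps)
    then have "japanese \<omega> \<le> (1 + 1 / \<delta>) * ?b" using le by (simp add: distrib_right)
    then have "japanese \<omega> powr s \<le> ((1 + 1 / \<delta>) * ?b) powr s" using s by (intro powr_mono2) auto
    also have "\<dots> = (1 + 1 / \<delta>) powr s * ?b powr s" by (rule powr_mult)
    finally show ?thesis by (simp add: add_increasing)
  qed
  then show ?thesis unfolding wt_def by (simp add: ennreal_mult[symmetric] ennreal_plus[symmetric] ennreal_leI del: ennreal_plus)
qed

abbreviation weighted_L1 :: "real \<Rightarrow> (real^'n \<Rightarrow> complex) \<Rightarrow> ennreal" where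
  "weighted_L1 s R \<equiv> (\<integral>\<^sup>+\<zeta>. wt s \<zeta> * ennreal (norm (R \<zeta>)) \<partial>lborel)"

text \<open>Multiplication by \<open>r\<close> acts on the modulation norm almost with the unweighted \<open>L\<^sup>1\<close> norm of its
  frequency density; the weighted norm of the density multiplies only the weaker unweighted norm
  of \<open>g\<close>.\<close>

lemma fun_norm_multiplier:
  assumes s: "0 \<le> s" and \<delta>: "0 < \<delta>" and g: "bcont g" and R: "integrable lborel R" and r: "\<And>t. r t = (\<integral>\<eta>. R \<eta> * cis (t \<bullet> \<eta>) \<partial>lborel)"
  shows "fun_norm s (\<lambda>t. g t * r t) \<le> ennreal ((1 + \<delta>) powr s) * (fun_norm s g * weighted_L1 0 R) + ennreal ((1 + 1 / \<delta>) powr s) * (fun_norm 0 g * weighted_L1 s R)"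
    and "fun_norm 0 (\<lambda>t. g t * r t) \<le> fun_norm 0 g * weighted_L1 0 R"
proof -
  have [measurable]: "R \<in> borel_measurable borel" using borel_measurable_integrable[OF R] by simp
  note [measurable] = stft_Lp_measurable[OF g]
  let ?R = "\<lambda>\<zeta>. ennreal (norm (R \<zeta>))"
  let ?A = "ennreal ((1 + \<delta>) powr s)" and ?B = "ennreal ((1 + 1 / \<delta>) powr s)"
  have "fun_norm 0 (\<lambda>t. g t * r t) \<le> (\<integral>\<^sup>+\<omega>. wt 0 \<omega> * (\<integral>\<^sup>+\<eta>. stft_Lp g \<eta> * ?R (\<omega> - \<eta>) \<partial>lborel) \<partial>lborel)"
    unfolding fun_norm_eq by (intro nn_integral_mono mult_left_mono stft_Lp_multiplier[OF g R r]) auto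
  also have "\<dots> \<le> ennreal (2 powr 0) * (fun_norm 0 g * weighted_L1 0 R)"
    unfolding fun_norm_eq by (rule weighted_convolution) auto
  finally show "fun_norm 0 (\<lambda>t. g t * r t) \<le> fun_norm 0 g * weighted_L1 0 R" by simp
  have "fun_norm s (\<lambda>t. g t * r t) \<le> (\<integral>\<^sup>+\<omega>. wt s \<omega> * (\<integral>\<^sup>+\<eta>. stft_Lp g \<eta> * ?R (\<omega> - \<eta>) \<partial>lborel) \<partial>lborel)"
    unfolding fun_norm_eq by (intro nn_integral_mono mult_left_mono stft_Lp_multiplier[OF g R r]) auto
  also have "\<dots> = (\<integral>\<^sup>+\<omega>. \<integral>\<^sup>+\<eta>. wt s \<omega> * (stft_Lp g \<eta> * ?R (\<omega> - \<eta>)) \<partial>lborel \<partial>lborel)"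
    by (simp add: nn_integral_cmult)
  also have "\<dots> = (\<integral>\<^sup>+\<eta>. \<integral>\<^sup>+\<omega>. wt s \<omega> * (stft_Lp g \<eta> * ?R (\<omega> - \<eta>)) \<partial>lborel \<partial>lborel)"
    by (rule lborel_pair.Fubini') measurable
  also have "\<dots> \<le> (\<integral>\<^sup>+\<eta>. \<integral>\<^sup>+\<omega>. (?A * (wt s \<eta> * stft_Lp g \<eta>)) * ?R (\<omega> - \<eta>) + (?B * stft_Lp g \<eta>) * (wt s (\<omega> - \<eta>) * ?R (\<omega> - \<eta>)) \<partial>lborel \<partial>lborel)"
  proof (intro nn_integral_mono)
    fix \<eta> \<omega> :: "real^'n"
    show "wt s \<omega> * (stft_Lp g \<eta> * ?R (\<omega> - \<eta>)) \<le> (?A * (wt s \<eta> * stft_Lp g \<eta>)) * ?R (\<omega> - \<eta>) + (?B * stft_Lp g \<eta>) * (wt s (\<omega> - \<eta>) * ?R (\<omega> - \<eta>))"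
      using mult_right_mono[OF wt_split[OF s \<delta>, of \<omega> \<eta>], of "stft_Lp g \<eta> * ?R (\<omega> - \<eta>)"]
      by (simp add: distrib_right distrib_left mult_ac)
  qed
  also have "\<dots> = (\<integral>\<^sup>+\<eta>. (?A * (wt s \<eta> * stft_Lp g \<eta>)) * weighted_L1 0 R + (?B * stft_Lp g \<eta>) * weighted_L1 s R \<partial>lborel)"
    using nn_integral_lborel_translate[of ?R] nn_integral_lborel_translate[of "\<lambda>\<zeta>. wt s \<zeta> * ?R \<zeta>"]
    by (simp add: nn_integral_add nn_integral_cmult)
  also have "\<dots> = (\<integral>\<^sup>+\<eta>. ?A * (wt s \<eta> * stft_Lp g \<eta>) \<partial>lborel) * weighted_L1 0 R + (\<integral>\<^sup>+\<eta>. ?B * stft_Lp g \<eta> \<partial>lborel) * weighted_L1 s R"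
    by (subst nn_integral_add; simp add: nn_integral_multc)
  also have "\<dots> = ?A * (fun_norm s g * weighted_L1 0 R) + ?B * (fun_norm 0 g * weighted_L1 s R)"
    unfolding fun_norm_eq by (simp add: nn_integral_cmult mult.assoc)
  finally show "fun_norm s (\<lambda>t. g t * r t) \<le> ?A * (fun_norm s g * weighted_L1 0 R) + ?B * (fun_norm 0 g * weighted_L1 s R)" .
qed

text \<open>The solution is of order \<open>n * q ^ n\<close>.\<close>

lemma linear_recursion_tendsto_0:
  fixes x :: "nat \<Rightarrow> real"
  assumes q: "0 < q" "q < 1" and x0: "\<And>n. 0 \<le> x n" and rec: "\<And>n. x (Suc n) \<le> q * x n + c * q ^ n"
  shows "x \<longlonglongrightarrow> 0"
proof -
  have le: "x n \<le> q ^ n * x 0 + (c / q) * (real n * q ^ n)" for n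
  proof (induction n)
    case (Suc n)
    have "x (Suc n) \<le> q * (q ^ n * x 0 + (c / q) * (real n * q ^ n)) + c * q ^ n"
      using rec[of n] mult_left_mono[OF Suc, of q] q by linarith
    also have "\<dots> = q ^ Suc n * x 0 + (c / q) * (real (Suc n) * q ^ Suc n)"
      using q by (simp add: field_simps)
    finally show ?case .
  qed simp
  have "(\<lambda>n. q ^ n * x 0 + (c / q) * (real n * q ^ n)) \<longlonglongrightarrow> 0 * x 0 + (c / q) * 0"
    using q by (intro tendsto_intros LIMSEQ_realpow_zero powser_times_n_limit_0) auto
  then have "(\<lambda>n. q ^ n * x 0 + (c / q) * (real n * q ^ n)) \<longlonglongrightarrow> 0" by simp
  then show ?thesis
    by (rule tendsto_sandwich[OF always_eventually always_eventually tendsto_const, rotated 2]) (use x0 le in auto)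
qed

text \<open>The unweighted norms of \<open>b r\<^sup>N\<close> decay geometrically. Feeding this into \<open>fun_norm_multiplier\<close>, with
  \<open>\<delta>\<close> so small that \<open>(1 + \<delta>) powr s\<close> times the unweighted norm of the density is still below \<open>1\<close>,
  gives a contractive recursion with geometrically small perturbation for the weighted norms.\<close>

lemma multiplier_powers_tendsto:
  assumes s: "0 \<le> s" and b: "mod_fun s b" and rb: "bcont r" and R: "integrable lborel R" and r: "\<And>t. r t = (\<integral>\<eta>. R \<eta> * cis (t \<bullet> \<eta>) \<partial>lborel)"
    and small: "weighted_L1 0 R < 1" and fin: "weighted_L1 s R < top"
  shows "(\<lambda>N. fun_norm s (\<lambda>t. b t * r t ^ N)) \<longlonglongrightarrow> 0"
proof -
  define q0 where "q0 = enn2real (weighted_L1 0 R)"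
  have fl0: "weighted_L1 0 R = ennreal q0" "0 \<le> q0" "q0 < 1"
    using small by (cases "weighted_L1 0 R"; simp add: q0_def ennreal_less_one_iff)+
  \<comment> \<open>A number above the norm and below \<open>1\<close> that is positive even if the norm is \<open>0\<close>.\<close>
  define q1 where "q1 = (q0 + 1) / 2"
  have q1: "q0 \<le> q1" "0 < q1" "q1 < 1" using fl0 by (auto simp: q1_def)
  have "((\<lambda>\<delta>. (1 + \<delta>) powr s * q1) \<longlongrightarrow> (1 + 0) powr s * q1) (at_right 0)"
    by (intro tendsto_intros) auto
  then have "\<forall>\<^sub>F \<delta> in at_right 0. (1 + \<delta>) powr s * q1 < 1" using q1 by (intro order_tendstoD) auto
  then obtain \<delta> where \<delta>: "0 < \<delta>" "(1 + \<delta>) powr s * q1 < 1"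
    unfolding eventually_at_right_field using dense[of "0::real"] by blast
  define q where "q = (1 + \<delta>) powr s * q1"
  have "1 \<le> (1 + \<delta>) powr s" using \<delta>(1) s by (intro ge_one_powr_ge_zero) auto
  then have qq: "q1 \<le> q" unfolding q_def using q1 by (simp add: mult_le_cancel_right1)
  have q: "0 < q" "q < 1" "q0 \<le> q" using qq q1 \<delta>(2)[folded q_def] by auto
  obtain F where F: "weighted_L1 s R = ennreal F" "0 \<le> F" using fin by (cases "weighted_L1 s R") auto
  define K where "K = (1 + 1 / \<delta>) powr s * F"
  define bN where "bN N t = b t * r t ^ N" for N t
  have bS: "bN (Suc N) = (\<lambda>t. bN N t * r t)" for N by (auto simp: bN_def)
  have bb: "bcont (bN N)" for N
    by (induction N) (auto simp: bS intro: bcont_mult rb simp: bN_def mod_fun_bcont[OF b])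
  have m0: "fun_norm 0 (bN N) \<le> ennreal (q ^ N) * fun_norm 0 b" for N
  proof (induction N)
    case 0 show ?case by (simp add: bN_def)
  next
    case (Suc N)
    have "fun_norm 0 (bN (Suc N)) \<le> fun_norm 0 (bN N) * weighted_L1 0 R"
      unfolding bS by (rule fun_norm_multiplier(2)[OF s \<delta>(1) bb R r])
    also have "\<dots> \<le> (ennreal (q ^ N) * fun_norm 0 b) * ennreal q"
      unfolding fl0(1) using q by (intro mult_mono Suc ennreal_leI) auto
    also have "\<dots> = ennreal (q ^ Suc N) * fun_norm 0 b" using q by (simp add: ennreal_mult mult_ac)
    finally show ?case .
  qed
  obtain M0 where M0: "fun_norm 0 b = ennreal M0" "0 \<le> M0" using mod_fun_finite[OF mod_fun_0[OF s b]] by (cases "fun_norm 0 b") auto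
  have step: "fun_norm s (bN (Suc N)) \<le> ennreal q * fun_norm s (bN N) + ennreal (K * M0 * q ^ N)" for N
  proof -
    have "fun_norm s (bN (Suc N)) \<le> ennreal ((1 + \<delta>) powr s) * (fun_norm s (bN N) * weighted_L1 0 R) + ennreal ((1 + 1 / \<delta>) powr s) * (fun_norm 0 (bN N) * weighted_L1 s R)"
      unfolding bS by (rule fun_norm_multiplier(1)[OF s \<delta>(1) bb R r])
    also have "\<dots> \<le> ennreal ((1 + \<delta>) powr s) * (fun_norm s (bN N) * ennreal q1) + ennreal ((1 + 1 / \<delta>) powr s) * ((ennreal (q ^ N) * ennreal M0) * ennreal F)"
      unfolding fl0(1) F(1) using q1 m0[of N] by (intro add_mono mult_left_mono mult_right_mono ennreal_leI) (auto simp: M0)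
    also have "\<dots> = ennreal q * fun_norm s (bN N) + ennreal (K * M0 * q ^ N)"
      using q1 q M0 F by (simp add: q_def K_def ennreal_mult mult_ac)
    finally show ?thesis .
  qed
  have fins: "fun_norm s (bN N) < top" for N
  proof (induction N)
    case 0 show ?case using mod_fun_finite[OF b] by (simp add: bN_def)
  next
    case (Suc N)
    have "ennreal q * fun_norm s (bN N) + ennreal (K * M0 * q ^ N) < top" using Suc by (simp add: ennreal_mult_less_top)
    then show ?case by (rule le_less_trans[OF step])
  qed
  define x where "x N = enn2real (fun_norm s (bN N))" for N
  have xe: "fun_norm s (bN N) = ennreal (x N)" for N using fins[of N] by (simp add: x_def)
  have "x \<longlonglongrightarrow> 0"
  proof (rule linear_recursion_tendsto_0[OF q(1,2)])
    show "0 \<le> x N" for N by (simp add: x_def)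
    show "x (Suc N) \<le> q * x N + K * M0 * q ^ N" for N
    proof -
      have K0: "0 \<le> K" using F(2) by (simp add: K_def)
      have "ennreal (x (Suc N)) \<le> ennreal (q * x N + K * M0 * q ^ N)"
        using step[of N] q M0 K0 unfolding xe by (simp add: ennreal_mult[symmetric] ennreal_plus[symmetric] x_def del: ennreal_plus)
      then show ?thesis using q M0 K0 by (subst (asm) ennreal_le_iff) (auto simp: x_def)
    qed
  qed
  then have "(\<lambda>N. ennreal (x N)) \<longlonglongrightarrow> ennreal 0" by (rule tendsto_ennrealI)
  then show ?thesis unfolding xe[symmetric] bN_def by simp
qed

section \<open>Local inversion\<close>

lemma ft_measurable:
  fixes g :: "real^'m::finite \<Rightarrow> complex"
  assumes [measurable]: "g \<in> borel_measurable borel" shows "ft g \<in> borel_measurable borel"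
  unfolding ft_def[abs_def] by measurable

lemma weighted_L1_mono: "0 \<le> s \<Longrightarrow> weighted_L1 0 R \<le> weighted_L1 s R"
  by (intro nn_integral_mono mult_right_mono) (auto simp: wt_ge_1)

lemma weighted_L1_ft_schwartz:
  assumes \<psi>: "\<psi> \<in> schwartz" shows "weighted_L1 s (ft \<psi>) < top"
proof -
  define m where "m = 2 * CARD('n) + nat \<lceil>s\<rceil>"
  have m: "2 * CARD('n) + nat \<lceil>s\<rceil> \<le> 2 * m"
  proof -
    have "m \<le> 2 * m" by simp
    then show ?thesis by (simp only: m_def)
  qed
  obtain C where C: "0 \<le> C" "\<And>(z::unit) \<omega>. norm (ft \<psi> \<omega>) \<le> C * decay (2 * m) \<omega> * (\<integral>t. decay (2 * CARD('n)) t \<partial>(lborel :: (real^'n) measure))"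
    by (rule ft_decay[OF schwartz_dbound[OF \<psi>, of "Suc (2 * m)" "2 * CARD('n)"]]) (auto intro: integrable_decay)
  define K where "K = C * (\<integral>t. decay (2 * CARD('n)) t \<partial>(lborel :: (real^'n) measure))"
  have K: "0 \<le> K" unfolding K_def using C(1) by (intro mult_nonneg_nonneg integral_nonneg_AE) auto
  have "wt s \<omega> * ennreal (norm (ft \<psi> \<omega>)) \<le> ennreal K * (wt s \<omega> * ennreal (decay (2 * m) \<omega>))" for \<omega>
  proof -
    have "ennreal (norm (ft \<psi> \<omega>)) \<le> ennreal K * ennreal (decay (2 * m) \<omega>)"
      using C(2)[of \<omega>] K by (simp add: K_def ennreal_mult[symmetric] ennreal_leI mult_ac)
    from mult_left_mono[OF this, of "wt s \<omega>"] show ?thesis by (simp add: mult_ac)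
  qed
  then have "weighted_L1 s (ft \<psi>) \<le> (\<integral>\<^sup>+\<omega>. ennreal K * (wt s \<omega> * ennreal (decay (2 * m) \<omega>)) \<partial>(lborel :: (real^'n) measure))"
    by (intro nn_integral_mono)
  also have "\<dots> < top" using wt_decay_finite[OF m] by (subst nn_integral_cmult) (auto simp: ennreal_mult_less_top)
  finally show ?thesis .
qed

text \<open>Locally, members of the modulation space are Fourier transforms of functions that are integrable
  against the weight, whatever the exponent \<open>p\<close> is.\<close>

lemma weighted_L1_ft_mult:
  assumes s: "0 \<le> s" and f: "mod_fun s f" and \<psi>: "\<psi> \<in> schwartz"
  shows "weighted_L1 s (ft (\<lambda>t. f t * \<psi> t)) < top"
proof -
  note fb = mod_fun_bcont[OF f]
  note [measurable] = local_stft_measurable[OF fb] stft_Lp_measurable[OF fb]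
  define m where "m = 2 * CARD('n) + nat \<lceil>s\<rceil>"
  have m: "2 * CARD('n) + nat \<lceil>s\<rceil> \<le> 2 * m"
  proof -
    have "m \<le> 2 * m" by simp
    then show ?thesis by (simp only: m_def)
  qed
  let ?d = "\<lambda>t::real^'n. ennreal (decay (2 * CARD('n)) t)"
  obtain C where C: "0 \<le> C" "\<And>g (z::unit) \<omega>. mod_fun 0 g \<Longrightarrow> ennreal (norm (ft (\<lambda>t. g t * \<psi> t) \<omega>)) \<le>
     ennreal C * (\<integral>\<^sup>+\<eta>. (\<integral>\<^sup>+t. ?d t * local_stft g t \<eta> \<partial>lborel) * ennreal (decay (2 * m) (\<omega> - \<eta>)) \<partial>lborel)"
    by (rule product_ft_bound[OF schwartz_dbound[OF \<psi>, of "Suc (2 * m)" "2 * CARD('n)"]]) (auto intro: integrable_decay)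
  define K where "K = ennreal C * (decay_mass TYPE('n) * (decay_mass TYPE('n) + 1))"
  have "ennreal (norm (ft (\<lambda>t. f t * \<psi> t) \<omega>)) \<le> K * (\<integral>\<^sup>+\<eta>. stft_Lp f \<eta> * ennreal (decay (2 * m) (\<omega> - \<eta>)) \<partial>lborel)" for \<omega>
  proof -
    have "(\<integral>\<^sup>+t. ?d t * local_stft f t \<eta> \<partial>lborel) \<le> decay_mass TYPE('n) * ((decay_mass TYPE('n) + 1) * stft_Lp f \<eta>)" for \<eta>
    proof -
      have "(\<integral>\<^sup>+t. ?d t * local_stft f t \<eta> \<partial>lborel) \<le> (\<integral>\<^sup>+t. ?d t * ((decay_mass TYPE('n) + 1) * stft_Lp f \<eta>) \<partial>lborel)"
        by (intro nn_integral_mono mult_left_mono local_stft_le fb) auto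
      also have "\<dots> = decay_mass TYPE('n) * ((decay_mass TYPE('n) + 1) * stft_Lp f \<eta>)"
        unfolding decay_mass_def by (rule nn_integral_multc) simp
      finally show ?thesis .
    qed
    then have "(\<integral>\<^sup>+\<eta>. (\<integral>\<^sup>+t. ?d t * local_stft f t \<eta> \<partial>lborel) * ennreal (decay (2 * m) (\<omega> - \<eta>)) \<partial>lborel) \<le>
      (\<integral>\<^sup>+\<eta>. (decay_mass TYPE('n) * ((decay_mass TYPE('n) + 1) * stft_Lp f \<eta>)) * ennreal (decay (2 * m) (\<omega> - \<eta>)) \<partial>lborel)"
      by (intro nn_integral_mono mult_right_mono) auto
    also have "\<dots> = (decay_mass TYPE('n) * (decay_mass TYPE('n) + 1)) * (\<integral>\<^sup>+\<eta>. stft_Lp f \<eta> * ennreal (decay (2 * m) (\<omega> - \<eta>)) \<partial>lborel)"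
      by (subst nn_integral_cmult[symmetric]) (auto simp: mult_ac)
    finally have "ennreal C * (\<integral>\<^sup>+\<eta>. (\<integral>\<^sup>+t. ?d t * local_stft f t \<eta> \<partial>lborel) * ennreal (decay (2 * m) (\<omega> - \<eta>)) \<partial>lborel) \<le> K * (\<integral>\<^sup>+\<eta>. stft_Lp f \<eta> * ennreal (decay (2 * m) (\<omega> - \<eta>)) \<partial>lborel)"
      unfolding K_def mult.assoc[of "ennreal C"] by (intro mult_left_mono) auto
    then show ?thesis using C(2)[OF mod_fun_0[OF s f], of \<omega>] by (rule order_trans[rotated])
  qed
  then have "weighted_L1 s (ft (\<lambda>t. f t * \<psi> t)) \<le> (\<integral>\<^sup>+\<omega>. K * (wt s \<omega> * (\<integral>\<^sup>+\<eta>. stft_Lp f \<eta> * ennreal (decay (2 * m) (\<omega> - \<eta>)) \<partial>lborel)) \<partial>lborel)"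
    by (intro nn_integral_mono) (use mult_left_mono in \<open>fastforce simp: mult.left_commute\<close>)
  also have "\<dots> = K * (\<integral>\<^sup>+\<omega>. wt s \<omega> * (\<integral>\<^sup>+\<eta>. stft_Lp f \<eta> * ennreal (decay (2 * m) (\<omega> - \<eta>)) \<partial>lborel) \<partial>lborel)"
    by (rule nn_integral_cmult) measurable
  also have "\<dots> \<le> K * (ennreal (2 powr s) * (fun_norm s f * (\<integral>\<^sup>+\<zeta>. wt s \<zeta> * ennreal (decay (2 * m) \<zeta>) \<partial>(lborel :: (real^'n) measure))))"
    unfolding fun_norm_eq by (intro mult_left_mono weighted_convolution[OF s, where R="\<lambda>\<zeta>. ennreal (decay (2 * m) \<zeta>)"]) auto
  also have "\<dots> < top"
    using decay_mass_finite[where 'n='n] wt_decay_finite[OF m] mod_fun_finite[OF f] by (simp add: K_def ennreal_mult_less_top)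
  finally show ?thesis .
qed

lemma weighted_L1_scale: "weighted_L1 s (\<lambda>\<omega>. R \<omega> / of_real c) \<le> ennreal (inverse \<bar>c\<bar>) * weighted_L1 s R" if [measurable]: "R \<in> borel_measurable borel"
proof -
  have "weighted_L1 s (\<lambda>\<omega>. R \<omega> / of_real c) = (\<integral>\<^sup>+\<omega>. ennreal (inverse \<bar>c\<bar>) * (wt s \<omega> * ennreal (norm (R \<omega>))) \<partial>lborel)"
    by (intro nn_integral_cong) (simp add: norm_mult norm_inverse divide_inverse ennreal_mult mult_ac)
  also have "\<dots> = ennreal (inverse \<bar>c\<bar>) * weighted_L1 s R" by (rule nn_integral_cmult) measurable
  finally show ?thesis by simp
qed

text \<open>Fourier inversion puts a localised member of the space into the form of a multiplier.\<close>

lemma weighted_L1_finite_representation: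
  assumes s: "0 \<le> s" and g: "bcont g" and int: "integrable lborel g" and fin: "weighted_L1 s (ft g) < top"
  defines "R \<equiv> \<lambda>\<omega>. ft g \<omega> / of_real ((2 * pi) ^ CARD('n))"
  shows "integrable lborel R" "\<And>t. g t = (\<integral>\<eta>. R \<eta> * cis (t \<bullet> \<eta>) \<partial>lborel)"
    "weighted_L1 s R < top" "weighted_L1 0 R \<le> ennreal (inverse ((2 * pi) ^ CARD('n))) * weighted_L1 0 (ft g)"
proof -
  have [measurable]: "ft g \<in> borel_measurable borel" by (rule ft_measurable[OF bcont_measurable[OF g]])
  have "weighted_L1 0 (ft g) < top" using weighted_L1_mono[OF s] fin le_less_trans by blast
  then have I: "integrable lborel (ft g)" by (simp add: integrable_iff_bounded)
  then show "integrable lborel R" unfolding R_def by simp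
  obtain B where B: "\<And>x. norm (g x) \<le> B" using bcont_bound[OF g] by blast
  show "g t = (\<integral>\<eta>. R \<eta> * cis (t \<bullet> \<eta>) \<partial>lborel)" for t
  proof -
    have "(\<integral>\<eta>. R \<eta> * cis (t \<bullet> \<eta>) \<partial>lborel) = (\<integral>\<eta>. ft g \<eta> * cis (t \<bullet> \<eta>) / of_real ((2 * pi) ^ CARD('n)) \<partial>lborel)"
      unfolding R_def by simp
    also have "\<dots> = (\<integral>\<eta>. ft g \<eta> * cis (t \<bullet> \<eta>) \<partial>lborel) / of_real ((2 * pi) ^ CARD('n))" by (rule integral_divide_zero)
    also have "\<dots> = g t" unfolding fourier_inversion[OF bcont_continuous[OF g] B int I] by simp
    finally show ?thesis by simp
  qed
  have le: "weighted_L1 r R \<le> ennreal (inverse ((2 * pi) ^ CARD('n))) * weighted_L1 r (ft g)" for r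
    unfolding R_def using weighted_L1_scale[of "ft g" r "(2 * pi) ^ CARD('n)"] by simp
  show "weighted_L1 0 R \<le> ennreal (inverse ((2 * pi) ^ CARD('n))) * weighted_L1 0 (ft g)" by (rule le)
  have "ennreal (inverse ((2 * pi) ^ CARD('n))) * weighted_L1 s (ft g) < top" using fin by (simp add: ennreal_mult_less_top)
  then show "weighted_L1 s R < top" by (rule le_less_trans[OF le])
qed

lemma ft_dilation:
  fixes B :: "real^'n \<Rightarrow> complex"
  assumes [measurable]: "B \<in> borel_measurable borel" and d: "0 < d"
  shows "ft (\<lambda>t. B ((1 / d) *\<^sub>R t + (- (1 / d)) *\<^sub>R x0)) \<omega> = of_real (d ^ CARD('n)) * (cis (- (x0 \<bullet> \<omega>)) * ft B (d *\<^sub>R \<omega>))"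
proof -
  let ?G = "\<lambda>t. B ((1 / d) *\<^sub>R t + (- (1 / d)) *\<^sub>R x0) * cis (- (t \<bullet> \<omega>))"
  have "(\<integral>v. ?G (x0 + d *\<^sub>R v) \<partial>lborel) = inverse (\<bar>d\<bar> ^ DIM(real^'n)) *\<^sub>R (\<integral>t. ?G t \<partial>lborel)"
    by (rule integral_lborel_affine) (use d in auto)
  then have "of_real (d ^ CARD('n)) * (\<integral>v. ?G (x0 + d *\<^sub>R v) \<partial>lborel) = ft (\<lambda>t. B ((1 / d) *\<^sub>R t + (- (1 / d)) *\<^sub>R x0)) \<omega>"
    using d by (simp add: ft_def scaleR_conv_of_real[where 'a=complex])
  moreover have "?G (x0 + d *\<^sub>R v) = cis (- (x0 \<bullet> \<omega>)) * (B v * cis (- (v \<bullet> (d *\<^sub>R \<omega>))))" for v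
  proof -
    have "(1 / d) *\<^sub>R (x0 + d *\<^sub>R v) + (- (1 / d)) *\<^sub>R x0 = v" using d by (simp add: scaleR_right_distrib)
    moreover have "cis (- ((x0 + d *\<^sub>R v) \<bullet> \<omega>)) = cis (- (x0 \<bullet> \<omega>)) * cis (- (v \<bullet> (d *\<^sub>R \<omega>)))"
      by (simp add: cis_mult inner_add_left)
    ultimately show ?thesis by (simp add: mult_ac)
  qed
  ultimately show ?thesis by (simp add: ft_def)
qed

text \<open>The \<open>L\<^sup>1\<close> modulus of continuity.\<close>

definition shift_diff :: "(real^'n \<Rightarrow> complex) \<Rightarrow> real^'n \<Rightarrow> ennreal" where
  "shift_diff X h = (\<integral>\<^sup>+\<omega>. ennreal (norm (X (\<omega> - h) - X \<omega>)) \<partial>lborel)"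

lemma shift_diff_le:
  assumes [measurable]: "X \<in> borel_measurable borel" shows "shift_diff X h \<le> 2 * weighted_L1 0 X"
proof -
  have "shift_diff X h \<le> (\<integral>\<^sup>+\<omega>. ennreal (norm (X (\<omega> - h))) + ennreal (norm (X \<omega>)) \<partial>lborel)"
    unfolding shift_diff_def by (intro nn_integral_mono) (simp add: norm_triangle_ineq4 ennreal_leI flip: ennreal_plus)
  also have "\<dots> = 2 * weighted_L1 0 X"
    using nn_integral_lborel_translate[of "\<lambda>\<omega>. ennreal (norm (X \<omega>))" h] by (simp add: nn_integral_add mult_2)
  finally show ?thesis .
qed

text \<open>Translating \<open>ft B\<close> amounts to multiplying \<open>B\<close> by a character, and the difference of a character
  from \<open>1\<close> is small together with its derivatives by \<open>dbound_cis_diff\<close>.\<close>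

lemma shift_diff_ft_tendsto:
  assumes B: "B \<in> schwartz" and h: "h \<longlonglongrightarrow> 0"
  shows "(\<lambda>k. shift_diff (ft B) (h k)) \<longlonglongrightarrow> 0"
proof -
  let ?n = "2 * CARD('n)" and ?N = "Suc (2 * CARD('n))"
  let ?W = "\<lambda>(v::real^'n) (t::real^'n). decay (Suc ?n) t * (norm v * japanese v ^ ?N * japanese t)"
  have d: "dbound ?N ?W (\<lambda>v t. B t * (cis (- (t \<bullet> v)) - 1))"
    by (intro dbound_mult schwartz_dbound[OF B] dbound_cis_diff)
  have W: "?W v t = norm v * japanese v ^ ?N * decay ?n t" for v t :: "real^'n"
    by (simp add: decay_def)
  have WI: "integrable lborel (?W v)" for v :: "real^'n"
    unfolding W by (intro integrable_mult_right integrable_decay) simp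
  obtain C where C: "0 \<le> C" "\<And>v \<omega>. norm (ft (\<lambda>t. B t * (cis (- (t \<bullet> v)) - 1)) \<omega>) \<le> C * decay ?n \<omega> * (\<integral>t. ?W v t \<partial>lborel)"
    by (rule ft_decay[OF d _ WI]) auto
  have diff: "ft B (\<omega> - v) - ft B \<omega> = ft (\<lambda>t. B t * (cis (- (t \<bullet> (- v))) - 1)) \<omega>" for v \<omega>
  proof -
    have I: "integrable lborel (\<lambda>t. B t * cis (- (t \<bullet> \<omega>)))" for \<omega> by (rule integrable_ft[OF schwartz_integrable[OF B]])
    have "ft B (\<omega> - v) - ft B \<omega> = (\<integral>t. B t * cis (- (t \<bullet> (\<omega> - v))) - B t * cis (- (t \<bullet> \<omega>)) \<partial>lborel)"
      unfolding ft_def by (rule Bochner_Integration.integral_diff[symmetric, OF I I])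
    also have "\<dots> = ft (\<lambda>t. B t * (cis (- (t \<bullet> (- v))) - 1)) \<omega>"
      unfolding ft_def
    proof (intro Bochner_Integration.integral_cong refl)
      fix t
      have "cis (- (t \<bullet> (\<omega> - v))) = cis (- (t \<bullet> (- v))) * cis (- (t \<bullet> \<omega>))" by (simp add: cis_mult inner_diff_right)
      then show "B t * cis (- (t \<bullet> (\<omega> - v))) - B t * cis (- (t \<bullet> \<omega>)) = B t * (cis (- (t \<bullet> (- v))) - 1) * cis (- (t \<bullet> \<omega>))"
        by (simp add: algebra_simps)
    qed
    finally show ?thesis .
  qed
  define M where "M = (\<integral>t. decay ?n t \<partial>(lborel :: (real^'n) measure))"
  have M: "0 \<le> M" unfolding M_def by (intro integral_nonneg_AE) auto
  have "shift_diff (ft B) v \<le> ennreal (C * M * (norm v * japanese v ^ ?N)) * decay_mass TYPE('n)" for v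
  proof -
    have "shift_diff (ft B) v \<le> (\<integral>\<^sup>+\<omega>. ennreal (C * M * (norm v * japanese v ^ ?N)) * ennreal (decay ?n \<omega>) \<partial>(lborel :: (real^'n) measure))"
      unfolding shift_diff_def
    proof (intro nn_integral_mono)
      fix \<omega>
      have "norm (ft B (\<omega> - v) - ft B \<omega>) \<le> C * M * (norm v * japanese v ^ ?N) * decay ?n \<omega>"
        using C(2)[of "- v" \<omega>] unfolding diff W by (simp add: M_def mult_ac)
      then show "ennreal (norm (ft B (\<omega> - v) - ft B \<omega>)) \<le> ennreal (C * M * (norm v * japanese v ^ ?N)) * ennreal (decay ?n \<omega>)"
        using C(1) M by (simp add: ennreal_mult[symmetric] ennreal_leI)
    qed
    also have "\<dots> = ennreal (C * M * (norm v * japanese v ^ ?N)) * decay_mass TYPE('n)"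
      unfolding decay_mass_def by (rule nn_integral_cmult) simp
    finally show ?thesis .
  qed
  moreover have "(\<lambda>k. ennreal (C * M * (norm (h k) * japanese (h k) ^ ?N)) * decay_mass TYPE('n)) \<longlonglongrightarrow> 0"
  proof -
    have "(\<lambda>k. C * M * (norm (h k) * japanese (h k) ^ ?N)) \<longlonglongrightarrow> C * M * (norm (0::real^'n) * japanese (0::real^'n) ^ ?N)"
      unfolding japanese_def by (intro tendsto_intros h)
    then have "(\<lambda>k. C * M * (norm (h k) * japanese (h k) ^ ?N)) \<longlonglongrightarrow> 0" by simp
    then have "(\<lambda>k. ennreal (C * M * (norm (h k) * japanese (h k) ^ ?N))) \<longlonglongrightarrow> ennreal 0" by (rule tendsto_ennrealI)
    then have "(\<lambda>k. ennreal (C * M * (norm (h k) * japanese (h k) ^ ?N)) * decay_mass TYPE('n)) \<longlonglongrightarrow> ennreal 0 * decay_mass TYPE('n)"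
      by (intro tendsto_mult_ennreal) (use decay_mass_finite[where 'n='n] in auto)
    then show ?thesis by simp
  qed
  ultimately show ?thesis
    by - (rule tendsto_sandwich[where f="\<lambda>_. 0" and
          h="\<lambda>k. ennreal (C * M * (norm (h k) * japanese (h k) ^ ?N)) * decay_mass TYPE('n)"], auto)
qed

text \<open>Wiener's local argument. Let \<open>r d\<close> be \<open>1 - f / f x0\<close> cut off at distance \<open>d\<close> from \<open>x0\<close>. For small
  \<open>d\<close> it equals the cut-off \<open>X d\<close> times \<open>r 1\<close>, so its Fourier transform is the convolution of
  \<open>ft (X d)\<close> with the density \<open>R 1\<close> of \<open>r 1\<close>. As \<open>r 1\<close> vanishes at \<open>x0\<close>, the integral of \<open>R 1\<close>
  against the character at \<open>x0\<close> is \<open>0\<close>, and \<open>ft (X d)\<close> may be replaced by its increments. After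
  rescaling these are the increments of \<open>ft B\<close> for the shifts \<open>d \<eta>\<close>, whose \<open>L\<^sup>1\<close> norms tend to \<open>0\<close>
  with \<open>d\<close>; dominated convergence in \<open>\<eta>\<close> concludes.\<close>

lemma local_smallness:
  assumes s: "0 \<le> s" and f: "mod_fun s f" and fx0: "f x0 \<noteq> 0"
    and \<beta>: "0 < \<rho>" "(\<lambda>x. complex_of_real (\<beta> x)) \<in> schwartz" "\<And>x. norm x \<le> \<rho> \<Longrightarrow> \<beta> x = 1" "\<And>x. 1 < norm x \<Longrightarrow> \<beta> x = 0"
  obtains d R where "0 < d" "mod_fun s (\<lambda>t. complex_of_real (\<beta> ((1 / d) *\<^sub>R t + (- (1 / d)) *\<^sub>R x0)) * (1 - f t / f x0))"
    "integrable lborel R"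
    "\<And>t. complex_of_real (\<beta> ((1 / d) *\<^sub>R t + (- (1 / d)) *\<^sub>R x0)) * (1 - f t / f x0) = (\<integral>\<eta>. R \<eta> * cis (t \<bullet> \<eta>) \<partial>lborel)"
    "weighted_L1 0 R < 1" "weighted_L1 s R < top"
proof -
  define B where "B x = complex_of_real (\<beta> x)" for x
  have B: "B \<in> schwartz" using \<beta>(2) by (simp add: B_def[abs_def])
  define X where "X d t = B ((1 / d) *\<^sub>R t + (- (1 / d)) *\<^sub>R x0)" for d t
  have X: "X d \<in> schwartz" if "0 < d" for d
    unfolding X_def[abs_def] using that by (intro schwartz_affine[OF B]) auto
  have nX: "norm ((1 / d) *\<^sub>R t + (- (1 / d)) *\<^sub>R x0) = norm (t - x0) / d" if "0 < d" for d t
    using that by (simp flip: scaleR_right_diff_distrib)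
  define r where "r d t = X d t * (1 - f t / f x0)" for d t
  have r_eq: "r d = (\<lambda>t. X d t - (1 / f x0) * (f t * X d t))" for d by (auto simp: r_def algebra_simps)
  have rm: "mod_fun s (r d)" if "0 < d" for d
    unfolding r_eq by (intro mod_fun_diff mod_fun_cmult mod_fun_mult[OF s f] schwartz_mod_fun X that)
  have Xint: "integrable lborel (\<lambda>t. f t * X d t)" if "0 < d" for d
    by (rule bcont_integrable[OF mod_fun_bcont[OF f] schwartz_integrable[OF X[OF that]]])
  have rint: "integrable lborel (r d)" if "0 < d" for d
    unfolding r_eq by (intro Bochner_Integration.integrable_diff integrable_mult_right Xint schwartz_integrable X that)
  have ftr: "ft (r d) \<omega> = ft (X d) \<omega> - (1 / f x0) * ft (\<lambda>t. f t * X d t) \<omega>" if "0 < d" for d \<omega>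
  proof -
    have "ft (r d) \<omega> = (\<integral>t. X d t * cis (- (t \<bullet> \<omega>)) - (1 / f x0) * (f t * X d t * cis (- (t \<bullet> \<omega>))) \<partial>lborel)"
      unfolding ft_def r_eq by (intro Bochner_Integration.integral_cong) (auto simp: algebra_simps)
    also have "\<dots> = ft (X d) \<omega> - (1 / f x0) * ft (\<lambda>t. f t * X d t) \<omega>"
      unfolding ft_def Bochner_Integration.integral_diff[OF integrable_ft[OF schwartz_integrable[OF X[OF that]]] integrable_mult_right[OF integrable_ft[OF Xint[OF that]]]]
        integral_mult_right_zero by (rule refl)
    finally show ?thesis .
  qed
  have flr: "weighted_L1 s (ft (r d)) < top" if d: "0 < d" for d
  proof -
    have [measurable]: "ft (X d) \<in> borel_measurable borel" "ft (\<lambda>t. f t * X d t) \<in> borel_measurable borel"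
      using borel_measurable_integrable[OF Xint[OF d]] schwartz_measurable[OF X[OF d]] by (auto intro!: ft_measurable)
    have "weighted_L1 s (ft (r d)) \<le> (\<integral>\<^sup>+\<omega>. wt s \<omega> * ennreal (norm (ft (X d) \<omega>)) + ennreal (norm (1 / f x0)) * (wt s \<omega> * ennreal (norm (ft (\<lambda>t. f t * X d t) \<omega>))) \<partial>lborel)"
    proof (intro nn_integral_mono)
      fix \<omega>
      have "norm (ft (r d) \<omega>) \<le> norm (ft (X d) \<omega>) + norm (1 / f x0) * norm (ft (\<lambda>t. f t * X d t) \<omega>)"
        unfolding ftr[OF d] norm_mult[symmetric] by (rule norm_triangle_ineq4)
      then have "ennreal (norm (ft (r d) \<omega>)) \<le> ennreal (norm (ft (X d) \<omega>)) + ennreal (norm (1 / f x0)) * ennreal (norm (ft (\<lambda>t. f t * X d t) \<omega>))"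
        by (simp add: ennreal_mult[symmetric] ennreal_leI flip: ennreal_plus)
      from mult_left_mono[OF this, of "wt s \<omega>"]
      show "wt s \<omega> * ennreal (norm (ft (r d) \<omega>)) \<le> wt s \<omega> * ennreal (norm (ft (X d) \<omega>)) + ennreal (norm (1 / f x0)) * (wt s \<omega> * ennreal (norm (ft (\<lambda>t. f t * X d t) \<omega>)))"
        by (simp add: distrib_left mult_ac)
    qed
    also have "\<dots> = weighted_L1 s (ft (X d)) + ennreal (norm (1 / f x0)) * weighted_L1 s (ft (\<lambda>t. f t * X d t))"
      by (simp add: nn_integral_add nn_integral_cmult)
    also have "\<dots> < top" using weighted_L1_ft_schwartz[OF X[OF d]] weighted_L1_ft_mult[OF s f X[OF d]] by (simp add: ennreal_mult_less_top)
    finally show ?thesis .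
  qed
  \<comment> \<open>The normalising constant of Fourier inversion, which also is the threshold for the \<open>L\<^sup>1\<close> norm.\<close>
  define c where "c = (2 * pi) ^ CARD('n)"
  have c: "0 < c" by (simp add: c_def)
  define R where "R d \<omega> = ft (r d) \<omega> / of_real c" for d \<omega>
  have R: "integrable lborel (R d)" "\<And>t. r d t = (\<integral>\<eta>. R d \<eta> * cis (t \<bullet> \<eta>) \<partial>lborel)" "weighted_L1 s (R d) < top"
    "weighted_L1 0 (R d) \<le> ennreal (inverse c) * weighted_L1 0 (ft (r d))" if d: "0 < d" for d
    using weighted_L1_finite_representation[OF s mod_fun_bcont[OF rm[OF d]] rint[OF d] flr[OF d]] unfolding R_def[abs_def] c_def by blast+
  have R1m [measurable]: "R 1 \<in> borel_measurable borel" using borel_measurable_integrable[OF R(1)[of 1]] by simp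
  have [measurable]: "ft B \<in> borel_measurable borel" by (rule ft_measurable[OF schwartz_measurable[OF B]])
  have smd [measurable]: "(\<lambda>\<eta>. shift_diff (ft B) (d *\<^sub>R \<eta>)) \<in> borel_measurable borel" for d
    unfolding shift_diff_def by measurable
  have small: "weighted_L1 0 (ft (r d)) \<le> (\<integral>\<^sup>+\<eta>. ennreal (norm (R 1 \<eta>)) * shift_diff (ft B) (d *\<^sub>R \<eta>) \<partial>lborel)" if d: "0 < d" "d \<le> \<rho>" for d
  proof -
    \<comment> \<open>For \<open>d \<le> \<rho>\<close> the cut-off \<open>X 1\<close> equals \<open>1\<close> on the support of \<open>X d\<close>.\<close>
    have "r d t = X d t * r 1 t" for t
    proof (cases "norm (t - x0) \<le> d")
      case True
      then have "X 1 t = 1" using d nX[of 1 t] by (simp add: X_def B_def \<beta>(3))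
      then show ?thesis by (simp add: r_def)
    next
      case False
      then have "1 < norm (t - x0) / d" using d by (simp add: field_simps)
      then have "X d t = 0" using nX[OF d(1), of t] by (simp add: X_def B_def \<beta>(4))
      then show ?thesis by (simp add: r_def)
    qed
    then have rd: "r d = (\<lambda>t. X d t * r 1 t)" by auto
    have ftX: "ft (X d) \<omega> = of_real (d ^ CARD('n)) * (cis (- (x0 \<bullet> \<omega>)) * ft B (d *\<^sub>R \<omega>))" for \<omega>
      unfolding X_def[abs_def] by (rule ft_dilation[OF schwartz_measurable[OF B] d(1)])
    have zero: "(\<integral>\<eta>. R 1 \<eta> * cis (x0 \<bullet> \<eta>) \<partial>lborel) = 0"
      using R(2)[of 1 x0] fx0 by (simp add: r_def)
    obtain A where A: "0 \<le> A" "\<And>\<omega>. norm (ft (X d) \<omega>) \<le> A"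
    proof
      show "norm (ft (X d) \<omega>) \<le> (\<integral>t. norm (X d t) \<partial>lborel)" for \<omega>
        unfolding ft_def by (rule order_trans[OF integral_norm_bound]) (simp add: norm_mult)
    qed (rule integral_nonneg_AE, simp)
    have [measurable]: "ft (X d) \<in> borel_measurable borel" by (rule ft_measurable[OF schwartz_measurable[OF X[OF d(1)]]])
    have pt: "ennreal (norm (ft (r d) \<xi>)) \<le> (\<integral>\<^sup>+\<eta>. ennreal (norm (R 1 \<eta>)) * (ennreal (d ^ CARD('n)) * ennreal (norm (ft B (d *\<^sub>R \<xi> - d *\<^sub>R \<eta>) - ft B (d *\<^sub>R \<xi>)))) \<partial>lborel)" for \<xi>
    proof -
      have I1: "integrable lborel (\<lambda>\<eta>. R 1 \<eta> * ft (X d) (\<xi> - \<eta>))"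
      proof (rule integrable_lborel_bounded[OF _ integrable_norm[OF R(1)[of 1]], of _ A])
        show "norm (R 1 \<eta> * ft (X d) (\<xi> - \<eta>)) \<le> A * norm (R 1 \<eta>)" for \<eta>
          using mult_left_mono[OF A(2)[of "\<xi> - \<eta>"], of "norm (R 1 \<eta>)"] by (simp add: norm_mult mult.commute)
      qed simp_all
      have I2: "integrable lborel (\<lambda>\<eta>. R 1 \<eta> * cis (x0 \<bullet> \<eta>) * ft (X d) \<xi>)"
      proof (rule integrable_lborel_bounded[OF _ integrable_norm[OF R(1)[of 1]], of _ A])
        show "norm (R 1 \<eta> * cis (x0 \<bullet> \<eta>) * ft (X d) \<xi>) \<le> A * norm (R 1 \<eta>)" for \<eta>
          using mult_left_mono[OF A(2)[of \<xi>], of "norm (R 1 \<eta>)"] by (simp add: norm_mult mult.commute)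
      qed simp_all
      \<comment> \<open>The subtracted term is \<open>0\<close> because \<open>r 1\<close> vanishes at \<open>x0\<close>.\<close>
      have "ft (r d) \<xi> = (\<integral>\<eta>. R 1 \<eta> * ft (X d) (\<xi> - \<eta>) \<partial>lborel) - (\<integral>\<eta>. R 1 \<eta> * cis (x0 \<bullet> \<eta>) \<partial>lborel) * ft (X d) \<xi>"
        unfolding rd zero using ft_multiplier[OF schwartz_integrable[OF X[OF d(1)]] R(1)[of 1] R(2)[of 1], of \<xi>] by simp
      also have "\<dots> = (\<integral>\<eta>. R 1 \<eta> * ft (X d) (\<xi> - \<eta>) - R 1 \<eta> * cis (x0 \<bullet> \<eta>) * ft (X d) \<xi> \<partial>lborel)"
        by (subst Bochner_Integration.integral_diff[OF I1 I2]) simp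
      finally have "ennreal (norm (ft (r d) \<xi>)) \<le> (\<integral>\<^sup>+\<eta>. ennreal (norm (R 1 \<eta> * ft (X d) (\<xi> - \<eta>) - R 1 \<eta> * cis (x0 \<bullet> \<eta>) * ft (X d) \<xi>)) \<partial>lborel)"
        using integral_norm_bound_ennreal[OF Bochner_Integration.integrable_diff[OF I1 I2]] by simp
      also have "\<dots> = (\<integral>\<^sup>+\<eta>. ennreal (norm (R 1 \<eta>)) * (ennreal (d ^ CARD('n)) * ennreal (norm (ft B (d *\<^sub>R \<xi> - d *\<^sub>R \<eta>) - ft B (d *\<^sub>R \<xi>)))) \<partial>lborel)"
      proof (intro nn_integral_cong)
        fix \<eta>
        have "cis (x0 \<bullet> \<eta>) * cis (- (x0 \<bullet> \<xi>)) = cis (- (x0 \<bullet> (\<xi> - \<eta>)))" by (simp add: cis_mult inner_diff_right)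
        then have "R 1 \<eta> * ft (X d) (\<xi> - \<eta>) - R 1 \<eta> * cis (x0 \<bullet> \<eta>) * ft (X d) \<xi> =
            R 1 \<eta> * (of_real (d ^ CARD('n)) * (cis (- (x0 \<bullet> (\<xi> - \<eta>))) * (ft B (d *\<^sub>R \<xi> - d *\<^sub>R \<eta>) - ft B (d *\<^sub>R \<xi>))))"
          unfolding ftX scaleR_right_diff_distrib by (simp add: algebra_simps)
        then show "ennreal (norm (R 1 \<eta> * ft (X d) (\<xi> - \<eta>) - R 1 \<eta> * cis (x0 \<bullet> \<eta>) * ft (X d) \<xi>)) =
            ennreal (norm (R 1 \<eta>)) * (ennreal (d ^ CARD('n)) * ennreal (norm (ft B (d *\<^sub>R \<xi> - d *\<^sub>R \<eta>) - ft B (d *\<^sub>R \<xi>))))"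
          using d by (simp add: norm_mult norm_power ennreal_mult)
      qed
      finally show ?thesis .
    qed
    have "weighted_L1 0 (ft (r d)) \<le> (\<integral>\<^sup>+\<xi>. \<integral>\<^sup>+\<eta>. ennreal (norm (R 1 \<eta>)) * (ennreal (d ^ CARD('n)) * ennreal (norm (ft B (d *\<^sub>R \<xi> - d *\<^sub>R \<eta>) - ft B (d *\<^sub>R \<xi>)))) \<partial>lborel \<partial>lborel)"
      using pt by (intro nn_integral_mono) simp
    also have "\<dots> = (\<integral>\<^sup>+\<eta>. \<integral>\<^sup>+\<xi>. ennreal (norm (R 1 \<eta>)) * (ennreal (d ^ CARD('n)) * ennreal (norm (ft B (d *\<^sub>R \<xi> - d *\<^sub>R \<eta>) - ft B (d *\<^sub>R \<xi>)))) \<partial>lborel \<partial>lborel)"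
      by (rule lborel_pair.Fubini') measurable
    also have "\<dots> = (\<integral>\<^sup>+\<eta>. ennreal (norm (R 1 \<eta>)) * shift_diff (ft B) (d *\<^sub>R \<eta>) \<partial>lborel)"
    proof (intro nn_integral_cong)
      fix \<eta>
      have "(\<integral>\<^sup>+\<xi>. ennreal (norm (ft B (d *\<^sub>R \<xi> - d *\<^sub>R \<eta>) - ft B (d *\<^sub>R \<xi>))) \<partial>lborel) = ennreal (inverse (d ^ CARD('n))) * shift_diff (ft B) (d *\<^sub>R \<eta>)"
        using nn_integral_lborel_affine[of "\<lambda>\<omega>. ennreal (norm (ft B (\<omega> - d *\<^sub>R \<eta>) - ft B \<omega>))" d 0] d by (simp add: shift_diff_def)
      moreover have "ennreal (d ^ CARD('n)) * (ennreal (inverse (d ^ CARD('n))) * T) = T" for T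
        using d by (simp add: mult.assoc[symmetric] ennreal_mult[symmetric])
      ultimately show "(\<integral>\<^sup>+\<xi>. ennreal (norm (R 1 \<eta>)) * (ennreal (d ^ CARD('n)) * ennreal (norm (ft B (d *\<^sub>R \<xi> - d *\<^sub>R \<eta>) - ft B (d *\<^sub>R \<xi>)))) \<partial>lborel) = ennreal (norm (R 1 \<eta>)) * shift_diff (ft B) (d *\<^sub>R \<eta>)"
        by (simp add: nn_integral_cmult)
    qed
    finally show ?thesis .
  qed
  define e where "e k = inverse (real (Suc k))" for k
  have e0: "e \<longlonglongrightarrow> 0" unfolding e_def by (rule LIMSEQ_inverse_real_of_nat)
  have epos: "0 < e k" for k by (simp add: e_def)
  have R1fin: "(\<integral>\<^sup>+\<eta>. ennreal (norm (R 1 \<eta>)) \<partial>lborel) < top" using R(1)[of 1] by (simp add: integrable_iff_bounded)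
  have flB: "weighted_L1 0 (ft B) < top" by (rule weighted_L1_ft_schwartz[OF B])
  have "(\<lambda>k. \<integral>\<^sup>+\<eta>. ennreal (norm (R 1 \<eta>)) * shift_diff (ft B) (e k *\<^sub>R \<eta>) \<partial>lborel) \<longlonglongrightarrow> (\<integral>\<^sup>+\<eta>. 0 \<partial>(lborel :: (real^'n) measure))"
  proof (rule nn_integral_dominated_convergence[where w="\<lambda>\<eta>. ennreal (norm (R 1 \<eta>)) * (2 * weighted_L1 0 (ft B))"])
    show "AE \<eta> in lborel. ennreal (norm (R 1 \<eta>)) * shift_diff (ft B) (e k *\<^sub>R \<eta>) \<le> ennreal (norm (R 1 \<eta>)) * (2 * weighted_L1 0 (ft B))" for k
      by (intro AE_I2 mult_left_mono shift_diff_le) auto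
    show "(\<integral>\<^sup>+\<eta>. ennreal (norm (R 1 \<eta>)) * (2 * weighted_L1 0 (ft B)) \<partial>lborel) < \<infinity>"
      using R1fin flB by (subst nn_integral_multc) (auto simp: ennreal_mult_less_top)
    show "AE \<eta> in lborel. (\<lambda>k. ennreal (norm (R 1 \<eta>)) * shift_diff (ft B) (e k *\<^sub>R \<eta>)) \<longlonglongrightarrow> 0"
    proof (rule AE_I2)
      fix \<eta> :: "real^'n"
      have "(\<lambda>k. e k *\<^sub>R \<eta>) \<longlonglongrightarrow> 0 *\<^sub>R \<eta>" by (intro tendsto_intros e0)
      then have "(\<lambda>k. shift_diff (ft B) (e k *\<^sub>R \<eta>)) \<longlonglongrightarrow> 0" by (intro shift_diff_ft_tendsto[OF B]) simp
      then have "(\<lambda>k. ennreal (norm (R 1 \<eta>)) * shift_diff (ft B) (e k *\<^sub>R \<eta>)) \<longlonglongrightarrow> ennreal (norm (R 1 \<eta>)) * 0"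
        by (intro tendsto_mult_ennreal) auto
      then show "(\<lambda>k. ennreal (norm (R 1 \<eta>)) * shift_diff (ft B) (e k *\<^sub>R \<eta>)) \<longlonglongrightarrow> 0" by simp
    qed
  qed (measurable)
  then have "\<forall>\<^sub>F k in sequentially. (\<integral>\<^sup>+\<eta>. ennreal (norm (R 1 \<eta>)) * shift_diff (ft B) (e k *\<^sub>R \<eta>) \<partial>lborel) < ennreal c"
    using c by (intro order_tendstoD) auto
  moreover have "\<forall>\<^sub>F k in sequentially. e k < \<rho>" using e0 \<beta>(1) by (rule order_tendstoD)
  ultimately have "\<forall>\<^sub>F k in sequentially. (\<integral>\<^sup>+\<eta>. ennreal (norm (R 1 \<eta>)) * shift_diff (ft B) (e k *\<^sub>R \<eta>) \<partial>lborel) < ennreal c \<and> e k < \<rho>"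
    by eventually_elim simp
  then obtain k where k: "(\<integral>\<^sup>+\<eta>. ennreal (norm (R 1 \<eta>)) * shift_diff (ft B) (e k *\<^sub>R \<eta>) \<partial>lborel) < ennreal c" "e k < \<rho>"
    using eventually_happens'[OF sequentially_bot] by blast
  have "weighted_L1 0 (R (e k)) < 1"
  proof -
    have "weighted_L1 0 (ft (r (e k))) < ennreal c" by (rule le_less_trans[OF small[OF epos] k(1)]) (use k(2) in simp)
    then obtain F where F: "weighted_L1 0 (ft (r (e k))) = ennreal F" "0 \<le> F" "F < c" by (cases "weighted_L1 0 (ft (r (e k)))") (auto simp: ennreal_less_iff)
    have "ennreal (inverse c) * ennreal F < 1"
      using F c by (simp add: ennreal_mult[symmetric] ennreal_less_one_iff field_simps)
    then show ?thesis using R(4)[OF epos[of k]] unfolding F(1) by (rule le_less_trans[rotated])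
  qed
  then show ?thesis
    using that[of "e k" "R (e k)"] epos[of k] rm[OF epos[of k]] R(1-3)[OF epos[of k]]
    unfolding r_def[abs_def] X_def B_def by blast
qed

section \<open>Closed ideals of modulation spaces\<close>

lemma distr_mult_distr_of: "bcont f \<Longrightarrow> bcont g \<Longrightarrow> distr_mult (distr_of f) (distr_of g) = distr_of (\<lambda>t. f t * g t)"
  by (simp add: distr_mult_def fun_of_distr_of)

lemma mod_dist_distr_of:
  "bcont f \<Longrightarrow> bcont g \<Longrightarrow> mod_dist \<phi> p s (distr_of f) (distr_of g) = enn2real (fun_norm s (\<lambda>t. f t - g t))"
  by (simp add: mod_dist_def distr_of_diff)

text \<open>Point evaluations are bounded by the norm.\<close>

lemma fun_norm_pos:
  assumes s: "0 \<le> s" and g: "mod_fun s g" and zero: "fun_norm s g = 0" shows "g = (\<lambda>t. 0)"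
proof -
  have "fun_norm 0 g = 0" using mod_norm_mono_weight[OF p s, of \<phi> "distr_of g"] zero by simp
  moreover obtain C where "\<And>g t. mod_fun 0 g \<Longrightarrow> norm (g t) \<le> C * enn2real (fun_norm 0 g)"
    using point_evaluation_bound by blast
  ultimately have "norm (g t) \<le> 0" for t using mod_fun_0[OF s g] by (metis enn2real_0 mult_zero_right)
  then show ?thesis by auto
qed

lemma modulation_metric:
  assumes s: "0 \<le> s" shows "Metric_space (modulation_space \<phi> p s) (mod_dist \<phi> p s)"
proof
  fix u v :: "'n functional"
  show "0 \<le> mod_dist \<phi> p s u v" by (simp add: mod_dist_def)
  show "mod_dist \<phi> p s u v = mod_dist \<phi> p s v u"
    by (simp add: mod_dist_def mod_norm_def stft_def norm_minus_commute)
next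
  fix u v assume "u \<in> modulation_space \<phi> p s" "v \<in> modulation_space \<phi> p s"
  then obtain f g where f: "u = distr_of f" "mod_fun s f" and g: "v = distr_of g" "mod_fun s g"
    unfolding modulation_space_eq[OF s] by blast
  have d: "mod_dist \<phi> p s u v = enn2real (fun_norm s (\<lambda>t. f t - g t))"
    unfolding f(1) g(1) by (rule mod_dist_distr_of[OF mod_fun_bcont[OF f(2)] mod_fun_bcont[OF g(2)]])
  show "(mod_dist \<phi> p s u v = 0) = (u = v)"
  proof
    assume "mod_dist \<phi> p s u v = 0"
    then have "fun_norm s (\<lambda>t. f t - g t) = 0"
      using mod_fun_finite[OF mod_fun_diff[OF f(2) g(2)]] by (auto simp: d enn2real_eq_0_iff)
    from fun_norm_pos[OF s mod_fun_diff[OF f(2) g(2)] this] have "f = g" by (auto simp: fun_eq_iff)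
    then show "u = v" by (simp only: f(1) g(1))
  next
    assume "u = v"
    then have "distr_of f = distr_of g" by (simp only: f(1) g(1))
    then have "fun_of (distr_of f) = fun_of (distr_of g)" by (rule arg_cong)
    then have eq: "f = g" unfolding fun_of_distr_of[OF mod_fun_bcont[OF f(2)]] fun_of_distr_of[OF mod_fun_bcont[OF g(2)]] .
    show "mod_dist \<phi> p s u v = 0" unfolding d eq by (simp add: fun_norm_eq stft_Lp_def V_def ft_def Lp_0)
  qed
next
  fix u v w assume "u \<in> modulation_space \<phi> p s" "v \<in> modulation_space \<phi> p s" "w \<in> modulation_space \<phi> p s"
  then obtain f g h where f: "u = distr_of f" "mod_fun s f" and g: "v = distr_of g" "mod_fun s g" and h: "w = distr_of h" "mod_fun s h"
    unfolding modulation_space_eq[OF s] by blast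
  note b = mod_fun_bcont[OF f(2)] mod_fun_bcont[OF g(2)] mod_fun_bcont[OF h(2)]
  have "fun_norm s (\<lambda>t. f t - h t) \<le> fun_norm s (\<lambda>t. f t - g t) + fun_norm s (\<lambda>t. g t - h t)"
    using fun_norm_add_le[OF bcont_diff[OF b(1,2)] bcont_diff[OF b(2,3)], of s] by simp
  moreover have fin: "fun_norm s (\<lambda>t. f t - g t) < top" "fun_norm s (\<lambda>t. g t - h t) < top"
    using mod_fun_finite mod_fun_diff f g h by blast+
  ultimately have "enn2real (fun_norm s (\<lambda>t. f t - h t)) \<le> enn2real (fun_norm s (\<lambda>t. f t - g t) + fun_norm s (\<lambda>t. g t - h t))"
    by (intro enn2real_mono) (auto simp: less_top)
  also have "\<dots> = enn2real (fun_norm s (\<lambda>t. f t - g t)) + enn2real (fun_norm s (\<lambda>t. g t - h t))"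
    using fin by (intro enn2real_plus)
  finally show "mod_dist \<phi> p s u w \<le> mod_dist \<phi> p s u v + mod_dist \<phi> p s v w"
    by (simp add: f g h mod_dist_distr_of b)
qed

text \<open>Sequential form of closedness, expressed through the functions.\<close>

lemma closed_ideal_limit:
  assumes s: "0 \<le> s" and J: "closed_ideal \<phi> p s J" and g: "mod_fun s g"
    and a: "\<And>k. mod_fun s (a k)" "\<And>k. distr_of (a k) \<in> J" and lim: "(\<lambda>k. fun_norm s (\<lambda>t. a k t - g t)) \<longlonglongrightarrow> 0"
  shows "distr_of g \<in> J"
proof (rule ccontr)
  assume n: "distr_of g \<notin> J"
  interpret Metric_space "modulation_space \<phi> p s" "mod_dist \<phi> p s" by (rule modulation_metric[OF s])
  have gM: "distr_of g \<in> modulation_space \<phi> p s" unfolding modulation_space_eq[OF s] using g by blast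
  have aM: "distr_of (a k) \<in> modulation_space \<phi> p s" for k unfolding modulation_space_eq[OF s] using a(1) by blast
  from J have "closedin mtopology J" by (simp add: closed_ideal_def mod_topology_def)
  then obtain r where r: "0 < r" "disjnt J (mball (distr_of g) r)"
    unfolding closedin_metric using n gM by blast
  have "\<forall>\<^sub>F k in sequentially. fun_norm s (\<lambda>t. a k t - g t) < ennreal r"
    using lim r(1) by (intro order_tendstoD) auto
  then obtain k where k: "fun_norm s (\<lambda>t. a k t - g t) < ennreal r"
    using eventually_happens'[OF sequentially_bot] by blast
  have "mod_dist \<phi> p s (distr_of g) (distr_of (a k)) = enn2real (fun_norm s (\<lambda>t. a k t - g t))"
    by (subst commute) (rule mod_dist_distr_of[OF mod_fun_bcont[OF a(1)] mod_fun_bcont[OF g]])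
  also have "\<dots> < r" using k r(1) by (cases "fun_norm s (\<lambda>t. a k t - g t)") (auto simp: ennreal_less_iff)
  finally have "distr_of (a k) \<in> mball (distr_of g) r"
    using gM aM by (simp add: in_mball)
  then show False using r(2) a(2)[of k] by (auto simp: disjnt_iff)
qed

text \<open>Closedness holds because point evaluations are continuous. The case of an empty set \<open>Z\<close> says that the
  whole space is a closed ideal.\<close>

lemma vanishing_closed_ideal:
  assumes s: "0 \<le> s" shows "closed_ideal \<phi> p s {distr_of g | g. mod_fun s g \<and> (\<forall>x\<in>Z. g x = 0)}"
  unfolding closed_ideal_def
proof
  let ?J = "{distr_of g | g. mod_fun s g \<and> (\<forall>x\<in>Z. g x = 0)}"
  show "mod_ideal \<phi> p s ?J"
    unfolding mod_ideal_def
  proof (intro conjI ballI allI)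
    show "?J \<subseteq> modulation_space \<phi> p s" by (auto simp: modulation_space_eq[OF s])
    have "(\<lambda>\<psi>::real^'n \<Rightarrow> complex. 0) = distr_of (\<lambda>t. 0)" by (auto simp: distr_of_def)
    then show "(\<lambda>\<psi>. 0) \<in> ?J" using schwartz_mod_fun[OF schwartz_0, of s] by blast
  next
    fix u v assume "u \<in> ?J" "v \<in> ?J"
    then obtain f g where f: "u = distr_of f" "mod_fun s f" "\<forall>x\<in>Z. f x = 0" and g: "v = distr_of g" "mod_fun s g" "\<forall>x\<in>Z. g x = 0" by blast
    then have "(\<lambda>\<psi>. u \<psi> + v \<psi>) = distr_of (\<lambda>t. f t + g t)" by (simp add: distr_of_add mod_fun_bcont)
    then show "(\<lambda>\<psi>. u \<psi> + v \<psi>) \<in> ?J" using mod_fun_add[OF f(2) g(2)] f g by force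
  next
    fix c u assume "u \<in> ?J"
    then obtain f where f: "u = distr_of f" "mod_fun s f" "\<forall>x\<in>Z. f x = 0" by blast
    then have "(\<lambda>\<psi>. c * u \<psi>) = distr_of (\<lambda>t. c * f t)" by (simp add: distr_of_cmult)
    then show "(\<lambda>\<psi>. c * u \<psi>) \<in> ?J" using mod_fun_cmult[OF f(2)] f by force
  next
    fix u v assume "u \<in> modulation_space \<phi> p s" "v \<in> ?J"
    then obtain f g where f: "u = distr_of f" "mod_fun s f" and g: "v = distr_of g" "mod_fun s g" "\<forall>x\<in>Z. g x = 0"
      unfolding modulation_space_eq[OF s] by blast
    then have "distr_mult u v = distr_of (\<lambda>t. f t * g t)" by (simp add: distr_mult_distr_of mod_fun_bcont)
    then show "distr_mult u v \<in> ?J" using mod_fun_mult[OF s f(2) g(2)] g by force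
  qed
  interpret Metric_space "modulation_space \<phi> p s" "mod_dist \<phi> p s" by (rule modulation_metric[OF s])
  obtain C where C: "0 \<le> C" "\<And>g t. mod_fun 0 g \<Longrightarrow> norm (g t) \<le> C * enn2real (fun_norm 0 g)"
    using point_evaluation_bound by blast
  have "closedin mtopology ?J"
    unfolding closedin_metric
  proof (intro conjI allI impI)
    show "?J \<subseteq> modulation_space \<phi> p s" by (auto simp: modulation_space_eq[OF s])
    fix u assume u: "u \<in> modulation_space \<phi> p s - ?J"
    then obtain g where g: "u = distr_of g" "mod_fun s g" unfolding modulation_space_eq[OF s] by blast
    with u obtain x where x: "x \<in> Z" "g x \<noteq> 0" by blast
    \<comment> \<open>The radius at which the bound for point evaluations keeps the value at \<open>x\<close> away from \<open>0\<close>; the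
      \<open>+ 1\<close> guards against \<open>C = 0\<close>.\<close>
    define r where "r = norm (g x) / (C + 1)"
    have r: "0 < r" using x C(1) by (simp add: r_def)
    have "disjnt ?J (mball u r)"
      unfolding disjnt_iff
    proof (intro allI notI, elim conjE)
      fix v assume "v \<in> ?J" and v: "v \<in> mball u r"
      then obtain b where b: "v = distr_of b" "mod_fun s b" "b x = 0" using x by blast
      have m: "mod_fun s (\<lambda>t. g t - b t)" by (rule mod_fun_diff[OF g(2) b(2)])
      have "norm (g x) \<le> C * enn2real (fun_norm 0 (\<lambda>t. g t - b t))"
        using C(2)[OF mod_fun_0[OF s m], of x] b by simp
      also have "\<dots> \<le> C * enn2real (fun_norm s (\<lambda>t. g t - b t))"
        using mod_norm_mono_weight[OF p s] mod_fun_finite[OF m] C(1) by (intro mult_left_mono enn2real_mono)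
      also have "enn2real (fun_norm s (\<lambda>t. g t - b t)) = mod_dist \<phi> p s u v"
        unfolding g(1) b(1) by (rule mod_dist_distr_of[symmetric, OF mod_fun_bcont[OF g(2)] mod_fun_bcont[OF b(2)]])
      also have "C * mod_dist \<phi> p s u v \<le> C * r" using v C(1) by (intro mult_left_mono) (auto simp: in_mball)
      also have "\<dots> < (C + 1) * r" using r by simp
      also have "\<dots> = norm (g x)" using C(1) by (simp add: r_def)
      finally show False by simp
    qed
    then show "\<exists>r>0. disjnt ?J (mball u r)" using r by blast
  qed
  then show "closedin (mod_topology \<phi> p s) ?J" by (simp add: mod_topology_def)
qed

text \<open>Neumann series. On the support of the bump \<open>b\<close> the function \<open>f / f x0\<close> equals \<open>1 - r\<close>, so multiplying
  \<open>f\<close> by the partial sums of \<open>b (1 + r + r\<^sup>2 + \<dots>) / f x0\<close> gives \<open>b - b r\<^sup>N\<close>, which converges to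
  \<open>b\<close> in the modulation space.\<close>

lemma closed_ideal_contains_local_unit:
  assumes s: "0 \<le> s" and J: "closed_ideal \<phi> p s J" and f: "mod_fun s f" "distr_of f \<in> J" and fx0: "f x0 \<noteq> 0"
  obtains e \<delta> where "mod_fun s e" "distr_of e \<in> J" "0 < \<delta>" "\<And>t. dist x0 t < \<delta> \<Longrightarrow> e t = 1"
proof -
  obtain \<beta> :: "real^'n \<Rightarrow> real" and \<rho> where \<beta>: "0 < \<rho>" "(\<lambda>x. complex_of_real (\<beta> x)) \<in> schwartz"
    "\<And>x. 0 \<le> \<beta> x" "\<And>x. \<beta> x \<le> 1" "\<And>x. norm x \<le> \<rho> \<Longrightarrow> \<beta> x = 1" "\<And>x. 1 < norm x \<Longrightarrow> \<beta> x = 0"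
    by (rule plateau_exists[where 'n='n]) (rule that)
  define X where "X d t = complex_of_real (\<beta> ((1 / d) *\<^sub>R t + (- (1 / d)) *\<^sub>R x0))" for d t
  have nX: "norm ((1 / d) *\<^sub>R t + (- (1 / d)) *\<^sub>R x0) = norm (t - x0) / d" if "0 < d" for d t
    using that by (simp flip: scaleR_right_diff_distrib)
  define G where "G d t = X d t * (1 - f t / f x0)" for d t
  have G_eq: "G d = (\<lambda>t. complex_of_real (\<beta> ((1 / d) *\<^sub>R t + (- (1 / d)) *\<^sub>R x0)) * (1 - f t / f x0))" for d
    by (simp add: fun_eq_iff G_def X_def)
  have "\<exists>d R. 0 < d \<and> mod_fun s (G d) \<and> integrable lborel R \<and> (\<forall>t. G d t = (\<integral>\<eta>. R \<eta> * cis (t \<bullet> \<eta>) \<partial>lborel)) \<and> weighted_L1 0 R < 1 \<and> weighted_L1 s R < top"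
  proof (rule local_smallness[of s f x0 \<rho> \<beta>, OF s f(1) fx0 \<beta>(1) \<beta>(2)])
    show "\<beta> x = 1" if "norm x \<le> \<rho>" for x using that by (rule \<beta>(5))
    show "\<beta> x = 0" if "1 < norm x" for x using that by (rule \<beta>(6))
  qed (unfold G_eq, intro exI conjI allI)
  then obtain d R where d: "0 < d" and rm: "mod_fun s (G d)" and R: "integrable lborel R"
    "\<And>t. G d t = (\<integral>\<eta>. R \<eta> * cis (t \<bullet> \<eta>) \<partial>lborel)" "weighted_L1 0 R < 1" "weighted_L1 s R < top"
    by blast
  define r where "r = G d"
  \<comment> \<open>The support lies within distance \<open>\<rho> * d\<close> of \<open>x0\<close>, where \<open>X d\<close> equals \<open>1\<close>.\<close>
  define b where "b = X (\<rho> * d)"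
  have dd: "0 < \<rho> * d" using d \<beta>(1) by simp
  have bm: "mod_fun s b" unfolding b_def X_def[abs_def]
    by (intro schwartz_mod_fun schwartz_affine[OF \<beta>(2)]) (use dd in auto)
  have rm': "mod_fun s r" using rm by (simp add: r_def)
  have brm: "mod_fun s (\<lambda>t. b t * r t ^ k)" for k
  proof (induction k)
    case (Suc k)
    from mod_fun_mult[OF s Suc rm'] show ?case by (simp add: mult_ac)
  qed (simp add: bm)
  have bsupp: "b t = 0 \<or> X d t = 1" for t
  proof (cases "norm (t - x0) \<le> \<rho> * d")
    case True
    then have "norm (t - x0) / d \<le> \<rho>" using d by (simp add: field_simps)
    then show ?thesis using nX[OF d, of t] by (simp add: X_def \<beta>(5))
  next
    case False
    then have "1 < norm (t - x0) / (\<rho> * d)" using dd by (simp add: field_simps)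
    then show ?thesis using nX[OF dd, of t] by (simp add: b_def X_def \<beta>(6))
  qed
  define a where "a N t = (\<Sum>k<N. b t * r t ^ k)" for N t
  have am: "mod_fun s (a N)" for N
  proof (induction N)
    case 0 then show ?case using schwartz_mod_fun[OF schwartz_0] by (simp add: a_def)
  next
    case (Suc N)
    from mod_fun_add[OF Suc brm[of N]] show ?case by (simp add: a_def)
  qed
  have tele: "(a N t * (1 / f x0)) * f t = b t - b t * r t ^ N" for N t
  proof (cases "b t = 0")
    case True then show ?thesis by (simp add: a_def)
  next
    case False
    then have r1: "f t / f x0 = 1 - r t" using bsupp[of t] by (simp add: r_def G_def)
    have "(1 - r t) * (\<Sum>k<N. r t ^ k) = 1 - r t ^ N" by (rule one_diff_power_eq[symmetric])
    then have "b t * ((\<Sum>k<N. r t ^ k) * (f t / f x0)) = b t * (1 - r t ^ N)" unfolding r1 by (simp add: mult.commute)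
    then show ?thesis by (simp add: a_def sum_distrib_left[symmetric] algebra_simps)
  qed
  define e where "e N t = b t - b t * r t ^ N" for N t
  have eJ: "distr_of (e N) \<in> J" for N
  proof -
    have m: "mod_fun s (\<lambda>t. (1 / f x0) * a N t)" by (rule mod_fun_cmult[OF am])
    have "distr_mult (distr_of (\<lambda>t. (1 / f x0) * a N t)) (distr_of f) = distr_of (\<lambda>t. (1 / f x0) * a N t * f t)"
      by (rule distr_mult_distr_of[OF mod_fun_bcont[OF m] mod_fun_bcont[OF f(1)]])
    also have "(\<lambda>t. (1 / f x0) * a N t * f t) = e N" using tele by (auto simp: e_def mult.commute)
    finally show ?thesis
      using J f(2) m unfolding closed_ideal_def mod_ideal_def modulation_space_eq[OF s] by (metis (no_types, lifting) image_eqI mem_Collect_eq)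
  qed
  have bJ: "distr_of b \<in> J"
  proof (rule closed_ideal_limit[OF s J bm _ eJ])
    show "mod_fun s (e N)" for N unfolding e_def by (rule mod_fun_diff[OF bm brm])
    have "fun_norm s (\<lambda>t. e N t - b t) = fun_norm s (\<lambda>t. b t * r t ^ N)" for N
    proof -
      have "V (\<lambda>t. e N t - b t) x \<xi> = - V (\<lambda>t. b t * r t ^ N) x \<xi>" for x \<xi>
        using V_cmult[of "-1" "\<lambda>t. b t * r t ^ N"] by (simp add: e_def)
      then show ?thesis by (simp add: fun_norm_eq stft_Lp_def)
    qed
    then show "(\<lambda>N. fun_norm s (\<lambda>t. e N t - b t)) \<longlonglongrightarrow> 0"
      using multiplier_powers_tendsto[OF s bm mod_fun_bcont[OF rm'] R(1) _ R(3,4)] R(2) by (simp add: r_def)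
  qed
  have "b t = 1" if "dist x0 t < \<rho> * (\<rho> * d)" for t
  proof -
    have "norm (t - x0) < \<rho> * (\<rho> * d)" using that by (simp add: dist_norm norm_minus_commute)
    then have "norm (t - x0) / (\<rho> * d) \<le> \<rho>" using dd by (simp add: field_simps)
    then show ?thesis using nX[OF dd, of t] by (simp add: b_def X_def \<beta>(5))
  qed
  then show ?thesis using that[OF bm bJ, of "\<rho> * (\<rho> * d)"] dd \<beta>(1) by simp
qed

text \<open>If \<open>a\<close> equals \<open>1\<close> on \<open>A\<close> and \<open>b\<close> equals \<open>1\<close> on \<open>B\<close>, then \<open>a + b - a b = 1 - (1 - a) (1 - b)\<close>
  equals \<open>1\<close> on the union and lies in every ideal containing both.\<close>

lemma closed_ideal_contains_unit_on_compact:
  assumes s: "0 \<le> s" and J: "closed_ideal \<phi> p s J" and f: "mod_fun s f" "distr_of f \<in> J" and nz: "\<And>x. f x \<noteq> 0"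
    and K: "compact K"
  obtains e where "mod_fun s e" "distr_of e \<in> J" "\<And>t. t \<in> K \<Longrightarrow> e t = 1"
proof -
  from J have ideal: "mod_ideal \<phi> p s J" by (simp add: closed_ideal_def)
  have sum_in: "(\<lambda>\<psi>. u \<psi> + v \<psi>) \<in> J" if "u \<in> J" "v \<in> J" for u v
    using ideal that by (simp add: mod_ideal_def)
  have multiple_in: "(\<lambda>\<psi>. c * u \<psi>) \<in> J" if "u \<in> J" for c u
    using ideal that by (simp add: mod_ideal_def)
  define Q where "Q A \<longleftrightarrow> (\<exists>e. mod_fun s e \<and> distr_of e \<in> J \<and> (\<forall>t\<in>A. e t = 1))" for A
  have "\<exists>\<delta>>0. Q (ball x \<delta>)" for x
    using closed_ideal_contains_local_unit[OF s J f nz[of x]] unfolding Q_def by (metis mem_ball)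
  then obtain \<delta> where \<delta>: "\<And>x. 0 < \<delta> x" "\<And>x. Q (ball x (\<delta> x))" by metis
  have Q0: "Q {}"
  proof -
    have "(\<lambda>\<psi>::real^'n \<Rightarrow> complex. 0) = distr_of (\<lambda>t. 0)" by (auto simp: distr_of_def)
    moreover have "(\<lambda>\<psi>. 0) \<in> J" using ideal by (simp add: mod_ideal_def)
    ultimately show ?thesis unfolding Q_def using schwartz_mod_fun[OF schwartz_0, of s] by auto
  qed
  have QU: "Q (A \<union> B)" if "Q A" "Q B" for A B
  proof -
    from that obtain a b where a: "mod_fun s a" "distr_of a \<in> J" "\<forall>t\<in>A. a t = 1"
      and b: "mod_fun s b" "distr_of b \<in> J" "\<forall>t\<in>B. b t = 1" unfolding Q_def by blast
    note bc = mod_fun_bcont[OF a(1)] mod_fun_bcont[OF b(1)]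
    have ab: "mod_fun s (\<lambda>t. a t * b t)" by (rule mod_fun_mult[OF s a(1) b(1)])
    have abJ: "distr_of (\<lambda>t. a t * b t) \<in> J"
    proof -
      have "distr_mult (distr_of a) (distr_of b) \<in> J"
        using ideal a(1) b(2) unfolding mod_ideal_def modulation_space_eq[OF s] by blast
      then show ?thesis by (simp add: distr_mult_distr_of bc)
    qed
    have "distr_of (\<lambda>t. a t + b t + (-1) * (a t * b t)) = (\<lambda>\<psi>. (distr_of a \<psi> + distr_of b \<psi>) + (-1) * distr_of (\<lambda>t. a t * b t) \<psi>)"
      by (subst distr_of_add[OF bcont_add[OF bc] bcont_cmult[OF mod_fun_bcont[OF ab]]], subst distr_of_add[OF bc], subst distr_of_cmult) (rule refl)
    moreover have "(\<lambda>\<psi>. (distr_of a \<psi> + distr_of b \<psi>) + (-1) * distr_of (\<lambda>t. a t * b t) \<psi>) \<in> J"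
      by (rule sum_in[OF sum_in[OF a(2) b(2)] multiple_in[OF abJ]])
    ultimately have "distr_of (\<lambda>t. a t + b t + (-1) * (a t * b t)) \<in> J" by simp
    moreover have "mod_fun s (\<lambda>t. a t + b t + (-1) * (a t * b t))"
      by (intro mod_fun_add mod_fun_cmult a b ab)
    ultimately show ?thesis unfolding Q_def using a(3) b(3)
      by (intro exI[of _ "\<lambda>t. a t + b t + (-1) * (a t * b t)"]) auto
  qed
  have "K \<subseteq> (\<Union>x\<in>K. ball x (\<delta> x))" using \<delta>(1) by force
  then obtain F where F: "finite F" "K \<subseteq> (\<Union>x\<in>F. ball x (\<delta> x))"
    using compactE_image[OF K, of K "\<lambda>x. ball x (\<delta> x)"] by (metis open_ball)
  from F(1) have "Q (\<Union>x\<in>F. ball x (\<delta> x))"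
    by (induction F rule: finite_induct) (auto intro: Q0 QU \<delta>)
  then obtain e where e: "mod_fun s e" "distr_of e \<in> J" "\<forall>t\<in>(\<Union>x\<in>F. ball x (\<delta> x)). e t = 1"
    unfolding Q_def by blast
  show ?thesis by (rule that[OF e(1,2)]) (use e(3) F(2) in blast)
qed

text \<open>A function of compact support is unchanged when multiplied by a unit for its support, and every
  member is a limit of such functions.\<close>

lemma closed_ideal_eq_all:
  assumes s: "0 \<le> s" and J: "closed_ideal \<phi> p s J" and f: "mod_fun s f" "distr_of f \<in> J" and nz: "\<And>x. f x \<noteq> 0"
  shows "J = modulation_space \<phi> p s"
proof
  from J have ideal: "mod_ideal \<phi> p s J" by (simp add: closed_ideal_def)
  then show "J \<subseteq> modulation_space \<phi> p s" by (simp add: mod_ideal_def)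
  obtain \<beta> :: "real^'n \<Rightarrow> real" and \<rho> where \<beta>: "0 < \<rho>" "(\<lambda>x. complex_of_real (\<beta> x)) \<in> schwartz"
    "\<And>x. 0 \<le> \<beta> x" "\<And>x. \<beta> x \<le> 1" "\<And>x. norm x \<le> \<rho> \<Longrightarrow> \<beta> x = 1" "\<And>x. 1 < norm x \<Longrightarrow> \<beta> x = 0"
    by (rule plateau_exists[where 'n='n]) (rule that)
  let ?h = "\<lambda>k t. complex_of_real (\<beta> (inverse (real (Suc k)) *\<^sub>R t))"
  show "modulation_space \<phi> p s \<subseteq> J"
    unfolding modulation_space_eq[OF s]
  proof safe
    fix g assume g: "mod_fun s g"
    have hm: "mod_fun s (?h k)" for k
      using schwartz_affine[OF \<beta>(2), of "inverse (real (Suc k))" 0] by (intro schwartz_mod_fun) simp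
    have m: "mod_fun s (\<lambda>t. g t * ?h k t)" for k by (rule mod_fun_mult[OF s g hm])
    show "distr_of g \<in> J"
    proof (rule closed_ideal_limit[OF s J g m])
      show "(\<lambda>k. fun_norm s (\<lambda>t. g t * ?h k t - g t)) \<longlonglongrightarrow> 0"
        by (rule dilation_tendsto[OF s g \<beta>(2)]) (use \<beta>(1,5) in simp)
      fix k
      obtain e where e: "mod_fun s e" "distr_of e \<in> J" "\<And>t. t \<in> cball 0 (real (Suc k)) \<Longrightarrow> e t = 1"
        using closed_ideal_contains_unit_on_compact[OF s J f nz compact_cball] by blast
      have "(g t * ?h k t) * e t = g t * ?h k t" for t
      proof (cases "t \<in> cball 0 (real (Suc k))")
        case False
        then have "1 < norm (inverse (real (Suc k)) *\<^sub>R t)" by (simp add: field_simps)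
        then show ?thesis by (simp add: \<beta>(6))
      qed (simp add: e(3))
      then have "distr_of (\<lambda>t. g t * ?h k t) = distr_mult (distr_of (\<lambda>t. g t * ?h k t)) (distr_of e)"
        by (simp only: distr_mult_distr_of[OF mod_fun_bcont[OF m] mod_fun_bcont[OF e(1)]])
      also have "\<dots> \<in> J"
        using ideal e(2) m[of k] unfolding mod_ideal_def modulation_space_eq[OF s] by blast
      finally show "distr_of (\<lambda>t. g t * ?h k t) \<in> J" .
    qed
  qed
qed

end

theorem theorem5p6:
  fixes \<phi> :: "real^'n::finite \<Rightarrow> complex" and p s :: real and f :: "'n functional"
  assumes "\<phi> \<in> schwartz" and "\<phi> \<noteq> (\<lambda>x. 0)"
    and "1 \<le> p" and "0 \<le> s"
    and "f \<in> modulation_space \<phi> p s"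
  shows "closed_ideal_gen \<phi> p s {f} = modulation_space \<phi> p s \<longleftrightarrow> (\<forall>x. fun_of f x \<noteq> 0)"
proof -
  interpret gabor \<phi> p by unfold_locales (use assms in auto)
  note s = assms(4)
  obtain F where F: "f = distr_of F" "mod_fun s F" using assms(5) unfolding modulation_space_eq[OF s] by blast
  have fun_f: "fun_of f = F" unfolding F(1) by (rule fun_of_distr_of[OF mod_fun_bcont[OF F(2)]])
  show ?thesis
  proof
    assume all: "closed_ideal_gen \<phi> p s {f} = modulation_space \<phi> p s"
    show "\<forall>x. fun_of f x \<noteq> 0"
    proof (intro allI notI)
      fix x0 assume "fun_of f x0 = 0"
      then have "f \<in> {distr_of g | g. mod_fun s g \<and> (\<forall>x\<in>{x0}. g x = 0)}" using F unfolding fun_f by blast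
      then have sub: "modulation_space \<phi> p s \<subseteq> {distr_of g | g. mod_fun s g \<and> (\<forall>x\<in>{x0}. g x = 0)}"
        using vanishing_closed_ideal[OF s, of "{x0}"] unfolding all[symmetric] closed_ideal_gen_def by blast
      \<comment> \<open>The window translated so that it does not vanish at \<open>x0\<close> is not in the vanishing ideal.\<close>
      obtain t0 where t0: "\<phi> t0 \<noteq> 0" using window_nz by auto
      have m: "mod_fun s (\<lambda>t. \<phi> (t - (x0 - t0)))" by (intro schwartz_mod_fun schwartz_translate window)
      then have "distr_of (\<lambda>t. \<phi> (t - (x0 - t0))) \<in> modulation_space \<phi> p s" unfolding modulation_space_eq[OF s] by blast
      then obtain g where g: "distr_of (\<lambda>t. \<phi> (t - (x0 - t0))) = distr_of g" "mod_fun s g" "g x0 = 0" using sub by blast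
      have "(\<lambda>t. \<phi> (t - (x0 - t0))) = g"
        using fun_of_distr_of[OF mod_fun_bcont[OF m]] fun_of_distr_of[OF mod_fun_bcont[OF g(2)]] g(1) by metis
      then have "\<phi> (x0 - (x0 - t0)) = 0" using g(3) by metis
      then show False using t0 by simp
    qed
  next
    assume nz: "\<forall>x. fun_of f x \<noteq> 0"
    have "J = modulation_space \<phi> p s" if "closed_ideal \<phi> p s J" "{f} \<subseteq> J" for J
      using closed_ideal_eq_all[OF s that(1) F(2)] that(2) nz by (simp add: F(1) fun_f[unfolded F(1)])
    moreover have "closed_ideal \<phi> p s (modulation_space \<phi> p s)"
    proof -
      have "{distr_of g | g. mod_fun s g \<and> (\<forall>x\<in>{}. g x = 0)} = modulation_space \<phi> p s"
        unfolding modulation_space_eq[OF s] by auto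
      then show ?thesis using vanishing_closed_ideal[OF s, of "{}"] by simp
    qed
    ultimately have "{J. closed_ideal \<phi> p s J \<and> {f} \<subseteq> J} = {modulation_space \<phi> p s}"
      using assms(5) by blast
    then show "closed_ideal_gen \<phi> p s {f} = modulation_space \<phi> p s"
      by (simp add: closed_ideal_gen_def)
  qed
qed

end
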